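(* Write points of $\mathbb{R}^6$ as $(p,q)$ with $p,q\in\mathbb{R}^3$, let $u(p,q) = \frac12(|p|^2-|q|^2)$, and let $$\Phi_0(p,q) = \frac{\bigl||p|+|q|\bigr|^3 - \bigl||p|-|q|\bigr|^3}{2^{5/2}\,|p|\,|q|}.$$ Then the cone $C$ over $\mathbb{S}^2\times\mathbb{S}^2$ in $\mathbb{R}^6$ is a minimizer of $A_{\Phi_0}$. Indeed, the hypersurfaces $\{u = 1\}$ and $\{u=-1\}$ are critical points of $A_{\Phi_0}$, and their dilations foliate either side of $C$.
   Context: For a positive even function $\Phi_0$ on the unit sphere $\mathbb{S}^5\subset\mathbb{R}^6$, identified with its one-homogeneous extension to $\mathbb{R}^6$, and an oriented hypersurface $\Sigma\subset\mathbb{R}^6$ with a choice of unit normal $\nu$, one sets $A_{\Phi_0}(\Sigma) := \int_\Sigma \Phi_0(\nu)$. The cone over $\mathbb{S}^2\times\mathbb{S}^2$ is $C=\{(p,q)\in\mathbb{R}^6 : |p|=|q|\}$. The function $\Phi_0$ is the restriction to the hyperplane $\{z=0\}$ of the one-homogeneous function $$\Phi(p,q,z) = \frac{\left((|p|+|q|)^2+2z^2\right)^{3/2}-\left((|p|-|q|)^2+2z^2\right)^{3/2}}{2^{5/2}|p||q|}$$ on $\mathbb{R}^7$, where $p,q\in\mathbb{R}^3$ and $z\in\mathbb{R}$. This $\Phi$ is a uniformly elliptic integrand (its level sets are uniformly convex) of class $C^{2,1}$ on $\mathbb{S}^6$, and the graph of $u$ over $\mathbb{R}^6$ is a critical point of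 the functional $A_\Phi(\Sigma)=\int_\Sigma\Phi(\nu)$ on oriented hypersurfaces $\Sigma\subset\mathbb{R}^7$. The formulas for $\Phi$ and $\Phi_0$ are understood as extended continuously to the points where $|p||q|=0$. *)

theory Defs
  imports "HOL-Analysis.Analysis" "HOL-Library.Disjoint_Sets"
begin

section \<open>Hausdorff measure\<close>

text \<open>The empty set is given weight 0 explicitly because \<open>0 ^ 0 = 1\<close>; \<open>bounded\<close> is needed
  because \<open>diameter\<close> is only meaningful on bounded sets. The Hausdorff outer measure is a metric
  outer measure, so it is countably additive on the Borel sets and \<open>measure_of\<close> keeps its values
  there.\<close>

definition hausdorff_premeasure :: "nat \<Rightarrow> real \<Rightarrow> 'a::metric_space set \<Rightarrow> ennreal" where
  "hausdorff_premeasure k \<delta> A =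
     (INF D \<in> {D :: nat \<Rightarrow> 'a set.
                 A \<subseteq> (\<Union>i. D i) \<and> (\<forall>i. bounded (D i) \<and> diameter (D i) \<le> \<delta>)}.
        \<Sum>i. if D i = {} then 0
            else ennreal (unit_ball_vol (real k) * (diameter (D i) / 2) ^ k))"

definition hausdorff_outer :: "nat \<Rightarrow> 'a::metric_space set \<Rightarrow> ennreal" where
  "hausdorff_outer k A = (SUP \<delta>\<in>{0<..}. hausdorff_premeasure k \<delta> A)"

definition hausdorff_measure :: "nat \<Rightarrow> 'a::metric_space measure" where
  "hausdorff_measure k = measure_of UNIV (sets borel) (hausdorff_outer k)"

definition surface_measure :: "'a::euclidean_space measure" where
  "surface_measure = hausdorff_measure (DIM('a) - 1)"


section \<open>Smooth maps and oriented hypersurfaces\<close>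

primrec C_k_map :: "nat \<Rightarrow> ('a::euclidean_space \<Rightarrow> 'b::euclidean_space) \<Rightarrow> bool" where
  "C_k_map 0 f \<longleftrightarrow> continuous_on UNIV f"
| "C_k_map (Suc k) f \<longleftrightarrow>
     (\<forall>x. f differentiable (at x)) \<and>
     (\<forall>b\<in>Basis. C_k_map k (\<lambda>x. frechet_derivative f (at x) b))"

definition compactly_supported :: "('a::euclidean_space \<Rightarrow> 'b::euclidean_space) \<Rightarrow> bool" where
  "compactly_supported X \<longleftrightarrow> compact (closure {x. X x \<noteq> 0})"

definition divergence :: "('a::euclidean_space \<Rightarrow> 'a) \<Rightarrow> 'a \<Rightarrow> real" where
  "divergence X x = (\<Sum>b\<in>Basis. frechet_derivative X (at x) b \<bullet> b)"

text \<open>A \<open>C\<^sup>1\<close> embedded hypersurface with unit normal field \<open>\<nu>\<close>. Replacing a local defining function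
  by its negative, and shrinking the neighbourhood, one can always arrange that its gradient points
  in the direction of a given continuous normal.\<close>

definition oriented_hypersurface :: "'a::euclidean_space set \<Rightarrow> ('a \<Rightarrow> 'a) \<Rightarrow> bool" where
  "oriented_hypersurface S \<nu> \<longleftrightarrow>
     (\<forall>x\<in>S. \<exists>U (g :: 'a \<Rightarrow> real) G.
        open U \<and> x \<in> U \<and> S \<inter> U = {y \<in> U. g y = 0} \<and>
        (\<forall>y\<in>U. GDERIV g y :> G y) \<and> continuous_on U G \<and>
        (\<forall>y\<in>S \<inter> U. G y \<noteq> 0 \<and> \<nu> y = sgn (G y)))"

text \<open>\<open>(S, \<nu>)\<close> is the oriented boundary of \<open>E\<close>, with \<open>\<nu>\<close> the outward normal, in the sense of geometric
  measure theory: \<open>S\<close> has locally finite area and the Gauss--Green formula holds. Hypersurfaces with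
  singularities are allowed. By the theorems of De Giorgi and Federer, \<open>E\<close> admits such a pair iff
  it has locally finite perimeter, and then, up to null sets for the surface measure, \<open>S\<close> is the
  reduced boundary and \<open>\<nu>\<close> the measure-theoretic normal.\<close>

definition oriented_boundary :: "'a::euclidean_space set \<Rightarrow> 'a set \<Rightarrow> ('a \<Rightarrow> 'a) \<Rightarrow> bool" where
  "oriented_boundary E S \<nu> \<longleftrightarrow>
     E \<in> sets lebesgue \<and> S \<in> sets borel \<and> \<nu> \<in> borel_measurable borel \<and>
     (AE x in surface_measure. x \<in> S \<longrightarrow> norm (\<nu> x) = 1) \<and>
     (\<forall>K. compact K \<longrightarrow> emeasure surface_measure (S \<inter> K) < \<infinity>) \<and>
     (\<forall>X. C_k_map 1 X \<and> compactly_supported X \<longrightarrow>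
        (LINT x:E|lebesgue. divergence X x) = (LINT x:S|surface_measure. X x \<bullet> \<nu> x))"


section \<open>Parametric functionals, minimizers and critical points\<close>

definition anisotropic_area ::
    "('a::euclidean_space \<Rightarrow> real) \<Rightarrow> 'a set \<Rightarrow> ('a \<Rightarrow> 'a) \<Rightarrow> real" where
  "anisotropic_area \<Phi> S \<nu> = (LINT x:S|surface_measure. \<Phi> (\<nu> x))"

text \<open>The oriented boundary \<open>(S, \<nu>)\<close> of \<open>E\<close> minimizes the functional with respect to arbitrary
  compactly supported perturbations of \<open>E\<close>. Areas are compared in a bounded neighbourhood of the
  perturbed region, since the total area may be infinite.\<close>

definition anisotropic_minimizer ::
    "('a::euclidean_space \<Rightarrow> real) \<Rightarrow> 'a set \<Rightarrow> 'a set \<Rightarrow> ('a \<Rightarrow> 'a) \<Rightarrow> bool" where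
  "anisotropic_minimizer \<Phi> E S \<nu> \<longleftrightarrow>
     oriented_boundary E S \<nu> \<and>
     (\<forall>E' S' \<nu>' K U.
        oriented_boundary E' S' \<nu>' \<and> compact K \<and> open U \<and> bounded U \<and> K \<subseteq> U \<and>
        (E - E') \<union> (E' - E) \<subseteq> K \<longrightarrow>
        anisotropic_area \<Phi> (S \<inter> U) \<nu> \<le> anisotropic_area \<Phi> (S' \<inter> U) \<nu>')"

text \<open>The unit normal transported by a diffeomorphism \<open>\<phi>\<close>: normals transform by the inverse transpose
  of the differential.\<close>

definition transported_normal ::
    "('a::euclidean_space \<Rightarrow> 'a) \<Rightarrow> ('a \<Rightarrow> 'a) \<Rightarrow> 'a \<Rightarrow> 'a" where
  "transported_normal \<phi> \<nu> y =
     (let x = inv \<phi> y in sgn (adjoint (inv (frechet_derivative \<phi> (at x))) (\<nu> x)))"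

text \<open>Vanishing first variation. For small \<open>t\<close> the map \<open>x \<mapsto> x + t X x\<close> is a diffeomorphism that is
  the identity off \<open>K\<close>, so only the part of \<open>S\<close> in \<open>K\<close> is moved.\<close>

definition anisotropic_critical_point ::
    "('a::euclidean_space \<Rightarrow> real) \<Rightarrow> 'a set \<Rightarrow> ('a \<Rightarrow> 'a) \<Rightarrow> bool" where
  "anisotropic_critical_point \<Phi> S \<nu> \<longleftrightarrow>
     closed S \<and> oriented_hypersurface S \<nu> \<and>
     (\<forall>X K. (\<forall>k. C_k_map k X) \<and> compact K \<and> {x. X x \<noteq> 0} \<subseteq> K \<longrightarrow>
        ((\<lambda>t. let \<phi> = (\<lambda>x. x + t *\<^sub>R X x)
              in anisotropic_area \<Phi> (\<phi> ` (S \<inter> K)) (transported_normal \<phi> \<nu>))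
           has_real_derivative 0) (at 0))"


section \<open>Foliations\<close>

text \<open>Codimension-one \<open>C\<^sup>1\<close> foliation of an open set: a partition into connected leaves such that,
  locally, the connected components of the leaves (the plaques) are the level sets of a
  submersion.\<close>

definition foliates :: "'a::euclidean_space set set \<Rightarrow> 'a set \<Rightarrow> bool" where
  "foliates \<L> \<Omega> \<longleftrightarrow>
     partition_on \<Omega> \<L> \<and> (\<forall>L\<in>\<L>. connected L) \<and>
     (\<forall>x\<in>\<Omega>. \<exists>U (f :: 'a \<Rightarrow> real) G.
        open U \<and> x \<in> U \<and> U \<subseteq> \<Omega> \<and>
        (\<forall>y\<in>U. GDERIV f y :> G y \<and> G y \<noteq> 0) \<and> continuous_on U G \<and>
        (\<forall>L\<in>\<L>. \<forall>P\<in>components (L \<inter> U). \<exists>c. P = {y \<in> U. f y = c}))"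

definition dilations :: "'a::real_vector set \<Rightarrow> 'a set set" where
  "dilations S = {(*\<^sub>R) r ` S | r. r > 0}"


section \<open>The cone, the foliating function and the integrand\<close>

type_synonym R3 = "real ^ 3"
type_synonym R6 = "R3 \<times> R3"

definition cone_C :: "R6 set" where
  "cone_C = {(p, q). norm p = norm q}"

definition u :: "R6 \<Rightarrow> real" where
  "u = (\<lambda>(p, q). ((norm p)\<^sup>2 - (norm q)\<^sup>2) / 2)"

text \<open>The direction of the gradient of \<open>u\<close>, normal to the level sets of \<open>u\<close> (and 0 at the origin, the
  singular point of the cone).\<close>

definition \<nu>\<^sub>u :: "R6 \<Rightarrow> R6" where
  "\<nu>\<^sub>u = (\<lambda>(p, q). sgn (p, - q))"

definition \<Phi>\<^sub>0 :: "R6 \<Rightarrow> real" where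
  "\<Phi>\<^sub>0 = (\<lambda>(p, q).
     if p = 0 \<or> q = 0 then 3 * (norm p + norm q) / 2 powr (3/2)
     else (\<bar>norm p + norm q\<bar> ^ 3 - \<bar>norm p - norm q\<bar> ^ 3)
            / (2 powr (5/2) * norm p * norm q))"

text \<open>The first branch of the definition is the continuous extension of the second.\<close>

lemma \<Phi>\<^sub>0_max_min:
  "\<Phi>\<^sub>0 x = (3 * max (norm (fst x)) (norm (snd x)) +
          (min (norm (fst x)) (norm (snd x)))\<^sup>2 / max (norm (fst x)) (norm (snd x))) / 2 powr (3/2)"
proof -
  obtain p q where x: "x = (p, q)" by (cases x)
  have two: "2 powr (5/2) = 2 * 2 powr (3/2 :: real)"
    using powr_add[of "2::real" 1 "3/2"] by simp
  define s where "s = (2::real) powr (3/2)"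
  have s: "s > 0" by (simp add: s_def)
  show ?thesis
  proof (cases "p = 0 \<or> q = 0")
    case True
    then show ?thesis by (auto simp: x \<Phi>\<^sub>0_def max_def min_def)
  next
    case False
    define a b where "a = norm p" and "b = norm q"
    have ab: "a > 0" "b > 0" using False by (auto simp: a_def b_def)
    have "(\<bar>a + b\<bar> ^ 3 - \<bar>a - b\<bar> ^ 3) / (2 * s * a * b) =
          (3 * max a b + (min a b)\<^sup>2 / max a b) / s"
    proof (cases "a \<le> b")
      case True
      then have "\<bar>a + b\<bar> = a + b" "\<bar>a - b\<bar> = b - a" using ab by auto
      then show ?thesis using True ab s
        by (simp add: max_def min_def field_simps power2_eq_square power3_eq_cube)
    next
      case False
      then have "\<bar>a + b\<bar> = a + b" "\<bar>a - b\<bar> = a - b" using ab by auto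
      then show ?thesis using False ab s
        by (simp add: max_def min_def field_simps power2_eq_square power3_eq_cube)
    qed
    then show ?thesis using False
      by (simp add: x \<Phi>\<^sub>0_def two s_def a_def b_def)
  qed
qed

lemma continuous_on_\<Phi>\<^sub>0: "continuous_on UNIV \<Phi>\<^sub>0"
proof -
  define M m where "M = (\<lambda>x::R6. max (norm (fst x)) (norm (snd x)))"
    and "m = (\<lambda>x::R6. min (norm (fst x)) (norm (snd x)))"
  have cont: "isCont M x" "isCont m x" for x
    unfolding M_def m_def by (auto intro!: continuous_intros)
  have M0: "M x = 0 \<longleftrightarrow> x = 0" for x
    by (cases x) (auto simp: M_def max_def zero_prod_def)
  have pos: "0 \<le> m x" "m x \<le> M x" "0 \<le> M x" for x
    by (auto simp: M_def m_def le_max_iff_disj)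
  have "isCont (\<lambda>x. (m x)\<^sup>2 / M x) x" for x
  proof (cases "x = 0")
    case False
    then show ?thesis using cont M0 by (auto intro!: continuous_intros)
  next
    case True
    have bd: "norm ((m y)\<^sup>2 / M y) \<le> M y" for y
    proof (cases "M y = 0")
      case False
      then have "M y > 0" using pos(3)[of y] by simp
      moreover have "(m y)\<^sup>2 \<le> (M y)\<^sup>2" using pos[of y] by (intro power_mono)
      ultimately show ?thesis by (simp add: field_simps power2_eq_square)
    qed simp
    have "M \<midarrow>0\<rightarrow> 0" using cont(1)[of 0] M0[of 0] by (simp add: isCont_def)
    then have "(\<lambda>y. (m y)\<^sup>2 / M y) \<midarrow>0\<rightarrow> 0"
      by (rule Lim_null_comparison[rotated]) (use bd in auto)
    then show ?thesis using True M0[of 0] by (simp add: isCont_def)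
  qed
  then have "isCont (\<lambda>x. (3 * M x + (m x)\<^sup>2 / M x) / 2 powr (3/2)) x" for x
    using cont by (auto intro!: continuous_intros)
  moreover have "\<Phi>\<^sub>0 = (\<lambda>x. (3 * M x + (m x)\<^sup>2 / M x) / 2 powr (3/2))"
    by (rule ext) (simp add: \<Phi>\<^sub>0_max_min M_def m_def)
  ultimately show ?thesis by (simp add: continuous_at_imp_continuous_on)
qed

end

theory Submission
  imports Defs
begin

text \<open>The gradient of \<open>\<Phi>\<close> along the normals of the graph of \<open>u / z\<close> restricts to a divergence-free field
  on \<open>\<real>\<^sup>6\<close> (this is the Euler--Lagrange equation of the graph), and for \<open>z \<rightarrow> 0\<close> it converges to a
  bounded field \<open>Z\<close> with \<open>Z \<bullet> \<nu>\<^sub>u = \<Phi>\<^sub>0 \<nu>\<^sub>u\<close>. By convexity \<open>Z \<bullet> w \<le> \<Phi>\<^sub>0 w\<close> for every \<open>w\<close>, with an error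
  quadratic in \<open>w - \<nu>\<^sub>u\<close> for unit \<open>w\<close>. So \<open>Z\<close> calibrates the cone and all level sets of \<open>u\<close>: its
  flux through a boundary is unchanged by compactly supported perturbations and bounds the area from
  below, which gives minimality, while the quadratic error makes the first variation vanish.

  The Gauss--Green formula for \<open>C\<^sup>1\<close> domains relative to the Hausdorff measure rests on the isodiametric
  inequality, obtained here from the Prekopa--Leindler inequality.\<close>

section \<open>The Hausdorff measure\<close>

text \<open>\<open>Z\<close> is homogeneous of degree 0, hence discontinuous at the origin, and no
  admissible field in the Gauss-Green formula that defines oriented boundaries. The smooth fields
  for z \<noteq> 0 are therefore kept until the flux has been evaluated. They are bounded uniformly
  and converge at every point: a competing boundary is Lebesgue null, so convergence almost
  everywhere in \<real>^6 would say nothing on it. The Gauss-Green formula must hold with constant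
  1, so Hausdorff measure has to match Lebesgue measure exactly on hyperplanes; since coverings use
  arbitrary sets, the lower bound amounts to the isodiametric inequality. The area element of a
  curved hypersurface is replaced by a comparison: on a small patch the projection along a fixed
  normal distorts distances by a factor of at most 1 + \<kappa>. This yields the formula up to an
  error proportional to the integral of a nonnegative test function. Such errors survive a partition
  of unity, and \<kappa> then tends to 0.\<close>

definition hausdorff_weight :: "nat \<Rightarrow> 'a::metric_space set \<Rightarrow> ennreal" where
  "hausdorff_weight k D =
     (if D = {} then 0 else ennreal (unit_ball_vol (real k) * (diameter D / 2) ^ k))"

definition fine_cover :: "real \<Rightarrow> 'a::metric_space set \<Rightarrow> (nat \<Rightarrow> 'a set) \<Rightarrow> bool" where
  "fine_cover \<delta> A D \<longleftrightarrow> A \<subseteq> (\<Union>i. D i) \<and> (\<forall>i. bounded (D i) \<and> diameter (D i) \<le> \<delta>)"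

lemma hausdorff_premeasure_alt:
  "hausdorff_premeasure k \<delta> A = (INF D \<in> {D. fine_cover \<delta> A D}. \<Sum>i. hausdorff_weight k (D i))"
  unfolding hausdorff_premeasure_def fine_cover_def hausdorff_weight_def by simp

lemma hausdorff_weight_empty [simp]: "hausdorff_weight k {} = 0"
  by (simp add: hausdorff_weight_def)

lemma hausdorff_premeasure_le:
  "fine_cover \<delta> A D \<Longrightarrow> hausdorff_premeasure k \<delta> A \<le> (\<Sum>i. hausdorff_weight k (D i))"
  unfolding hausdorff_premeasure_alt by (rule INF_lower) auto

lemma hausdorff_premeasure_empty: "\<delta> \<ge> 0 \<Longrightarrow> hausdorff_premeasure k \<delta> {} = 0"
  using hausdorff_premeasure_le[of \<delta> "{}" "\<lambda>_. {}" k] by (simp add: fine_cover_def)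

lemma hausdorff_premeasure_mono:
  "A \<subseteq> B \<Longrightarrow> hausdorff_premeasure k \<delta> A \<le> hausdorff_premeasure k \<delta> B"
  unfolding hausdorff_premeasure_alt fine_cover_def by (rule INF_superset_mono) auto

lemma hausdorff_premeasure_antimono:
  "\<delta> \<le> \<delta>' \<Longrightarrow> hausdorff_premeasure k \<delta>' A \<le> hausdorff_premeasure k \<delta> A"
  unfolding hausdorff_premeasure_alt fine_cover_def
  by (rule INF_superset_mono) (auto intro: order_trans)

lemma hausdorff_premeasure_close:
  assumes "hausdorff_premeasure k \<delta> A < \<infinity>" "e > 0"
  obtains D where "fine_cover \<delta> A D"
    "(\<Sum>i. hausdorff_weight k (D i)) \<le> hausdorff_premeasure k \<delta> A + ennreal e"
proof -
  have "hausdorff_premeasure k \<delta> A < hausdorff_premeasure k \<delta> A + ennreal e"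
    using assms by (simp add: ennreal_add_left_cancel_less[of _ 0, simplified])
  then show ?thesis
    using that unfolding hausdorff_premeasure_alt[of k \<delta> A] INF_less_iff
    by (auto intro: less_imp_le)
qed

lemma hausdorff_premeasure_subadditive:
  fixes A :: "nat \<Rightarrow> 'a::metric_space set"
  shows "hausdorff_premeasure k \<delta> (\<Union>i. A i) \<le> (\<Sum>i. hausdorff_premeasure k \<delta> (A i))"
proof (cases "(\<Sum>i. hausdorff_premeasure k \<delta> (A i)) < \<infinity>")
  case True
  then have fin: "hausdorff_premeasure k \<delta> (A i) < \<infinity>" for i
    by (metis ennreal_suminf_lessD infinity_ennreal_def)
  show ?thesis
  proof (rule ennreal_le_epsilon)
    fix e :: real assume "0 < e"
    have "\<exists>D. fine_cover \<delta> (A i) D \<and> (\<Sum>j. hausdorff_weight k (D j))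
            \<le> hausdorff_premeasure k \<delta> (A i) + ennreal (e * (1/2) ^ Suc i)" for i
      using hausdorff_premeasure_close[OF fin, of "e * (1/2) ^ Suc i" i] \<open>0 < e\<close> by fastforce
    then obtain D where D: "\<And>i. fine_cover \<delta> (A i) (D i)"
      and sD: "\<And>i. (\<Sum>j. hausdorff_weight k (D i j))
            \<le> hausdorff_premeasure k \<delta> (A i) + ennreal (e * (1/2) ^ Suc i)" by metis
    define F where "F = (\<lambda>n. case_prod D (prod_decode n))"
    have "fine_cover \<delta> (\<Union>i. A i) F"
      unfolding fine_cover_def
    proof (intro conjI allI subsetI)
      fix x assume "x \<in> (\<Union>i. A i)"
      then obtain i j where "x \<in> D i j" using D by (fastforce simp: fine_cover_def)
      then have "x \<in> F (prod_encode (i, j))" by (simp add: F_def)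
      then show "x \<in> (\<Union>i. F i)" by blast
    qed (use D in \<open>auto simp: F_def fine_cover_def split: prod.split\<close>)
    then have "hausdorff_premeasure k \<delta> (\<Union>i. A i) \<le> (\<Sum>i. hausdorff_weight k (F i))"
      by (rule hausdorff_premeasure_le)
    also have "\<dots> = (\<Sum>i. (\<lambda>(i, j). hausdorff_weight k (D i j)) (prod_decode i))"
      by (simp add: F_def case_prod_beta)
    also have "\<dots> = (\<Sum>i. \<Sum>j. hausdorff_weight k (D i j))"
      by (rule suminf_ennreal_2dimen) simp
    also have "\<dots> \<le> (\<Sum>i. hausdorff_premeasure k \<delta> (A i) + ennreal (e * (1/2) ^ Suc i))"
      by (intro suminf_le sD) auto
    also have "\<dots> = (\<Sum>i. hausdorff_premeasure k \<delta> (A i)) + (\<Sum>i. ennreal (e * (1/2) ^ Suc i))"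
      by (rule suminf_add[symmetric]) auto
    also have "(\<Sum>i. ennreal (e * (1/2) ^ Suc i)) = ennreal e"
    proof -
      have "(\<lambda>i. e * (1/2) ^ Suc i) sums (e * 1)"
        by (intro sums_mult power_half_series)
      then show ?thesis
        using \<open>0 < e\<close> by (subst suminf_ennreal2) (auto simp: sums_iff)
    qed
    finally show "hausdorff_premeasure k \<delta> (\<Union>i. A i)
        \<le> (\<Sum>i. hausdorff_premeasure k \<delta> (A i)) + ennreal e" .
  qed
qed (simp add: not_less top_unique)

lemma hausdorff_premeasure_le_outer:
  "0 < \<delta> \<Longrightarrow> hausdorff_premeasure k \<delta> A \<le> hausdorff_outer k A"
  unfolding hausdorff_outer_def by (rule SUP_upper) auto

lemma hausdorff_outer_leI:
  "(\<And>\<delta>. 0 < \<delta> \<Longrightarrow> hausdorff_premeasure k \<delta> A \<le> m) \<Longrightarrow> hausdorff_outer k A \<le> m"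
  unfolding hausdorff_outer_def by (rule SUP_least) auto

lemma hausdorff_outer_empty [simp]: "hausdorff_outer k {} = 0"
  using hausdorff_outer_leI[of k "{}" 0] by (simp add: hausdorff_premeasure_empty)

lemma hausdorff_outer_mono: "A \<subseteq> B \<Longrightarrow> hausdorff_outer k A \<le> hausdorff_outer k B"
  by (meson hausdorff_outer_leI hausdorff_premeasure_le_outer hausdorff_premeasure_mono order_trans)

lemma hausdorff_outer_subadditive:
  fixes A :: "nat \<Rightarrow> 'a::metric_space set"
  shows "hausdorff_outer k (\<Union>i. A i) \<le> (\<Sum>i. hausdorff_outer k (A i))"
proof (rule hausdorff_outer_leI)
  fix \<delta> :: real assume "0 < \<delta>"
  have "hausdorff_premeasure k \<delta> (\<Union>i. A i) \<le> (\<Sum>i. hausdorff_premeasure k \<delta> (A i))"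
    by (rule hausdorff_premeasure_subadditive)
  also have "\<dots> \<le> (\<Sum>i. hausdorff_outer k (A i))"
    by (intro suminf_le hausdorff_premeasure_le_outer \<open>0 < \<delta>\<close>) auto
  finally show "hausdorff_premeasure k \<delta> (\<Union>i. A i) \<le> (\<Sum>i. hausdorff_outer k (A i))" .
qed

lemma hausdorff_outer_Un: "hausdorff_outer k (A \<union> B) \<le> hausdorff_outer k A + hausdorff_outer k B"
proof -
  define C where "C = (\<lambda>i::nat. if i = 0 then A else if i = 1 then B else {})"
  have "hausdorff_outer k (\<Union>i. C i) \<le> (\<Sum>i. hausdorff_outer k (C i))"
    by (rule hausdorff_outer_subadditive)
  also have "\<dots> = (\<Sum>i<2. hausdorff_outer k (C i))"
    by (rule suminf_finite) (auto simp: C_def)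
  also have "\<dots> = hausdorff_outer k A + hausdorff_outer k B"
    by (simp add: C_def numeral_2_eq_2)
  also have "(\<Union>i. C i) = A \<union> B"
    unfolding C_def by (auto split: if_splits intro: exI[of _ 0] exI[of _ "Suc 0"])
  finally show ?thesis .
qed

text \<open>A set of diameter less than \<open>d\<close> meets at most one of \<open>A\<close> and \<open>B\<close>.\<close>

lemma hausdorff_outer_separated:
  assumes "0 < d" and sep: "\<And>x y. x \<in> A \<Longrightarrow> y \<in> B \<Longrightarrow> d \<le> dist x y"
  shows "hausdorff_outer k A + hausdorff_outer k B \<le> hausdorff_outer k (A \<union> B)"
proof -
  have pre: "hausdorff_premeasure k \<delta> A + hausdorff_premeasure k \<delta> B \<le> hausdorff_premeasure k \<delta> (A \<union> B)"
    if \<delta>: "0 < \<delta>" "\<delta> < d" for \<delta>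
    unfolding hausdorff_premeasure_alt[of k \<delta> "A \<union> B"]
  proof (rule INF_greatest, clarify)
    fix D assume D: "fine_cover \<delta> (A \<union> B) D"
    define D1 where "D1 = (\<lambda>i. if D i \<inter> A = {} then {} else D i)"
    define D2 where "D2 = (\<lambda>i. if D i \<inter> A = {} then D i else {})"
    have bd: "bounded (D i)" "diameter (D i) \<le> \<delta>" for i using D by (auto simp: fine_cover_def)
    have disj: "D i \<inter> B = {}" if "D i \<inter> A \<noteq> {}" for i
    proof (rule ccontr)
      assume "D i \<inter> B \<noteq> {}"
      with that obtain x y where "x \<in> D i" "y \<in> D i" "x \<in> A" "y \<in> B" by blast
      then have "d \<le> dist x y" "dist x y \<le> diameter (D i)"
        using sep diameter_bounded_bound[OF bd(1)] by auto
      then show False using bd(2)[of i] \<delta> by linarith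
    qed
    have "fine_cover \<delta> A D1"
      using D \<delta> bd unfolding fine_cover_def D1_def by (fastforce)
    moreover have "fine_cover \<delta> B D2"
      unfolding fine_cover_def
    proof (intro conjI allI subsetI)
      fix x assume "x \<in> B"
      then obtain i where "x \<in> D i" using D by (auto simp: fine_cover_def)
      then have "x \<in> D2 i" using disj[of i] \<open>x \<in> B\<close> by (auto simp: D2_def)
      then show "x \<in> (\<Union>i. D2 i)" by blast
    qed (use bd \<delta> in \<open>auto simp: D2_def\<close>)
    ultimately have "hausdorff_premeasure k \<delta> A + hausdorff_premeasure k \<delta> B
        \<le> (\<Sum>i. hausdorff_weight k (D1 i)) + (\<Sum>i. hausdorff_weight k (D2 i))"
      by (intro add_mono hausdorff_premeasure_le)
    also have "\<dots> = (\<Sum>i. hausdorff_weight k (D1 i) + hausdorff_weight k (D2 i))"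
      by (rule suminf_add) auto
    also have "\<dots> = (\<Sum>i. hausdorff_weight k (D i))"
      by (rule suminf_cong) (simp add: D1_def D2_def)
    finally show "hausdorff_premeasure k \<delta> A + hausdorff_premeasure k \<delta> B \<le> (\<Sum>i. hausdorff_weight k (D i))" .
  qed
  have "hausdorff_outer k A + hausdorff_outer k B
      = (SUP \<delta>\<in>{0<..}. SUP \<delta>'\<in>{0<..}. hausdorff_premeasure k \<delta> A + hausdorff_premeasure k \<delta>' B)"
    unfolding hausdorff_outer_def
    by (subst ennreal_SUP_add_left[symmetric], simp, subst ennreal_SUP_add_right, auto)
  also have "\<dots> \<le> hausdorff_outer k (A \<union> B)"
  proof (intro SUP_least)
    fix \<delta> \<delta>' :: real assume "\<delta> \<in> {0<..}" "\<delta>' \<in> {0<..}"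
    \<comment> \<open>One scale for both sets: premeasures grow as the scale shrinks, and below
      \<open>d\<close> no covering set meets both.\<close>
    define e where "e = min (min \<delta> \<delta>') (d/2)"
    have e: "0 < e" "e < d" "e \<le> \<delta>" "e \<le> \<delta>'"
      using \<open>0 < d\<close> \<open>\<delta> \<in> {0<..}\<close> \<open>\<delta>' \<in> {0<..}\<close> by (auto simp: e_def)
    have "hausdorff_premeasure k \<delta> A + hausdorff_premeasure k \<delta>' B
        \<le> hausdorff_premeasure k e A + hausdorff_premeasure k e B"
      by (intro add_mono hausdorff_premeasure_antimono e)
    also have "\<dots> \<le> hausdorff_premeasure k e (A \<union> B)" by (intro pre e)
    also have "\<dots> \<le> hausdorff_outer k (A \<union> B)" by (intro hausdorff_premeasure_le_outer e)
    finally show "hausdorff_premeasure k \<delta> A + hausdorff_premeasure k \<delta>' B \<le> hausdorff_outer k (A \<union> B)" .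
  qed
  finally show ?thesis .
qed

section \<open>Borel sets are Caratheodory measurable\<close>

lemma outer_measure_space_hausdorff:
  "outer_measure_space (Pow UNIV) (hausdorff_outer k)"
  by (auto simp: outer_measure_space_def positive_def increasing_def countably_subadditive_def
      hausdorff_outer_mono intro: hausdorff_outer_subadditive)

text \<open>Caratheodory's criterion. The shells \<open>R n\<close> with even, respectively odd, index are mutually
  separated, so their measures are summable.\<close>

lemma hausdorff_outer_shells:
  assumes F: "closed F" "F \<noteq> {}" and fin: "hausdorff_outer k A < \<infinity>" and "A \<inter> F = {}"
  shows "hausdorff_outer k A \<le> (SUP n. hausdorff_outer k {x \<in> A. 1 / Suc n \<le> infdist x F})"
proof -
  define B where "B = (\<lambda>n. {x \<in> A. 1 / Suc n \<le> infdist x F})"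
  define R where "R = (\<lambda>n. {x \<in> A. 1 / real (Suc (Suc n)) \<le> infdist x F \<and> infdist x F < 1 / Suc n})"
  have pos: "0 < infdist x F" if "x \<in> A" for x
    using that assms by (metis disjoint_iff in_closed_iff_infdist_zero infdist_nonneg order_less_le)
  \<comment> \<open>A point of \<open>R m\<close> has distance at least 1/(m+2) from
    \<open>F\<close>, a point of \<open>R n\<close> with n \<ge> m + 2 less than 1/(m+3). Adjacent
    shells touch, hence the skipped index.\<close>
  have sep: "1 / real (Suc (Suc m)) - 1 / Suc (Suc (Suc m)) \<le> dist x y"
    if "x \<in> R m" "y \<in> R n" "m + 2 \<le> n" for x y m n
  proof -
    have "1 / real (Suc n) \<le> 1 / real (Suc (Suc (Suc m)))" using that(3) by (simp add: frac_le)
    moreover have "infdist x F \<le> infdist y F + dist x y" by (rule infdist_triangle)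
    ultimately show ?thesis using that(1,2) unfolding R_def by simp
  qed
  have gap: "0 < 1 / real (Suc (Suc m)) - 1 / Suc (Suc (Suc m))" for m by (intro diff_gt_0_iff_gt[THEN iffD2] frac_less2) auto
  have parity: "(\<Sum>i<n. hausdorff_outer k (R (2 * i + j))) \<le> hausdorff_outer k A" for n j
  proof -
    have "(\<Sum>i<n. hausdorff_outer k (R (2 * i + j))) \<le> hausdorff_outer k (\<Union>i<n. R (2 * i + j))"
    proof (induction n)
      case (Suc n)
      have "hausdorff_outer k (\<Union>i<n. R (2 * i + j)) + hausdorff_outer k (R (2 * n + j))
          \<le> hausdorff_outer k ((\<Union>i<n. R (2 * i + j)) \<union> R (2 * n + j))"
      proof (rule hausdorff_outer_separated)
        show "0 < 1 / real (Suc (Suc (2*n+j))) - 1 / Suc (Suc (Suc (2*n+j)))" by (rule gap)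
        fix x y assume "x \<in> (\<Union>i<n. R (2 * i + j))" "y \<in> R (2 * n + j)"
        then obtain i where i: "i < n" "x \<in> R (2 * i + j)" by auto
        \<comment> \<open>The gaps shrink with the index, so the value at the largest index bounds
          the distance to all the earlier shells of the same parity.\<close>
        have "1 / real (Suc (Suc (2*n+j))) - 1 / Suc (Suc (Suc (2*n+j)))
            \<le> 1 / real (Suc (Suc (2*i+j))) - 1 / Suc (Suc (Suc (2*i+j)))"
        proof -
          have mono: "1 / ((b::real) + 2) - 1 / (b + 3) \<le> 1 / (a + 2) - 1 / (a + 3)"
            if "0 \<le> a" "a \<le> b" for a b
          proof -
            have eq: "1 / (c + 2) - 1 / (c + 3) = 1 / ((c + 2) * (c + 3))" if "0 \<le> c" for c :: real
              using that by (simp add: field_simps)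
            have "(a + 2) * (a + 3) \<le> (b + 2) * (b + 3)" using that by (intro mult_mono) auto
            then show ?thesis using that by (simp add: eq frac_le)
          qed
          show ?thesis using mono[of "real (2*i+j)" "real (2*n+j)"] i by (simp add: algebra_simps)
        qed
        then show "1 / real (Suc (Suc (2*n+j))) - 1 / Suc (Suc (Suc (2*n+j))) \<le> dist x y"
          using sep[OF i(2) \<open>y \<in> R (2 * n + j)\<close>] i(1) by linarith
      qed
      also have "(\<Union>i<n. R (2 * i + j)) \<union> R (2 * n + j) = (\<Union>i<Suc n. R (2 * i + j))"
        by (auto simp: less_Suc_eq)
      finally have "hausdorff_outer k (\<Union>i<n. R (2 * i + j)) + hausdorff_outer k (R (2 * n + j))
         \<le> hausdorff_outer k (\<Union>i<Suc n. R (2 * i + j))" .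
      then show ?case
        unfolding sum.lessThan_Suc by (rule order_trans[OF add_right_mono[OF Suc.IH]])
    qed simp
    also have "\<dots> \<le> hausdorff_outer k A" by (rule hausdorff_outer_mono) (auto simp: R_def)
    finally show ?thesis .
  qed
  have split2: "(\<Sum>i<2*n. f i) = (\<Sum>i<n. f (2 * i)) + (\<Sum>i<n. f (2 * i + 1))" for n and f :: "nat \<Rightarrow> ennreal"
    by (induction n) (simp_all add: add_ac)
  have "(\<Sum>i. hausdorff_outer k (R i)) \<le> 2 * hausdorff_outer k A"
    unfolding suminf_eq_SUP
  proof (rule SUP_least)
    fix n
    have "(\<Sum>i<n. hausdorff_outer k (R i)) \<le> (\<Sum>i<2*n. hausdorff_outer k (R i))"
      by (rule sum_mono2) auto
    also have "\<dots> \<le> hausdorff_outer k A + hausdorff_outer k A"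
      unfolding split2 using parity[where n=n and j=0] parity[where n=n and j=1] by (intro add_mono) auto
    finally show "(\<Sum>i<n. hausdorff_outer k (R i)) \<le> 2 * hausdorff_outer k A" by (simp add: mult_2)
  qed
  then have finR: "(\<Sum>i. hausdorff_outer k (R i)) \<noteq> \<infinity>"
    using fin by (metis ennreal_mult_eq_top_iff ennreal_numeral infinity_ennreal_def leD
        ennreal_neq_top top.not_eq_extremum)
  \<comment> \<open>Outside \<open>B n\<close> the least \<open>l\<close> with 1/(l+1) \<le> infdist
    exceeds \<open>n\<close>, and the point lies in the shell number l - 1, whose index is at least
    \<open>n\<close>.\<close>
  have cover: "A \<subseteq> B n \<union> (\<Union>i. R (i + n))" for n
  proof
    fix x assume x: "x \<in> A"
    show "x \<in> B n \<union> (\<Union>i. R (i + n))"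
    proof (cases "x \<in> B n")
      case False
      define P where "P = (\<lambda>m. 1 / real (Suc m) \<le> infdist x F)"
      obtain m where "inverse (real (Suc m)) < infdist x F" using reals_Archimedean[OF pos[OF x]] by auto
      then have "P m" by (simp add: P_def inverse_eq_divide)
      define l where "l = (LEAST m. P m)"
      have l: "P l" "\<And>m. m < l \<Longrightarrow> \<not> P m" unfolding l_def using \<open>P m\<close> by (auto intro: LeastI dest: not_less_Least)
      have "\<not> P i" if "i \<le> n" for i
      proof
        assume "P i"
        moreover have "1 / real (Suc n) \<le> 1 / real (Suc i)" using that by (simp add: frac_le)
        ultimately show False using False x unfolding P_def B_def by simp
      qed
      then have "n < l" using l(1) not_less by blast
      then obtain i where i: "l = Suc (i + n)" by (metis add.commute less_iff_Suc_add)
      then have "x \<in> R (i + n)" using l(1) l(2)[of "i + n"] x by (auto simp: R_def P_def)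
      then show ?thesis by blast
    qed simp
  qed
  have bound: "hausdorff_outer k A \<le> (SUP n. hausdorff_outer k (B n)) + (\<Sum>i. hausdorff_outer k (R (i + n)))" for n
  proof -
    have "hausdorff_outer k A \<le> hausdorff_outer k (B n \<union> (\<Union>i. R (i + n)))"
      by (rule hausdorff_outer_mono[OF cover])
    also have "\<dots> \<le> hausdorff_outer k (B n) + hausdorff_outer k (\<Union>i. R (i + n))"
      by (rule hausdorff_outer_Un)
    also have "\<dots> \<le> (SUP n. hausdorff_outer k (B n)) + (\<Sum>i. hausdorff_outer k (R (i + n)))"
      by (intro add_mono SUP_upper hausdorff_outer_subadditive) auto
    finally show ?thesis .
  qed
  \<comment> \<open>The parity estimate made the series over all shells finite, so its tails
    vanish.\<close>
  have "(\<lambda>n. (\<Sum>i. hausdorff_outer k (R (i + n)))) \<longlonglongrightarrow> 0"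
  proof -
    define r where "r = (\<lambda>i. enn2real (hausdorff_outer k (R i)))"
    have r: "hausdorff_outer k (R i) = ennreal (r i)" "0 \<le> r i" for i
      using finR by (auto simp: r_def dest: ennreal_suminf_lessD[of _ _ i] simp flip: top.not_eq_extremum
         intro!: ennreal_enn2real[symmetric])
        (metis ennreal_suminf_lessD top.not_eq_extremum)
    have sr: "summable r"
      by (rule summable_suminf_not_top) (use r finR in auto)
    have eq: "(\<Sum>i. hausdorff_outer k (R (i + n))) = ennreal (\<Sum>i. r (i + n))" for n
      unfolding r(1) by (rule suminf_ennreal2) (use r sr summable_ignore_initial_segment in auto)
    have "(\<lambda>n. \<Sum>i. r (i + n)) \<longlonglongrightarrow> 0" by (rule suminf_exist_split2[OF sr])
    then show ?thesis unfolding eq using tendsto_ennrealI by fastforce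
  qed
  then have "(\<lambda>n. (SUP n. hausdorff_outer k (B n)) + (\<Sum>i. hausdorff_outer k (R (i + n))))
      \<longlonglongrightarrow> (SUP n. hausdorff_outer k (B n)) + 0"
    by (intro tendsto_add tendsto_const)
  then have "hausdorff_outer k A \<le> (SUP n. hausdorff_outer k (B n)) + 0"
    by (rule LIMSEQ_le_const) (use bound in auto)
  then show ?thesis by (simp add: B_def)
qed

text \<open>\<open>A - F\<close> is exhausted in measure by its parts at distance at least 1/(n+1)
  from \<open>F\<close>. Each of these is separated from \<open>F \<inter> A\<close>, and on
  separated sets the outer measure is additive.\<close>

lemma closed_lambda_system_hausdorff:
  fixes F :: "'a::metric_space set"
  assumes "closed F"
  shows "F \<in> lambda_system UNIV (Pow UNIV) (hausdorff_outer k)"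
proof (cases "F = {}")
  case True
  then show ?thesis by (simp add: lambda_system_def)
next
  case False
  have "hausdorff_outer k (F \<inter> A) + hausdorff_outer k (A - F) \<le> hausdorff_outer k A" for A
  proof (cases "hausdorff_outer k A < \<infinity>")
    case True
    have "hausdorff_outer k (A - F) < \<infinity>"
      using True hausdorff_outer_mono[of "A - F" A k] by (meson Diff_subset le_less_trans)
    then have "hausdorff_outer k (A - F) \<le> (SUP n. hausdorff_outer k {x \<in> A - F. 1 / Suc n \<le> infdist x F})"
      by (intro hausdorff_outer_shells assms False) auto
    then have "hausdorff_outer k (F \<inter> A) + hausdorff_outer k (A - F)
      \<le> hausdorff_outer k (F \<inter> A) + (SUP n. hausdorff_outer k {x \<in> A - F. 1 / Suc n \<le> infdist x F})"
      by (rule add_left_mono)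
    also have "\<dots> = (SUP n. hausdorff_outer k (F \<inter> A) + hausdorff_outer k {x \<in> A - F. 1 / Suc n \<le> infdist x F})"
      by (rule ennreal_SUP_add_right) auto
    also have "\<dots> \<le> hausdorff_outer k A"
    proof (rule SUP_least)
      fix n
      have "hausdorff_outer k (F \<inter> A) + hausdorff_outer k {x \<in> A - F. 1 / Suc n \<le> infdist x F}
         \<le> hausdorff_outer k ((F \<inter> A) \<union> {x \<in> A - F. 1 / Suc n \<le> infdist x F})"
      proof (rule hausdorff_outer_separated)
        fix x y assume "x \<in> F \<inter> A" "y \<in> {x \<in> A - F. 1 / Suc n \<le> infdist x F}"
        then show "1 / Suc n \<le> dist x y" using infdist_le[of x F y] by (auto simp: dist_commute)
      qed simp
      also have "\<dots> \<le> hausdorff_outer k A" by (rule hausdorff_outer_mono) auto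
      finally show "hausdorff_outer k (F \<inter> A) + hausdorff_outer k {x \<in> A - F. 1 / Suc n \<le> infdist x F}
         \<le> hausdorff_outer k A" .
    qed
    finally show ?thesis .
  qed (simp add: not_less top_unique)
  moreover have "hausdorff_outer k A \<le> hausdorff_outer k (F \<inter> A) + hausdorff_outer k (A - F)" for A
    using hausdorff_outer_Un[of k "F \<inter> A" "A - F"] by (simp add: Int_commute Int_Diff_Un)
  ultimately have "hausdorff_outer k (F \<inter> A) + hausdorff_outer k (A - F) = hausdorff_outer k A" for A
    by (intro antisym)
  then show ?thesis by (auto simp: lambda_system_def Diff_eq Int_commute)
qed

lemma measure_space_hausdorff: "measure_space UNIV (sets borel) (hausdorff_outer k)"
proof -
  interpret sigma_algebra UNIV "Pow (UNIV :: 'a set)" by (rule sigma_algebra_Pow)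
  define L where "L = lambda_system UNIV (Pow (UNIV :: 'a set)) (hausdorff_outer k)"
  have L: "measure_space UNIV L (hausdorff_outer k)"
    unfolding L_def by (rule caratheodory_lemma[OF outer_measure_space_hausdorff])
  have "sets (borel :: 'a measure) \<subseteq> L"
  proof -
    interpret L: sigma_algebra UNIV L using L by (simp add: measure_space_def)
    show ?thesis
      unfolding borel_eq_closed
      using L.sigma_sets_subset[of "Collect closed"] closed_lambda_system_hausdorff[of _ k]
      by (auto simp: L_def)
  qed
  then show ?thesis
    by (intro measure_down[OF L]) (metis sets.sigma_algebra_axioms space_borel)
qed

section \<open>The measure on Borel sets, Lipschitz maps and isometries\<close>

lemma sets_hausdorff_measure [simp, measurable_cong]: "sets (hausdorff_measure k) = sets borel"
  unfolding hausdorff_measure_def by (metis sets.sigma_sets_eq sets_measure_of space_borel sets.space_closed)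

lemma space_hausdorff_measure [simp]: "space (hausdorff_measure k) = UNIV"
  unfolding hausdorff_measure_def by (simp add: space_measure_of_conv)

lemma emeasure_hausdorff_measure:
  "B \<in> sets borel \<Longrightarrow> emeasure (hausdorff_measure k) B = hausdorff_outer k B"
  unfolding hausdorff_measure_def using measure_space_hausdorff[of k]
  by (intro emeasure_measure_of_sigma) (auto simp: measure_space_def)

text \<open>Intersecting a cover with \<open>A\<close> and mapping it multiplies diameters by at
  most \<open>L\<close>, hence weights by at most L^k; the scale \<delta> / L of the source becomes
  \<delta>. The later comparisons of areas under projections, dilations and diffeomorphisms rest on
  this.\<close>

lemma hausdorff_outer_lipschitz:
  fixes f :: "'a::metric_space \<Rightarrow> 'b::metric_space"
  assumes "0 < L" and lip: "\<And>x y. x \<in> A \<Longrightarrow> y \<in> A \<Longrightarrow> dist (f x) (f y) \<le> L * dist x y"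
  shows "hausdorff_outer k (f ` A) \<le> ennreal (L ^ k) * hausdorff_outer k A"
proof (rule hausdorff_outer_leI)
  fix \<delta> :: real assume "0 < \<delta>"
  have "hausdorff_premeasure k \<delta> (f ` A) \<le> ennreal (L ^ k) * hausdorff_premeasure k (\<delta> / L) A"
  proof -
    have "hausdorff_premeasure k \<delta> (f ` A) \<le> ennreal (L ^ k) * (\<Sum>i. hausdorff_weight k (D i))"
      if D: "fine_cover (\<delta> / L) A D" for D
    proof -
      define E where "E = (\<lambda>i. f ` (A \<inter> D i))"
      have bd: "bounded (D i)" "diameter (D i) \<le> \<delta> / L" for i using D by (auto simp: fine_cover_def)
      have dE: "dist u v \<le> L * diameter (D i)" if "u \<in> E i" "v \<in> E i" for u v i
      proof -
        obtain x y where xy: "x \<in> A" "y \<in> A" "x \<in> D i" "y \<in> D i" "u = f x" "v = f y"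
          using \<open>u \<in> E i\<close> \<open>v \<in> E i\<close> unfolding E_def by auto
        then have "dist u v \<le> L * dist x y" using lip by auto
        also have "\<dots> \<le> L * diameter (D i)"
          using diameter_bounded_bound[OF bd(1)] xy \<open>0 < L\<close> by (intro mult_left_mono) auto
        finally show ?thesis .
      qed
      have bE: "bounded (E i)" for i
        unfolding bounded_two_points using dE by blast
      have diamE: "diameter (E i) \<le> L * diameter (D i)" for i
      proof (rule ccontr)
        assume less: "\<not> ?thesis"
        have "0 \<le> L * diameter (D i)" using diameter_ge_0[OF bd(1)] \<open>0 < L\<close> by simp
        then obtain c where c: "L * diameter (D i) < c" "c < diameter (E i)" "0 < c"
          using less dense[of "L * diameter (D i)" "diameter (E i)"] by auto
        obtain x y where "x \<in> E i" "y \<in> E i" "c < dist x y"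
          using diameter_lower_bounded[OF bE c(3,2)] by auto
        then show False using dE[of x i y] c(1) by linarith
      qed
      have "fine_cover \<delta> (f ` A) E"
        unfolding fine_cover_def
      proof (intro conjI allI)
        show "f ` A \<subseteq> (\<Union>i. E i)" using D by (fastforce simp: E_def fine_cover_def)
        fix i
        show "bounded (E i)" by (rule bE)
        have "L * diameter (D i) \<le> \<delta>" using bd(2)[of i] \<open>0 < L\<close> by (simp add: field_simps)
        then show "diameter (E i) \<le> \<delta>" using diamE[of i] by linarith
      qed
      then have "hausdorff_premeasure k \<delta> (f ` A) \<le> (\<Sum>i. hausdorff_weight k (E i))"
        by (rule hausdorff_premeasure_le)
      also have "\<dots> \<le> (\<Sum>i. ennreal (L ^ k) * hausdorff_weight k (D i))"
      proof (intro suminf_le)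
        fix i
        show "hausdorff_weight k (E i) \<le> ennreal (L ^ k) * hausdorff_weight k (D i)"
        proof (cases "E i = {}")
          case False
          then have "D i \<noteq> {}" by (auto simp: E_def)
          have "(diameter (E i) / 2) ^ k \<le> (L * diameter (D i) / 2) ^ k"
            using diamE[of i] diameter_ge_0[OF bE[of i]] by (intro power_mono) auto
          then have "unit_ball_vol (real k) * (diameter (E i) / 2) ^ k
              \<le> unit_ball_vol (real k) * (L * diameter (D i) / 2) ^ k"
            by (intro mult_left_mono) auto
          also have "\<dots> = L ^ k * (unit_ball_vol (real k) * (diameter (D i) / 2) ^ k)"
            by (simp add: power_mult_distrib power_divide)
          finally have "unit_ball_vol (real k) * (diameter (E i) / 2) ^ k
              \<le> L ^ k * (unit_ball_vol (real k) * (diameter (D i) / 2) ^ k)" .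
          then show ?thesis using False \<open>D i \<noteq> {}\<close> \<open>0 < L\<close> diameter_ge_0[OF bd(1)]
            by (simp add: hausdorff_weight_def ennreal_mult[symmetric] ennreal_leI)
        qed simp
      qed auto
      also have "\<dots> = ennreal (L ^ k) * (\<Sum>i. hausdorff_weight k (D i))"
        by (rule ennreal_suminf_cmult)
      finally show ?thesis .
    qed
    note bound = this
    have inv: "ennreal (1 / L ^ k) * (ennreal (L ^ k) * z) = z" "ennreal (L ^ k) * (ennreal (1 / L ^ k) * z) = z" for z
      using \<open>0 < L\<close> by (simp_all add: mult.assoc[symmetric] ennreal_mult[symmetric])
    have "ennreal (1 / L ^ k) * hausdorff_premeasure k \<delta> (f ` A) \<le> hausdorff_premeasure k (\<delta> / L) A"
      unfolding hausdorff_premeasure_alt[of k "\<delta> / L"]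
    proof (rule INF_greatest)
      fix D assume "D \<in> {D. fine_cover (\<delta> / L) A D}"
      then have "ennreal (1 / L ^ k) * hausdorff_premeasure k \<delta> (f ` A)
          \<le> ennreal (1 / L ^ k) * (ennreal (L ^ k) * (\<Sum>i. hausdorff_weight k (D i)))"
        by (intro mult_left_mono bound) auto
      then show "ennreal (1 / L ^ k) * hausdorff_premeasure k \<delta> (f ` A) \<le> (\<Sum>i. hausdorff_weight k (D i))"
        unfolding inv .
    qed
    then have "ennreal (L ^ k) * (ennreal (1 / L ^ k) * hausdorff_premeasure k \<delta> (f ` A))
        \<le> ennreal (L ^ k) * hausdorff_premeasure k (\<delta> / L) A"
      by (rule mult_left_mono) auto
    then show ?thesis unfolding inv .
  qed
  also have "\<dots> \<le> ennreal (L ^ k) * hausdorff_outer k A"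
    using \<open>0 < L\<close> \<open>0 < \<delta>\<close> by (intro mult_left_mono hausdorff_premeasure_le_outer) auto
  finally show "hausdorff_premeasure k \<delta> (f ` A) \<le> ennreal (L ^ k) * hausdorff_outer k A" .
qed

lemma hausdorff_outer_singleton:
  assumes "0 < k" shows "hausdorff_outer k {x} = 0"
proof -
  have "hausdorff_premeasure k \<delta> {x} \<le> 0" if "0 < \<delta>" for \<delta>
  proof -
    have "fine_cover \<delta> {x} (\<lambda>_. {x})" using that unfolding fine_cover_def by auto
    then have "hausdorff_premeasure k \<delta> {x} \<le> (\<Sum>i::nat. hausdorff_weight k {x})"
      by (rule hausdorff_premeasure_le)
    also have "hausdorff_weight k {x} = 0"
      unfolding hausdorff_weight_def using assms by (simp add: zero_power)
    finally show ?thesis by simp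
  qed
  then have "hausdorff_outer k {x} \<le> 0" by (rule hausdorff_outer_leI)
  then show ?thesis by simp
qed

lemma linear_isometry_eq_iff:
  fixes f :: "'a::real_normed_vector \<Rightarrow> 'b::real_normed_vector"
  assumes "linear f" "\<And>x. norm (f x) = norm x"
  shows "dist (f x) (f y) = dist x y" "f x = f y \<longleftrightarrow> x = y"
proof -
  show "dist (f x) (f y) = dist x y" unfolding dist_norm using assms(2)[of "x - y"] linear_diff[OF assms(1)] by metis
  then show "f x = f y \<longleftrightarrow> x = y" by (metis dist_eq_0_iff)
qed

text \<open>Up to a null set, an open set is a disjoint union of balls, and isometries preserve balls.\<close>

lemma distr_lborel_isometry:
  fixes f :: "'a::euclidean_space \<Rightarrow> 'b::euclidean_space"
  assumes lin: "linear f" and iso: "\<And>x. norm (f x) = norm x" and dim: "DIM('a) = DIM('b)"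
  shows "distr lborel borel f = lborel"
proof -
  have cont: "continuous_on UNIV f" using lin by (simp add: linear_continuous_on linear_conv_bounded_linear)
  have meas [measurable]: "f \<in> borel_measurable borel" using cont by (rule borel_measurable_continuous_onI)
  have inj: "inj f" using linear_isometry_eq_iff[OF lin iso] by (auto simp: inj_def)
  have surj: "surj f"
  proof -
    have "dim (range f) = DIM('a)" using dim_image_eq[OF lin] inj by (simp add: inj_on_subset)
    moreover have "subspace (range f)" using lin by (simp add: linear_subspace_image subspace_UNIV)
    ultimately show ?thesis by (metis dim dim_eq_full dim_UNIV span_eq_iff)
  qed
  have ball: "f -` cball x r = cball (inv f x) r" for x r
  proof -
    have "dist x (f z) = dist (inv f x) z" for z
      using linear_isometry_eq_iff(1)[OF lin iso, of "inv f x" z] surj_f_inv_f[OF surj, of x] by simp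
    then show ?thesis by auto
  qed
  define g where "g = inv f"
  have g: "f (g x) = x" "g (f z) = z" for x z using surj inj by (simp_all add: g_def surj_f_inv_f)
  have g_lip: "dist (g x) (g y) = dist x y" for x y using linear_isometry_eq_iff(1)[OF lin iso, of "g x" "g y"] g by simp
  have open_eq: "emeasure lborel (f -` U) = emeasure lborel U" if "open U" for U
  proof -
    obtain C where C: "countable C" "C \<subseteq> {p. 0 < snd p \<and> cball (fst p) (snd p) \<subseteq> U}"
      "pairwise (\<lambda>i j. disjnt (cball (fst i) (snd i)) (cball (fst j) (snd j))) C"
      "negligible (U - (\<Union>i \<in> C. cball (fst i) (snd i)))"
    proof (rule Vitali_covering_theorem_cballs[of "{p. 0 < snd p \<and> cball (fst p) (snd p) \<subseteq> U}" snd U fst])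
      fix x and d :: real assume "x \<in> U" "0 < d"
      then obtain e where "0 < e" "cball x e \<subseteq> U" using \<open>open U\<close> open_contains_cball by blast
      then show "\<exists>i. i \<in> {p. 0 < snd p \<and> cball (fst p) (snd p) \<subseteq> U} \<and> x \<in> cball (fst i) (snd i) \<and> snd i < d"
        using \<open>0 < d\<close> by (intro exI[of _ "(x, min e (d/2))"]) auto
    qed auto
    define N where "N = U - (\<Union>i \<in> C. cball (fst i) (snd i))"
    have Nm: "N \<in> sets borel" unfolding N_def using \<open>open U\<close> C(1) by (intro sets.Diff sets.countable_UN') auto
    have N0: "emeasure lborel N = 0" using C(4) Nm unfolding N_def[symmetric]
      by (simp add: negligible_iff_null_sets null_sets_def)
    have disj: "disjoint_family_on (\<lambda>i. cball (fst i) (snd i)) C"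
      using C(3) by (auto simp: disjoint_family_on_def pairwise_def disjnt_def)
    \<comment> \<open>The null set left over by the balls is pulled back by the inverse isometry,
      which is 1-Lipschitz between spaces of equal dimension and so preserves null sets.\<close>
    have "negligible (g ` N)"
      by (rule negligible_locally_Lipschitz_image) (use dim C(4) g_lip in \<open>auto simp: N_def dist_norm intro!: exI[of _ UNIV] exI[of _ 1]\<close>)
    moreover have gN: "g ` N = f -` N" by (auto simp: g(1)) (metis g(2) image_eqI)
    moreover have fN: "f -` N \<in> sets borel" using measurable_sets[OF meas Nm] by simp
    ultimately have N1: "emeasure lborel (f -` N) = 0"
      by (simp add: negligible_iff_null_sets null_sets_def)
    have UN: "U = (\<Union>i \<in> C. cball (fst i) (snd i)) \<union> N" using C(2) by (auto simp: N_def)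
    have "emeasure lborel U = emeasure lborel (\<Union>i \<in> C. cball (fst i) (snd i))"
      by (subst UN, rule emeasure_Un_null_set) (use N0 Nm C(1) in \<open>auto simp: null_sets_def intro!: sets.countable_UN'\<close>)
    also have "\<dots> = (\<integral>\<^sup>+ i. emeasure lborel (cball (fst i) (snd i)) \<partial>count_space C)"
      by (rule emeasure_UN_countable[OF _ C(1) disj]) auto
    also have "\<dots> = (\<integral>\<^sup>+ i. emeasure lborel (f -` cball (fst i) (snd i)) \<partial>count_space C)"
      using C(2) unfolding ball by (intro nn_integral_cong) (auto simp: emeasure_cball dim)
    also have "\<dots> = emeasure lborel (\<Union>i \<in> C. f -` cball (fst i) (snd i))"
    proof (rule emeasure_UN_countable[symmetric, OF _ C(1)])
      show "disjoint_family_on (\<lambda>i. f -` cball (fst i) (snd i)) C"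
        using disj unfolding disjoint_family_on_def by blast
    qed (simp add: ball)
    also have "\<dots> = emeasure lborel (f -` U)"
    proof -
      have "f -` U = (\<Union>i \<in> C. f -` cball (fst i) (snd i)) \<union> f -` N" by (subst UN) auto
      moreover have "(\<Union>i \<in> C. f -` cball (fst i) (snd i)) \<in> sets lborel"
        using C(1) by (intro sets.countable_UN') (auto simp: ball)
      ultimately show ?thesis
        using N1 fN by (simp add: emeasure_Un_null_set null_sets_def)
    qed
    finally show ?thesis ..
  qed
  have "lborel = distr lborel borel f"
  proof (rule lborel_eqI)
    fix l u :: 'b assume lu: "\<And>b. b \<in> Basis \<Longrightarrow> l \<bullet> b \<le> u \<bullet> b"
    show "emeasure (distr lborel borel f) (box l u) = (\<Prod>b\<in>Basis. (u - l) \<bullet> b)"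
      by (subst emeasure_distr) (use lu open_eq[OF open_box] in \<open>auto simp: emeasure_lborel_box_eq inner_diff_left\<close>)
  qed simp
  then show ?thesis by simp
qed

section \<open>The isodiametric inequality\<close>

text \<open>Inner regularity with nonempty compact sets, because the sum-set argument on the line
  picks extremal points.\<close>

lemma emeasure_lborel_inner_compact:
  fixes A :: "'a::euclidean_space set"
  assumes "A \<in> sets borel" "A \<noteq> {}"
  shows "emeasure lborel A = (SUP K\<in>{K. compact K \<and> K \<subseteq> A \<and> K \<noteq> {}}. emeasure lborel K)" (is "_ = ?S")
proof (rule antisym)
  show "emeasure lborel A \<le> ?S"
  proof (rule ennreal_le_epsilon)
    fix e :: real assume "0 < e"
    obtain T where T: "closed T" "T \<subseteq> A" "emeasure lebesgue (A - T) < ennreal e"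
      by (rule sets_lebesgue_inner_closed[of A e]) (use assms(1) \<open>0 < e\<close> in simp_all)
    have Tb: "T \<in> sets borel" using T(1) by simp
    have "emeasure lborel T = (SUP n. emeasure lborel (T \<inter> cball 0 (real n)))"
    proof -
      have "(\<Union>n. T \<inter> cball 0 (real n)) = T" by (auto simp: real_arch_simple)
      moreover have "incseq (\<lambda>n. T \<inter> cball 0 (real n))" by (auto simp: incseq_def)
      ultimately show ?thesis
        using SUP_emeasure_incseq[of "\<lambda>n. T \<inter> cball 0 (real n)" lborel] Tb
        by (simp add: image_subset_iff)
    qed
    also have "\<dots> \<le> ?S"
    proof (rule SUP_least)
      fix n :: nat
      show "emeasure lborel (T \<inter> cball 0 (real n)) \<le> ?S"
      proof (cases "T \<inter> cball 0 (real n) = {}")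
        case False
        then show ?thesis using T by (intro SUP_upper) (auto intro: closed_Int_compact)
      qed simp
    qed
    finally have "emeasure lborel T \<le> ?S" .
    moreover have "emeasure lborel (A - T) \<le> ennreal e" using T(3) assms(1) Tb by (simp add: less_imp_le)
    moreover have "emeasure lborel A \<le> emeasure lborel T + emeasure lborel (A - T)"
      using emeasure_subadditive[of T lborel "A - T"] T(2) Tb assms(1) by (simp add: Un_absorb1)
    ultimately show "emeasure lborel A \<le> ?S + ennreal e" by (meson add_mono order_trans)
  qed
  show "?S \<le> emeasure lborel A" using assms(1) by (intro SUP_least emeasure_mono) auto
qed

section \<open>Brunn-Minkowski on the line\<close>

lemma emeasure_lborel_translate:
  fixes A :: "real set"
  assumes "A \<in> sets borel"
  shows "emeasure lborel {z. z - b \<in> A} = emeasure lborel A"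
proof -
  have "emeasure lborel A = (\<integral>\<^sup>+x. indicator A x \<partial>lborel)" using assms by simp
  also have "\<dots> = ennreal \<bar>1\<bar> * (\<integral>\<^sup>+x. indicator A (- b + 1 * x) \<partial>lborel)"
    by (rule nn_integral_real_affine) (use assms in auto)
  also have "\<dots> = (\<integral>\<^sup>+x. indicator {z. z - b \<in> A} x \<partial>lborel)" by (auto intro!: nn_integral_cong simp: indicator_def)
  also have "\<dots> = emeasure lborel {z. z - b \<in> A}"
    by (rule nn_integral_indicator) (use assms in measurable)
  finally show ?thesis ..
qed

lemma emeasure_lborel_double:
  fixes A :: "real set"
  assumes "A \<in> sets borel"
  shows "emeasure lborel {z. z / 2 \<in> A} = 2 * emeasure lborel A"
proof -
  have "(\<integral>\<^sup>+x. indicator {z. z / 2 \<in> A} x \<partial>lborel) = ennreal \<bar>2\<bar> * (\<integral>\<^sup>+x. indicator {z. z / 2 \<in> A} (0 + 2 * x) \<partial>lborel)"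
    by (rule nn_integral_real_affine) (use assms in \<open>auto intro!: borel_measurable_indicator\<close>)
  moreover have "{z. z / 2 \<in> A} \<in> sets borel" using assms by measurable
  moreover have "(\<integral>\<^sup>+x. indicator {z. z / 2 \<in> A} (0 + 2 * x) \<partial>lborel) = (\<integral>\<^sup>+x. indicator A x \<partial>lborel)"
    by (intro nn_integral_cong) (auto simp: indicator_def)
  ultimately show ?thesis using assms by simp
qed

text \<open>The translates \<open>A + min B\<close> and \<open>max A + B\<close> lie in \<open>A + B\<close> and share a single point.\<close>

lemma brunn_minkowski_real_compact:
  fixes A B C :: "real set"
  assumes A: "compact A" "A \<noteq> {}" and B: "compact B" "B \<noteq> {}" and C: "C \<in> sets borel"
    and mid: "\<And>x y. x \<in> A \<Longrightarrow> y \<in> B \<Longrightarrow> (x + y) / 2 \<in> C"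
  shows "emeasure lborel A + emeasure lborel B \<le> 2 * emeasure lborel C"
proof -
  obtain a where a: "a \<in> A" "\<And>x. x \<in> A \<Longrightarrow> x \<le> a" using compact_attains_sup[OF A] by auto
  obtain b where b: "b \<in> B" "\<And>x. x \<in> B \<Longrightarrow> b \<le> x" using compact_attains_inf[OF B] by auto
  have m: "A \<in> sets borel" "B \<in> sets borel" using A B by (auto simp: borel_compact)
  define S where "S = {z. z - b \<in> A} - {a + b}"
  define T where "T = {z. z - a \<in> B}"
  have Sm: "{z. z - b \<in> A} \<in> sets borel" "T \<in> sets borel" unfolding T_def using m by measurable
  have "emeasure lborel A = emeasure lborel {z. z - b \<in> A}" by (rule emeasure_lborel_translate[OF m(1), symmetric])
  also have "\<dots> = emeasure lborel S"
    unfolding S_def by (rule emeasure_Diff_null_set[symmetric]) (use Sm in auto)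
  finally have "emeasure lborel A + emeasure lborel B = emeasure lborel S + emeasure lborel T"
    unfolding T_def by (simp add: emeasure_lborel_translate[OF m(2)])
  also have "\<dots> = emeasure lborel (S \<union> T)"
    by (rule plus_emeasure) (use Sm a(2) b(2) in \<open>auto simp: S_def T_def, force\<close>)
  also have "\<dots> \<le> emeasure lborel {z. z / 2 \<in> C}"
  proof (rule emeasure_mono)
    show "S \<union> T \<subseteq> {z. z / 2 \<in> C}"
      using mid[of "z - b" b for z] mid[of a "z - a" for z] a(1) b(1) by (auto simp: S_def T_def)
    show "{z. z / 2 \<in> C} \<in> sets lborel" using C by measurable
  qed
  also have "\<dots> = 2 * emeasure lborel C" by (rule emeasure_lborel_double[OF C])
  finally show ?thesis .
qed

text \<open>\<open>C\<close> is an arbitrary Borel set containing the midpoints, since the set of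
  midpoints of two Borel sets need not be Borel. Both measures on the left are suprema over compact
  subsets, where the extremal-point argument is available.\<close>

lemma brunn_minkowski_real:
  fixes A B C :: "real set"
  assumes A: "A \<in> sets borel" "A \<noteq> {}" and B: "B \<in> sets borel" "B \<noteq> {}" and C: "C \<in> sets borel"
    and mid: "\<And>x y. x \<in> A \<Longrightarrow> y \<in> B \<Longrightarrow> (x + y) / 2 \<in> C"
  shows "emeasure lborel A + emeasure lborel B \<le> 2 * emeasure lborel C"
proof -
  let ?K = "\<lambda>A. {K::real set. compact K \<and> K \<subseteq> A \<and> K \<noteq> {}}"
  have ne: "?K A \<noteq> {}" if "A \<noteq> {}" for A :: "real set"
  proof -
    from that obtain x where "x \<in> A" by blast
    then have "{x} \<in> ?K A" by auto
    then show ?thesis by blast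
  qed
  have "emeasure lborel A + emeasure lborel B
     = (SUP K\<in>?K A. SUP L\<in>?K B. emeasure lborel K + emeasure lborel L)"
    unfolding emeasure_lborel_inner_compact[OF A] emeasure_lborel_inner_compact[OF B]
    by (subst ennreal_SUP_add_left[symmetric, OF ne[OF A(2)]], subst ennreal_SUP_add_right[OF ne[OF B(2)]]) auto
  also have "\<dots> \<le> 2 * emeasure lborel C"
    by (intro SUP_least brunn_minkowski_real_compact C) (use mid in auto)
  finally show ?thesis .
qed

section \<open>The Prekopa-Leindler inequality\<close>

lemma nn_integral_layer_cake:
  fixes f :: "'a::euclidean_space \<Rightarrow> ennreal"
  assumes [measurable]: "f \<in> borel_measurable borel" and le1: "\<And>x. f x \<le> 1"
  shows "(\<integral>\<^sup>+x. f x \<partial>lborel) = (\<integral>\<^sup>+l. indicator {0<..<1::real} l * emeasure lborel {x. ennreal l < f x} \<partial>lborel)"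
proof -
  have pt: "f x = (\<integral>\<^sup>+l. indicator {0<..<1} l * indicator {x. ennreal l < f x} x \<partial>lborel)" for x
  proof -
    obtain r where r: "0 \<le> r" "f x = ennreal r"
      using le1[of x] by (cases "f x") (auto simp: top_unique)
    then have "r \<le> 1" using le1[of x] by (simp add: ennreal_le_1)
    have "(\<integral>\<^sup>+l. indicator {0<..<1} l * indicator {x. ennreal l < f x} x \<partial>lborel)
       = (\<integral>\<^sup>+l. indicator {0<..<r} l \<partial>lborel)"
      by (intro nn_integral_cong) (use r \<open>r \<le> 1\<close> in \<open>auto simp: indicator_def ennreal_less_iff\<close>)
    also have "\<dots> = ennreal r" using r by simp
    finally show ?thesis using r by simp
  qed
  have "(\<integral>\<^sup>+x. f x \<partial>lborel)
     = (\<integral>\<^sup>+x. (\<integral>\<^sup>+l. indicator {0<..<1::real} l * indicator {x. ennreal l < f x} x \<partial>lborel) \<partial>lborel)"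
    by (subst pt) simp
  also have "\<dots> = (\<integral>\<^sup>+l. (\<integral>\<^sup>+x. indicator {0<..<1::real} l * indicator {x. ennreal l < f x} x \<partial>lborel) \<partial>lborel)"
    by (rule lborel_pair.Fubini'[symmetric]) (auto simp: case_prod_beta indicator_def)
  also have "\<dots> = (\<integral>\<^sup>+l. indicator {0<..<1::real} l * emeasure lborel {x. ennreal l < f x} \<partial>lborel)"
    by (intro nn_integral_cong, subst nn_integral_cmult) auto
  finally show ?thesis .
qed

text \<open>The inequality for the weight 1/2, squared so that no roots of extended reals occur. As
  a predicate of the type it can be lifted along products and handed to statements about an abstract
  space of the right dimension.\<close>

definition prekopa_leindler :: "'a::euclidean_space itself \<Rightarrow> bool" where
  "prekopa_leindler _ \<longleftrightarrow>
     (\<forall>f g h :: 'a \<Rightarrow> ennreal. f \<in> borel_measurable borel \<and> g \<in> borel_measurable borel \<and> h \<in> borel_measurable borel \<and>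
        (\<forall>x y. f x * g y \<le> (h ((1/2) *\<^sub>R (x + y)))\<^sup>2) \<longrightarrow>
        (\<integral>\<^sup>+x. f x \<partial>lborel) * (\<integral>\<^sup>+x. g x \<partial>lborel) \<le> (\<integral>\<^sup>+x. h x \<partial>lborel)\<^sup>2)"

text \<open>Tensorization: the inequality in the second factor, applied to the slices at
  \<open>s\<close> and \<open>t\<close>, is exactly the hypothesis of the inequality in the first
  factor for the integrals over slices.\<close>

lemma prekopa_leindler_prod:
  assumes a: "prekopa_leindler TYPE('a::euclidean_space)" and b: "prekopa_leindler TYPE('b::euclidean_space)"
  shows "prekopa_leindler TYPE('a \<times> 'b)"
  unfolding prekopa_leindler_def
proof (intro allI impI, elim conjE)
  fix f g h :: "'a \<times> 'b \<Rightarrow> ennreal"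
  assume m: "f \<in> borel_measurable borel" "g \<in> borel_measurable borel" "h \<in> borel_measurable borel"
    and le: "\<forall>x y. f x * g y \<le> (h ((1/2) *\<^sub>R (x + y)))\<^sup>2"
  then have [measurable]: "f \<in> borel_measurable (borel \<Otimes>\<^sub>M borel)" "g \<in> borel_measurable (borel \<Otimes>\<^sub>M borel)"
    "h \<in> borel_measurable (borel \<Otimes>\<^sub>M borel)" by (simp_all add: borel_prod)
  have "(\<integral>\<^sup>+y. f (s, y) \<partial>lborel) * (\<integral>\<^sup>+y. g (t, y) \<partial>lborel) \<le> (\<integral>\<^sup>+y. h ((1/2) *\<^sub>R (s + t), y) \<partial>lborel)\<^sup>2" for s t
    using b[unfolded prekopa_leindler_def, rule_format, of "\<lambda>y. f (s, y)" "\<lambda>y. g (t, y)" "\<lambda>y. h ((1/2) *\<^sub>R (s + t), y)"]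
      le by (auto simp: scaleR_prod_def plus_prod_def)
  then have "(\<integral>\<^sup>+x. \<integral>\<^sup>+y. f (x, y) \<partial>lborel \<partial>lborel) * (\<integral>\<^sup>+x. \<integral>\<^sup>+y. g (x, y) \<partial>lborel \<partial>lborel)
     \<le> (\<integral>\<^sup>+x. \<integral>\<^sup>+y. h (x, y) \<partial>lborel \<partial>lborel)\<^sup>2"
    by (intro a[unfolded prekopa_leindler_def, rule_format]) auto
  then show "(\<integral>\<^sup>+x. f x \<partial>lborel) * (\<integral>\<^sup>+x. g x \<partial>lborel) \<le> (\<integral>\<^sup>+x. h x \<partial>lborel)\<^sup>2"
    using lborel.nn_integral_fst[of f lborel] lborel.nn_integral_fst[of g lborel] lborel.nn_integral_fst[of h lborel] m
    by (simp add: lborel_prod)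
qed

text \<open>The inequality of arithmetic and geometric means; it turns the additive inequality for
  normalized functions into the multiplicative one.\<close>

lemma ennreal_mult_le_square:
  fixes x y z :: ennreal
  assumes "x + y \<le> 2 * z" shows "x * y \<le> z\<^sup>2"
proof (cases "z = \<infinity>")
  case False
  then obtain c where c: "0 \<le> c" "z = ennreal c" by (cases z) auto
  then have "x + y \<le> ennreal (2 * c)" using assms by (simp add: ennreal_mult)
  then have "x \<noteq> \<infinity>" "y \<noteq> \<infinity>" by (auto simp: top_unique)
  then obtain a b where ab: "0 \<le> a" "x = ennreal a" "0 \<le> b" "y = ennreal b" by (cases x; cases y) auto
  then have "a + b \<le> 2 * c" using \<open>x + y \<le> ennreal (2 * c)\<close> c by (simp add: ennreal_plus[symmetric] del: ennreal_plus)
  then have "(a + b)\<^sup>2 \<le> (2 * c)\<^sup>2" using ab by (intro power_mono) auto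
  moreover have "0 \<le> (a - b)\<^sup>2" by simp
  ultimately have "a * b \<le> c\<^sup>2" by (simp add: power2_eq_square algebra_simps)
  then show ?thesis using ab c by (simp add: ennreal_mult[symmetric] ennreal_power ennreal_leI)
qed (simp add: power2_eq_square)

text \<open>If f(x) and g(y) exceed \<open>l\<close>, then so does \<open>h\<close> at the midpoint,
  so Brunn-Minkowski bounds the level sets of \<open>f\<close> and \<open>g\<close> by that of
  \<open>h\<close>. It needs nonempty level sets, which for all l < 1 means supremum at least 1.
  Bounded functions are rescaled to supremum 1, general ones are truncated first.\<close>

lemma prekopa_leindler_real: "prekopa_leindler TYPE(real)"
proof -
  have normalized: "(\<integral>\<^sup>+x. f x \<partial>lborel) + (\<integral>\<^sup>+x. g x \<partial>lborel) \<le> 2 * (\<integral>\<^sup>+x. h x \<partial>lborel)"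
    if [measurable]: "f \<in> borel_measurable borel" "g \<in> borel_measurable borel" "h \<in> borel_measurable borel"
      and le1: "\<And>x. f x \<le> 1" "\<And>x. g x \<le> 1" and near1: "\<And>l. l < 1 \<Longrightarrow> \<exists>x. l < f x" "\<And>l. l < 1 \<Longrightarrow> \<exists>x. l < g x"
      and le: "\<And>x y. f x * g y \<le> (h ((x + y) / 2))\<^sup>2" for f g h :: "real \<Rightarrow> ennreal"
  proof -
    have "(\<integral>\<^sup>+x. f x \<partial>lborel) + (\<integral>\<^sup>+x. g x \<partial>lborel)
      = (\<integral>\<^sup>+l. indicator {0<..<1::real} l * emeasure lborel {x. ennreal l < f x} \<partial>lborel)
        + (\<integral>\<^sup>+l. indicator {0<..<1::real} l * emeasure lborel {x. ennreal l < g x} \<partial>lborel)"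
      by (simp add: nn_integral_layer_cake le1)
    also have "\<dots> = (\<integral>\<^sup>+l. indicator {0<..<1::real} l * emeasure lborel {x. ennreal l < f x}
        + indicator {0<..<1::real} l * emeasure lborel {x. ennreal l < g x} \<partial>lborel)"
      by (rule nn_integral_add[symmetric]) auto
    \<comment> \<open>\<open>h\<close> is cut at 1 because the layer formula applies to functions
      bounded by 1; the level sets for l < 1 do not change.\<close>
    also have "\<dots> \<le> (\<integral>\<^sup>+l. 2 * (indicator {0<..<1::real} l * emeasure lborel {x. ennreal l < min (h x) 1}) \<partial>lborel)"
    proof (rule nn_integral_mono)
      fix l :: real
      show "indicator {0<..<1::real} l * emeasure lborel {x. ennreal l < f x}
        + indicator {0<..<1::real} l * emeasure lborel {x. ennreal l < g x}
        \<le> 2 * (indicator {0<..<1::real} l * emeasure lborel {x. ennreal l < min (h x) 1})"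
      proof (cases "l \<in> {0<..<1}")
        case True
        then have l1: "ennreal l < 1" using ennreal_less_iff[of l 1] by simp
        have "emeasure lborel {x. ennreal l < f x} + emeasure lborel {x. ennreal l < g x}
          \<le> 2 * emeasure lborel {x. ennreal l < min (h x) 1}"
        proof (rule brunn_minkowski_real)
          fix x y assume "x \<in> {x. ennreal l < f x}" "y \<in> {x. ennreal l < g x}"
          then have "ennreal l * ennreal l < ennreal l * g y"
            using True by (intro ennreal_mult_strict_left_mono) auto
          also have "\<dots> \<le> f x * g y"
            using \<open>x \<in> _\<close> by (intro mult_right_mono) auto
          also have "\<dots> \<le> (h ((x + y) / 2))\<^sup>2" by (rule le)
          finally have "ennreal l < h ((x + y) / 2)"
            by (metis leD leI mult_mono power2_eq_square zero_le)
          then show "(x + y) / 2 \<in> {x. ennreal l < min (h x) 1}" using l1 by simp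
        qed (use near1[OF l1] in auto)
        then show ?thesis using True by simp
      qed simp
    qed
    also have "\<dots> = 2 * (\<integral>\<^sup>+l. indicator {0<..<1::real} l * emeasure lborel {x. ennreal l < min (h x) 1} \<partial>lborel)"
      by (rule nn_integral_cmult) auto
    also have "\<dots> = 2 * (\<integral>\<^sup>+x. min (h x) 1 \<partial>lborel)" by (subst nn_integral_layer_cake[symmetric]) auto
    also have "\<dots> \<le> 2 * (\<integral>\<^sup>+x. h x \<partial>lborel)" by (intro mult_left_mono nn_integral_mono) auto
    finally show ?thesis .
  qed
  have bounded: "(\<integral>\<^sup>+x. f x \<partial>lborel) * (\<integral>\<^sup>+x. g x \<partial>lborel) \<le> (\<integral>\<^sup>+x. h x \<partial>lborel)\<^sup>2"
    if [measurable]: "f \<in> borel_measurable borel" "g \<in> borel_measurable borel" "h \<in> borel_measurable borel"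
      and bdd: "\<And>x. f x \<le> ennreal M" "\<And>x. g x \<le> ennreal M"
      and le: "\<And>x y. f x * g y \<le> (h ((x + y) / 2))\<^sup>2" for f g h :: "real \<Rightarrow> ennreal" and M
  proof -
    have "(SUP x. f x) \<le> ennreal M" "(SUP x. g x) \<le> ennreal M" using bdd by (auto intro: SUP_least)
    then obtain a b where ab: "0 \<le> a" "(SUP x. f x) = ennreal a" "0 \<le> b" "(SUP x. g x) = ennreal b"
      by (cases "SUP x. f x"; cases "SUP x. g x") (auto simp: top_unique)
    have fa: "f x \<le> ennreal a" and gb: "g x \<le> ennreal b" for x
      unfolding ab(2)[symmetric] ab(4)[symmetric] by (auto intro: SUP_upper)
    show ?thesis
    proof (cases "a = 0 \<or> b = 0")
      case True
      then have "(\<forall>x. f x = 0) \<or> (\<forall>x. g x = 0)" using fa gb by fastforce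
      then show ?thesis by auto
    next
      case False
      then have ab0: "0 < a" "0 < b" using ab by auto
      \<comment> \<open>The hypothesis is preserved when \<open>f\<close>, \<open>g\<close>,
        \<open>h\<close> are divided by \<open>a\<close>, \<open>b\<close> and their geometric
        mean.\<close>
      define c where "c = sqrt (a * b)"
      have c0: "0 < c" "c\<^sup>2 = a * b" using ab0 by (simp_all add: c_def)
      have scale: "ennreal (1 / r) * (ennreal r * z) = z" "ennreal r * (ennreal (1 / r) * z) = z" if "0 < r" for r z
        using that by (simp_all add: mult.assoc[symmetric] ennreal_mult[symmetric])
      have near: "\<exists>x. l < ennreal (1 / r) * k x" if "0 < r" "(SUP x. k x) = ennreal r" "l < 1" for r k and l :: ennreal
      proof -
        have "ennreal r * l < ennreal r * 1" using that by (intro ennreal_mult_strict_left_mono) auto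
        then have "\<exists>x. ennreal r * l < k x" using that(2) less_SUP_iff[of "ennreal r * l" k UNIV] by auto
        then obtain x where "ennreal r * l < k x" ..
        then have "ennreal (1 / r) * (ennreal r * l) < ennreal (1 / r) * k x"
          using that(1) by (intro ennreal_mult_strict_left_mono) auto
        then show ?thesis using scale[OF that(1)] by auto
      qed
      have le1: "ennreal (1 / r) * z \<le> 1" if "0 < r" "z \<le> ennreal r" for r z
        using mult_left_mono[OF that(2), of "ennreal (1 / r)"] that(1) by (simp add: ennreal_mult[symmetric])
      have cc: "ennreal (1 / a) * ennreal (1 / b) = (ennreal (1 / c))\<^sup>2"
        using ab0 c0 by (simp add: ennreal_mult[symmetric] ennreal_power power_divide)
      have "(\<integral>\<^sup>+x. ennreal (1 / a) * f x \<partial>lborel) + (\<integral>\<^sup>+x. ennreal (1 / b) * g x \<partial>lborel)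
        \<le> 2 * (\<integral>\<^sup>+x. ennreal (1 / c) * h x \<partial>lborel)"
      proof (rule normalized)
        fix x y
        have "ennreal (1 / a) * f x * (ennreal (1 / b) * g y) = (ennreal (1 / c))\<^sup>2 * (f x * g y)"
          unfolding cc[symmetric] by (simp add: mult_ac)
        also have "\<dots> \<le> (ennreal (1 / c))\<^sup>2 * (h ((x + y) / 2))\<^sup>2" by (intro mult_left_mono le) auto
        finally show "ennreal (1 / a) * f x * (ennreal (1 / b) * g y) \<le> (ennreal (1 / c) * h ((x + y) / 2))\<^sup>2"
          by (simp add: power_mult_distrib)
      qed (use le1 fa gb ab0 near ab in auto)
      then have "ennreal (1 / a) * (\<integral>\<^sup>+x. f x \<partial>lborel) * (ennreal (1 / b) * (\<integral>\<^sup>+x. g x \<partial>lborel))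
        \<le> (ennreal (1 / c) * (\<integral>\<^sup>+x. h x \<partial>lborel))\<^sup>2"
        by (intro ennreal_mult_le_square) (simp add: nn_integral_cmult)
      then have "(ennreal (1 / c))\<^sup>2 * ((\<integral>\<^sup>+x. f x \<partial>lborel) * (\<integral>\<^sup>+x. g x \<partial>lborel))
        \<le> (ennreal (1 / c))\<^sup>2 * (\<integral>\<^sup>+x. h x \<partial>lborel)\<^sup>2"
        unfolding cc[symmetric] by (simp add: power_mult_distrib cc mult_ac)
      then have "(ennreal c)\<^sup>2 * ((ennreal (1 / c))\<^sup>2 * ((\<integral>\<^sup>+x. f x \<partial>lborel) * (\<integral>\<^sup>+x. g x \<partial>lborel)))
        \<le> (ennreal c)\<^sup>2 * ((ennreal (1 / c))\<^sup>2 * (\<integral>\<^sup>+x. h x \<partial>lborel)\<^sup>2)"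
        by (rule mult_left_mono) auto
      moreover have "(ennreal c)\<^sup>2 * ((ennreal (1 / c))\<^sup>2 * z) = z" for z
        using scale(2)[of "c\<^sup>2" z] c0(1) by (simp add: ennreal_power power_divide)
      ultimately show ?thesis by simp
    qed
  qed
  show ?thesis
    unfolding prekopa_leindler_def
  proof (intro allI impI, elim conjE)
    fix f g h :: "real \<Rightarrow> ennreal"
    assume m [measurable]: "f \<in> borel_measurable borel" "g \<in> borel_measurable borel" "h \<in> borel_measurable borel"
      and le: "\<forall>x y. f x * g y \<le> (h ((1/2) *\<^sub>R (x + y)))\<^sup>2"
    \<comment> \<open>Truncation makes the suprema finite. It is applied to \<open>f\<close> and
      \<open>g\<close> alone, so the hypothesis persists with the same \<open>h\<close>.\<close>
    have trunc: "(\<integral>\<^sup>+x. k x \<partial>lborel) = (SUP n. (\<integral>\<^sup>+x. min (k x) (of_nat n) \<partial>lborel))"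
      if [measurable]: "k \<in> borel_measurable borel" for k :: "real \<Rightarrow> ennreal"
    proof -
      have "(SUP n. min (k x) (of_nat n)) = k x" for x
      proof (rule antisym)
        show "k x \<le> (SUP n. min (k x) (of_nat n))"
        proof (cases "k x = \<infinity>")
          case True
          then show ?thesis using ennreal_SUP_of_nat_eq_top by (simp add: min_def top_unique)
        next
          case False
          then have "\<exists>n. k x < of_nat n" using ennreal_Ex_less_of_nat[of "k x"] by (simp add: less_top)
          then obtain n :: nat where "k x \<le> of_nat n" using less_imp_le by blast
          then have "min (k x) (of_nat n) = k x" by simp
          then show ?thesis by (metis SUP_upper UNIV_I)
        qed
      qed (auto intro: SUP_least)
      then have "(\<integral>\<^sup>+x. k x \<partial>lborel) = (\<integral>\<^sup>+x. (SUP n. min (k x) (of_nat n)) \<partial>lborel)" by simp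
      also have "\<dots> = (SUP n. (\<integral>\<^sup>+x. min (k x) (of_nat n) \<partial>lborel))"
      proof (rule nn_integral_monotone_convergence_SUP)
        show "incseq (\<lambda>n x. min (k x) (of_nat n :: ennreal))"
          unfolding incseq_def le_fun_def by (intro allI impI min.mono order_refl of_nat_mono)
        show "(\<lambda>x. min (k x) (of_nat n)) \<in> borel_measurable lborel" for n by measurable
      qed
      finally show ?thesis .
    qed
    have "(\<integral>\<^sup>+x. f x \<partial>lborel) * (\<integral>\<^sup>+x. g x \<partial>lborel)
      = (SUP m. SUP n. (\<integral>\<^sup>+x. min (f x) (of_nat n) \<partial>lborel) * (\<integral>\<^sup>+x. min (g x) (of_nat m) \<partial>lborel))"
      by (simp only: trunc[OF m(1)] trunc[OF m(2)] SUP_mult_left_ennreal SUP_mult_right_ennreal)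
    also have "\<dots> \<le> (\<integral>\<^sup>+x. h x \<partial>lborel)\<^sup>2"
    proof (intro SUP_least)
      fix m n :: nat
      show "(\<integral>\<^sup>+x. min (f x) (of_nat n) \<partial>lborel) * (\<integral>\<^sup>+x. min (g x) (of_nat m) \<partial>lborel) \<le> (\<integral>\<^sup>+x. h x \<partial>lborel)\<^sup>2"
      proof (rule bounded[where M="real (n + m)"])
        fix x y
        show "min (f x) (of_nat n) * min (g y) (of_nat m) \<le> (h ((x + y) / 2))\<^sup>2"
          by (rule order_trans[OF mult_mono le[rule_format, of x y, simplified]]) auto
      qed (auto simp: min_le_iff_disj ennreal_of_nat_eq_real_of_nat)
    qed
    finally show "(\<integral>\<^sup>+x. f x \<partial>lborel) * (\<integral>\<^sup>+x. g x \<partial>lborel) \<le> (\<integral>\<^sup>+x. h x \<partial>lborel)\<^sup>2" .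
  qed
qed

text \<open>The set \<open>(A - A) / 2\<close> lies in a ball of radius \<open>diameter A / 2\<close>.\<close>

lemma isodiametric_inequality:
  fixes A :: "'a::euclidean_space set"
  assumes PL: "prekopa_leindler TYPE('a)" and A: "compact A"
  shows "emeasure lborel A \<le> hausdorff_weight DIM('a) A"
proof (cases "A = {}")
  case False
  define B where "B = uminus ` A"
  define H where "H = (\<lambda>(x, y). (1/2) *\<^sub>R (x - y)) ` (A \<times> A)"
  have B: "compact B" unfolding B_def by (intro compact_continuous_image A continuous_intros)
  have H: "compact H" unfolding H_def
    by (intro compact_continuous_image compact_Times A) (auto simp: case_prod_beta intro!: continuous_intros)
  have bor [measurable]: "A \<in> sets borel" "B \<in> sets borel" "H \<in> sets borel" using A B H by (auto intro: borel_compact)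
  have "emeasure lborel B = emeasure (distr lborel borel uminus) B"
    by (subst distr_lborel_isometry[of "uminus :: 'a \<Rightarrow> 'a"]) (auto simp: linear_iff)
  also have "\<dots> = emeasure lborel A"
    by (subst emeasure_distr) (auto simp: B_def vimage_def image_iff bor(2)[unfolded B_def] intro!: arg_cong[where f="emeasure lborel"])
  finally have BA: "emeasure lborel B = emeasure lborel A" .
  \<comment> \<open>The midpoint of a point of \<open>A\<close> and a point of \<open>-A\<close> is
    half a difference of points of \<open>A\<close>, so the inequality for indicator functions
    bounds |A| |-A| by |H|^2.\<close>
  have "(\<integral>\<^sup>+x. indicator A x \<partial>lborel) * (\<integral>\<^sup>+x. indicator B x \<partial>lborel) \<le> (\<integral>\<^sup>+x. indicator H x \<partial>lborel)\<^sup>2"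
  proof (rule PL[unfolded prekopa_leindler_def, rule_format], intro conjI allI)
    fix x y :: 'a
    show "indicator A x * indicator B y \<le> (indicator H ((1/2) *\<^sub>R (x + y)) :: ennreal)\<^sup>2"
    proof (cases "x \<in> A \<and> y \<in> B")
      case True
      then have "(x, - y) \<in> A \<times> A" by (auto simp: B_def)
      then have "(1/2) *\<^sub>R (x - - y) \<in> H" unfolding H_def by (rule rev_image_eqI) simp
      then show ?thesis by (simp add: indicator_def)
    qed (auto simp: indicator_def)
  qed auto
  then have sq: "emeasure lborel A * emeasure lborel A \<le> (emeasure lborel H)\<^sup>2" using BA by simp
  have "emeasure lborel A \<le> emeasure lborel H"
  proof (rule ccontr)
    assume "\<not> ?thesis"
    then have lt: "emeasure lborel H < emeasure lborel A" by simp
    have fin: "emeasure lborel A < \<infinity>" using emeasure_compact_finite[OF A] by simp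
    obtain a where a: "0 \<le> a" "emeasure lborel A = ennreal a" using fin by (cases "emeasure lborel A") auto
    obtain b where b: "0 \<le> b" "emeasure lborel H = ennreal b" using fin lt by (cases "emeasure lborel H") auto
    have "b < a" using lt a b by (simp add: ennreal_less_iff)
    moreover have "a * a \<le> b\<^sup>2" using sq a b by (simp add: ennreal_mult[symmetric] ennreal_power)
    moreover have "b * b < a * a" using \<open>b < a\<close> b(1) by (intro mult_strict_mono') auto
    ultimately show False by (simp add: power2_eq_square)
  qed
  also have "\<dots> \<le> emeasure lborel (cball (0::'a) (diameter A / 2))"
  proof (rule emeasure_mono)
    show "H \<subseteq> cball 0 (diameter A / 2)"
      using diameter_bounded_bound[OF compact_imp_bounded[OF A]] by (auto simp: H_def dist_norm)
  qed simp
  also have "\<dots> = hausdorff_weight DIM('a) A"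
    using False diameter_ge_0[OF compact_imp_bounded[OF A]] by (simp add: emeasure_cball hausdorff_weight_def)
  finally show ?thesis .
qed simp

section \<open>Top-dimensional Hausdorff measure is Lebesgue measure\<close>

lemma hausdorff_weight_cball:
  fixes a :: "'a::euclidean_space"
  assumes "0 < r" shows "hausdorff_weight DIM('a) (cball a r) = emeasure lborel (cball a r)"
  using assms by (simp add: hausdorff_weight_def emeasure_cball)

text \<open>The dilation factor \<open>s\<close> serves two covering arguments: 1 when disjoint
  balls fill an open set up to a null set, 5 when the enlarged balls of a Vitali selection cover a
  null set.\<close>

lemma hausdorff_premeasure_disjoint_balls:
  fixes a :: "'i \<Rightarrow> 'a::euclidean_space"
  assumes C: "countable C" and disj: "pairwise (\<lambda>i j. disjnt (cball (a i) (r i)) (cball (a j) (r j))) C"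
    and r: "\<And>i. i \<in> C \<Longrightarrow> 0 < r i \<and> 2 * (s * r i) \<le> \<delta>" and s: "0 < s" and "0 \<le> \<delta>"
  shows "hausdorff_premeasure DIM('a) \<delta> (\<Union>i\<in>C. cball (a i) (s * r i))
    \<le> ennreal (s ^ DIM('a)) * emeasure lborel (\<Union>i\<in>C. cball (a i) (r i))"
proof -
  \<comment> \<open>Covers are sequences, while \<open>C\<close> may be finite: the remaining
    indices get the empty set, whose weight is 0 by definition.\<close>
  define f where "f = from_nat_into C"
  define M where "M = to_nat_on C ` C"
  define D where "D = (\<lambda>m. if m \<in> M then cball (a (f m)) (s * r (f m)) else {})"
  define G where "G = (\<lambda>m. if m \<in> M then cball (a (f m)) (r (f m)) else {})"
  have f: "f m \<in> C" "to_nat_on C (f m) = m" if "m \<in> M" for m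
    using that C by (auto simp: f_def M_def)
  have fM: "C = f ` M" using C by (force simp: f_def M_def)
  have UD: "(\<Union>m. D m) = (\<Union>i\<in>C. cball (a i) (s * r i))"
    unfolding fM D_def by (auto split: if_splits)
  have UG: "(\<Union>m. G m) = (\<Union>i\<in>C. cball (a i) (r i))"
    unfolding fM G_def by (auto split: if_splits)
  have dG: "disjoint_family G"
    unfolding disjoint_family_on_def
  proof (intro ballI impI)
    fix m n :: nat assume "m \<noteq> n"
    show "G m \<inter> G n = {}"
    proof (cases "m \<in> M \<and> n \<in> M")
      case True
      then have "f m \<noteq> f n" using \<open>m \<noteq> n\<close> f(2) by metis
      then show ?thesis using pairwiseD[OF disj f(1) f(1)] True by (simp add: G_def disjnt_def)
    qed (auto simp: G_def)
  qed
  have "fine_cover \<delta> (\<Union>i\<in>C. cball (a i) (s * r i)) D"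
    unfolding fine_cover_def UD using r[OF f(1)] s \<open>0 \<le> \<delta>\<close> by (auto simp: D_def)
  then have "hausdorff_premeasure DIM('a) \<delta> (\<Union>i\<in>C. cball (a i) (s * r i)) \<le> (\<Sum>m. hausdorff_weight DIM('a) (D m))"
    by (rule hausdorff_premeasure_le)
  also have "\<dots> = (\<Sum>m. ennreal (s ^ DIM('a)) * emeasure lborel (G m))"
  proof (rule suminf_cong)
    fix m show "hausdorff_weight DIM('a) (D m) = ennreal (s ^ DIM('a)) * emeasure lborel (G m)"
    proof (cases "m \<in> M")
      case True
      then have "0 < r (f m)" using r f by auto
      then show ?thesis using True s
        by (simp add: D_def G_def hausdorff_weight_cball emeasure_cball ennreal_mult[symmetric] power_mult_distrib mult_ac)
    qed (simp add: D_def G_def)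
  qed
  also have "\<dots> = ennreal (s ^ DIM('a)) * (\<Sum>m. emeasure lborel (G m))" by (rule ennreal_suminf_cmult)
  also have "(\<Sum>m. emeasure lborel (G m)) = emeasure lborel (\<Union>m. G m)"
    by (rule suminf_emeasure[OF _ dG]) (auto simp: G_def)
  finally show ?thesis unfolding UG .
qed

text \<open>In dimension n, an open neighbourhood of measure at most e / 5^n contains disjoint balls
  whose fivefold enlargements cover \<open>N\<close>; the enlargement costs exactly the factor
  5^n.\<close>

lemma hausdorff_premeasure_null:
  fixes N :: "'a::euclidean_space set"
  assumes N: "N \<in> sets borel" "emeasure lborel N = 0" and "0 < \<delta>"
  shows "hausdorff_premeasure DIM('a) \<delta> N = 0"
proof -
  have "hausdorff_premeasure DIM('a) \<delta> N \<le> 0 + ennreal e" if "0 < e" for e :: real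
  proof -
    define e' where "e' = e / 5 ^ DIM('a)"
    have "0 < e'" using \<open>0 < e\<close> by (simp add: e'_def)
    obtain U where U: "open U" "N \<subseteq> U" "emeasure lborel (U - N) < ennreal e'"
      using outer_regular_lborel[OF N(1) \<open>0 < e'\<close>] by blast
    have "emeasure lborel U \<le> emeasure lborel N + emeasure lborel (U - N)"
      using emeasure_subadditive[of N lborel "U - N"] U N(1) by (simp add: Un_absorb1)
    then have U': "emeasure lborel U \<le> ennreal e'" using N(2) U(3) by simp
    \<comment> \<open>The enlarged ball has diameter 10 r, which must not exceed \<delta>.\<close>
    have "\<exists>r. 0 < r \<and> 10 * r \<le> \<delta> \<and> cball x r \<subseteq> U" if "x \<in> N" for x
    proof -
      have "x \<in> U" using that U(2) by blast
      then obtain t where "0 < t" "cball x t \<subseteq> U" using U(1) open_contains_cball by blast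
      then show ?thesis using \<open>0 < \<delta>\<close> by (intro exI[of _ "min t (\<delta>/10)"]) auto
    qed
    then obtain r where r: "\<And>x. x \<in> N \<Longrightarrow> 0 < r x \<and> 10 * r x \<le> \<delta> \<and> cball x (r x) \<subseteq> U" by metis
    obtain C where C: "countable C" "C \<subseteq> N"
      "pairwise (\<lambda>i j. disjnt (cball i (r i)) (cball j (r j))) C" "N \<subseteq> (\<Union>i\<in>C. cball i (5 * r i))"
    proof (rule Vitali_covering_lemma_cballs[where K=N and S=N and a="\<lambda>x. x" and r=r and B=\<delta>])
      show "N \<subseteq> (\<Union>i\<in>N. cball i (r i))" using r by force
      show "0 < r i \<and> r i \<le> \<delta>" if "i \<in> N" for i using r[OF that] by linarith
    qed
    have "hausdorff_premeasure DIM('a) \<delta> N \<le> hausdorff_premeasure DIM('a) \<delta> (\<Union>i\<in>C. cball i (5 * r i))"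
      by (rule hausdorff_premeasure_mono[OF C(4)])
    also have "\<dots> \<le> ennreal (5 ^ DIM('a)) * emeasure lborel (\<Union>i\<in>C. cball i (r i))"
      by (rule hausdorff_premeasure_disjoint_balls[OF C(1,3)]) (use r C(2) \<open>0 < \<delta>\<close> in fastforce)+
    also have "\<dots> \<le> ennreal (5 ^ DIM('a)) * emeasure lborel U"
      using r C(2) U(1) by (intro mult_left_mono emeasure_mono) auto
    also have "\<dots> \<le> ennreal (5 ^ DIM('a)) * ennreal e'" by (intro mult_left_mono U') auto
    also have "\<dots> = ennreal e" using \<open>0 < e\<close> by (simp add: e'_def ennreal_mult[symmetric])
    finally show ?thesis by simp
  qed
  then have "hausdorff_premeasure DIM('a) \<delta> N \<le> 0" by (rule ennreal_le_epsilon)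
  then show ?thesis by simp
qed

lemma hausdorff_premeasure_Un:
  "hausdorff_premeasure k \<delta> (A \<union> B) \<le> hausdorff_premeasure k \<delta> A + hausdorff_premeasure k \<delta> B" if "0 \<le> \<delta>"
proof -
  define C where "C = (\<lambda>i::nat. if i = 0 then A else if i = 1 then B else {})"
  have "hausdorff_premeasure k \<delta> (\<Union>i. C i) \<le> (\<Sum>i. hausdorff_premeasure k \<delta> (C i))"
    by (rule hausdorff_premeasure_subadditive)
  also have "\<dots> = (\<Sum>i<2. hausdorff_premeasure k \<delta> (C i))"
    using hausdorff_premeasure_empty[OF that] by (intro suminf_finite) (auto simp: C_def)
  also have "\<dots> = hausdorff_premeasure k \<delta> A + hausdorff_premeasure k \<delta> B"
    by (simp add: C_def numeral_2_eq_2)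
  also have "(\<Union>i. C i) = A \<union> B"
    unfolding C_def by (auto split: if_splits intro: exI[of _ 0] exI[of _ "Suc 0"])
  finally show ?thesis .
qed

text \<open>Upper bound: Vitali's theorem fills an open neighbourhood of \<open>B\<close> with
  disjoint balls of diameter at most \<delta>, up to a set of zero premeasure, and the weight of a
  ball is its volume. Lower bound: the isodiametric inequality for the closures of the covering
  sets.\<close>

theorem hausdorff_outer_eq_lborel:
  fixes B :: "'a::euclidean_space set"
  assumes PL: "prekopa_leindler TYPE('a)" and B: "B \<in> sets borel"
  shows "hausdorff_outer DIM('a) B = emeasure lborel B"
proof (rule antisym)
  show "hausdorff_outer DIM('a) B \<le> emeasure lborel B"
  proof (rule hausdorff_outer_leI, rule ennreal_le_epsilon)
    fix \<delta> e :: real assume "0 < \<delta>" "0 < e"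
    obtain U where U: "open U" "B \<subseteq> U" "emeasure lborel (U - B) < ennreal e"
      using outer_regular_lborel[OF B \<open>0 < e\<close>] by blast
    obtain C where C: "countable C" "C \<subseteq> {p. 0 < snd p \<and> 2 * snd p \<le> \<delta> \<and> cball (fst p) (snd p) \<subseteq> U}"
      "pairwise (\<lambda>i j. disjnt (cball (fst i) (snd i)) (cball (fst j) (snd j))) C"
      "negligible (U - (\<Union>i \<in> C. cball (fst i) (snd i)))"
    proof (rule Vitali_covering_theorem_cballs[of "{p. 0 < snd p \<and> 2 * snd p \<le> \<delta> \<and> cball (fst p) (snd p) \<subseteq> U}" snd U fst])
      fix x and d :: real assume "x \<in> U" "0 < d"
      then obtain e where "0 < e" "cball x e \<subseteq> U" using \<open>open U\<close> open_contains_cball by blast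
      then show "\<exists>i. i \<in> {p. 0 < snd p \<and> 2 * snd p \<le> \<delta> \<and> cball (fst p) (snd p) \<subseteq> U} \<and> x \<in> cball (fst i) (snd i) \<and> snd i < d"
        using \<open>0 < d\<close> \<open>0 < \<delta>\<close> by (intro exI[of _ "(x, min (min e (d/2)) (\<delta>/2))"]) auto
    qed auto
    define V where "V = (\<Union>i \<in> C. cball (fst i) (snd i))"
    have V: "V \<in> sets borel" unfolding V_def using C(1) by (intro sets.countable_UN') auto
    have "U - V \<in> sets borel" using V U(1) by auto
    moreover then have "emeasure lborel (U - V) = 0" using C(4) unfolding V_def[symmetric]
      by (simp add: negligible_iff_null_sets null_sets_def)
    ultimately have null: "hausdorff_premeasure DIM('a) \<delta> (U - V) = 0"
      using \<open>0 < \<delta>\<close> by (rule hausdorff_premeasure_null)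
    have "hausdorff_premeasure DIM('a) \<delta> B \<le> hausdorff_premeasure DIM('a) \<delta> (V \<union> (U - V))"
      by (rule hausdorff_premeasure_mono) (use U in auto)
    also have "\<dots> \<le> hausdorff_premeasure DIM('a) \<delta> V + hausdorff_premeasure DIM('a) \<delta> (U - V)"
      by (rule hausdorff_premeasure_Un) (use \<open>0 < \<delta>\<close> in auto)
    also have "\<dots> = hausdorff_premeasure DIM('a) \<delta> (\<Union>i \<in> C. cball (fst i) (1 * snd i))" using null by (simp add: V_def)
    also have "\<dots> \<le> ennreal (1 ^ DIM('a)) * emeasure lborel (\<Union>i \<in> C. cball (fst i) (snd i))"
      by (rule hausdorff_premeasure_disjoint_balls[OF C(1,3)]) (use C(2) \<open>0 < \<delta>\<close> in auto)
    also have "\<dots> \<le> emeasure lborel U" using C(2) U(1) by (auto intro!: emeasure_mono)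
    also have "\<dots> \<le> emeasure lborel B + emeasure lborel (U - B)"
      using emeasure_subadditive[of B lborel "U - B"] U B by (simp add: Un_absorb1)
    also have "\<dots> \<le> emeasure lborel B + ennreal e" using U(3) by (intro add_left_mono) auto
    finally show "hausdorff_premeasure DIM('a) \<delta> B \<le> emeasure lborel B + ennreal e" .
  qed
next
  \<comment> \<open>Any positive scale would do, since the isodiametric inequality holds for
    covering sets of every size.\<close>
  have "emeasure lborel B \<le> hausdorff_premeasure DIM('a) 1 B"
    unfolding hausdorff_premeasure_alt
  proof (rule INF_greatest)
    fix D assume "D \<in> {D. fine_cover 1 B D}"
    then have D: "B \<subseteq> (\<Union>i. D i)" "\<And>i. bounded (D i)" by (auto simp: fine_cover_def)
    have "B \<subseteq> (\<Union>i. closure (D i))" by (rule order_trans[OF D(1)]) (intro UN_mono order_refl closure_subset)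
    then have "emeasure lborel B \<le> emeasure lborel (\<Union>i. closure (D i))"
      by (rule emeasure_mono) simp
    also have "\<dots> \<le> (\<Sum>i. emeasure lborel (closure (D i)))"
      by (rule emeasure_subadditive_countably) (simp add: image_subset_iff)
    also have "\<dots> \<le> (\<Sum>i. hausdorff_weight DIM('a) (D i))"
    proof (intro suminf_le)
      fix i
      have "emeasure lborel (closure (D i)) \<le> hausdorff_weight DIM('a) (closure (D i))"
        using D(2) by (intro isodiametric_inequality PL) (simp add: compact_closure)
      also have "\<dots> = hausdorff_weight DIM('a) (D i)"
        using D(2) by (simp add: hausdorff_weight_def diameter_closure)
      finally show "emeasure lborel (closure (D i)) \<le> hausdorff_weight DIM('a) (D i)" .
    qed auto
    finally show "emeasure lborel B \<le> (\<Sum>i. hausdorff_weight DIM('a) (D i))" .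
  qed
  also have "\<dots> \<le> hausdorff_outer DIM('a) B" by (rule hausdorff_premeasure_le_outer) simp
  finally show "emeasure lborel B \<le> hausdorff_outer DIM('a) B" .
qed

section \<open>Test functions\<close>

definition C1_scalar :: "('a::euclidean_space \<Rightarrow> real) \<Rightarrow> ('a \<Rightarrow> 'a) \<Rightarrow> bool" where
  "C1_scalar f F \<longleftrightarrow> (\<forall>x. GDERIV f x :> F x) \<and> continuous_on UNIV F"

definition supp :: "('a::topological_space \<Rightarrow> 'b::zero) \<Rightarrow> 'a set" where
  "supp f = closure {x. f x \<noteq> 0}"

lemma C1_scalar_gderiv: "C1_scalar f F \<Longrightarrow> GDERIV f x :> F x"
  by (simp add: C1_scalar_def)

lemma C1_scalar_cont_grad: "C1_scalar f F \<Longrightarrow> continuous_on A F"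
  unfolding C1_scalar_def using continuous_on_subset by blast

lemma C1_scalar_cont: "C1_scalar f F \<Longrightarrow> continuous_on A f"
  unfolding C1_scalar_def gderiv_def by (meson continuous_at_imp_continuous_on has_derivative_continuous)

lemma C1_scalar_const: "C1_scalar (\<lambda>x. c) (\<lambda>x. 0)"
  by (simp add: C1_scalar_def GDERIV_const)

lemma C1_scalar_add: "C1_scalar f F \<Longrightarrow> C1_scalar g G \<Longrightarrow> C1_scalar (\<lambda>x. f x + g x) (\<lambda>x. F x + G x)"
  by (simp add: C1_scalar_def GDERIV_add continuous_on_add)

lemma C1_scalar_diff: "C1_scalar f F \<Longrightarrow> C1_scalar g G \<Longrightarrow> C1_scalar (\<lambda>x. f x - g x) (\<lambda>x. F x - G x)"
  by (simp add: C1_scalar_def GDERIV_diff continuous_on_diff)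

lemma C1_scalar_mult:
  assumes "C1_scalar f F" "C1_scalar g G"
  shows "C1_scalar (\<lambda>x. f x * g x) (\<lambda>x. f x *\<^sub>R G x + g x *\<^sub>R F x)"
  unfolding C1_scalar_def
proof
  show "\<forall>x. GDERIV (\<lambda>x. f x * g x) x :> f x *\<^sub>R G x + g x *\<^sub>R F x"
    using GDERIV_mult[OF C1_scalar_gderiv[OF assms(1)] C1_scalar_gderiv[OF assms(2)]] by (rule allI)
  show "continuous_on UNIV (\<lambda>x. f x *\<^sub>R G x + g x *\<^sub>R F x)"
    by (intro continuous_on_add continuous_on_scaleR C1_scalar_cont[OF assms(1)] C1_scalar_cont[OF assms(2)]
        C1_scalar_cont_grad[OF assms(1)] C1_scalar_cont_grad[OF assms(2)])
qed

lemma supp_subset: "x \<notin> supp f \<Longrightarrow> f x = 0"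
  unfolding supp_def using closure_subset[of "{x. f x \<noteq> 0}"] by blast

lemma supp_mono: "(\<And>x. g x \<noteq> 0 \<Longrightarrow> f x \<noteq> 0) \<Longrightarrow> supp g \<subseteq> supp f"
  unfolding supp_def by (intro closure_mono) auto

lemma supp_subset_closed: "closed A \<Longrightarrow> (\<And>x. g x \<noteq> 0 \<Longrightarrow> x \<in> A) \<Longrightarrow> supp g \<subseteq> A"
  unfolding supp_def by (intro closure_minimal) auto

lemma closed_supp: "closed (supp f)"
  by (simp add: supp_def)

lemma C1_scalar_grad_supp:
  assumes "C1_scalar f F" "x \<notin> supp f" shows "F x = 0"
proof -
  have "GDERIV f x :> 0"
    unfolding gderiv_def
  proof (rule has_derivative_transform_within_open[where f="\<lambda>_. 0" and s="- supp f"])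
    show "((\<lambda>_. 0) has_derivative (\<lambda>h. h \<bullet> 0)) (at x)" by simp
  qed (use assms(2) closed_supp[of f] in \<open>auto simp: supp_subset\<close>)
  then have "(\<lambda>h. h \<bullet> F x) = (\<lambda>h. h \<bullet> 0)"
    using C1_scalar_gderiv[OF assms(1), of x] unfolding gderiv_def by (rule has_derivative_unique[rotated])
  then have "F x \<bullet> F x = F x \<bullet> 0" by (rule fun_cong)
  then show ?thesis by simp
qed

lemma C_k_map_1I:
  assumes der: "\<And>x. (X has_derivative X' x) (at x)" and cont: "\<And>v. continuous_on UNIV (\<lambda>x. X' x v)"
  shows "C_k_map 1 X" "divergence X x = (\<Sum>b\<in>Basis. X' x b \<bullet> b)"
proof -
  have eq: "frechet_derivative X (at x) = X' x" for x using frechet_derivative_at[OF der] by metis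
  then show "divergence X x = (\<Sum>b\<in>Basis. X' x b \<bullet> b)" by (simp add: divergence_def)
  show "C_k_map 1 X" using der cont by (auto simp: eq differentiable_def)
qed

lemma C_k_map_1D:
  assumes "C_k_map 1 X"
  shows "(X has_derivative frechet_derivative X (at x)) (at x)"
    "continuous_on UNIV (\<lambda>x. frechet_derivative X (at x) v)"
proof -
  have diff: "X differentiable (at x)" for x using assms by simp
  then show der: "(X has_derivative frechet_derivative X (at x)) (at x)" for x
    by (simp add: frechet_derivative_works)
  have "frechet_derivative X (at x) v = (\<Sum>b\<in>Basis. (v \<bullet> b) *\<^sub>R frechet_derivative X (at x) b)" for x
  proof -
    interpret bounded_linear "frechet_derivative X (at x)" using der by (rule has_derivative_bounded_linear)
    show ?thesis by (metis (no_types, lifting) euclidean_representation scaleR sum sum.cong)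
  qed
  then show "continuous_on UNIV (\<lambda>x. frechet_derivative X (at x) v)"
    using assms by (simp only:) (intro continuous_intros, auto)
qed

text \<open>Splits a vector field into coordinates, so that the Gauss-Green formula has to be shown
  for one scalar function and one direction at a time.\<close>

lemma C_k_map_1_component:
  assumes "C_k_map 1 X"
  defines "F \<equiv> (\<lambda>b x. \<Sum>c\<in>Basis. (frechet_derivative X (at x) c \<bullet> b) *\<^sub>R c)"
  shows "C1_scalar (\<lambda>x. X x \<bullet> b) (F b)" "divergence X x = (\<Sum>b\<in>Basis. F b x \<bullet> b)"
proof -
  note D = C_k_map_1D[OF assms(1)]
  show "C1_scalar (\<lambda>x. X x \<bullet> b) (F b)"
    unfolding C1_scalar_def
  proof (intro conjI allI)
    fix x
    interpret bounded_linear "frechet_derivative X (at x)" using D(1) by (rule has_derivative_bounded_linear)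
    have "h \<bullet> F b x = frechet_derivative X (at x) h \<bullet> b" for h
    proof -
      have "frechet_derivative X (at x) h = (\<Sum>c\<in>Basis. (h \<bullet> c) *\<^sub>R frechet_derivative X (at x) c)"
        by (metis (no_types, lifting) euclidean_representation scaleR sum sum.cong)
      then show ?thesis by (simp add: F_def inner_sum_left inner_sum_right mult.commute)
    qed
    then show "GDERIV (\<lambda>x. X x \<bullet> b) x :> F b x"
      unfolding gderiv_def by (simp only:) (intro has_derivative_inner_left D)
    show "continuous_on UNIV (F b)" unfolding F_def by (intro continuous_intros D)
  qed
  show "divergence X x = (\<Sum>b\<in>Basis. F b x \<bullet> b)"
    unfolding divergence_def
  proof (rule sum.cong[OF refl])
    fix b :: 'a assume b: "b \<in> Basis"
    have "F b x \<bullet> b = (\<Sum>c\<in>Basis. (if c = b then frechet_derivative X (at x) b \<bullet> b else 0))"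
      unfolding F_def inner_sum_left by (rule sum.cong[OF refl]) (use b in \<open>auto simp: inner_Basis\<close>)
    then show "frechet_derivative X (at x) b \<bullet> b = F b x \<bullet> b" using b by simp
  qed
qed

section \<open>Cutoff functions of class C^1 and partitions of unity\<close>

lemma DERIV_pos_part_square: "((\<lambda>t. (max 0 t)\<^sup>2) has_real_derivative 2 * max 0 t) (at (t::real))"
proof (cases "t = 0")
  case True
  have "(\<lambda>h. (max 0 h)\<^sup>2 / h) \<midarrow>0\<rightarrow> (0::real)"
  proof (rule Lim_null_comparison)
    show "\<forall>\<^sub>F h in at 0. norm ((max 0 h)\<^sup>2 / h) \<le> \<bar>h\<bar>"
      by (rule always_eventually) (auto simp: max_def power2_eq_square)
    show "(\<lambda>h::real. \<bar>h\<bar>) \<midarrow>0\<rightarrow> 0" by (rule tendsto_rabs_zero[OF tendsto_ident_at])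
  qed
  then show ?thesis using True by (simp add: DERIV_def)
next
  case False
  show ?thesis
  proof (cases "0 < t")
    case True
    have "((\<lambda>t. t\<^sup>2) has_real_derivative 2 * max 0 t) (at t)"
      using True by (auto intro!: derivative_eq_intros)
    then show ?thesis
      by (rule has_field_derivative_transform_within_open[where S="{0<..}"]) (use True in auto)
  next
    case neg: False
    have "((\<lambda>t. 0) has_real_derivative 2 * max 0 t) (at t)" using neg by simp
    then show ?thesis
      by (rule has_field_derivative_transform_within_open[where S="{..<0}"]) (use neg False in auto)
  qed
qed

text \<open>A function of the squared distance, so that the bump is differentiable at its centre
  too. For r > 0 it is 1 for s \<le> r^2 and 0 for s \<ge> 4 r^2; the two terms of the denominator
  never vanish together, and squares of positive parts are of class C^1.\<close>

definition bump_profile :: "real \<Rightarrow> real \<Rightarrow> real" where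
  "bump_profile r s = (max 0 (4 * r\<^sup>2 - s))\<^sup>2 / ((max 0 (4 * r\<^sup>2 - s))\<^sup>2 + (max 0 (s - r\<^sup>2))\<^sup>2)"

definition bump :: "'a::euclidean_space \<Rightarrow> real \<Rightarrow> 'a \<Rightarrow> real" where
  "bump a r x = bump_profile r ((x - a) \<bullet> (x - a))"

lemma bump_profile_denominator:
  fixes r s :: real
  assumes "0 < r" shows "0 < (max 0 (4 * r\<^sup>2 - s))\<^sup>2 + (max 0 (s - r\<^sup>2))\<^sup>2"
proof (cases "s < 4 * r\<^sup>2")
  case True
  then have "0 < (max 0 (4 * r\<^sup>2 - s))\<^sup>2" by simp
  then show ?thesis by (simp add: add_pos_nonneg)
next
  case False
  moreover have "0 < r\<^sup>2" using assms by simp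
  ultimately have "0 < s - r\<^sup>2" by linarith
  then have "0 < (max 0 (s - r\<^sup>2))\<^sup>2" by simp
  then show ?thesis by (simp add: add_nonneg_pos)
qed

lemma bump_range: "0 \<le> bump a r x" "bump a r x \<le> 1"
proof -
  have "A / (A + B) \<le> 1 \<and> 0 \<le> A / (A + B)" if "0 \<le> A" "0 \<le> B" for A B :: real
    using that by (cases "A + B = 0") (auto simp: divide_le_eq)
  then show "0 \<le> bump a r x" "bump a r x \<le> 1"
    unfolding bump_def bump_profile_def by simp_all
qed

lemma bump_eq_1:
  assumes "0 < r" "norm (x - a) \<le> r" shows "bump a r x = 1"
proof -
  have "(x - a) \<bullet> (x - a) \<le> r\<^sup>2" using assms by (simp add: power_mono flip: power2_norm_eq_inner)
  then show ?thesis using bump_profile_denominator[OF assms(1), of "(x - a) \<bullet> (x - a)"]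
    by (simp add: bump_def bump_profile_def)
qed

lemma bump_eq_0:
  assumes "0 < r" "2 * r \<le> norm (x - a)" shows "bump a r x = 0"
proof -
  have "(2 * r)\<^sup>2 \<le> (norm (x - a))\<^sup>2" using assms by (intro power_mono) auto
  then have "4 * r\<^sup>2 \<le> (x - a) \<bullet> (x - a)" by (simp add: power2_norm_eq_inner power_mult_distrib)
  then show ?thesis by (simp add: bump_def bump_profile_def)
qed

lemma bump_nonzero:
  assumes "0 < r" "bump a r x \<noteq> 0" shows "x \<in> cball a (2 * r)"
  using bump_eq_0[OF assms(1), of x a] assms(2) by (force simp: dist_norm norm_minus_commute)

lemma C1_bump:
  fixes a :: "'a::euclidean_space"
  assumes "0 < r" shows "\<exists>F. C1_scalar (bump a r) F"
proof -
  define A where "A = (\<lambda>s. (max 0 (4 * r\<^sup>2 - s))\<^sup>2)"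
  define A' where "A' = (\<lambda>s. - (2 * max 0 (4 * r\<^sup>2 - s)))"
  define B where "B = (\<lambda>s. (max 0 (s - r\<^sup>2))\<^sup>2)"
  define B' where "B' = (\<lambda>s. 2 * max 0 (s - r\<^sup>2))"
  define P where "P = (\<lambda>s. (A' s * (A s + B s) - A s * (A' s + B' s)) / ((A s + B s) * (A s + B s)))"
  have dA: "(A has_real_derivative A' s) (at s)" for s
  proof -
    have "((\<lambda>s. 4 * r\<^sup>2 - s) has_real_derivative - 1) (at s)" by (auto intro!: derivative_eq_intros)
    from DERIV_chain2[OF DERIV_pos_part_square this] show ?thesis by (simp add: A_def A'_def)
  qed
  have dB: "(B has_real_derivative B' s) (at s)" for s
  proof -
    have "((\<lambda>s. s - r\<^sup>2) has_real_derivative 1) (at s)" by (auto intro!: derivative_eq_intros)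
    from DERIV_chain2[OF DERIV_pos_part_square this] show ?thesis by (simp add: B_def B'_def)
  qed
  have nz: "A s + B s \<noteq> 0" for s using bump_profile_denominator[OF assms, of s] unfolding A_def B_def by linarith
  have prof: "bump_profile r = (\<lambda>s. A s / (A s + B s))" by (simp add: fun_eq_iff bump_profile_def A_def B_def)
  have dP: "(bump_profile r has_real_derivative P s) (at s)" for s
    unfolding prof P_def by (intro DERIV_divide DERIV_add dA dB nz)
  have cP: "continuous_on UNIV P"
    unfolding P_def A'_def B'_def A_def B_def
    by (intro continuous_intros) (use nz in \<open>simp add: A_def B_def\<close>)
  have q: "GDERIV (\<lambda>x. (x - a) \<bullet> (x - a)) x :> 2 *\<^sub>R (x - a)" for x
    unfolding gderiv_def by (auto intro!: derivative_eq_intros simp: inner_commute)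
  have "C1_scalar (bump a r) (\<lambda>x. P ((x - a) \<bullet> (x - a)) *\<^sub>R 2 *\<^sub>R (x - a))"
    unfolding C1_scalar_def
  proof (intro conjI allI)
    fix x
    show "GDERIV (bump a r) x :> P ((x - a) \<bullet> (x - a)) *\<^sub>R 2 *\<^sub>R (x - a)"
      unfolding bump_def by (rule GDERIV_DERIV_compose[OF q dP])
    have "continuous_on UNIV (\<lambda>x::'a. P ((x - a) \<bullet> (x - a)))"
      by (rule continuous_on_compose2[OF cP]) (auto intro!: continuous_intros)
    then show "continuous_on UNIV (\<lambda>x. P ((x - a) \<bullet> (x - a)) *\<^sub>R 2 *\<^sub>R (x - a))"
      by (intro continuous_intros)
  qed
  then show ?thesis by blast
qed

text \<open>Nonnegative functions, because the error estimates to be localized are proportional to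
  the integral of the function, and these integrals have to add up.\<close>

definition test_fun :: "'a::euclidean_space set \<Rightarrow> ('a \<Rightarrow> real) \<Rightarrow> bool" where
  "test_fun \<Omega> f \<longleftrightarrow> (\<exists>F. C1_scalar f F) \<and> (\<forall>x. 0 \<le> f x) \<and> compact (supp f) \<and> supp f \<subseteq> \<Omega>"

lemma test_fun_subset: "test_fun V f \<Longrightarrow> V \<subseteq> \<Omega> \<Longrightarrow> test_fun \<Omega> f"
  by (auto simp: test_fun_def)

lemma test_fun_mult:
  assumes f: "test_fun \<Omega> f" and g: "C1_scalar g G" "\<And>x. 0 \<le> g x" and "\<And>x. g x \<noteq> 0 \<Longrightarrow> x \<in> A" "closed A"
  shows "test_fun (\<Omega> \<inter> A) (\<lambda>x. f x * g x)"
proof -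
  have s: "supp (\<lambda>x. f x * g x) \<subseteq> supp f" by (rule supp_mono) auto
  have "supp (\<lambda>x. f x * g x) \<subseteq> A" by (rule supp_subset_closed[OF assms(5)]) (use assms(4) in auto)
  moreover have "compact (supp (\<lambda>x. f x * g x))"
    using s f closed_supp unfolding test_fun_def by (metis compact_Int_closed inf.absorb2)
  ultimately show ?thesis using f g s C1_scalar_mult unfolding test_fun_def by (auto, blast)
qed

text \<open>A partition of unity by telescoping: \<open>f = f b + f (1 - b)\<close>, and \<open>1 - b\<close> vanishes on the ball
  on which \<open>b = 1\<close>.\<close>

lemma test_fun_localize:
  fixes Q :: "('a::euclidean_space \<Rightarrow> real) \<Rightarrow> bool"
  assumes loc: "\<And>x. x \<in> \<Omega> \<Longrightarrow> \<exists>V. open V \<and> x \<in> V \<and> (\<forall>f. test_fun (V \<inter> \<Omega>) f \<longrightarrow> Q f)"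
    and zero: "Q (\<lambda>x. 0)"
    and add: "\<And>f g. test_fun \<Omega> f \<Longrightarrow> test_fun \<Omega> g \<Longrightarrow> Q f \<Longrightarrow> Q g \<Longrightarrow> Q (\<lambda>x. f x + g x)"
    and f: "test_fun \<Omega> f"
  shows "Q f"
proof -
  have "\<exists>r. x \<in> \<Omega> \<longrightarrow> 0 < r \<and> (\<forall>f. test_fun (\<Omega> \<inter> cball x (2 * r)) f \<longrightarrow> Q f)" for x
  proof (cases "x \<in> \<Omega>")
    case True
    obtain V where V: "open V" "x \<in> V" "\<forall>f. test_fun (V \<inter> \<Omega>) f \<longrightarrow> Q f" using loc[OF True] by blast
    obtain e where e: "0 < e" "cball x e \<subseteq> V" using V open_contains_cball by blast
    \<comment> \<open>Half of \<open>e\<close>, since the bump of radius r is supported in the ball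
      of radius 2 r.\<close>
    then have "test_fun (\<Omega> \<inter> cball x (2 * (e / 2))) f \<Longrightarrow> Q f" for f
      using V(3) test_fun_subset[of "\<Omega> \<inter> cball x e" f "V \<inter> \<Omega>"] by auto
    then show ?thesis using e(1) by (intro exI[of _ "e/2"]) auto
  qed auto
  then obtain r where r: "\<And>x. x \<in> \<Omega> \<Longrightarrow> 0 < r x"
    "\<And>x f. x \<in> \<Omega> \<Longrightarrow> test_fun (\<Omega> \<inter> cball x (2 * r x)) f \<Longrightarrow> Q f" by metis
  have ind: "Q f" if "finite J" "J \<subseteq> \<Omega>" "test_fun \<Omega> f" "supp f \<subseteq> (\<Union>x\<in>J. ball x (r x))" for J f
    using that
  proof (induction J arbitrary: f rule: finite_induct)
    case empty
    then have "f = (\<lambda>x. 0)" using supp_subset by fastforce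
    then show ?case using zero by simp
  next
    case (insert a J)
    define b where "b = bump a (r a)"
    have ra: "0 < r a" "a \<in> \<Omega>" using insert.prems r by auto
    obtain B where B: "C1_scalar b B" unfolding b_def using C1_bump[OF ra(1)] by blast
    have B1: "C1_scalar (\<lambda>x. 1 - b x) (\<lambda>x. 0 - B x)" by (rule C1_scalar_diff[OF C1_scalar_const B])
    have t1: "test_fun (\<Omega> \<inter> cball a (2 * r a)) (\<lambda>x. f x * b x)"
    proof (rule test_fun_mult[OF insert.prems(2) B])
      fix x show "b x \<noteq> 0 \<Longrightarrow> x \<in> cball a (2 * r a)"
        using bump_nonzero[OF ra(1), of a x] by (simp add: b_def)
    qed (auto simp: b_def bump_range)
    have t2: "test_fun (\<Omega> \<inter> - ball a (r a)) (\<lambda>x. f x * (1 - b x))"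
    proof (rule test_fun_mult[OF insert.prems(2) B1])
      fix x show "1 - b x \<noteq> 0 \<Longrightarrow> x \<in> - ball a (r a)"
        using bump_eq_1[OF ra(1), of x a] by (auto simp: b_def dist_norm norm_minus_commute)
      show "0 \<le> 1 - b x" using bump_range[of a "r a" x] by (simp add: b_def)
    qed auto
    have "supp (\<lambda>x. f x * (1 - b x)) \<subseteq> supp f" by (rule supp_mono) auto
    then have "supp (\<lambda>x. f x * (1 - b x)) \<subseteq> (\<Union>x\<in>J. ball x (r x))"
      using insert.prems(3) t2 by (auto simp: test_fun_def)
    then have "Q (\<lambda>x. f x * (1 - b x))"
      using insert.prems(1) t2 by (intro insert.IH) (auto intro: test_fun_subset)
    moreover have "Q (\<lambda>x. f x * b x)" using r(2)[OF ra(2) t1] .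
    ultimately have "Q (\<lambda>x. f x * b x + f x * (1 - b x))"
      by (intro add) (auto intro: test_fun_subset[OF t1] test_fun_subset[OF t2])
    then show ?case by (simp add: algebra_simps)
  qed
  have comp: "compact (supp f)" "supp f \<subseteq> \<Omega>" using f by (auto simp: test_fun_def)
  have "supp f \<subseteq> (\<Union>x\<in>\<Omega>. ball x (r x))" using comp(2) r(1) by force
  then obtain J where "J \<subseteq> \<Omega>" "finite J" "supp f \<subseteq> (\<Union>x\<in>J. ball x (r x))"
    using compactE_image[OF comp(1), of \<Omega> "\<lambda>x. ball x (r x)"] by blast
  then show ?thesis using ind f by blast
qed

text \<open>Built from finitely many bumps as 1 minus the product of the functions 1 - bump: this is
  1 where one of the bumps is 1, vanishes where all of them vanish, and stays between 0 and 1. The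
  value 1 on an open set around \<open>K\<close> makes the gradient vanish there.\<close>

lemma C1_urysohn:
  fixes K :: "'a::euclidean_space set"
  assumes K: "compact K" and U: "open U" "K \<subseteq> U"
  obtains e E W where "C1_scalar e E" "\<And>x. 0 \<le> e x" "\<And>x. e x \<le> 1" "open W" "K \<subseteq> W"
    "\<And>x. x \<in> W \<Longrightarrow> e x = 1" "compact (supp e)" "supp e \<subseteq> U"
proof -
  have "\<exists>r. x \<in> K \<longrightarrow> 0 < r \<and> cball x (2 * r) \<subseteq> U" for x
  proof (cases "x \<in> K")
    case True
    then have "x \<in> U" using U by blast
    then obtain e where "0 < e" "cball x e \<subseteq> U" using U(1) open_contains_cball by blast
    then show ?thesis by (intro exI[of _ "e/2"]) auto
  qed auto
  then obtain r where r: "\<And>x. x \<in> K \<Longrightarrow> 0 < r x" "\<And>x. x \<in> K \<Longrightarrow> cball x (2 * r x) \<subseteq> U" by metis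
  have ind: "\<exists>e E. C1_scalar e E \<and> (\<forall>x. 0 \<le> e x \<and> e x \<le> 1) \<and> (\<forall>x\<in>(\<Union>y\<in>J. ball y (r y)). e x = 1)
      \<and> (\<forall>x. e x \<noteq> 0 \<longrightarrow> x \<in> (\<Union>y\<in>J. cball y (2 * r y)))" if "finite J" "J \<subseteq> K" for J
    using that
  proof (induction J rule: finite_induct)
    case empty
    show ?case by (rule exI[of _ "\<lambda>x. 0"], rule exI[of _ "\<lambda>x. 0"]) (simp add: C1_scalar_const)
  next
    case (insert a J)
    then have "J \<subseteq> K" by blast
    from insert.IH[OF this] obtain e E where "C1_scalar e E \<and> (\<forall>x. 0 \<le> e x \<and> e x \<le> 1) \<and> (\<forall>x\<in>(\<Union>y\<in>J. ball y (r y)). e x = 1)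
      \<and> (\<forall>x. e x \<noteq> 0 \<longrightarrow> x \<in> (\<Union>y\<in>J. cball y (2 * r y)))" by blast
    then have e: "C1_scalar e E" "\<And>x. 0 \<le> e x" "\<And>x. e x \<le> 1"
      "\<And>x. x\<in>(\<Union>y\<in>J. ball y (r y)) \<Longrightarrow> e x = 1" "\<And>x. e x \<noteq> 0 \<Longrightarrow> x \<in> (\<Union>y\<in>J. cball y (2 * r y))" by blast+
    have ra: "0 < r a" using insert.prems r by auto
    obtain B where B: "C1_scalar (bump a (r a)) B" using C1_bump[OF ra(1)] by blast
    define e' where "e' = (\<lambda>x. 1 - (1 - e x) * (1 - bump a (r a) x))"
    have "\<exists>E'. C1_scalar e' E'"
      unfolding e'_def
      using C1_scalar_diff[OF C1_scalar_const C1_scalar_mult[OF C1_scalar_diff[OF C1_scalar_const e(1)] C1_scalar_diff[OF C1_scalar_const B]]]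
      by blast
    moreover have "0 \<le> e' x \<and> e' x \<le> 1" for x
    proof -
      have "0 \<le> (1 - e x) * (1 - bump a (r a) x)" "(1 - e x) * (1 - bump a (r a) x) \<le> 1"
        using e(2,3)[of x] bump_range[of a "r a" x] by (auto intro!: mult_nonneg_nonneg mult_le_one)
      then show ?thesis by (simp add: e'_def)
    qed
    moreover have "e' x = 1" if "x \<in> (\<Union>y\<in>insert a J. ball y (r y))" for x
    proof -
      from that have "x \<in> ball a (r a) \<or> x \<in> (\<Union>y\<in>J. ball y (r y))" by blast
      moreover have "bump a (r a) x = 1" if "x \<in> ball a (r a)"
        using bump_eq_1[OF ra, of x a] that by (simp add: dist_norm norm_minus_commute)
      ultimately have "bump a (r a) x = 1 \<or> e x = 1" using e(4) by blast
      then show ?thesis by (auto simp: e'_def)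
    qed
    moreover have "x \<in> (\<Union>y\<in>insert a J. cball y (2 * r y))" if "e' x \<noteq> 0" for x
    proof -
      from that have "e x \<noteq> 0 \<or> bump a (r a) x \<noteq> 0" by (auto simp: e'_def)
      then show ?thesis
      proof
        assume "e x \<noteq> 0" then show ?thesis using e(5) by blast
      next
        assume "bump a (r a) x \<noteq> 0"
        then have "x \<in> cball a (2 * r a)" using bump_nonzero[OF ra] by blast
        then show ?thesis by blast
      qed
    qed
    ultimately show ?case by blast
  qed
  have "K \<subseteq> (\<Union>x\<in>K. ball x (r x))" using r(1) by force
  then obtain J where J: "J \<subseteq> K" "finite J" "K \<subseteq> (\<Union>x\<in>J. ball x (r x))"
    using compactE_image[OF K, of K "\<lambda>x. ball x (r x)"] by blast
  from ind[OF J(2,1)] obtain e E where "C1_scalar e E \<and> (\<forall>x. 0 \<le> e x \<and> e x \<le> 1) \<and> (\<forall>x\<in>(\<Union>y\<in>J. ball y (r y)). e x = 1)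
      \<and> (\<forall>x. e x \<noteq> 0 \<longrightarrow> x \<in> (\<Union>y\<in>J. cball y (2 * r y)))" by blast
  then have e: "C1_scalar e E" "\<And>x. 0 \<le> e x" "\<And>x. e x \<le> 1"
      "\<And>x. x\<in>(\<Union>y\<in>J. ball y (r y)) \<Longrightarrow> e x = 1" "\<And>x. e x \<noteq> 0 \<Longrightarrow> x \<in> (\<Union>y\<in>J. cball y (2 * r y))" by blast+
  define M where "M = (\<Union>y\<in>J. cball y (2 * r y))"
  have M: "compact M" unfolding M_def using J(2) by (intro compact_UN) auto
  have sM: "supp e \<subseteq> M" using e(5) by (intro supp_subset_closed compact_imp_closed[OF M]) (auto simp: M_def)
  show thesis
  proof (rule that[OF e(1-3), of "\<Union>y\<in>J. ball y (r y)"])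
    show "compact (supp e)" using M sM closed_supp by (metis compact_Int_closed inf.absorb2)
    have "M \<subseteq> U" unfolding M_def using r(2) J(1) by blast
    then show "supp e \<subseteq> U" using sM by blast
  qed (use J e in auto)
qed

section \<open>The Gauss--Green formula for domains with \<open>C\<^sup>1\<close> boundary\<close>

lemma integral_deriv_left_halfline:
  fixes \<phi> \<phi>' :: "real \<Rightarrow> real"
  assumes der: "\<And>s. (\<phi> has_real_derivative \<phi>' s) (at s)" and cont: "\<And>s. isCont \<phi>' s"
    and zero: "\<And>s. M < \<bar>s\<bar> \<Longrightarrow> \<phi> s = 0 \<and> \<phi>' s = 0"
  shows "(\<integral>s. indicator {..<t} s * \<phi>' s \<partial>lborel) = \<phi> t" "(\<integral>s. \<phi>' s \<partial>lborel) = 0"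
proof -
  have half: "(\<integral>s. indicator {..<t} s * \<phi>' s \<partial>lborel) = \<phi> t" for t
  proof -
    define R where "R = max \<bar>M\<bar> \<bar>t\<bar> + 1"
    have R: "M < R" "- R \<le> t" "0 < R" by (auto simp: R_def)
    have "continuous_on UNIV \<phi>'" using cont by (simp add: continuous_at_imp_continuous_on)
    then have [measurable]: "\<phi>' \<in> borel_measurable borel" by (rule borel_measurable_continuous_onI)
    have "(\<integral>s. indicator {..<t} s * \<phi>' s \<partial>lborel) = (\<integral>s. \<phi>' s * indicator {-R..t} s \<partial>lborel)"
    proof (rule integral_cong_AE)
      show "AE s in lborel. indicator {..<t} s * \<phi>' s = \<phi>' s * indicator {-R..t} s"
        using AE_lborel_singleton[of t]
      proof eventually_elim
        case (elim s)
        show ?case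
        proof (cases "s < - R")
          case True
          then have "\<phi>' s = 0" using zero[of s] R by auto
          then show ?thesis by simp
        qed (use elim in \<open>auto simp: indicator_def\<close>)
      qed
    qed auto
    also have "\<dots> = \<phi> t - \<phi> (- R)"
      by (rule integral_FTC_Icc_real) (use R der cont in auto)
    also have "\<phi> (- R) = 0" using zero[of "- R"] R by auto
    finally show ?thesis by simp
  qed
  then show "(\<integral>s. indicator {..<t} s * \<phi>' s \<partial>lborel) = \<phi> t" .
  have "(\<integral>s. \<phi>' s \<partial>lborel) = (\<integral>s. indicator {..<\<bar>M\<bar> + 1} s * \<phi>' s \<partial>lborel)"
    by (rule Bochner_Integration.integral_cong) (use zero in \<open>auto simp: indicator_def\<close>)
  also have "\<dots> = 0" using half zero[of "\<bar>M\<bar> + 1"] by simp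
  finally show "(\<integral>s. \<phi>' s \<partial>lborel) = 0" .
qed

lemma convex_gderiv_mvt:
  fixes g :: "'a::euclidean_space \<Rightarrow> real"
  assumes "convex U" "\<And>y. y \<in> U \<Longrightarrow> GDERIV g y :> G y" "a \<in> U" "b \<in> U"
  obtains \<xi> where "\<xi> \<in> U" "g b - g a = (b - a) \<bullet> G \<xi>"
proof -
  define p where "p = (\<lambda>t. a + t *\<^sub>R (b - a))"
  have pU: "p t \<in> U" if "0 \<le> t" "t \<le> 1" for t
    using convexD_alt[OF assms(1,3,4), of t] that by (simp add: p_def algebra_simps)
  have "\<exists>t\<in>{0<..<1}. g (p 1) - g (p 0) = (\<lambda>h. (h *\<^sub>R (b - a)) \<bullet> G (p t)) (1 - 0)"
  proof (rule mvt_simple[where f="\<lambda>t. g (p t)" and f'="\<lambda>t h. (h *\<^sub>R (b - a)) \<bullet> G (p t)"])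
    fix t :: real assume t: "0 \<le> t" "t \<le> 1"
    have "(p has_derivative (\<lambda>h. h *\<^sub>R (b - a))) (at t within {0..1})"
      unfolding p_def by (auto intro!: derivative_eq_intros)
    moreover have "(g has_derivative (\<lambda>h. h \<bullet> G (p t))) (at (p t))"
      using assms(2)[OF pU, of t] t by (simp add: gderiv_def)
    ultimately show "((\<lambda>t. g (p t)) has_derivative (\<lambda>h. (h *\<^sub>R (b - a)) \<bullet> G (p t))) (at t within {0..1})"
      by (rule has_derivative_compose)
  qed simp
  then obtain t where "t \<in> {0<..<1}" "g (p 1) - g (p 0) = (b - a) \<bullet> G (p t)" by auto
  then show thesis using that[of "p t"] pU[of t] by (simp add: p_def)
qed

lemma C1_scalar_line:
  assumes "C1_scalar f F" "compact (supp f)" "norm e = 1"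
  shows "((\<lambda>s. f (z + s *\<^sub>R e)) has_real_derivative F (z + s *\<^sub>R e) \<bullet> e) (at s)"
    "isCont (\<lambda>s. F (z + s *\<^sub>R e) \<bullet> e) s"
    "\<exists>M. \<forall>s. M < \<bar>s\<bar> \<longrightarrow> f (z + s *\<^sub>R e) = 0 \<and> F (z + s *\<^sub>R e) \<bullet> e = 0"
proof -
  have "((\<lambda>s. z + s *\<^sub>R e) has_derivative (\<lambda>h. h *\<^sub>R e)) (at s)" by (auto intro!: derivative_eq_intros)
  then have "((\<lambda>s. f (z + s *\<^sub>R e)) has_derivative (\<lambda>h. (h *\<^sub>R e) \<bullet> F (z + s *\<^sub>R e))) (at s)"
    by (rule has_derivative_compose) (use C1_scalar_gderiv[OF assms(1)] in \<open>simp add: gderiv_def\<close>)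
  then show "((\<lambda>s. f (z + s *\<^sub>R e)) has_real_derivative F (z + s *\<^sub>R e) \<bullet> e) (at s)"
    by (rule has_derivative_imp_has_field_derivative) (simp add: inner_commute)
  have "continuous_on UNIV (\<lambda>s. F (z + s *\<^sub>R e) \<bullet> e)"
    by (intro continuous_on_inner continuous_on_const continuous_on_compose2[OF C1_scalar_cont_grad[OF assms(1), of UNIV]]
        continuous_on_add continuous_on_scaleR continuous_on_id) auto
  then show "isCont (\<lambda>s. F (z + s *\<^sub>R e) \<bullet> e) s" by (simp add: continuous_on_eq_continuous_at)
  obtain R where R: "\<And>x. x \<in> supp f \<Longrightarrow> norm x \<le> R" using compact_imp_bounded[OF assms(2)] bounded_iff by metis
  have "z + s *\<^sub>R e \<notin> supp f" if "R + norm z < \<bar>s\<bar>" for s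
  proof
    assume "z + s *\<^sub>R e \<in> supp f"
    then have "norm (z + s *\<^sub>R e) \<le> R" by (rule R)
    moreover have "norm (s *\<^sub>R e) \<le> norm (z + s *\<^sub>R e) + norm z"
      using norm_triangle_ineq4[of "z + s *\<^sub>R e" z] by simp
    ultimately show False using that assms(3) by simp
  qed
  then show "\<exists>M. \<forall>s. M < \<bar>s\<bar> \<longrightarrow> f (z + s *\<^sub>R e) = 0 \<and> F (z + s *\<^sub>R e) \<bullet> e = 0"
    by (intro exI[of _ "R + norm z"]) (simp add: supp_subset C1_scalar_grad_supp[OF assms(1)])
qed

lemma integrable_compact_support:
  fixes h :: "'a::euclidean_space \<Rightarrow> real"
  assumes "continuous_on UNIV h" "compact K" "\<And>x. x \<notin> K \<Longrightarrow> h x = 0" "E \<in> sets borel"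
  shows "integrable lborel (\<lambda>x. indicator E x * h x)"
proof -
  have "integrable lborel (\<lambda>x. indicator K x *\<^sub>R h x)"
    by (rule borel_integrable_compact[OF assms(2) continuous_on_subset[OF assms(1)]]) simp
  from integrable_mult_indicator[OF _ this, of E]
  have "integrable lborel (\<lambda>x. indicator E x *\<^sub>R (indicator K x *\<^sub>R h x))"
    using assms(4) by simp
  also have "(\<lambda>x. indicator E x *\<^sub>R (indicator K x *\<^sub>R h x)) = (\<lambda>x. indicator E x * h x)"
    using assms(3) by (auto simp: fun_eq_iff indicator_def)
  finally show ?thesis .
qed

lemma C1_scalar_integrable:
  assumes "C1_scalar f F" "compact (supp f)" "E \<in> sets borel"
  shows "integrable lborel (\<lambda>x. indicator E x * (F x \<bullet> e))"
  by (rule integrable_compact_support[OF _ assms(2) _ assms(3)])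
    (auto intro!: continuous_on_inner C1_scalar_cont_grad[OF assms(1)] simp: C1_scalar_grad_supp[OF assms(1)])

text \<open>Inside \<open>U\<close> the function \<open>g\<close> increases strictly along the line.
  So a zero at parameter \<open>t\<close> makes \<open>E\<close> the part before \<open>t\<close>,
  and the integral of the derivative of \<open>f\<close> is the value of \<open>f\<close> at the
  zero. Without a zero, the part of the line in \<open>U\<close> lies on one side by connectedness,
  and the integral is 0. Outside \<open>U\<close> the gradient of \<open>f\<close> vanishes and
  nothing is contributed.\<close>

lemma line_integral_crossing:
  assumes f: "C1_scalar f F" "compact (supp f)" "supp f \<subseteq> U" and e: "norm e = 1"
    and U: "convex U" "\<And>y. y \<in> U \<Longrightarrow> GDERIV g y :> G y" "\<And>y. y \<in> U \<Longrightarrow> 0 < e \<bullet> G y"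
    and E: "E \<inter> U = {y\<in>U. g y < 0}"
  shows "z + t *\<^sub>R e \<in> U \<Longrightarrow> g (z + t *\<^sub>R e) = 0 \<Longrightarrow>
      (\<integral>s. indicator E (z + s *\<^sub>R e) * (F (z + s *\<^sub>R e) \<bullet> e) \<partial>lborel) = f (z + t *\<^sub>R e)"
    "(\<And>t. z + t *\<^sub>R e \<in> U \<Longrightarrow> g (z + t *\<^sub>R e) \<noteq> 0) \<Longrightarrow>
      (\<integral>s. indicator E (z + s *\<^sub>R e) * (F (z + s *\<^sub>R e) \<bullet> e) \<partial>lborel) = 0"
proof -
  note line = C1_scalar_line[OF f(1,2) e, where z=z]
  obtain M where M: "\<And>s. M < \<bar>s\<bar> \<Longrightarrow> f (z + s *\<^sub>R e) = 0 \<and> F (z + s *\<^sub>R e) \<bullet> e = 0" using line(3) by blast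
  have half: "(\<integral>s. indicator {..<t} s * (F (z + s *\<^sub>R e) \<bullet> e) \<partial>lborel) = f (z + t *\<^sub>R e)"
    "(\<integral>s. F (z + s *\<^sub>R e) \<bullet> e \<partial>lborel) = 0" for t
    by (rule integral_deriv_left_halfline[OF line(1,2)], erule M)+
  have off: "F (z + s *\<^sub>R e) = 0" if "z + s *\<^sub>R e \<notin> U" for s
    using that f(3) by (intro C1_scalar_grad_supp[OF f(1)]) auto
  have mono: "g (z + s *\<^sub>R e) < g (z + t *\<^sub>R e)" if st: "s < t" "z + s *\<^sub>R e \<in> U" "z + t *\<^sub>R e \<in> U" for s t
  proof -
    obtain \<xi> where "\<xi> \<in> U" "g (z + t *\<^sub>R e) - g (z + s *\<^sub>R e) = ((z + t *\<^sub>R e) - (z + s *\<^sub>R e)) \<bullet> G \<xi>"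
      using convex_gderiv_mvt[OF U(1,2) st(2,3)] by blast
    moreover have "(z + t *\<^sub>R e) - (z + s *\<^sub>R e) = (t - s) *\<^sub>R e" by (simp add: algebra_simps)
    ultimately have "g (z + t *\<^sub>R e) - g (z + s *\<^sub>R e) = (t - s) * (e \<bullet> G \<xi>)" "0 < e \<bullet> G \<xi>" using U(3) by simp_all
    then show ?thesis using st(1) by (metis diff_gt_0_iff_gt mult_pos_pos)
  qed
  {
    assume t: "z + t *\<^sub>R e \<in> U" "g (z + t *\<^sub>R e) = 0"
    have "indicator E (z + s *\<^sub>R e) * (F (z + s *\<^sub>R e) \<bullet> e) = indicator {..<t} s * (F (z + s *\<^sub>R e) \<bullet> e)" for s
    proof (cases "z + s *\<^sub>R e \<in> U")
      case True
      then have "z + s *\<^sub>R e \<in> E \<longleftrightarrow> g (z + s *\<^sub>R e) < 0" using E by blast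
      also have "\<dots> \<longleftrightarrow> s < t" using mono[of s t] mono[of t s] t True by (cases s t rule: linorder_cases) auto
      finally show ?thesis by (simp add: indicator_def)
    qed (simp add: off)
    then show "(\<integral>s. indicator E (z + s *\<^sub>R e) * (F (z + s *\<^sub>R e) \<bullet> e) \<partial>lborel) = f (z + t *\<^sub>R e)"
      using half(1)[of t] by (simp only:)
  }
  assume no: "\<And>t. z + t *\<^sub>R e \<in> U \<Longrightarrow> g (z + t *\<^sub>R e) \<noteq> 0"
  define I where "I = {s. z + s *\<^sub>R e \<in> U}"
  have "convex I"
  proof (rule convexI)
    fix s t u v :: real assume st: "s \<in> I" "t \<in> I" "0 \<le> u" "0 \<le> v" "u + v = 1"
    have "u *\<^sub>R (z + s *\<^sub>R e) + v *\<^sub>R (z + t *\<^sub>R e) \<in> U" using convexD[OF U(1)] st by (simp add: I_def)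
    moreover have "u *\<^sub>R (z + s *\<^sub>R e) + v *\<^sub>R (z + t *\<^sub>R e) = (u + v) *\<^sub>R z + (u * s + v * t) *\<^sub>R e" by (simp add: algebra_simps)
    ultimately show "u *\<^sub>R s + v *\<^sub>R t \<in> I" using st(5) by (simp add: I_def)
  qed
  then have "connected I" by (rule convex_connected)
  moreover have "continuous_on I (\<lambda>s. g (z + s *\<^sub>R e))"
  proof (rule continuous_on_compose2[of U g])
    show "continuous_on U g"
      using U(2) unfolding gderiv_def by (intro continuous_at_imp_continuous_on ballI) (rule has_derivative_continuous)
    show "continuous_on I (\<lambda>s. z + s *\<^sub>R e)" by (intro continuous_intros)
  qed (auto simp: I_def)
  ultimately have conn: "connected ((\<lambda>s. g (z + s *\<^sub>R e)) ` I)" by (rule connected_continuous_image[rotated])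
  have "(\<forall>s\<in>I. g (z + s *\<^sub>R e) < 0) \<or> (\<forall>s\<in>I. 0 < g (z + s *\<^sub>R e))"
  proof (rule ccontr)
    assume "\<not> ?thesis"
    then obtain s t where "s \<in> I" "t \<in> I" "0 \<le> g (z + s *\<^sub>R e)" "g (z + t *\<^sub>R e) \<le> 0" by (auto simp: not_less)
    then have "0 \<in> (\<lambda>s. g (z + s *\<^sub>R e)) ` I" using connectedD_interval[OF conn] by blast
    then show False using no by (auto simp: I_def)
  qed
  then show "(\<integral>s. indicator E (z + s *\<^sub>R e) * (F (z + s *\<^sub>R e) \<bullet> e) \<partial>lborel) = 0"
  proof
    assume neg: "\<forall>s\<in>I. g (z + s *\<^sub>R e) < 0"
    have "indicator E (z + s *\<^sub>R e) * (F (z + s *\<^sub>R e) \<bullet> e) = F (z + s *\<^sub>R e) \<bullet> e" for s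
    proof (cases "z + s *\<^sub>R e \<in> U")
      case True
      then have "z + s *\<^sub>R e \<in> E" using neg E by (auto simp: I_def)
      then show ?thesis by simp
    qed (simp add: off)
    then show ?thesis using half(2) by (simp only:)
  next
    assume pos: "\<forall>s\<in>I. 0 < g (z + s *\<^sub>R e)"
    have "indicator E (z + s *\<^sub>R e) * (F (z + s *\<^sub>R e) \<bullet> e) = 0" for s
    proof (cases "z + s *\<^sub>R e \<in> U")
      case True
      then have "0 < g (z + s *\<^sub>R e)" using pos by (simp add: I_def)
      moreover have "z + s *\<^sub>R e \<in> E \<longleftrightarrow> g (z + s *\<^sub>R e) < 0" using True E by blast
      ultimately have "z + s *\<^sub>R e \<notin> E" by simp
      then show ?thesis by simp
    qed (simp add: off)
    then show ?thesis by (simp only: Bochner_Integration.integral_zero)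
  qed
qed

text \<open>Coordinates adapted to a normal \<open>n\<close>: an abstract space \<open>'v\<close> of
  the right dimension plays the role of the hyperplane orthogonal to \<open>n\<close>, so that
  Lebesgue measure is available on it.\<close>

lemma isometric_splitting:
  fixes n :: "'a::euclidean_space"
  assumes n: "norm n = 1" and dim: "DIM('a) = DIM('v::euclidean_space) + 1"
  obtains \<Psi> :: "'v::euclidean_space \<times> real \<Rightarrow> 'a" where "linear \<Psi>" "\<And>z. norm (\<Psi> z) = norm z" "\<Psi> (0, 1) = n"
proof -
  have "n \<noteq> 0" using n by auto
  then have d: "dim {x. n \<bullet> x = 0} = DIM('v)" using dim_hyperplane[of n] dim by simp
  obtain \<iota> :: "'v \<Rightarrow> 'a" where i: "linear \<iota>" "\<iota> \<in> UNIV \<rightarrow> {x. n \<bullet> x = 0}" "\<And>x. x \<in> UNIV \<Longrightarrow> norm (\<iota> x) = norm x"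
    using isometry_subset_subspace[of "UNIV :: 'v set" "{x. n \<bullet> x = 0}"] d by (auto simp: subspace_hyperplane)
  define \<Psi> where "\<Psi> = (\<lambda>(y, s). \<iota> y + s *\<^sub>R n)"
  have "linear \<Psi>"
    unfolding \<Psi>_def linear_iff using i(1) by (auto simp: linear_iff algebra_simps scaleR_prod_def)
  moreover have "norm (\<Psi> z) = norm z" for z
  proof (cases z)
    case (Pair y s)
    have "\<iota> y \<bullet> n = 0" using i(2) by (auto simp: inner_commute)
    then have "(norm (\<iota> y + s *\<^sub>R n))\<^sup>2 = (norm y)\<^sup>2 + s\<^sup>2"
      using i(3)[of y] n by (simp add: power2_norm_eq_inner inner_add_left inner_add_right inner_commute norm_eq_1 flip: power2_eq_square)
         (simp flip: power2_norm_eq_inner)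
    then show ?thesis by (simp add: Pair \<Psi>_def norm_Pair real_sqrt_unique)
  qed
  moreover have "\<Psi> (0, 1) = n" using i(1) by (simp add: \<Psi>_def linear_0)
  ultimately show thesis by (rule that)
qed

lemma fubini_isometry:
  fixes \<Psi> :: "'v::euclidean_space \<times> real \<Rightarrow> 'a::euclidean_space" and h :: "'a \<Rightarrow> real"
  assumes lin: "linear \<Psi>" and iso: "\<And>z. norm (\<Psi> z) = norm z" and dim: "DIM('a) = DIM('v) + 1"
    and h: "integrable lborel h"
  shows "(\<integral>x. h x \<partial>lborel) = (\<integral>y. (\<integral>s. h (\<Psi> (y, s)) \<partial>lborel) \<partial>lborel)"
    "integrable lborel (\<lambda>y. (\<integral>s. h (\<Psi> (y, s)) \<partial>lborel))"
proof -
  have distr: "distr lborel borel \<Psi> = lborel" by (rule distr_lborel_isometry[OF lin iso]) (simp add: dim)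
  have [measurable]: "\<Psi> \<in> borel_measurable borel"
    using lin by (intro borel_measurable_continuous_onI) (simp add: linear_continuous_on linear_conv_bounded_linear)
  have h': "integrable (distr lborel borel \<Psi>) h" using h distr by simp
  then have "integrable lborel (\<lambda>z. h (\<Psi> z))"
    by (subst (asm) integrable_distr_eq) (use borel_measurable_integrable[OF h] in auto)
  then have int: "integrable (lborel \<Otimes>\<^sub>M lborel) (\<lambda>z. h (\<Psi> z))" by (simp add: lborel_prod)
  have "(\<integral>x. h x \<partial>lborel) = (\<integral>x. h x \<partial>distr lborel borel \<Psi>)" using distr by simp
  also have "\<dots> = (\<integral>z. h (\<Psi> z) \<partial>lborel)" by (rule integral_distr) (use borel_measurable_integrable[OF h] in auto)
  also have "\<dots> = (\<integral>z. h (\<Psi> z) \<partial>(lborel \<Otimes>\<^sub>M lborel))" by (simp add: lborel_prod)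
  also have "\<dots> = (\<integral>y. (\<integral>s. h (\<Psi> (y, s)) \<partial>lborel) \<partial>lborel)" by (rule lborel_pair.integral_fst'[symmetric, OF int])
  finally show "(\<integral>x. h x \<partial>lborel) = (\<integral>y. (\<integral>s. h (\<Psi> (y, s)) \<partial>lborel) \<partial>lborel)" .
  show "integrable lborel (\<lambda>y. (\<integral>s. h (\<Psi> (y, s)) \<partial>lborel))" by (rule lborel_pair.integrable_fst'[OF int])
qed

text \<open>Along every line in the direction \<open>e\<close> the set \<open>E\<close> is an initial segment.\<close>

lemma directional_integral_nonneg:
  fixes E :: "'a::euclidean_space set"
  assumes f: "C1_scalar f F" "compact (supp f)" "supp f \<subseteq> U" "\<And>x. 0 \<le> f x"
    and U: "convex U" "\<And>y. y \<in> U \<Longrightarrow> GDERIV g y :> G y" "\<And>y. y \<in> U \<Longrightarrow> 0 < e \<bullet> G y"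
    and E: "E \<inter> U = {y\<in>U. g y < 0}" "E \<in> sets borel" and dim: "DIM('a) = DIM('v::euclidean_space) + 1"
  shows "0 \<le> (\<integral>x. indicator E x * (F x \<bullet> e) \<partial>lborel)"
proof (cases "U = {}")
  case True
  then have "F x = 0" for x using f(3) by (intro C1_scalar_grad_supp[OF f(1)]) auto
  then show ?thesis by simp
next
  case False
  then have "e \<noteq> 0" using U(3) by fastforce
  define d where "d = sgn e"
  have d: "norm d = 1" "e = norm e *\<^sub>R d" "0 < d \<bullet> G y" if "y \<in> U" for y
    using \<open>e \<noteq> 0\<close> U(3)[OF that] by (auto simp: d_def norm_sgn sgn_div_norm)
  have d1: "norm d = 1" using \<open>e \<noteq> 0\<close> by (simp add: d_def norm_sgn)
  obtain \<Psi> :: "'v \<times> real \<Rightarrow> 'a" where P: "linear \<Psi>" "\<And>z. norm (\<Psi> z) = norm z" "\<Psi> (0, 1) = d"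
    using isometric_splitting[OF d1 dim] by blast
  have Ps: "\<Psi> (y, s) = \<Psi> (y, 0) + s *\<^sub>R d" for y s
    using linear_add[OF P(1), of "(y, 0)" "s *\<^sub>R (0, 1)"] linear_scale[OF P(1), of s "(0, 1)"] P(3)
    by (simp add: scaleR_prod_def)
  have "0 \<le> (\<integral>s. indicator E (\<Psi> (y, s)) * (F (\<Psi> (y, s)) \<bullet> d) \<partial>lborel)" for y
  proof -
    define z where "z = \<Psi> (y, 0)"
    have z: "\<Psi> (y, s) = z + s *\<^sub>R d" for s using Ps[of y s] by (simp only: z_def)
    show ?thesis
    proof (cases "\<exists>t. z + t *\<^sub>R d \<in> U \<and> g (z + t *\<^sub>R d) = 0")
      case True
      then obtain t where "z + t *\<^sub>R d \<in> U" "g (z + t *\<^sub>R d) = 0" by blast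
      then show ?thesis
        using line_integral_crossing(1)[OF f(1-3) d1 U(1,2) d(3) E(1)] f(4) by (simp add: z)
    next
      case False
      then show ?thesis
        using line_integral_crossing(2)[OF f(1-3) d1 U(1,2) d(3) E(1), of z] by (simp add: z)
    qed
  qed
  then have "0 \<le> (\<integral>x. indicator E x * (F x \<bullet> d) \<partial>lborel)"
    by (subst fubini_isometry(1)[OF P(1,2) dim C1_scalar_integrable[OF f(1,2) E(2)]]) (rule Bochner_Integration.integral_nonneg, simp)
  then have "0 \<le> norm e * (\<integral>x. indicator E x * (F x \<bullet> d) \<partial>lborel)" by simp
  also have "\<dots> = (\<integral>x. norm e * (indicator E x * (F x \<bullet> d)) \<partial>lborel)" by simp
  also have "\<dots> = (\<integral>x. indicator E x * (F x \<bullet> e) \<partial>lborel)"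
  proof -
    have "F x \<bullet> e = norm e * (F x \<bullet> d)" for x
      using \<open>e \<noteq> 0\<close> by (simp add: d_def sgn_div_norm)
    then show ?thesis by (intro Bochner_Integration.integral_cong) auto
  qed
  finally show ?thesis .
qed

section \<open>A single boundary patch\<close>

lemma linear_isometry_surj:
  fixes f :: "'a::euclidean_space \<Rightarrow> 'b::euclidean_space"
  assumes lin: "linear f" and iso: "\<And>x. norm (f x) = norm x" and dim: "DIM('a) = DIM('b)"
  shows "surj f"
proof -
  have inj: "inj f" using linear_isometry_eq_iff[OF lin iso] by (auto simp: inj_def)
  have "dim (range f) = DIM('a)" using dim_image_eq[OF lin] inj by (simp add: inj_on_subset)
  moreover have "subspace (range f)" using lin by (simp add: linear_subspace_image subspace_UNIV)
  ultimately show ?thesis by (metis dim dim_eq_full dim_UNIV span_eq_iff)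
qed

text \<open>A patch in which the unit normal deviates from a fixed unit vector \<open>n\<close> by
  at most \<kappa> / 4, so that in the coordinates \<Psi> the hypersurface is a graph in direction
  \<open>n\<close>. The margin 1/4 is small enough for two purposes: the graph map is (1 +
  \<kappa>)-Lipschitz, and \<open>g\<close> grows in every direction \<kappa> n + w with
  \<open>w\<close> orthogonal to \<open>n\<close> of length at most 1.\<close>

locale boundary_patch =
  fixes \<Psi> :: "'v::euclidean_space \<times> real \<Rightarrow> 'a::euclidean_space"
    and E S U :: "'a set" and g :: "'a \<Rightarrow> real" and G :: "'a \<Rightarrow> 'a" and n :: 'a and \<kappa> :: real
  assumes lin: "linear \<Psi>" and iso: "\<And>z. norm (\<Psi> z) = norm z" and dim: "DIM('a) = DIM('v) + 1"
    and n: "\<Psi> (0, 1) = n" and PL: "prekopa_leindler TYPE('v)"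
    and U: "open U" "convex U" "bounded U"
    and E: "E \<in> sets borel" "E \<inter> U = {y\<in>U. g y < 0}" and S: "S \<in> sets borel" "S \<inter> U = {y\<in>U. g y = 0}"
    and gd: "\<And>y. y \<in> U \<Longrightarrow> GDERIV g y :> G y"
    and \<kappa>: "0 < \<kappa>" "\<kappa> \<le> 1" and G: "\<And>y. y \<in> U \<Longrightarrow> G y \<noteq> 0" "\<And>y. y \<in> U \<Longrightarrow> norm (sgn (G y) - n) \<le> \<kappa> / 4"
begin

definition \<Theta> where "\<Theta> = inv \<Psi>"

lemma \<Theta>: "\<Psi> (\<Theta> x) = x" "\<Theta> (\<Psi> z) = z"
proof -
  have "surj \<Psi>" by (rule linear_isometry_surj[OF lin iso]) (simp add: dim)
  moreover have "inj \<Psi>" using linear_isometry_eq_iff[OF lin iso] by (auto simp: inj_def)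
  ultimately show "\<Psi> (\<Theta> x) = x" "\<Theta> (\<Psi> z) = z" by (simp_all add: \<Theta>_def surj_f_inv_f)
qed

lemma dist_\<Theta>: "dist (\<Theta> x) (\<Theta> y) = dist x y"
  using linear_isometry_eq_iff(1)[OF lin iso, of "\<Theta> x" "\<Theta> y"] by (simp add: \<Theta>)

lemma norm_n: "norm n = 1"
  using iso[of "(0, 1)"] n by (simp add: norm_Pair)

lemma inner_\<Psi>: "\<Psi> a \<bullet> \<Psi> b = a \<bullet> b"
  unfolding dot_norm linear_add[OF lin, symmetric] iso ..

lemma snd_\<Theta>: "snd (\<Theta> x) = x \<bullet> n"
  using inner_\<Psi>[of "\<Theta> x" "(0, 1)"] unfolding n by (simp add: \<Theta> inner_prod_def)

lemma \<Psi>_split: "\<Psi> (y, s) = \<Psi> (y, 0) + s *\<^sub>R n"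
  using linear_add[OF lin, of "(y, 0)" "s *\<^sub>R (0, 1)"] linear_scale[OF lin, of s "(0, 1)"] n
  by (simp add: scaleR_prod_def)

definition \<pi> where "\<pi> x = fst (\<Theta> x)"

lemma dist_\<pi>: "dist (\<pi> x) (\<pi> y) \<le> dist x y"
  unfolding \<pi>_def using dist_fst_le[of "\<Theta> x" "\<Theta> y"] by (simp add: dist_\<Theta>)

lemma dist_split: "(dist x y)\<^sup>2 = (dist (\<pi> x) (\<pi> y))\<^sup>2 + ((x - y) \<bullet> n)\<^sup>2"
proof -
  have "(dist (\<Theta> x) (\<Theta> y))\<^sup>2 = (dist (\<pi> x) (\<pi> y))\<^sup>2 + (dist (snd (\<Theta> x)) (snd (\<Theta> y)))\<^sup>2"
    unfolding \<pi>_def dist_prod_def by simp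
  then show ?thesis by (simp only: dist_\<Theta> snd_\<Theta> dist_real_def inner_diff_left power2_abs)
qed

lemma n_sgn:
  assumes "y \<in> U"
  shows "1 - \<kappa> / 4 \<le> n \<bullet> sgn (G y)" "\<bar>v \<bullet> sgn (G y) - v \<bullet> n\<bar> \<le> norm v * (\<kappa> / 4)"
proof -
  have *: "\<bar>v \<bullet> sgn (G y) - v \<bullet> n\<bar> \<le> norm v * (\<kappa> / 4)" for v
  proof -
    have "\<bar>v \<bullet> (sgn (G y) - n)\<bar> \<le> norm v * norm (sgn (G y) - n)" by (rule Cauchy_Schwarz_ineq2)
    also have "\<dots> \<le> norm v * (\<kappa> / 4)" using G(2)[OF assms] by (intro mult_left_mono) auto
    finally show ?thesis by (simp add: inner_diff_right)
  qed
  show "\<bar>v \<bullet> sgn (G y) - v \<bullet> n\<bar> \<le> norm v * (\<kappa> / 4)" by (rule *)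
  have "n \<bullet> n = 1" using norm_n by (simp add: norm_eq_1)
  then have "\<bar>n \<bullet> sgn (G y) - 1\<bar> \<le> \<kappa> / 4" using *[of n] by (simp only: norm_n mult_1)
  then show "1 - \<kappa> / 4 \<le> n \<bullet> sgn (G y)" by linarith
qed

lemma direction_pos:
  assumes "y \<in> U" "0 < v \<bullet> sgn (G y)" shows "0 < v \<bullet> G y"
proof -
  have "G y = norm (G y) *\<^sub>R sgn (G y)" using G(1)[OF assms(1)] by (simp add: sgn_div_norm)
  then have "v \<bullet> G y = norm (G y) * (v \<bullet> sgn (G y))" by (metis inner_scaleR_right)
  then show ?thesis using assms G(1) by simp
qed

lemma n_pos: "y \<in> U \<Longrightarrow> 0 < n \<bullet> G y"
  using n_sgn(1)[of y] \<kappa> by (intro direction_pos) auto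

text \<open>By the mean value theorem a chord of \<open>S\<close> is orthogonal to some normal in
  \<open>U\<close>, so its component along \<open>n\<close> is at most \<kappa> / 4 of its length.
  Pythagoras then bounds the length by the projection.\<close>

lemma graph_lipschitz:
  assumes "a \<in> S \<inter> U" "b \<in> S \<inter> U"
  shows "dist a b \<le> (1 + \<kappa>) * dist (\<pi> a) (\<pi> b)"
proof -
  have ab: "a \<in> U" "b \<in> U" "g a = 0" "g b = 0" using assms S(2) by auto
  obtain \<xi> where xi: "\<xi> \<in> U" "g b - g a = (b - a) \<bullet> G \<xi>" using convex_gderiv_mvt[OF U(2) gd ab(1,2)] by blast
  then have "(b - a) \<bullet> sgn (G \<xi>) = 0" using ab by (simp add: sgn_div_norm)
  then have "\<bar>(b - a) \<bullet> n\<bar> \<le> norm (b - a) * (\<kappa> / 4)" using n_sgn(2)[OF xi(1), of "b - a"] by simp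
  then have "\<bar>(a - b) \<bullet> n\<bar> \<le> dist a b * (\<kappa> / 4)" by (simp add: dist_norm norm_minus_commute inner_diff_left abs_minus_commute)
  then have "((a - b) \<bullet> n)\<^sup>2 \<le> (dist a b * (\<kappa> / 4))\<^sup>2" by (metis abs_ge_zero power2_abs power_mono)
  then have 1: "(dist a b)\<^sup>2 * (1 - \<kappa>\<^sup>2 / 16) \<le> (dist (\<pi> a) (\<pi> b))\<^sup>2"
    using dist_split[of a b] by (simp add: power_mult_distrib algebra_simps power_divide)
  have "\<kappa>\<^sup>2 \<le> \<kappa>" "0 \<le> \<kappa>\<^sup>2" using \<kappa> by (simp_all add: power2_eq_square mult_left_le)
  \<comment> \<open>For (1 + \<kappa>)^2 (1 - \<kappa>^2 / 16) \<ge> 1: this makes the only negative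
    term of the expansion at most \<kappa> / 4, which 2 \<kappa> absorbs.\<close>
  have "\<kappa>\<^sup>2 * (1 + \<kappa>)\<^sup>2 \<le> \<kappa> * 2\<^sup>2" using \<kappa> \<open>\<kappa>\<^sup>2 \<le> \<kappa>\<close> by (intro mult_mono power_mono) auto
  moreover have "(1 + \<kappa>)\<^sup>2 * (1 - \<kappa>\<^sup>2 / 16) = 1 + 2 * \<kappa> + \<kappa>\<^sup>2 - \<kappa>\<^sup>2 * (1 + \<kappa>)\<^sup>2 / 16"
    by (simp add: power2_eq_square field_simps)
  moreover have "1 \<le> 1 + 2 * \<kappa> + \<kappa>\<^sup>2 - \<kappa>\<^sup>2 * (1 + \<kappa>)\<^sup>2 / 16"
    using calculation(1) \<kappa> \<open>0 \<le> \<kappa>\<^sup>2\<close> by (simp only: power2_eq_square)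
  ultimately have 2: "1 \<le> (1 + \<kappa>)\<^sup>2 * (1 - \<kappa>\<^sup>2 / 16)" by simp
  have "(dist a b)\<^sup>2 \<le> (dist a b)\<^sup>2 * ((1 + \<kappa>)\<^sup>2 * (1 - \<kappa>\<^sup>2 / 16))" using mult_left_mono[OF 2, of "(dist a b)\<^sup>2"] by simp
  also have "\<dots> = (1 + \<kappa>)\<^sup>2 * ((dist a b)\<^sup>2 * (1 - \<kappa>\<^sup>2 / 16))" by (simp add: mult_ac)
  also have "\<dots> \<le> (1 + \<kappa>)\<^sup>2 * (dist (\<pi> a) (\<pi> b))\<^sup>2" using 1 by (intro mult_left_mono) auto
  also have "\<dots> = ((1 + \<kappa>) * dist (\<pi> a) (\<pi> b))\<^sup>2" by (simp add: power_mult_distrib)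
  finally show ?thesis by (rule power2_le_imp_le) (use \<kappa> in simp)
qed

definition W where "W = \<pi> ` (S \<inter> U)"
definition \<sigma> where "\<sigma> y = inv_into (S \<inter> U) \<pi> y"

lemma inj_\<pi>: "inj_on \<pi> (S \<inter> U)"
proof (rule inj_onI)
  fix a b assume "a \<in> S \<inter> U" "b \<in> S \<inter> U" "\<pi> a = \<pi> b"
  then show "a = b" using graph_lipschitz[of a b] by simp
qed

lemma \<sigma>: "y \<in> W \<Longrightarrow> \<sigma> y \<in> S \<inter> U" "y \<in> W \<Longrightarrow> \<pi> (\<sigma> y) = y" "x \<in> S \<inter> U \<Longrightarrow> \<sigma> (\<pi> x) = x" "x \<in> S \<inter> U \<Longrightarrow> \<pi> x \<in> W"
  unfolding W_def \<sigma>_def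
  by (rule inv_into_into, assumption) (rule f_inv_into_f, assumption, rule inv_into_f_f[OF inj_\<pi>], assumption, rule imageI)

lemma continuous_\<pi>: "continuous_on A \<pi>"
  unfolding continuous_on_iff
proof (intro ballI allI impI)
  fix x and e :: real assume "0 < e"
  then show "\<exists>d>0. \<forall>x'\<in>A. dist x' x < d \<longrightarrow> dist (\<pi> x') (\<pi> x) < e"
    using le_less_trans[OF dist_\<pi>] by (intro exI[of _ e]) simp
qed

lemma continuous_\<sigma>: "continuous_on W \<sigma>"
  unfolding continuous_on_iff
proof (intro ballI allI impI)
  fix y and e :: real assume y: "y \<in> W" "0 < e"
  show "\<exists>d>0. \<forall>y'\<in>W. dist y' y < d \<longrightarrow> dist (\<sigma> y') (\<sigma> y) < e"
  proof (intro exI[of _ "e / (1 + \<kappa>)"] conjI ballI impI)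
    show "0 < e / (1 + \<kappa>)" using y \<kappa> by simp
    fix y' assume "y' \<in> W" "dist y' y < e / (1 + \<kappa>)"
    then have "(1 + \<kappa>) * dist y' y < e" using \<kappa> by (simp add: field_simps)
    then show "dist (\<sigma> y') (\<sigma> y) < e" using graph_lipschitz[OF \<sigma>(1)[OF \<open>y' \<in> W\<close>] \<sigma>(1)[OF y(1)]] \<sigma>(2) y \<open>y' \<in> W\<close> by simp
  qed
qed

lemma continuous_g: "continuous_on U g"
  using gd unfolding gderiv_def by (intro continuous_at_imp_continuous_on ballI) (rule has_derivative_continuous)

text \<open>The projection of a Borel set need not be Borel. Here \<open>U\<close> is a countable
  union of compact sets and \<open>S\<close> is relatively closed in \<open>U\<close>, so
  \<open>W\<close> is a countable union of compact images.\<close>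

lemma W_borel: "W \<in> sets borel"
proof -
  have "\<exists>C::nat \<Rightarrow> 'a set. (\<forall>m. compact (C m)) \<and> (\<forall>m. C m \<subseteq> U) \<and> \<Union>(range C) = U"
    by (rule open_Union_compact_subsets[OF U(1)]) blast
  then obtain C :: "nat \<Rightarrow> 'a set" where C: "\<And>m. compact (C m)" "\<And>m. C m \<subseteq> U" "\<Union>(range C) = U" by blast
  have "compact (S \<inter> C m)" for m
  proof -
    have "closed (C m \<inter> g -` {0})"
      by (rule continuous_closed_preimage[OF continuous_on_subset[OF continuous_g C(2)] compact_imp_closed[OF C(1)]]) simp
    moreover have "S \<inter> C m = C m \<inter> (C m \<inter> g -` {0})" using C(2)[of m] S(2) by blast
    ultimately show ?thesis using C(1) compact_Int_closed by metis
  qed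
  then have "\<pi> ` (S \<inter> C m) \<in> sets borel" for m
    by (intro borel_compact compact_continuous_image continuous_\<pi>)
  moreover have "W = (\<Union>m. \<pi> ` (S \<inter> C m))" unfolding W_def using C(3) by blast
  ultimately show ?thesis by auto
qed

lemma bounded_W: "bounded W"
proof -
  obtain B where B: "\<And>x y. x \<in> U \<Longrightarrow> y \<in> U \<Longrightarrow> dist x y \<le> B" using U(3) unfolding bounded_two_points by blast
  show ?thesis unfolding bounded_two_points
  proof (intro exI[of _ B] ballI)
    fix x y assume "x \<in> W" "y \<in> W"
    then have "dist (\<pi> (\<sigma> x)) (\<pi> (\<sigma> y)) \<le> B" using \<sigma>(1) B order_trans[OF dist_\<pi>] by blast
    then show "dist x y \<le> B" using \<sigma>(2) \<open>x \<in> W\<close> \<open>y \<in> W\<close> by simp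
  qed
qed

text \<open>The graph map extended by 0, to be measurable on the whole space.\<close>

definition \<sigma>0 where "\<sigma>0 y = indicator W y *\<^sub>R \<sigma> y"

lemma \<sigma>0_measurable [measurable]: "\<sigma>0 \<in> borel_measurable borel"
  unfolding \<sigma>0_def by (rule borel_measurable_continuous_on_indicator[OF W_borel continuous_\<sigma>])

text \<open>The projection is 1-Lipschitz and its inverse (1 + \<kappa>)-Lipschitz, while on
  \<open>'v\<close> Hausdorff and Lebesgue measure agree. This two-sided estimate takes the place of
  the area formula.\<close>

lemma projected_measure:
  assumes A: "A \<in> sets borel"
  shows "emeasure lborel (W \<inter> \<sigma>0 -` A) \<le> hausdorff_outer DIM('v) (S \<inter> U \<inter> A)"
    "hausdorff_outer DIM('v) (S \<inter> U \<inter> A) \<le> ennreal ((1 + \<kappa>) ^ DIM('v)) * emeasure lborel (W \<inter> \<sigma>0 -` A)"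
proof -
  have eq: "W \<inter> \<sigma>0 -` A = \<pi> ` (S \<inter> U \<inter> A)"
  proof (intro equalityI subsetI)
    fix y assume "y \<in> W \<inter> \<sigma>0 -` A"
    then have "\<sigma> y \<in> S \<inter> U \<inter> A" "y = \<pi> (\<sigma> y)" using \<sigma>(1,2) by (auto simp: \<sigma>0_def)
    then show "y \<in> \<pi> ` (S \<inter> U \<inter> A)" by blast
  next
    fix y assume "y \<in> \<pi> ` (S \<inter> U \<inter> A)"
    then obtain x where "x \<in> S \<inter> U" "x \<in> A" "y = \<pi> x" by blast
    then show "y \<in> W \<inter> \<sigma>0 -` A" using \<sigma>(3,4)[of x] by (simp add: \<sigma>0_def)
  qed
  have meas: "W \<inter> \<sigma>0 -` A \<in> sets borel" using W_borel measurable_sets[OF \<sigma>0_measurable A] by simp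
  have vol: "emeasure lborel (W \<inter> \<sigma>0 -` A) = hausdorff_outer DIM('v) (\<pi> ` (S \<inter> U \<inter> A))"
    using hausdorff_outer_eq_lborel[OF PL meas] eq by simp
  show "emeasure lborel (W \<inter> \<sigma>0 -` A) \<le> hausdorff_outer DIM('v) (S \<inter> U \<inter> A)"
    unfolding vol using hausdorff_outer_lipschitz[of 1 "S \<inter> U \<inter> A" \<pi> "DIM('v)"] dist_\<pi> by simp
  have "hausdorff_outer DIM('v) (\<sigma> ` \<pi> ` (S \<inter> U \<inter> A)) \<le> ennreal ((1 + \<kappa>) ^ DIM('v)) * hausdorff_outer DIM('v) (\<pi> ` (S \<inter> U \<inter> A))"
  proof (rule hausdorff_outer_lipschitz)
    fix x y assume "x \<in> \<pi> ` (S \<inter> U \<inter> A)" "y \<in> \<pi> ` (S \<inter> U \<inter> A)"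
    then obtain a b where "x = \<pi> a" "y = \<pi> b" "a \<in> S \<inter> U" "b \<in> S \<inter> U" by blast
    then show "dist (\<sigma> x) (\<sigma> y) \<le> (1 + \<kappa>) * dist x y" using graph_lipschitz \<sigma>(3) by simp
  qed (use \<kappa> in simp)
  moreover have "\<sigma> ` \<pi> ` (S \<inter> U \<inter> A) = S \<inter> U \<inter> A" unfolding image_image using \<sigma>(3) by (auto simp: image_iff)
  ultimately show "hausdorff_outer DIM('v) (S \<inter> U \<inter> A) \<le> ennreal ((1 + \<kappa>) ^ DIM('v)) * emeasure lborel (W \<inter> \<sigma>0 -` A)"
    unfolding vol by simp
qed

lemma surface_measure_eq: "(surface_measure :: 'a measure) = hausdorff_measure DIM('v)"
  unfolding surface_measure_def by (simp add: dim)

lemma U_borel: "U \<in> sets borel" using U(1) by simp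

lemma patch_finite: "emeasure surface_measure (S \<inter> U) < \<infinity>"
proof -
  have "emeasure surface_measure (S \<inter> U) = hausdorff_outer DIM('v) (S \<inter> U \<inter> UNIV)"
    unfolding surface_measure_eq using S(1) U_borel by (simp add: emeasure_hausdorff_measure)
  also have "\<dots> \<le> ennreal ((1 + \<kappa>) ^ DIM('v)) * emeasure lborel W" using projected_measure(2)[of UNIV] by simp
  also have "\<dots> < \<infinity>" using emeasure_bounded_finite[OF bounded_W] by (simp add: ennreal_mult_less_top)
  finally show ?thesis .
qed

text \<open>The estimates for sets are inequalities between two measures, one of them the image of
  Lebesgue measure on \<open>W\<close> under the graph map, and as such they pass to
  integrals.\<close>

lemma patch_nn_integral:
  fixes f :: "'a \<Rightarrow> ennreal"
  assumes [measurable]: "f \<in> borel_measurable borel"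
  shows "(\<integral>\<^sup>+y. indicator W y * f (\<sigma>0 y) \<partial>lborel) \<le> (\<integral>\<^sup>+x. indicator (S \<inter> U) x * f x \<partial>surface_measure)"
    "(\<integral>\<^sup>+x. indicator (S \<inter> U) x * f x \<partial>surface_measure) \<le> ennreal ((1 + \<kappa>) ^ DIM('v)) * (\<integral>\<^sup>+y. indicator W y * f (\<sigma>0 y) \<partial>lborel)"
proof -
  define \<mu>1 where "\<mu>1 = distr (density lborel (indicator W)) borel \<sigma>0"
  define \<mu>2 :: "'a measure" where "\<mu>2 = density surface_measure (indicator (S \<inter> U))"
  have SU [measurable]: "S \<inter> U \<in> sets borel" using S(1) U_borel by auto
  note W_borel [measurable]
  have sets: "sets \<mu>1 = sets borel" "sets \<mu>2 = sets borel" by (simp_all add: \<mu>1_def \<mu>2_def surface_measure_eq)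
  have \<sigma>W: "\<sigma>0 -` A \<in> sets borel" if "A \<in> sets borel" for A using measurable_sets[OF \<sigma>0_measurable that] by simp
  have m1: "emeasure \<mu>1 A = emeasure lborel (W \<inter> \<sigma>0 -` A)" if "A \<in> sets borel" for A
    unfolding \<mu>1_def using that \<sigma>W[OF that]
    by (simp add: emeasure_distr emeasure_density W_borel indicator_inter_arith[symmetric] sets.Int)
  have m2: "emeasure \<mu>2 A = hausdorff_outer DIM('v) (S \<inter> U \<inter> A)" if "A \<in> sets borel" for A
    unfolding \<mu>2_def surface_measure_eq using that SU
    by (simp add: emeasure_density indicator_inter_arith[symmetric] emeasure_hausdorff_measure sets.Int)
  have i1: "nn_integral \<mu>1 f = (\<integral>\<^sup>+y. indicator W y * f (\<sigma>0 y) \<partial>lborel)"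
    unfolding \<mu>1_def by (simp add: nn_integral_distr nn_integral_density)
  have i2: "nn_integral \<mu>2 f = (\<integral>\<^sup>+x. indicator (S \<inter> U) x * f x \<partial>surface_measure)"
    unfolding \<mu>2_def by (rule nn_integral_density) (auto simp: surface_measure_eq)
  have "\<mu>1 \<le> \<mu>2"
    by (subst le_measure) (use sets m1 m2 projected_measure(1) in auto)
  then show "(\<integral>\<^sup>+y. indicator W y * f (\<sigma>0 y) \<partial>lborel) \<le> (\<integral>\<^sup>+x. indicator (S \<inter> U) x * f x \<partial>surface_measure)"
    unfolding i1[symmetric] i2[symmetric] by (intro nn_integral_mono_measure) (simp_all add: sets)
  have "\<mu>2 \<le> scale_measure (ennreal ((1 + \<kappa>) ^ DIM('v))) \<mu>1"
    by (subst le_measure) (use sets m1 m2 projected_measure(2) in auto)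
  then have "nn_integral \<mu>2 f \<le> nn_integral (scale_measure (ennreal ((1 + \<kappa>) ^ DIM('v))) \<mu>1) f"
    by (intro nn_integral_mono_measure) (simp_all add: sets)
  also have "\<dots> = ennreal ((1 + \<kappa>) ^ DIM('v)) * nn_integral \<mu>1 f"
    by (rule nn_integral_scale_measure) (simp add: measurable_cong_sets[OF sets(1) refl])
  finally show "(\<integral>\<^sup>+x. indicator (S \<inter> U) x * f x \<partial>surface_measure)
     \<le> ennreal ((1 + \<kappa>) ^ DIM('v)) * (\<integral>\<^sup>+y. indicator W y * f (\<sigma>0 y) \<partial>lborel)"
    unfolding i1 i2 .
qed

context
  fixes f :: "'a \<Rightarrow> real" and F :: "'a \<Rightarrow> 'a"
  assumes f: "C1_scalar f F" "compact (supp f)" "supp f \<subseteq> U" "\<And>x. 0 \<le> f x"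
begin

text \<open>The volume side of the Gauss-Green formula for the field \<open>f\<close> times the
  constant vector \<open>e\<close>. It is linear in \<open>e\<close>, so that normal and tangential
  directions can be treated separately.\<close>

definition flux where "flux e = (\<integral>x. indicator E x * (F x \<bullet> e) \<partial>lborel)"

lemma flux_add: "flux (a + b) = flux a + flux b"
  unfolding flux_def inner_add_right distrib_left
  by (rule Bochner_Integration.integral_add) (rule C1_scalar_integrable[OF f(1,2) E(1)])+

lemma flux_scale: "flux (c *\<^sub>R a) = c * flux a"
  unfolding flux_def by (simp add: mult.left_commute)

text \<open>A line in direction \<open>n\<close> meets the patch at most once, in the point of the
  graph above \<open>y\<close>, and contributes the value of \<open>f\<close> there. Fubini sums
  this over \<open>W\<close>, without any error term.\<close>

lemma flux_normal:
  "integrable lborel (\<lambda>y. indicator W y * f (\<sigma>0 y))" "flux n = (\<integral>y. indicator W y * f (\<sigma>0 y) \<partial>lborel)"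
proof -
  have line: "(\<integral>s. indicator E (\<Psi> (y, s)) * (F (\<Psi> (y, s)) \<bullet> n) \<partial>lborel) = indicator W y * f (\<sigma>0 y)" for y
  proof -
    define z where "z = \<Psi> (y, 0)"
    have z: "\<Psi> (y, s) = z + s *\<^sub>R n" for s using \<Psi>_split[of y s] by (simp only: z_def)
    show ?thesis
    proof (cases "y \<in> W")
      case True
      define x where "x = \<sigma> y"
      have x: "x \<in> S \<inter> U" "fst (\<Theta> x) = y" using \<sigma>(1,2)[OF True] by (auto simp: x_def \<pi>_def)
      have "x = \<Psi> (fst (\<Theta> x), snd (\<Theta> x))" by (simp add: \<Theta>)
      then have xe: "z + snd (\<Theta> x) *\<^sub>R n = x" using x(2) z by simp
      have "x \<in> U" "g x = 0" using x(1) S(2) by auto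
      then have "(\<integral>s. indicator E (z + s *\<^sub>R n) * (F (z + s *\<^sub>R n) \<bullet> n) \<partial>lborel) = f (z + snd (\<Theta> x) *\<^sub>R n)"
        by (intro line_integral_crossing(1)[OF f(1-3) norm_n U(2) gd n_pos E(2)]) (simp_all only: xe)
      then show ?thesis
        using True xe by (simp add: \<sigma>0_def x_def z)
    next
      case False
      have "g (z + t *\<^sub>R n) \<noteq> 0" if "z + t *\<^sub>R n \<in> U" for t
      proof
        assume "g (z + t *\<^sub>R n) = 0"
        then have "\<Psi> (y, t) \<in> S \<inter> U" using that S(2) by (simp add: z)
        then have "\<pi> (\<Psi> (y, t)) \<in> W" by (rule \<sigma>(4))
        then show False using False by (simp add: \<pi>_def \<Theta>)
      qed
      then show ?thesis
        using False line_integral_crossing(2)[OF f(1-3) norm_n U(2) gd n_pos E(2), of z] by (simp add: z)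
    qed
  qed
  have int: "integrable lborel (\<lambda>x. indicator E x * (F x \<bullet> n))" by (rule C1_scalar_integrable[OF f(1,2) E(1)])
  show "integrable lborel (\<lambda>y. indicator W y * f (\<sigma>0 y))"
    using fubini_isometry(2)[OF lin iso dim int] by (simp only: line)
  show "flux n = (\<integral>y. indicator W y * f (\<sigma>0 y) \<partial>lborel)"
    unfolding flux_def using fubini_isometry(1)[OF lin iso dim int] by (simp only: line)
qed

lemma f_measurable [measurable]: "f \<in> borel_measurable borel"
  by (rule borel_measurable_continuous_onI) (rule C1_scalar_cont[OF f(1)])

lemma f_indicator: "indicator S x * f x = indicator (S \<inter> U) x * f x"
  using f(3) supp_subset[of x f] by (auto simp: indicator_def)

text \<open>Both bounds are first taken for nonnegative integrals, where the upper one yields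
  integrability on the hypersurface.\<close>

lemma surface_integral_compare:
  "integrable surface_measure (\<lambda>x. indicator S x * f x)"
  "flux n \<le> (\<integral>x. indicator S x * f x \<partial>surface_measure)"
  "(\<integral>x. indicator S x * f x \<partial>surface_measure) \<le> (1 + \<kappa>) ^ DIM('v) * flux n"
proof -
  have SU [measurable]: "S \<inter> U \<in> sets borel" using S(1) U_borel by auto
  have fn0: "0 \<le> flux n" unfolding flux_normal(2) using f(4) by (intro Bochner_Integration.integral_nonneg) simp
  have N: "(\<integral>\<^sup>+y. indicator W y * ennreal (f (\<sigma>0 y)) \<partial>lborel) = ennreal (flux n)"
  proof -
    have "(\<integral>\<^sup>+y. indicator W y * ennreal (f (\<sigma>0 y)) \<partial>lborel) = (\<integral>\<^sup>+y. ennreal (indicator W y * f (\<sigma>0 y)) \<partial>lborel)"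
      by (intro nn_integral_cong) (auto simp: indicator_def)
    also have "\<dots> = ennreal (flux n)" unfolding flux_normal(2)
      by (rule nn_integral_eq_integral[OF flux_normal(1)]) (simp add: f(4))
    finally show ?thesis .
  qed
  have H: "(\<integral>\<^sup>+x. indicator (S \<inter> U) x * ennreal (f x) \<partial>surface_measure) = (\<integral>\<^sup>+x. ennreal (indicator S x * f x) \<partial>surface_measure)"
    unfolding f_indicator by (intro nn_integral_cong) (auto simp: indicator_def)
  have le: "ennreal (flux n) \<le> (\<integral>\<^sup>+x. ennreal (indicator S x * f x) \<partial>surface_measure)"
    "(\<integral>\<^sup>+x. ennreal (indicator S x * f x) \<partial>surface_measure) \<le> ennreal ((1 + \<kappa>) ^ DIM('v)) * ennreal (flux n)"
    using patch_nn_integral[of "\<lambda>x. ennreal (f x)"] unfolding N H by auto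
  show int: "integrable surface_measure (\<lambda>x. indicator S x * f x)"
  proof (rule integrableI_nonneg)
    show "(\<lambda>x. indicator S x * f x) \<in> borel_measurable surface_measure"
      unfolding surface_measure_eq using S(1) by measurable
    show "(\<integral>\<^sup>+x. ennreal (indicator S x * f x) \<partial>surface_measure) < \<infinity>"
      using le(2) by (rule le_less_trans) (simp add: ennreal_mult_less_top)
  qed (simp add: f(4))
  have eq: "(\<integral>\<^sup>+x. ennreal (indicator S x * f x) \<partial>surface_measure) = ennreal (\<integral>x. indicator S x * f x \<partial>surface_measure)"
    by (rule nn_integral_eq_integral[OF int]) (simp add: f(4))
  have h0: "0 \<le> (\<integral>x. indicator S x * f x \<partial>surface_measure)" using f(4) by (intro Bochner_Integration.integral_nonneg) simp
  show "flux n \<le> (\<integral>x. indicator S x * f x \<partial>surface_measure)"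
    using le(1) h0 unfolding eq by simp
  show "(\<integral>x. indicator S x * f x \<partial>surface_measure) \<le> (1 + \<kappa>) ^ DIM('v) * flux n"
    using le(2) \<kappa> fn0 unfolding eq by (simp add: ennreal_mult[symmetric])
qed

text \<open>The vectors \<kappa> n + v and \<kappa> n - v both have positive inner product with all
  the normals of the patch, so their fluxes are nonnegative; linearity turns this into a two-sided
  bound.\<close>

lemma flux_tangential:
  assumes "v \<bullet> n = 0" "norm v \<le> 1" shows "\<bar>flux v\<bar> \<le> \<kappa> * flux n"
proof -
  have pos: "0 \<le> flux (\<kappa> *\<^sub>R n + w)" if w: "w \<bullet> n = 0" "norm w \<le> 1" for w
    unfolding flux_def
  proof (rule directional_integral_nonneg[OF f U(2) gd _ E(2,1) dim])
    fix y assume y: "y \<in> U"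
    have "norm w * (\<kappa> / 4) \<le> 1 * (\<kappa> / 4)" using w \<kappa> by (intro mult_right_mono) auto
    then have "- (\<kappa> / 4) \<le> w \<bullet> sgn (G y)" using n_sgn(2)[OF y, of w] w by linarith
    moreover have "\<kappa> * (3 / 4) \<le> \<kappa> * (n \<bullet> sgn (G y))"
      using n_sgn(1)[OF y] \<kappa> by (intro mult_left_mono) auto
    moreover have "(\<kappa> *\<^sub>R n + w) \<bullet> sgn (G y) = \<kappa> * (n \<bullet> sgn (G y)) + w \<bullet> sgn (G y)"
      by (simp add: inner_add_left)
    ultimately have "0 < (\<kappa> *\<^sub>R n + w) \<bullet> sgn (G y)" using \<kappa>(1) by linarith
    then show "0 < (\<kappa> *\<^sub>R n + w) \<bullet> G y" by (rule direction_pos[OF y])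
  qed
  have "flux (- v) = - flux v" using flux_scale[of "-1" v] by simp
  then show ?thesis using pos[of v] pos[of "- v"] assms unfolding flux_add flux_scale by auto
qed

text \<open>The factor collects three errors: (1 + \<kappa>)^k - 1 with k the dimension of
  \<open>'v\<close>, from comparing \<open>W\<close> with the patch; \<kappa> from the tangential
  flux; and a further \<kappa> from replacing the true normal by \<open>n\<close>. It multiplies the
  integral of \<open>f\<close>, so that errors of several patches can be added.\<close>

lemma patch_gauss_green:
  assumes \<nu>: "\<nu> \<in> borel_measurable borel" "\<And>y. y \<in> S \<inter> U \<Longrightarrow> \<nu> y = sgn (G y)" and e: "norm e = 1"
  shows "\<bar>flux e - (\<integral>x. indicator S x * (f x * (\<nu> x \<bullet> e)) \<partial>surface_measure)\<bar>
    \<le> ((1 + \<kappa>) ^ DIM('v) - 1 + 2 * \<kappa>) * (\<integral>x. indicator S x * f x \<partial>surface_measure)"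
proof -
  define h where "h = (\<integral>x. indicator S x * f x \<partial>surface_measure)"
  define N where "N = flux n"
  note cmp = surface_integral_compare[folded h_def N_def]
  have N0: "0 \<le> N" unfolding N_def flux_normal(2) using f(4) by (intro Bochner_Integration.integral_nonneg) simp
  have nn: "n \<bullet> n = 1" using norm_n by (simp add: norm_eq_1)
  define v where "v = e - (e \<bullet> n) *\<^sub>R n"
  have v: "v \<bullet> n = 0" by (simp add: v_def inner_diff_left nn)
  have en: "\<bar>e \<bullet> n\<bar> \<le> 1" using Cauchy_Schwarz_ineq2[of e n] e norm_n by simp
  have "v \<bullet> v = 1 - (e \<bullet> n)\<^sup>2"
    using e nn by (simp add: v_def inner_diff_left inner_diff_right norm_eq_1 inner_commute power2_eq_square)
  then have "norm v \<le> 1" by (simp add: norm_le_square[of v 1, simplified] dot_square_norm)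
  then have T: "\<bar>flux v\<bar> \<le> \<kappa> * N" unfolding N_def by (rule flux_tangential[OF v])
  have "e = (e \<bullet> n) *\<^sub>R n + v" by (simp add: v_def)
  then have fe: "flux e = (e \<bullet> n) * N + flux v" unfolding N_def by (metis flux_add flux_scale)
  have 1: "\<bar>flux e - (e \<bullet> n) * h\<bar> \<le> ((1 + \<kappa>) ^ DIM('v) - 1 + \<kappa>) * h"
  proof -
    have "\<bar>flux e - (e \<bullet> n) * h\<bar> \<le> \<bar>(e \<bullet> n) * (N - h)\<bar> + \<bar>flux v\<bar>" unfolding fe by (simp add: algebra_simps)
    also have "\<bar>(e \<bullet> n) * (N - h)\<bar> \<le> 1 * \<bar>N - h\<bar>" unfolding abs_mult using en by (intro mult_right_mono) auto
    also have "\<bar>N - h\<bar> \<le> ((1 + \<kappa>) ^ DIM('v) - 1) * N" using cmp(2,3) by (simp add: algebra_simps)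
    also have "1 * (((1 + \<kappa>) ^ DIM('v) - 1) * N) + \<bar>flux v\<bar> \<le> ((1 + \<kappa>) ^ DIM('v) - 1 + \<kappa>) * N"
      using T by (simp add: algebra_simps)
    also have "\<dots> \<le> ((1 + \<kappa>) ^ DIM('v) - 1 + \<kappa>) * h"
      using cmp(2) \<kappa> by (intro mult_left_mono) auto
    finally show ?thesis by simp
  qed
  have S' [measurable]: "S \<in> sets borel" by (rule S(1))
  note \<nu>(1) [measurable]
  have bd: "\<bar>indicator S x * (f x * (\<nu> x \<bullet> e)) - indicator S x * f x * (e \<bullet> n)\<bar> \<le> \<kappa> / 4 * (indicator S x * f x)" for x
  proof (cases "x \<in> S \<inter> U")
    case True
    then have "\<bar>e \<bullet> \<nu> x - e \<bullet> n\<bar> \<le> \<kappa> / 4" using n_sgn(2)[of x e] \<nu>(2)[OF True] e by simp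
    then have "f x * \<bar>e \<bullet> \<nu> x - e \<bullet> n\<bar> \<le> f x * (\<kappa> / 4)" using f(4) by (intro mult_left_mono) auto
    moreover have "\<bar>f x * (\<nu> x \<bullet> e) - f x * (e \<bullet> n)\<bar> = f x * \<bar>e \<bullet> \<nu> x - e \<bullet> n\<bar>"
      using f(4)[of x] by (simp add: abs_mult right_diff_distrib[symmetric] inner_commute)
    ultimately show ?thesis using True by (simp add: mult.commute)
  next
    case False
    then have "x \<notin> S \<or> f x = 0" using f(3) supp_subset[of x f] by auto
    then show ?thesis by auto
  qed
  have int_e: "integrable surface_measure (\<lambda>x. indicator S x * (f x * (\<nu> x \<bullet> e)) - indicator S x * f x * (e \<bullet> n))"
  proof (rule Bochner_Integration.integrable_bound)
    show "integrable surface_measure (\<lambda>x. \<kappa> / 4 * (indicator S x * f x))" by (intro integrable_mult_right cmp(1))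
    show "(\<lambda>x. indicator S x * (f x * (\<nu> x \<bullet> e)) - indicator S x * f x * (e \<bullet> n)) \<in> borel_measurable surface_measure"
      unfolding surface_measure_eq by measurable
    show "AE x in surface_measure. norm (indicator S x * (f x * (\<nu> x \<bullet> e)) - indicator S x * f x * (e \<bullet> n))
        \<le> norm (\<kappa> / 4 * (indicator S x * f x))"
      using bd by (intro AE_I2) (metis abs_ge_self order_trans real_norm_def)
  qed
  have int_n: "integrable surface_measure (\<lambda>x. indicator S x * f x * (e \<bullet> n))" by (intro integrable_mult_left cmp(1))
  have "(\<integral>x. indicator S x * (f x * (\<nu> x \<bullet> e)) \<partial>surface_measure)
      = (\<integral>x. (indicator S x * (f x * (\<nu> x \<bullet> e)) - indicator S x * f x * (e \<bullet> n)) + indicator S x * f x * (e \<bullet> n) \<partial>surface_measure)"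
    by simp
  also have "\<dots> = (\<integral>x. (indicator S x * (f x * (\<nu> x \<bullet> e)) - indicator S x * f x * (e \<bullet> n)) \<partial>surface_measure) + h * (e \<bullet> n)"
    unfolding h_def by (subst Bochner_Integration.integral_add[OF int_e int_n]) simp
  finally have "\<bar>(\<integral>x. indicator S x * (f x * (\<nu> x \<bullet> e)) \<partial>surface_measure) - h * (e \<bullet> n)\<bar>
     = \<bar>\<integral>x. (indicator S x * (f x * (\<nu> x \<bullet> e)) - indicator S x * f x * (e \<bullet> n)) \<partial>surface_measure\<bar>" by simp
  also have "\<dots> \<le> (\<integral>x. \<kappa> / 4 * (indicator S x * f x) \<partial>surface_measure)"
    using bd by (intro order_trans[OF integral_abs_bound] integral_mono integrable_abs int_e integrable_mult_right cmp(1))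
  also have "\<dots> = \<kappa> / 4 * h" by (simp add: h_def)
  also have "\<dots> \<le> \<kappa> * h" using \<kappa> cmp(2) N0 by (intro mult_right_mono) auto
  finally have 2: "\<bar>(\<integral>x. indicator S x * (f x * (\<nu> x \<bullet> e)) \<partial>surface_measure) - h * (e \<bullet> n)\<bar> \<le> \<kappa> * h" .
  have "((1 + \<kappa>) ^ DIM('v) - 1 + 2 * \<kappa>) * h = ((1 + \<kappa>) ^ DIM('v) - 1 + \<kappa>) * h + \<kappa> * h" by (simp add: algebra_simps)
  moreover have "\<bar>flux e - I\<bar> \<le> \<bar>flux e - (e \<bullet> n) * h\<bar> + \<bar>I - h * (e \<bullet> n)\<bar>" for I by (simp add: mult.commute)
  ultimately show ?thesis using 1 2 unfolding h_def[symmetric] by (smt (verit))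
qed

end

end

text \<open>\<open>E\<close> is the side where the local function is negative, so \<nu> points out
  of \<open>E\<close>. Points away from \<open>S\<close> qualify as well, by a function without
  zeros nearby, so the condition can be imposed at every point of an open set.\<close>

definition C1_side :: "'a::euclidean_space set \<Rightarrow> 'a set \<Rightarrow> ('a \<Rightarrow> 'a) \<Rightarrow> 'a \<Rightarrow> bool" where
  "C1_side E S \<nu> x \<longleftrightarrow>
     (\<exists>U (g :: 'a \<Rightarrow> real) G. open U \<and> x \<in> U \<and> E \<inter> U = {y\<in>U. g y < 0} \<and> S \<inter> U = {y\<in>U. g y = 0} \<and>
        (\<forall>y\<in>U. GDERIV g y :> G y \<and> G y \<noteq> 0) \<and> continuous_on U G \<and> (\<forall>y\<in>S \<inter> U. \<nu> y = sgn (G y)))"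

lemma C1_side_away:
  assumes "open U" "x \<in> U" "S \<inter> U = {}" "U \<subseteq> E \<or> E \<inter> U = {}"
  shows "C1_side E S \<nu> (x::'a::euclidean_space)"
proof -
  obtain b :: 'a where b: "b \<in> Basis" using nonempty_Basis by blast
  \<comment> \<open>On the unit ball around \<open>x\<close> the linear term stays below 1 in
    absolute value, so the constant decides the sign.\<close>
  define c where "c = (if U \<subseteq> E then - 1 else 1 :: real)"
  define g where "g = (\<lambda>y. (y - x) \<bullet> b + c)"
  define V where "V = U \<inter> ball x 1"
  have small: "\<bar>(y - x) \<bullet> b\<bar> < 1" if "y \<in> V" for y
    using Basis_le_norm[OF b, of "y - x"] that by (simp add: V_def dist_norm norm_minus_commute)
  have "g y < 0 \<longleftrightarrow> U \<subseteq> E" "g y \<noteq> 0" if "y \<in> V" for y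
    using small[OF that] by (auto simp: g_def c_def)
  then have "E \<inter> V = {y\<in>V. g y < 0}" "S \<inter> V = {y\<in>V. g y = 0}"
    using assms(3,4) by (auto simp: V_def)
  moreover have "GDERIV g y :> b \<and> b \<noteq> 0" for y
    unfolding g_def gderiv_def using b by (auto intro!: derivative_eq_intros simp: nonzero_Basis)
  moreover have "open V" "x \<in> V" "S \<inter> V = {}" using assms by (auto simp: V_def)
  ultimately show ?thesis
    unfolding C1_side_def by (intro exI[of _ V] exI[of _ g] exI[of _ "\<lambda>_. b"]) (simp add: continuous_on_const)
qed

lemma C1_scalar_unique:
  assumes "C1_scalar f F" "C1_scalar f F'" shows "F = F'"
proof
  fix x
  have "(\<lambda>h. h \<bullet> F x) = (\<lambda>h. h \<bullet> F' x)"
    using C1_scalar_gderiv[OF assms(1), of x] C1_scalar_gderiv[OF assms(2), of x]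
    unfolding gderiv_def by (rule has_derivative_unique)
  then show "F x = F' x" by (metis inner_commute vector_eq_ldot)
qed

lemma small_distortion:
  fixes k :: nat and e :: real
  assumes "0 < e"
  obtains \<kappa> :: real where "0 < \<kappa>" "\<kappa> \<le> 1" "(1 + \<kappa>) ^ k - 1 + 2 * \<kappa> \<le> e"
proof -
  have "((\<lambda>t::real. (1 + t) ^ k - 1 + 2 * t) \<longlongrightarrow> (1 + 0) ^ k - 1 + 2 * 0) (at_right 0)"
    by (intro tendsto_intros)
  then have "\<forall>\<^sub>F t::real in at_right 0. (1 + t) ^ k - 1 + 2 * t < e"
    by (rule order_tendstoD(2)) (simp add: assms)
  moreover have "\<forall>\<^sub>F t::real in at_right 0. t \<in> {0<..<1}"
    by (rule eventually_at_right_real) simp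
  ultimately have "\<forall>\<^sub>F t::real in at_right 0. (1 + t) ^ k - 1 + 2 * t < e \<and> t \<in> {0<..<1}"
    by (rule eventually_conj)
  from eventually_happens'[OF trivial_limit_at_right_real this]
  obtain t :: real where "(1 + t) ^ k - 1 + 2 * t < e \<and> t \<in> {0<..<1}" ..
  then show thesis by (intro that[of t]) auto
qed

text \<open>Continuity of the normal makes the patch condition true close to \<open>x\<close>,
  whatever \<kappa> is. The neighbourhood depends on \<open>e\<close>: the formula without error
  emerges only when \<open>e\<close> tends to 0 for a fixed test function.\<close>

lemma local_gauss_green:
  fixes E S :: "'a::euclidean_space set"
  assumes dim: "DIM('a) = DIM('v::euclidean_space) + 1" and PL: "prekopa_leindler TYPE('v)"
    and meas: "E \<in> sets borel" "S \<in> sets borel" "\<nu> \<in> borel_measurable borel"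
    and side: "C1_side E S \<nu> x" and e: "0 < e"
  obtains V where "open V" "x \<in> V" "emeasure surface_measure (S \<inter> V) < \<infinity>"
    "\<And>f F d. C1_scalar f F \<Longrightarrow> compact (supp f) \<Longrightarrow> supp f \<subseteq> V \<Longrightarrow> (\<And>x. 0 \<le> f x) \<Longrightarrow> norm d = 1 \<Longrightarrow>
       \<bar>(\<integral>x. indicator E x * (F x \<bullet> d) \<partial>lborel) - (\<integral>x. indicator S x * (f x * (\<nu> x \<bullet> d)) \<partial>surface_measure)\<bar>
         \<le> e * (\<integral>x. indicator S x * f x \<partial>surface_measure)"
proof -
  from side obtain U and g :: "'a \<Rightarrow> real" and G where
    "open U \<and> x \<in> U \<and> E \<inter> U = {y\<in>U. g y < 0} \<and> S \<inter> U = {y\<in>U. g y = 0} \<and>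
        (\<forall>y\<in>U. GDERIV g y :> G y \<and> G y \<noteq> 0) \<and> continuous_on U G \<and> (\<forall>y\<in>S \<inter> U. \<nu> y = sgn (G y))"
    unfolding C1_side_def by (elim exE)
  then have U: "open U" "x \<in> U" "E \<inter> U = {y\<in>U. g y < 0}" "S \<inter> U = {y\<in>U. g y = 0}"
    "\<And>y. y \<in> U \<Longrightarrow> GDERIV g y :> G y" "\<And>y. y \<in> U \<Longrightarrow> G y \<noteq> 0" "continuous_on U G"
    "\<And>y. y \<in> S \<inter> U \<Longrightarrow> \<nu> y = sgn (G y)"
    by simp_all
  obtain \<kappa> :: real where k: "0 < \<kappa>" "\<kappa> \<le> 1" "(1 + \<kappa>) ^ DIM('v) - 1 + 2 * \<kappa> \<le> e"
    using small_distortion[OF e] by blast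
  define n where "n = sgn (G x)"
  have n1: "norm n = 1" using U(2,6) by (simp add: n_def norm_sgn)
  have "continuous_on U (\<lambda>y. sgn (G y))"
    unfolding sgn_div_norm using U(6) by (intro continuous_intros U(7)) auto
  moreover have "0 < \<kappa> / 4" using k(1) by simp
  ultimately have "\<exists>d>0. \<forall>y\<in>U. dist y x < d \<longrightarrow> dist (sgn (G y)) (sgn (G x)) < \<kappa> / 4"
    using U(2) unfolding continuous_on_iff by blast
  then obtain d where d: "0 < d" "\<And>y. y \<in> U \<Longrightarrow> dist y x < d \<Longrightarrow> dist (sgn (G y)) (sgn (G x)) < \<kappa> / 4" by blast
  obtain r where r: "0 < r" "ball x r \<subseteq> U" using U(1,2) open_contains_ball by blast
  define V where "V = ball x (min r d)"
  have V: "V \<subseteq> U" "x \<in> V" using r d by (auto simp: V_def)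
  obtain \<Psi> :: "'v \<times> real \<Rightarrow> 'a" where P: "linear \<Psi>" "\<And>z. norm (\<Psi> z) = norm z" "\<Psi> (0, 1) = n"
    using isometric_splitting[OF n1 dim] by blast
  have nu: "\<nu> y = sgn (G y)" if "y \<in> S \<inter> V" for y using U(8) that V(1) by blast
  interpret boundary_patch \<Psi> E S V g G n \<kappa>
  proof (rule boundary_patch.intro)
    show "E \<inter> V = {y \<in> V. g y < 0}" "S \<inter> V = {y \<in> V. g y = 0}" using U(3,4) V(1) by auto
    fix y assume y: "y \<in> V"
    then show "GDERIV g y :> G y" "G y \<noteq> 0" using U(5,6) V(1) by auto
    have "dist (sgn (G y)) (sgn (G x)) < \<kappa> / 4" using y V(1) by (intro d(2)) (auto simp: V_def dist_commute)
    then show "norm (sgn (G y) - n) \<le> \<kappa> / 4" by (simp add: n_def dist_norm)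
  qed (rule P dim PL meas(1,2) k(1,2) | simp add: V_def)+
  have final: "\<bar>(\<integral>x. indicator E x * (F x \<bullet> d) \<partial>lborel) - (\<integral>x. indicator S x * (f x * (\<nu> x \<bullet> d)) \<partial>surface_measure)\<bar>
         \<le> e * (\<integral>x. indicator S x * f x \<partial>surface_measure)"
    if f: "C1_scalar f F" "compact (supp f)" "supp f \<subseteq> V" "\<And>x. 0 \<le> f x" "norm d = 1" for f F d
  proof -
    have "\<bar>(\<integral>x. indicator E x * (F x \<bullet> d) \<partial>lborel) - (\<integral>x. indicator S x * (f x * (\<nu> x \<bullet> d)) \<partial>surface_measure)\<bar>
       \<le> ((1 + \<kappa>) ^ DIM('v) - 1 + 2 * \<kappa>) * (\<integral>x. indicator S x * f x \<partial>surface_measure)"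
      using patch_gauss_green[OF f(1-4) meas(3) nu f(5)] unfolding flux_def[OF f(1-4)] .
    also have "\<dots> \<le> e * (\<integral>x. indicator S x * f x \<partial>surface_measure)"
      using f(4) by (intro mult_right_mono k(3) Bochner_Integration.integral_nonneg) simp
    finally show ?thesis .
  qed
  show thesis by (rule that[OF _ V(2) patch_finite final]) (simp_all add: V_def)
qed

section \<open>The Gauss-Green formula on a C^1 domain\<close>

lemma sets_surface_measure [simp, measurable_cong]: "sets surface_measure = sets borel"
  by (simp add: surface_measure_def)

lemma space_surface_measure [simp]: "space surface_measure = UNIV"
  by (simp add: surface_measure_def)

lemma surface_integrable:
  fixes h :: "'a::euclidean_space \<Rightarrow> real"
  assumes "S \<in> sets borel" "K \<in> sets borel" "emeasure surface_measure (S \<inter> K) < \<infinity>" "h \<in> borel_measurable borel"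
    and bd: "AE x in surface_measure. x \<in> S \<longrightarrow> \<bar>h x\<bar> \<le> B" and zero: "\<And>x. x \<notin> K \<Longrightarrow> h x = 0"
  shows "integrable surface_measure (\<lambda>x. indicator S x * h x)"
proof (rule Bochner_Integration.integrable_bound)
  show "integrable surface_measure (\<lambda>x. indicator (S \<inter> K) x * B)"
    using assms(1-3) by (intro integrable_mult_left integrable_real_indicator) auto
  show "(\<lambda>x. indicator S x * h x) \<in> borel_measurable surface_measure"
    using assms(1,4) by measurable
  show "AE x in surface_measure. norm (indicator S x * h x) \<le> norm (indicator (S \<inter> K) x * B)"
    using bd by eventually_elim (use zero in \<open>auto simp: indicator_def\<close>)
qed

lemma C1_bounded:
  assumes "C1_scalar f F" "compact (supp f)" obtains B where "\<And>x. \<bar>f x\<bar> \<le> B"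
proof -
  have "bounded (f ` supp f)"
    by (intro compact_imp_bounded compact_continuous_image assms(2) C1_scalar_cont[OF assms(1)])
  then obtain B where B: "\<And>x. x \<in> supp f \<Longrightarrow> \<bar>f x\<bar> \<le> B" unfolding bounded_iff by auto
  have "\<bar>f x\<bar> \<le> max B 0" for x
    using B[of x] supp_subset[of x f] by (cases "x \<in> supp f") auto
  then show thesis by (rule that)
qed

text \<open>Regularity is required at the points of \<Omega>, which will carry the test fields; this
  admits the cone with its vertex removed. The type \<open>'v\<close> stands for the tangent
  hyperplanes.\<close>

locale C1_domain =
  fixes E S :: "'a::euclidean_space set" and \<nu> and \<Omega> and v :: "'v::euclidean_space itself"
  assumes dim: "DIM('a) = DIM('v) + 1" and PL: "prekopa_leindler TYPE('v)"
    and meas: "E \<in> sets borel" "S \<in> sets borel" "\<nu> \<in> borel_measurable borel"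
    and \<Omega>: "open \<Omega>" and side: "\<And>x. x \<in> \<Omega> \<Longrightarrow> C1_side E S \<nu> x"
begin

lemma norm_normal: "x \<in> S \<inter> \<Omega> \<Longrightarrow> norm (\<nu> x) = 1"
proof -
  assume x: "x \<in> S \<inter> \<Omega>"
  then have "C1_side E S \<nu> x" using side by blast
  then obtain U and g :: "'a \<Rightarrow> real" and G where
    "open U \<and> x \<in> U \<and> E \<inter> U = {y\<in>U. g y < 0} \<and> S \<inter> U = {y\<in>U. g y = 0} \<and>
        (\<forall>y\<in>U. GDERIV g y :> G y \<and> G y \<noteq> 0) \<and> continuous_on U G \<and> (\<forall>y\<in>S \<inter> U. \<nu> y = sgn (G y))"
    unfolding C1_side_def by (elim exE)
  then have "\<nu> x = sgn (G x)" "G x \<noteq> 0" using x by blast+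
  then show ?thesis by (simp add: norm_sgn)
qed

lemma compact_finite:
  assumes "compact K" "K \<subseteq> \<Omega>" shows "emeasure surface_measure (S \<inter> K) < \<infinity>"
proof -
  have "\<exists>V. open V \<and> x \<in> V \<and> emeasure surface_measure (S \<inter> V) < \<infinity>" if "x \<in> \<Omega>" for x
    using local_gauss_green[OF dim PL meas side[OF that], of 1] by (metis zero_less_one)
  then obtain V where V: "\<And>x. x \<in> \<Omega> \<Longrightarrow> open (V x) \<and> x \<in> V x \<and> emeasure surface_measure (S \<inter> V x) < \<infinity>" by metis
  obtain J where J: "J \<subseteq> K" "finite J" "K \<subseteq> (\<Union>x\<in>J. V x)"
    using compactE_image[OF assms(1), of K V] V assms(2) by blast
  have Vm: "S \<inter> V x \<in> sets borel" if "x \<in> J" for x using V[of x] that J(1) assms(2) meas(2) by auto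
  have "(\<Union>x\<in>J. S \<inter> V x) \<in> sets surface_measure"
    using sets.finite_UN[OF J(2), of "\<lambda>x. S \<inter> V x" borel] Vm by simp
  then have "emeasure surface_measure (S \<inter> K) \<le> emeasure surface_measure (\<Union>x\<in>J. S \<inter> V x)"
    by (rule emeasure_mono[rotated]) (use J(3) in blast)
  also have "\<dots> \<le> (\<Sum>x\<in>J. emeasure surface_measure (S \<inter> V x))"
    using J(2) Vm by (intro emeasure_subadditive_finite) auto
  also have "\<dots> < \<infinity>" using J V assms(2) by (auto simp: subset_iff)
  finally show ?thesis .
qed

lemma integrable_surface:
  assumes h: "h \<in> borel_measurable borel" and K: "compact K" "K \<subseteq> \<Omega>" "\<And>x. x \<notin> K \<Longrightarrow> h x = 0"
    and bd: "\<And>x. x \<in> S \<Longrightarrow> \<bar>h x\<bar> \<le> B"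
  shows "integrable surface_measure (\<lambda>x. indicator S x * (h x :: real))"
proof (rule surface_integrable[OF meas(2) borel_compact[OF K(1)] compact_finite[OF K(1,2)] h])
  show "AE x in surface_measure. x \<in> S \<longrightarrow> \<bar>h x\<bar> \<le> B" by (rule AE_I2) (simp add: bd)
qed (rule K(3))

lemma integrable_test:
  assumes "C1_scalar f F" "compact (supp f)" "supp f \<subseteq> \<Omega>"
  shows "integrable surface_measure (\<lambda>x. indicator S x * f x)"
    "integrable surface_measure (\<lambda>x. indicator S x * (f x * (\<nu> x \<bullet> d)))"
proof -
  obtain B where B: "\<And>x. \<bar>f x\<bar> \<le> B" using C1_bounded[OF assms(1,2)] by blast
  have fm [measurable]: "f \<in> borel_measurable borel"
    by (rule borel_measurable_continuous_onI) (rule C1_scalar_cont[OF assms(1)])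
  note meas(3) [measurable]
  show "integrable surface_measure (\<lambda>x. indicator S x * f x)"
    by (rule integrable_surface[OF fm assms(2,3), where B=B]) (erule supp_subset, rule B)
  show "integrable surface_measure (\<lambda>x. indicator S x * (f x * (\<nu> x \<bullet> d)))"
  proof (rule integrable_surface[OF _ assms(2,3)])
    show "\<bar>f x * (\<nu> x \<bullet> d)\<bar> \<le> B * norm d" if "x \<in> S" for x
    proof (cases "x \<in> \<Omega>")
      case True
      then have "\<bar>\<nu> x \<bullet> d\<bar> \<le> norm d" using Cauchy_Schwarz_ineq2[of "\<nu> x" d] norm_normal[of x] that by simp
      then show ?thesis unfolding abs_mult using B[of x] by (intro mult_mono) auto
    next
      case False
      then have "f x = 0" using assms(3) by (intro supp_subset) blast
      moreover have "0 \<le> B" using B[of x] by linarith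
      ultimately show ?thesis by simp
    qed
    show "(\<lambda>x. f x * (\<nu> x \<bullet> d)) \<in> borel_measurable borel" by measurable
    show "f x * (\<nu> x \<bullet> d) = 0" if "x \<notin> supp f" for x using supp_subset[OF that] by simp
  qed
qed

text \<open>For fixed \<open>e\<close> the estimate |err| \<le> e * mass holds near every point and
  is stable under sums, since \<open>err\<close> and \<open>mass\<close> are both additive. A
  partition of unity makes it global, and \<open>mass f\<close> does not depend on
  \<open>e\<close>.\<close>

lemma gauss_green_nonneg:
  assumes f: "C1_scalar f F" "compact (supp f)" "supp f \<subseteq> \<Omega>" "\<And>x. 0 \<le> f x" and d: "norm d = 1"
  shows "(\<integral>x. indicator E x * (F x \<bullet> d) \<partial>lborel) = (\<integral>x. indicator S x * (f x * (\<nu> x \<bullet> d)) \<partial>surface_measure)"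
proof -
  define err where "err = (\<lambda>(f::'a \<Rightarrow> real) (F::'a \<Rightarrow> 'a). (\<integral>x. indicator E x * (F x \<bullet> d) \<partial>lborel) - (\<integral>x. indicator S x * (f x * (\<nu> x \<bullet> d)) \<partial>surface_measure))"
  define mass where "mass = (\<lambda>f::'a \<Rightarrow> real. (\<integral>x. indicator S x * f x \<partial>surface_measure))"
  have bound: "\<bar>err f F\<bar> \<le> e * mass f" if "0 < e" for e
  proof -
    define Q where "Q = (\<lambda>f. \<forall>F. C1_scalar f F \<longrightarrow> \<bar>err f F\<bar> \<le> e * mass f)"
    have "Q f"
    proof (rule test_fun_localize[of \<Omega>])
      fix x assume "x \<in> \<Omega>"
      show "\<exists>V. open V \<and> x \<in> V \<and> (\<forall>f. test_fun (V \<inter> \<Omega>) f \<longrightarrow> Q f)"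
      proof (rule local_gauss_green[OF dim PL meas side[OF \<open>x \<in> \<Omega>\<close>] \<open>0 < e\<close>])
        fix V assume V: "open V" "x \<in> V"
          "\<And>f F d. C1_scalar f F \<Longrightarrow> compact (supp f) \<Longrightarrow> supp f \<subseteq> V \<Longrightarrow> (\<And>x. 0 \<le> f x) \<Longrightarrow> norm d = 1 \<Longrightarrow>
       \<bar>(\<integral>x. indicator E x * (F x \<bullet> d) \<partial>lborel) - (\<integral>x. indicator S x * (f x * (\<nu> x \<bullet> d)) \<partial>surface_measure)\<bar>
         \<le> e * (\<integral>x. indicator S x * f x \<partial>surface_measure)"
        have "Q f" if t: "test_fun (V \<inter> \<Omega>) f" for f
          unfolding Q_def err_def mass_def
        proof (intro allI impI)
          fix F assume "C1_scalar f F"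
          then show "\<bar>(\<integral>x. indicator E x * (F x \<bullet> d) \<partial>lborel) - (\<integral>x. indicator S x * (f x * (\<nu> x \<bullet> d)) \<partial>surface_measure)\<bar>
              \<le> e * (\<integral>x. indicator S x * f x \<partial>surface_measure)"
            by (rule V(3)) (use t d in \<open>auto simp: test_fun_def\<close>)
        qed
        then show "\<exists>V. open V \<and> x \<in> V \<and> (\<forall>f. test_fun (V \<inter> \<Omega>) f \<longrightarrow> Q f)" using V(1,2) by blast
      qed
    next
      have "err (\<lambda>x. 0) F = 0" if "C1_scalar (\<lambda>x. 0) F" for F
        using C1_scalar_unique[OF that C1_scalar_const] by (simp add: err_def)
      then show "Q (\<lambda>x. 0)" by (simp add: Q_def mass_def)
    next
      fix f g assume t: "test_fun \<Omega> f" "test_fun \<Omega> g" and Q: "Q f" "Q g"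
      obtain F G where F: "C1_scalar f F" "compact (supp f)" "supp f \<subseteq> \<Omega>"
        and G: "C1_scalar g G" "compact (supp g)" "supp g \<subseteq> \<Omega>" using t unfolding test_fun_def by blast
      have m: "mass (\<lambda>x. f x + g x) = mass f + mass g"
        unfolding mass_def distrib_left
        by (rule Bochner_Integration.integral_add[OF integrable_test(1)[OF F] integrable_test(1)[OF G]])
      have "err (\<lambda>x. f x + g x) (\<lambda>x. F x + G x) = err f F + err g G"
        unfolding err_def distrib_left distrib_right inner_add_left
        by (subst Bochner_Integration.integral_add[OF C1_scalar_integrable[OF F(1,2) meas(1)] C1_scalar_integrable[OF G(1,2) meas(1)]],
            subst Bochner_Integration.integral_add[OF integrable_test(2)[OF F] integrable_test(2)[OF G]]) simp
      moreover have "\<bar>err f F\<bar> \<le> e * mass f" "\<bar>err g G\<bar> \<le> e * mass g" using Q F(1) G(1) unfolding Q_def by blast+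
      ultimately have "\<bar>err (\<lambda>x. f x + g x) (\<lambda>x. F x + G x)\<bar> \<le> e * mass (\<lambda>x. f x + g x)"
        unfolding m distrib_left by linarith
      then show "Q (\<lambda>x. f x + g x)"
        unfolding Q_def using C1_scalar_unique[OF C1_scalar_add[OF F(1) G(1)]] by metis
    next
      show "test_fun \<Omega> f" unfolding test_fun_def using f by blast
    qed
    then show ?thesis using f(1) unfolding Q_def by blast
  qed
  have m0: "0 \<le> mass f" unfolding mass_def using f(4) by (intro Bochner_Integration.integral_nonneg) simp
  have "\<bar>err f F\<bar> \<le> 0 + e" if "0 < e" for e
  proof -
    \<comment> \<open>The shift by 1 covers the case of zero mass.\<close>
    have "\<bar>err f F\<bar> \<le> e / (mass f + 1) * mass f" using that m0 by (intro bound) simp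
    also have "\<dots> \<le> e" using that m0 by (simp add: field_simps)
    finally show ?thesis by simp
  qed
  then have "\<bar>err f F\<bar> \<le> 0" by (rule field_le_epsilon)
  then show ?thesis by (simp add: err_def)
qed

text \<open>A signed function is the difference of the nonnegative functions f + B e and B e, where
  \<open>B\<close> bounds |f| and \<open>e\<close> is a cutoff equal to 1 on the support of
  \<open>f\<close>.\<close>

lemma gauss_green_scalar:
  assumes f: "C1_scalar f F" "compact (supp f)" "supp f \<subseteq> \<Omega>" and d: "norm d = 1"
  shows "(\<integral>x. indicator E x * (F x \<bullet> d) \<partial>lborel) = (\<integral>x. indicator S x * (f x * (\<nu> x \<bullet> d)) \<partial>surface_measure)"
proof -
  obtain B where B: "\<And>x. \<bar>f x\<bar> \<le> B" using C1_bounded[OF f(1,2)] by blast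
  obtain e H W where e: "C1_scalar e H" "\<And>x. 0 \<le> e x" "\<And>x. e x \<le> 1" "open W" "supp f \<subseteq> W"
    "\<And>x. x \<in> W \<Longrightarrow> e x = 1" "compact (supp e)" "supp e \<subseteq> \<Omega>"
    by (rule C1_urysohn[OF f(2) \<Omega> f(3)]) (blast intro: that)
  have B0: "0 \<le> B" using B[of undefined] by linarith
  define f2 where "f2 = (\<lambda>x. B * e x)"
  define F2 where "F2 = (\<lambda>x. B *\<^sub>R H x + e x *\<^sub>R 0)"
  have c2: "C1_scalar f2 F2" unfolding f2_def F2_def by (rule C1_scalar_mult[OF C1_scalar_const e(1)])
  have s2: "supp f2 \<subseteq> supp e" unfolding f2_def by (rule supp_mono) simp
  then have k2: "compact (supp f2)" "supp f2 \<subseteq> \<Omega>" using e(7,8) closed_supp[of f2] by (metis compact_Int_closed inf.absorb2, blast)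
  have c1: "C1_scalar (\<lambda>x. f x + f2 x) (\<lambda>x. F x + F2 x)" by (rule C1_scalar_add[OF f(1) c2])
  have s1: "supp (\<lambda>x. f x + f2 x) \<subseteq> supp f \<union> supp f2"
  proof (rule supp_subset_closed)
    show "x \<in> supp f \<union> supp f2" if "f x + f2 x \<noteq> 0" for x using that supp_subset[of x f] supp_subset[of x f2] by (metis Un_iff add.right_neutral)
  qed (simp add: closed_supp closed_Un)
  have k1: "compact (supp (\<lambda>x. f x + f2 x))" "supp (\<lambda>x. f x + f2 x) \<subseteq> \<Omega>"
    using compact_Un[OF f(2) k2(1)] s1 closed_supp[of "\<lambda>x. f x + f2 x"] f(3) k2(2)
    by (metis compact_Int_closed inf.absorb2, blast)
  have nn: "0 \<le> f x + f2 x" for x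
  proof (cases "x \<in> supp f")
    case True
    then have "e x = 1" using e(5,6) by blast
    then show ?thesis using B[of x] by (simp add: f2_def abs_le_iff)
  next
    case False
    then show ?thesis using supp_subset[of x f] e(2)[of x] B0 by (simp add: f2_def)
  qed
  have "(\<integral>x. indicator E x * ((F x + F2 x) \<bullet> d) \<partial>lborel) = (\<integral>x. indicator S x * ((f x + f2 x) * (\<nu> x \<bullet> d)) \<partial>surface_measure)"
    by (rule gauss_green_nonneg[OF c1 k1 nn d])
  moreover have "(\<integral>x. indicator E x * (F2 x \<bullet> d) \<partial>lborel) = (\<integral>x. indicator S x * (f2 x * (\<nu> x \<bullet> d)) \<partial>surface_measure)"
    using e(2) B0 by (intro gauss_green_nonneg[OF c2 k2 _ d]) (simp add: f2_def)
  moreover have "(\<integral>x. indicator E x * ((F x + F2 x) \<bullet> d) \<partial>lborel)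
      = (\<integral>x. indicator E x * (F x \<bullet> d) \<partial>lborel) + (\<integral>x. indicator E x * (F2 x \<bullet> d) \<partial>lborel)"
    unfolding inner_add_left distrib_left
    by (rule Bochner_Integration.integral_add[OF C1_scalar_integrable[OF f(1,2) meas(1)] C1_scalar_integrable[OF c2 k2(1) meas(1)]])
  moreover have "(\<integral>x. indicator S x * ((f x + f2 x) * (\<nu> x \<bullet> d)) \<partial>surface_measure)
      = (\<integral>x. indicator S x * (f x * (\<nu> x \<bullet> d)) \<partial>surface_measure) + (\<integral>x. indicator S x * (f2 x * (\<nu> x \<bullet> d)) \<partial>surface_measure)"
    unfolding distrib_right distrib_left
    by (rule Bochner_Integration.integral_add[OF integrable_test(2)[OF f] integrable_test(2)[OF c2 k2]])
  ultimately show ?thesis by linarith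
qed

theorem gauss_green:
  assumes X: "C_k_map 1 X" "compact (supp X)" "supp X \<subseteq> \<Omega>"
  shows "(LINT x:E|lebesgue. divergence X x) = (LINT x:S|surface_measure. X x \<bullet> \<nu> x)"
proof -
  define F where "F = (\<lambda>b x. \<Sum>c\<in>Basis. (frechet_derivative X (at x) c \<bullet> b) *\<^sub>R c)"
  have F: "C1_scalar (\<lambda>x. X x \<bullet> b) (F b)" "divergence X x = (\<Sum>b\<in>Basis. F b x \<bullet> b)" for b x
    unfolding F_def by (rule C_k_map_1_component[OF X(1)])+
  have s: "supp (\<lambda>x. X x \<bullet> b) \<subseteq> supp X" for b by (rule supp_mono) auto
  have k: "compact (supp (\<lambda>x. X x \<bullet> b))" "supp (\<lambda>x. X x \<bullet> b) \<subseteq> \<Omega>" for b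
    using X(2,3) s[of b] closed_supp[of "\<lambda>x. X x \<bullet> b"] by (metis compact_Int_closed inf.absorb2, blast)
  have "(LINT x:E|lebesgue. divergence X x) = (\<integral>x. indicator E x * divergence X x \<partial>lebesgue)"
    unfolding set_lebesgue_integral_def by simp
  also have "\<dots> = (\<integral>x. indicator E x * divergence X x \<partial>lborel)"
  proof (rule integral_completion)
    have "continuous_on UNIV (divergence X)"
      unfolding F(2) by (intro continuous_intros C1_scalar_cont_grad[OF F(1)])
    then have [measurable]: "divergence X \<in> borel_measurable borel" by (rule borel_measurable_continuous_onI)
    show "(\<lambda>x. indicator E x * divergence X x) \<in> borel_measurable lborel" using meas(1) by measurable
  qed
  also have "\<dots> = (\<integral>x. (\<Sum>b\<in>Basis. indicator E x * (F b x \<bullet> b)) \<partial>lborel)" unfolding F(2) sum_distrib_left ..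
  also have "\<dots> = (\<Sum>b\<in>Basis. (\<integral>x. indicator E x * (F b x \<bullet> b) \<partial>lborel))"
    by (rule Bochner_Integration.integral_sum) (rule C1_scalar_integrable[OF F(1) k(1) meas(1)])
  also have "\<dots> = (\<Sum>b\<in>Basis. (\<integral>x. indicator S x * ((X x \<bullet> b) * (\<nu> x \<bullet> b)) \<partial>surface_measure))"
    by (intro sum.cong refl gauss_green_scalar[OF F(1) k]) simp
  also have "\<dots> = (\<integral>x. (\<Sum>b\<in>Basis. indicator S x * ((X x \<bullet> b) * (\<nu> x \<bullet> b))) \<partial>surface_measure)"
    by (rule Bochner_Integration.integral_sum[symmetric]) (rule integrable_test(2)[OF F(1) k])
  also have "\<dots> = (LINT x:S|surface_measure. X x \<bullet> \<nu> x)"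
    by (simp only: set_lebesgue_integral_def sum_distrib_left[symmetric] euclidean_inner[symmetric] real_scaleR_def)
  finally show ?thesis .
qed

lemma oriented_boundary:
  assumes "\<Omega> = UNIV" shows "oriented_boundary E S \<nu>"
  unfolding oriented_boundary_def
proof (intro conjI allI impI)
  show "E \<in> sets lebesgue" using meas(1) by simp
  show "AE x in surface_measure. x \<in> S \<longrightarrow> norm (\<nu> x) = 1" using norm_normal assms by simp
  show "emeasure surface_measure (S \<inter> K) < \<infinity>" if "compact K" for K using compact_finite[OF that] assms by simp
  fix X :: "'a \<Rightarrow> 'a" assume "C_k_map 1 X \<and> compactly_supported X"
  then show "(LINT x:E|lebesgue. divergence X x) = (LINT x:S|surface_measure. X x \<bullet> \<nu> x)"
    using assms by (intro gauss_green) (auto simp: compactly_supported_def supp_def)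
qed (use meas in auto)

end

section \<open>The calibration\<close>

text \<open>Functions built from |p|^2 and |q|^2 have gradients of the form (a p, b q). Recording
  the two coefficients alone reduces the calculus of the calibration to real algebra.\<close>

definition radial :: "(R6 \<Rightarrow> real) \<Rightarrow> (R6 \<Rightarrow> real) \<Rightarrow> (R6 \<Rightarrow> real) \<Rightarrow> bool" where
  "radial f a b \<longleftrightarrow> C1_scalar f (\<lambda>x. (a x *\<^sub>R fst x, b x *\<^sub>R snd x))"

lemma radial_cong: "radial f a b \<Longrightarrow> (\<And>x. a x = a' x) \<Longrightarrow> (\<And>x. b x = b' x) \<Longrightarrow> radial f a' b'"
  by (simp add: radial_def)

lemma radial_const: "radial (\<lambda>x. c) (\<lambda>x. 0) (\<lambda>x. 0)"
  using C1_scalar_const[where 'a=R6, of c] unfolding radial_def zero_prod_def by simp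

lemma radial_add: "radial f a b \<Longrightarrow> radial g a' b' \<Longrightarrow> radial (\<lambda>x. f x + g x) (\<lambda>x. a x + a' x) (\<lambda>x. b x + b' x)"
  unfolding radial_def by (drule (1) C1_scalar_add) (simp add: scaleR_add_left)

lemma radial_diff: "radial f a b \<Longrightarrow> radial g a' b' \<Longrightarrow> radial (\<lambda>x. f x - g x) (\<lambda>x. a x - a' x) (\<lambda>x. b x - b' x)"
  unfolding radial_def by (drule (1) C1_scalar_diff) (simp add: scaleR_diff_left)

lemma radial_mult:
  "radial f a b \<Longrightarrow> radial g a' b' \<Longrightarrow>
    radial (\<lambda>x. f x * g x) (\<lambda>x. f x * a' x + g x * a x) (\<lambda>x. f x * b' x + g x * b x)"
  unfolding radial_def by (drule (1) C1_scalar_mult) (simp add: scaleR_add_left)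

lemma C1_scalar_compose:
  assumes f: "C1_scalar f F" and h: "\<And>x. (h has_real_derivative h' (f x)) (at (f x))"
    and cont: "continuous_on UNIV (\<lambda>x. h' (f x))"
  shows "C1_scalar (\<lambda>x. h (f x)) (\<lambda>x. h' (f x) *\<^sub>R F x)"
  unfolding C1_scalar_def
proof (intro conjI allI)
  show "GDERIV (\<lambda>x. h (f x)) x :> h' (f x) *\<^sub>R F x" for x
    by (rule GDERIV_DERIV_compose[OF C1_scalar_gderiv[OF f] h])
  show "continuous_on UNIV (\<lambda>x. h' (f x) *\<^sub>R F x)"
    by (rule continuous_on_scaleR[OF cont C1_scalar_cont_grad[OF f]])
qed

lemma radial_sqrt:
  assumes "radial f a b" and pos: "\<And>x. 0 < f x"
  shows "radial (\<lambda>x. sqrt (f x)) (\<lambda>x. a x / (2 * sqrt (f x))) (\<lambda>x. b x / (2 * sqrt (f x)))"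
proof -
  have f: "C1_scalar f (\<lambda>x. (a x *\<^sub>R fst x, b x *\<^sub>R snd x))" using assms(1) by (simp add: radial_def)
  have "C1_scalar (\<lambda>x. sqrt (f x)) (\<lambda>x. (1 / (2 * sqrt (f x))) *\<^sub>R (a x *\<^sub>R fst x, b x *\<^sub>R snd x))"
  proof (rule C1_scalar_compose[OF f])
    show "(sqrt has_real_derivative 1 / (2 * sqrt (f x))) (at (f x))" for x
      by (rule DERIV_cong[OF DERIV_real_sqrt[OF pos]]) (simp add: inverse_eq_divide)
    have "sqrt (f x) \<noteq> 0" for x using pos[of x] by simp
    then show "continuous_on UNIV (\<lambda>x. 1 / (2 * sqrt (f x)))"
      by (intro continuous_intros C1_scalar_cont[OF f]) auto
  qed
  then show ?thesis by (simp add: radial_def)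
qed

lemma radial_inverse:
  assumes "radial f a b" and pos: "\<And>x. 0 < f x"
  shows "radial (\<lambda>x. 1 / f x) (\<lambda>x. - a x / (f x)\<^sup>2) (\<lambda>x. - b x / (f x)\<^sup>2)"
proof -
  have f: "C1_scalar f (\<lambda>x. (a x *\<^sub>R fst x, b x *\<^sub>R snd x))" using assms(1) by (simp add: radial_def)
  have nz: "f x \<noteq> 0" for x using pos[of x] by simp
  have "C1_scalar (\<lambda>x. 1 / f x) (\<lambda>x. (- 1 / (f x)\<^sup>2) *\<^sub>R (a x *\<^sub>R fst x, b x *\<^sub>R snd x))"
  proof (rule C1_scalar_compose[OF f])
    show "((\<lambda>y. 1 / y) has_real_derivative - 1 / (f x)\<^sup>2) (at (f x))" for x
      using nz[of x] by (auto intro!: derivative_eq_intros simp: power2_eq_square)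
    show "continuous_on UNIV (\<lambda>x. - 1 / (f x)\<^sup>2)"
      using nz by (intro continuous_intros C1_scalar_cont[OF f]) auto
  qed
  then show ?thesis by (simp add: radial_def)
qed

lemma radial_fst: "radial (\<lambda>x. fst x \<bullet> fst x) (\<lambda>x. 2) (\<lambda>x. 0)"
  unfolding radial_def C1_scalar_def gderiv_def
  by (auto intro!: derivative_eq_intros continuous_intros simp: inner_commute)

lemma radial_snd: "radial (\<lambda>x. snd x \<bullet> snd x) (\<lambda>x. 0) (\<lambda>x. 2)"
  unfolding radial_def C1_scalar_def gderiv_def
  by (auto intro!: derivative_eq_intros continuous_intros simp: inner_commute)

text \<open>The integrand \<open>\<Phi>(p, q, z)\<close> on \<open>\<real>\<^sup>7\<close> equals \<open>(2 R + Q) / (\<surd>2 P)\<close> with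
  \<open>R = \<bar>p\<bar>\<^sup>2 + \<bar>q\<bar>\<^sup>2 + 2 z\<^sup>2\<close> and, for \<open>c = z\<^sup>2\<close>, the functions \<open>Q\<close>, \<open>P\<close> below. The field \<open>cal c\<close> is its
  gradient in \<open>(p, q)\<close> at \<open>(p, -q, z)\<close>, i.e. at the normal of a dilated graph of \<open>u\<close>. It is smooth
  for \<open>c > 0\<close>, and criticality of that graph says that it is divergence-free.\<close>

definition calQ :: "real \<Rightarrow> R6 \<Rightarrow> real" where
  "calQ c x = sqrt ((fst x \<bullet> fst x - snd x \<bullet> snd x) * (fst x \<bullet> fst x - snd x \<bullet> snd x)
      + 4 * c * (fst x \<bullet> fst x + snd x \<bullet> snd x) + 4 * c * c)"

definition calP :: "real \<Rightarrow> R6 \<Rightarrow> real" where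
  "calP c x = sqrt (2 * (fst x \<bullet> fst x + snd x \<bullet> snd x + 2 * c + calQ c x))"

text \<open>Let A and B be the two square roots in \<Phi>. Then \<open>calP\<close> is A + B and
  \<open>calQ\<close> is A B, and factoring A^3 - B^3 cancels |p| |q|. Twice the derivative of (2 R
  + Q) / P in |p|^2 simplifies to this coefficient by means of Q + |p|^2 - |q|^2 + 2 c = P^2 / 2 - 2
  |q|^2.\<close>

definition calf :: "real \<Rightarrow> R6 \<Rightarrow> real" where
  "calf c x = 3 / calP c x - 4 * (snd x \<bullet> snd x) / calP c x ^ 3"

definition calh :: "real \<Rightarrow> R6 \<Rightarrow> real" where
  "calh c x = 3 / calP c x - 4 * (fst x \<bullet> fst x) / calP c x ^ 3"

definition cal :: "real \<Rightarrow> R6 \<Rightarrow> R6" where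
  "cal c x = (1 / sqrt 2) *\<^sub>R (calf c x *\<^sub>R fst x, - calh c x *\<^sub>R snd x)"

text \<open>Here \<open>a\<close>, \<open>b\<close> stand for |p|^2, |q|^2, and (A p, B q) is the
  gradient of \<open>P\<close>. The left side is the divergence of the field up to a constant
  factor, the isolated 3s being the dimension of each factor \<real>^3. Multiplied by Q P^5 it
  becomes a polynomial that vanishes by the two relations for Q^2 and P^2.\<close>

lemma divergence_identity:
  fixes a b c Q P :: real
  assumes "0 < Q" "0 < P" and Q: "Q * Q = (a - b) * (a - b) + 4 * c * (a + b) + 4 * c * c"
    and P: "P * P = 2 * (a + b + 2 * c + Q)"
  defines "A \<equiv> 2 * (Q + a - b + 2 * c) / (Q * P)" and "B \<equiv> 2 * (Q + b - a + 2 * c) / (Q * P)"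
  shows "a * (- 3 * A / P\<^sup>2 + 12 * b * A / P ^ 4) + 3 * (3 / P - 4 * b / P ^ 3)
     - b * (- 3 * B / P\<^sup>2 + 12 * a * B / P ^ 4) - 3 * (3 / P - 4 * a / P ^ 3) = 0"
proof -
  have "- 6 * a * (Q + a - b + 2 * c) * (P * P) + 24 * a * b * (Q + a - b + 2 * c)
      + 6 * b * (Q + b - a + 2 * c) * (P * P) - 24 * a * b * (Q + b - a + 2 * c)
      + 12 * (a - b) * Q * (P * P) = 0" (is "?N = 0")
    using Q P by algebra
  moreover have "a * (- 3 * A / P\<^sup>2 + 12 * b * A / P ^ 4) + 3 * (3 / P - 4 * b / P ^ 3)
     - b * (- 3 * B / P\<^sup>2 + 12 * a * B / P ^ 4) - 3 * (3 / P - 4 * a / P ^ 3) = ?N / (Q * P ^ 5)"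
    using assms(1,2) unfolding A_def B_def
    by (simp add: field_simps power2_eq_square power3_eq_cube power4_eq_xxxx eval_nat_numeral)
  ultimately show ?thesis by simp
qed

context
  fixes c :: real
  assumes c: "0 < c"
begin

lemma calQ_arg_pos: "0 < (fst x \<bullet> fst x - snd x \<bullet> snd x) * (fst x \<bullet> fst x - snd x \<bullet> snd x)
      + 4 * c * (fst x \<bullet> fst x + snd x \<bullet> snd x) + 4 * c * (c::real)"
proof -
  have "0 \<le> 4 * c * (fst x \<bullet> fst x + snd x \<bullet> snd x)" "0 < 4 * c * c" using c by simp_all
  then show ?thesis using zero_le_square[of "fst x \<bullet> fst x - snd x \<bullet> snd x"] by linarith
qed

lemma calQ_pos: "0 < calQ c x"
  unfolding calQ_def using calQ_arg_pos by simp

lemma calP_arg_pos: "0 < 2 * (fst x \<bullet> fst x + snd x \<bullet> snd x + 2 * c + calQ c x)"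
  using c calQ_pos[of x] by (simp add: add_nonneg_pos)

lemma calP_pos: "0 < calP c x"
  unfolding calP_def using calP_arg_pos by simp

lemma calQ_sq: "calQ c x * calQ c x = (fst x \<bullet> fst x - snd x \<bullet> snd x) * (fst x \<bullet> fst x - snd x \<bullet> snd x)
      + 4 * c * (fst x \<bullet> fst x + snd x \<bullet> snd x) + 4 * c * c"
  unfolding calQ_def using less_imp_le[OF calQ_arg_pos[of x]] by (simp only: real_sqrt_mult_self abs_of_nonneg)

lemma calP_sq: "calP c x * calP c x = 2 * (fst x \<bullet> fst x + snd x \<bullet> snd x + 2 * c + calQ c x)"
  unfolding calP_def using less_imp_le[OF calP_arg_pos[of x]] by (simp only: real_sqrt_mult_self abs_of_nonneg)

lemma radial_calQ:
  "radial (calQ c) (\<lambda>x. 2 * (fst x \<bullet> fst x - snd x \<bullet> snd x + 2 * c) / calQ c x)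
     (\<lambda>x. 2 * (snd x \<bullet> snd x - fst x \<bullet> fst x + 2 * c) / calQ c x)"
proof -
  note D = radial_diff[OF radial_fst radial_snd]
  note arg = radial_add[OF radial_add[OF radial_mult[OF D D]
        radial_mult[OF radial_const[of "4 * c"] radial_add[OF radial_fst radial_snd]]] radial_const[of "4 * c * c"]]
  let ?D = "\<lambda>x::R6. fst x \<bullet> fst x - snd x \<bullet> snd x"
  have nz: "calQ c x \<noteq> 0" for x using calQ_pos[of x] by auto
  have "radial (calQ c)
      (\<lambda>x. (?D x * (2 - 0) + ?D x * (2 - 0) + (4 * c * (2 + 0) + (fst x \<bullet> fst x + snd x \<bullet> snd x) * 0) + 0) / (2 * calQ c x))
      (\<lambda>x. (?D x * (0 - 2) + ?D x * (0 - 2) + (4 * c * (0 + 2) + (fst x \<bullet> fst x + snd x \<bullet> snd x) * 0) + 0) / (2 * calQ c x))"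
    using radial_sqrt[OF arg calQ_arg_pos] unfolding calQ_def[abs_def] .
  then show ?thesis
    by (rule radial_cong) (use nz in \<open>simp_all add: field_simps\<close>)
qed

lemma radial_calP:
  "radial (calP c) (\<lambda>x. 2 * (calQ c x + fst x \<bullet> fst x - snd x \<bullet> snd x + 2 * c) / (calQ c x * calP c x))
     (\<lambda>x. 2 * (calQ c x + snd x \<bullet> snd x - fst x \<bullet> fst x + 2 * c) / (calQ c x * calP c x))"
proof -
  note arg = radial_mult[OF radial_const[of 2]
      radial_add[OF radial_add[OF radial_add[OF radial_fst radial_snd] radial_const[of "2 * c"]] radial_calQ]]
  have nz: "calQ c x \<noteq> 0" "calP c x \<noteq> 0" for x using calQ_pos[of x] calP_pos[of x] by auto
  have "radial (calP c) (\<lambda>x. (2 * (2 + 0 + 0 + 2 * (fst x \<bullet> fst x - snd x \<bullet> snd x + 2 * c) / calQ c x)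
       + (fst x \<bullet> fst x + snd x \<bullet> snd x + 2 * c + calQ c x) * 0) / (2 * calP c x))
      (\<lambda>x. (2 * (0 + 2 + 0 + 2 * (snd x \<bullet> snd x - fst x \<bullet> fst x + 2 * c) / calQ c x)
       + (fst x \<bullet> fst x + snd x \<bullet> snd x + 2 * c + calQ c x) * 0) / (2 * calP c x))"
    using radial_sqrt[OF arg calP_arg_pos] unfolding calP_def[abs_def] .
  then show ?thesis
    by (rule radial_cong) (use nz in \<open>simp_all add: field_simps\<close>)
qed

definition PA where "PA x = 2 * (calQ c x + fst x \<bullet> fst x - snd x \<bullet> snd x + 2 * c) / (calQ c x * calP c x)"
definition PB where "PB x = 2 * (calQ c x + snd x \<bullet> snd x - fst x \<bullet> fst x + 2 * c) / (calQ c x * calP c x)"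

text \<open>The divergence involves the p-derivative of \<open>calf\<close> and the q-derivative of
  \<open>calh\<close>; the other two coefficients are left unspecified.\<close>

lemma radial_calfh:
  "\<exists>b. radial (calf c) (\<lambda>x. - 3 * PA x / (calP c x)\<^sup>2 + 12 * (snd x \<bullet> snd x) * PA x / calP c x ^ 4) b"
  "\<exists>a. radial (calh c) a (\<lambda>x. - 3 * PB x / (calP c x)\<^sup>2 + 12 * (fst x \<bullet> fst x) * PB x / calP c x ^ 4)"
proof -
  have P: "radial (calP c) PA PB" using radial_calP by (simp add: PA_def[abs_def] PB_def[abs_def])
  note I = radial_inverse[OF P calP_pos]
  note I3 = radial_mult[OF I radial_mult[OF I I]]
  have nz: "calP c x \<noteq> 0" for x using calP_pos[of x] by auto
  have f: "calf c = (\<lambda>x. 3 * (1 / calP c x) - 4 * (snd x \<bullet> snd x) * (1 / calP c x * (1 / calP c x * (1 / calP c x))))"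
    by (simp add: fun_eq_iff calf_def power3_eq_cube)
  have h: "calh c = (\<lambda>x. 3 * (1 / calP c x) - 4 * (fst x \<bullet> fst x) * (1 / calP c x * (1 / calP c x * (1 / calP c x))))"
    by (simp add: fun_eq_iff calh_def power3_eq_cube)
  note F = radial_diff[OF radial_mult[OF radial_const[of 3] I] radial_mult[OF radial_mult[OF radial_const[of 4] radial_snd] I3]]
  note H = radial_diff[OF radial_mult[OF radial_const[of 3] I] radial_mult[OF radial_mult[OF radial_const[of 4] radial_fst] I3]]
  show "\<exists>b. radial (calf c) (\<lambda>x. - 3 * PA x / (calP c x)\<^sup>2 + 12 * (snd x \<bullet> snd x) * PA x / calP c x ^ 4) b"
    unfolding f by (rule exI, rule radial_cong[OF F _ refl])
      (use nz in \<open>simp add: field_simps power2_eq_square power4_eq_xxxx\<close>)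
  show "\<exists>a. radial (calh c) a (\<lambda>x. - 3 * PB x / (calP c x)\<^sup>2 + 12 * (fst x \<bullet> fst x) * PB x / calP c x ^ 4)"
    unfolding h by (rule exI, rule radial_cong[OF H refl])
      (use nz in \<open>simp add: field_simps power2_eq_square power4_eq_xxxx\<close>)
qed

lemma sum_Basis_prod_real:
  fixes f :: "'a::euclidean_space \<times> 'b::euclidean_space \<Rightarrow> real"
  shows "sum f Basis = (\<Sum>i\<in>Basis. f (i, 0)) + (\<Sum>i\<in>Basis. f (0, i))"
proof -
  have disj: "(\<lambda>u. (u::'a, 0::'b)) ` Basis \<inter> (\<lambda>v. (0, v)) ` Basis = {}"
    by (auto simp: nonzero_Basis)
  show ?thesis
    unfolding Basis_prod_def sum.union_disjoint[OF finite_imageI[OF finite_Basis] finite_imageI[OF finite_Basis] disj]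
    by (simp add: sum.reindex inj_on_def)
qed

lemma sum_Basis_fst: "(\<Sum>b\<in>(Basis::R6 set). (fst b, 0) \<bullet> b) = 3"
  unfolding sum_Basis_prod_real by (simp add: inner_Basis)

lemma sum_Basis_snd: "(\<Sum>b\<in>(Basis::R6 set). (0, snd b) \<bullet> b) = 3"
  unfolding sum_Basis_prod_real by (simp add: inner_Basis)

lemma cal_derivative:
  obtains X' where "\<And>x. (cal c has_derivative X' x) (at x)" "\<And>v. continuous_on UNIV (\<lambda>x. X' x v)"
    "\<And>x. (\<Sum>b\<in>Basis. X' x b \<bullet> b) = 0"
proof -
  define fa where "fa = (\<lambda>x. - 3 * PA x / (calP c x)\<^sup>2 + 12 * (snd x \<bullet> snd x) * PA x / calP c x ^ 4)"
  define hb where "hb = (\<lambda>x. - 3 * PB x / (calP c x)\<^sup>2 + 12 * (fst x \<bullet> fst x) * PB x / calP c x ^ 4)"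
  obtain fb where f: "radial (calf c) fa fb" using radial_calfh(1) unfolding fa_def by blast
  obtain ha where h: "radial (calh c) ha hb" using radial_calfh(2) unfolding hb_def by blast
  define F where "F = (\<lambda>x. (fa x *\<^sub>R fst x, fb x *\<^sub>R snd x))"
  define H where "H = (\<lambda>x. (ha x *\<^sub>R fst x, hb x *\<^sub>R snd x))"
  have F: "C1_scalar (calf c) F" using f by (simp add: radial_def F_def)
  have H: "C1_scalar (calh c) H" using h by (simp add: radial_def H_def)
  define X' where "X' = (\<lambda>x v. (1 / sqrt 2) *\<^sub>R ((v \<bullet> F x) *\<^sub>R fst x + calf c x *\<^sub>R fst v, - ((v \<bullet> H x) *\<^sub>R snd x + calh c x *\<^sub>R snd v)))"
  have "(cal c has_derivative X' x) (at x)" for x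
  proof -
    define k :: real where "k = 1 / sqrt 2"
    show ?thesis
      unfolding cal_def[abs_def] X'_def k_def[symmetric]
      using C1_scalar_gderiv[OF F, of x] C1_scalar_gderiv[OF H, of x] unfolding gderiv_def
      by (auto intro!: derivative_eq_intros simp: algebra_simps)
  qed
  moreover have "continuous_on UNIV (\<lambda>x. X' x v)" for v
    unfolding X'_def
    by (intro continuous_intros C1_scalar_cont[OF F] C1_scalar_cont[OF H] C1_scalar_cont_grad[OF F] C1_scalar_cont_grad[OF H])
  moreover have "(\<Sum>b\<in>Basis. X' x b \<bullet> b) = 0" for x
  proof -
    have eucl: "(\<Sum>b\<in>Basis. (b \<bullet> w) * (b \<bullet> v)) = v \<bullet> w" for v w :: R6
      by (subst euclidean_inner[of v w]) (simp only: inner_commute[of v] inner_commute[of w] mult.commute)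
    have "X' x b \<bullet> b = (1 / sqrt 2) * ((b \<bullet> F x) * (b \<bullet> (fst x, 0)) + calf c x * ((fst b, 0) \<bullet> b)
        - (b \<bullet> H x) * (b \<bullet> (0, snd x)) - calh c x * ((0, snd b) \<bullet> b))" for b
      unfolding X'_def inner_scaleR_left
      by (simp add: inner_prod_def[of _ b] inner_prod_def[of b "(_, _)"] inner_add_left inner_diff_left inner_commute[of "fst b" "fst x"]
          inner_commute[of "snd b" "snd x"] del: mult_cancel_left)
    then have "(\<Sum>b\<in>Basis. X' x b \<bullet> b) = (1 / sqrt 2) * ((fst x, 0) \<bullet> F x + calf c x * 3 - (0, snd x) \<bullet> H x - calh c x * 3)"
      by (simp only: sum_distrib_left[symmetric] sum.distrib sum_subtractf eucl sum_Basis_fst sum_Basis_snd)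
    also have "(fst x, 0) \<bullet> F x = (fst x \<bullet> fst x) * fa x" by (simp add: F_def inner_prod_def)
    also have "(0, snd x) \<bullet> H x = (snd x \<bullet> snd x) * hb x" by (simp add: H_def inner_prod_def)
    also have "(fst x \<bullet> fst x) * fa x + calf c x * 3 - (snd x \<bullet> snd x) * hb x - calh c x * 3 = 0"
      using divergence_identity[OF calQ_pos calP_pos calQ_sq calP_sq, of x]
      by (simp add: fa_def hb_def PA_def PB_def calf_def calh_def mult.commute)
    finally show ?thesis by simp
  qed
  ultimately show thesis by (rule that)
qed

end

section \<open>The limit field and the calibration inequality\<close>

lemma calQ_zero: "calQ 0 x = \<bar>fst x \<bullet> fst x - snd x \<bullet> snd x\<bar>"
  by (simp add: calQ_def)

lemma calP_zero: "calP 0 x = 2 * max (norm (fst x)) (norm (snd x))"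
proof -
  define a b where "a = norm (fst x)" and "b = norm (snd x)"
  have ab: "fst x \<bullet> fst x = a\<^sup>2" "snd x \<bullet> snd x = b\<^sup>2" "0 \<le> a" "0 \<le> b"
    by (simp_all add: a_def b_def power2_norm_eq_inner)
  have "2 * (a\<^sup>2 + b\<^sup>2 + \<bar>a\<^sup>2 - b\<^sup>2\<bar>) = (2 * max a b)\<^sup>2"
  proof (cases "a \<le> b")
    case True
    then have "a\<^sup>2 \<le> b\<^sup>2" using ab by (intro power_mono)
    then show ?thesis using True by (simp add: max_def power_mult_distrib)
  next
    case False
    then have "b\<^sup>2 \<le> a\<^sup>2" using ab by (intro power_mono) auto
    then show ?thesis using False by (simp add: max_def power_mult_distrib)
  qed
  then have "calP 0 x = sqrt ((2 * max a b)\<^sup>2)" unfolding calP_def calQ_zero ab by simp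
  also have "\<dots> = 2 * max a b" unfolding real_sqrt_abs using ab by simp
  finally show ?thesis by (simp only: a_def b_def)
qed

text \<open>The statement is for every single point because hypersurfaces are Lebesgue null. At the
  origin all the fields vanish; elsewhere \<open>calP 0 x\<close> is positive and the formulas are
  continuous in c.\<close>

lemma cal_tendsto: "((\<lambda>c. cal c x) \<longlongrightarrow> cal 0 x) (at_right 0)"
proof (cases "x = 0")
  case True
  then show ?thesis by (simp add: cal_def)
next
  case False
  then have "fst x \<noteq> 0 \<or> snd x \<noteq> 0" by (simp add: prod_eq_iff)
  then have nz: "calP 0 x \<noteq> 0" unfolding calP_zero by (auto simp: max_def)
  have Q: "((\<lambda>c. calQ c x) \<longlongrightarrow> calQ 0 x) (at_right 0)" unfolding calQ_def by (intro tendsto_intros)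
  have P: "((\<lambda>c. calP c x) \<longlongrightarrow> calP 0 x) (at_right 0)" unfolding calP_def by (intro tendsto_intros Q)
  show ?thesis unfolding cal_def calf_def calh_def using nz by (intro tendsto_intros P) auto
qed

text \<open>Since |p| and |q| are at most \<open>P\<close>, each component is at most 3 + 4 = 7.
  What matters is uniformity in \<open>c\<close>, for dominated convergence.\<close>

lemma cal_bound:
  assumes "0 \<le> c" shows "norm (cal c x) \<le> 14"
proof -
  define a b P where "a = norm (fst x)" and "b = norm (snd x)" and "P = calP c x"
  have ab: "fst x \<bullet> fst x = a\<^sup>2" "snd x \<bullet> snd x = b\<^sup>2" "0 \<le> a" "0 \<le> b"
    by (simp_all add: a_def b_def power2_norm_eq_inner)
  have Q0: "0 \<le> calQ c x" unfolding calQ_def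
  proof (rule real_sqrt_ge_zero)
    have "0 \<le> 4 * c * (fst x \<bullet> fst x + snd x \<bullet> snd x)" "0 \<le> 4 * c * c" using assms by simp_all
    then show "0 \<le> (fst x \<bullet> fst x - snd x \<bullet> snd x) * (fst x \<bullet> fst x - snd x \<bullet> snd x)
      + 4 * c * (fst x \<bullet> fst x + snd x \<bullet> snd x) + 4 * c * c"
      using zero_le_square[of "fst x \<bullet> fst x - snd x \<bullet> snd x"] by linarith
  qed
  have P: "P = sqrt (2 * (a\<^sup>2 + b\<^sup>2 + 2 * c + calQ c x))" by (simp add: P_def calP_def ab)
  have "a\<^sup>2 \<le> 2 * (a\<^sup>2 + b\<^sup>2 + 2 * c + calQ c x)" "b\<^sup>2 \<le> 2 * (a\<^sup>2 + b\<^sup>2 + 2 * c + calQ c x)"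
    by (use assms Q0 zero_le_power2[of a] zero_le_power2[of b] in \<open>simp_all\<close>)
  then have aP: "a \<le> P" "b \<le> P" unfolding P by (simp_all add: real_le_rsqrt)
  have coeff: "\<bar>3 / P - 4 * t\<^sup>2 / P ^ 3\<bar> * s \<le> 7" if "0 \<le> s" "s \<le> P" "0 \<le> t" "t \<le> P" for s t
  proof (cases "P = 0")
    case False
    then have "0 < P" using that by linarith
    have "t\<^sup>2 \<le> P\<^sup>2" using that by (intro power_mono)
    then have "4 * t\<^sup>2 / P ^ 3 \<le> 4 * P\<^sup>2 / P ^ 3" using \<open>0 < P\<close> by (intro divide_right_mono) auto
    also have "\<dots> = 4 / P" using \<open>0 < P\<close> by (simp add: power2_eq_square power3_eq_cube)
    finally have "4 * t\<^sup>2 / P ^ 3 \<le> 4 / P" .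
    moreover have "0 \<le> 4 * t\<^sup>2 / P ^ 3" "0 \<le> 3 / P" using \<open>0 < P\<close> by auto
    moreover have "3 / P \<le> 7 / P" "4 / P \<le> 7 / P" using \<open>0 < P\<close> by (simp_all add: divide_right_mono)
    ultimately have "\<bar>3 / P - 4 * t\<^sup>2 / P ^ 3\<bar> \<le> 7 / P" by linarith
    then have "\<bar>3 / P - 4 * t\<^sup>2 / P ^ 3\<bar> * s \<le> 7 / P * P" using that \<open>0 < P\<close> by (intro mult_mono) auto
    then show ?thesis using \<open>0 < P\<close> by simp
  qed (use that in auto)
  have "norm (calf c x *\<^sub>R fst x, - calh c x *\<^sub>R snd x) \<le> norm (calf c x *\<^sub>R fst x) + norm (- calh c x *\<^sub>R snd x)"
    by (rule norm_Pair_le)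
  also have "norm (calf c x *\<^sub>R fst x) \<le> 7"
    using coeff[of a b] aP ab unfolding calf_def by (simp add: P_def a_def)
  also have "norm (- calh c x *\<^sub>R snd x) \<le> 7"
    using coeff[of b a] aP ab unfolding calh_def by (simp add: P_def b_def abs_minus_commute)
  finally have "norm (calf c x *\<^sub>R fst x, - calh c x *\<^sub>R snd x) \<le> 14" by simp
  moreover have "1 / sqrt 2 \<le> (1::real)" by simp
  ultimately have "(1 / sqrt 2) * norm (calf c x *\<^sub>R fst x, - calh c x *\<^sub>R snd x) \<le> 1 * 14"
    by (intro mult_mono) auto
  then show ?thesis unfolding cal_def norm_scaleR by simp
qed

text \<open>Here \<open>s\<close> is |q| / |p|. The left side is the tangent plane at (1, s) of the
  one-homogeneous function on the right, so the inequality expresses convexity. On either side of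
  the diagonal the gap is an explicit nonnegative expression: m1 (t - s)^2 where m1 dominates, and a
  sum of two such terms where m2 does.\<close>

lemma calibration_real_lower:
  fixes s m1 m2 :: real
  assumes "0 \<le> s" "s \<le> 1" "0 \<le> m1" "0 \<le> m2"
  shows "(3 - s\<^sup>2) * m1 + 2 * s * m2 \<le> 3 * max m1 m2 + (min m1 m2)\<^sup>2 / max m1 m2"
proof (cases "m2 \<le> m1")
  case True
  show ?thesis
  proof (cases "m1 = 0")
    case False
    define t where "t = m2 / m1"
    have m2: "m2 = t * m1" using False by (simp add: t_def)
    have "0 \<le> m1 * (t - s)\<^sup>2" using assms by simp
    moreover have "3 * m1 + m2\<^sup>2 / m1 - ((3 - s\<^sup>2) * m1 + 2 * s * m2) = m1 * (t - s)\<^sup>2"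
      using False by (simp add: m2 power2_eq_square field_simps)
    moreover have "max m1 m2 = m1" "min m1 m2 = m2" using True by auto
    ultimately show ?thesis by simp
  qed (use True assms in auto)
next
  case False
  define t where "t = m1 / m2"
  have t: "m1 = t * m2" "0 \<le> t" "t \<le> 1" "0 < m2" using False assms by (simp_all add: t_def)
  have "t * (1 + s) \<le> 1 * (1 + 1)" using t assms by (intro mult_mono) auto
  then have h: "0 \<le> (1 - s) * (2 - t * (1 + s))" using assms by (intro mult_nonneg_nonneg) auto
  have "0 \<le> m2 * ((1 - t)\<^sup>2 + (1 - s) * (2 - t * (1 + s)))"
    by (rule mult_nonneg_nonneg[OF less_imp_le[OF t(4)] add_nonneg_nonneg[OF zero_le_power2 h]])
  moreover have "3 * m2 + m1\<^sup>2 / m2 - ((3 - s\<^sup>2) * m1 + 2 * s * m2) = m2 * ((1 - t)\<^sup>2 + (1 - s) * (2 - t * (1 + s)))"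
    using t(4) by (simp add: t(1) power2_eq_square field_simps)
  moreover have "max m1 m2 = m2" "min m1 m2 = m1" using False by auto
  ultimately show ?thesis by simp
qed

text \<open>The same gaps, bounded above by a multiple of D^2. Unit length keeps the larger
  coordinate above 1/2. If the two points lie on different sides of the diagonal, m2 - m1 and A - B
  are both nonnegative with sum at most 2 D, so both are small.\<close>

lemma calibration_real_upper:
  fixes A B m1 m2 D :: real
  assumes A: "0 \<le> B" "B \<le> A" "A\<^sup>2 + B\<^sup>2 = 1" and m: "0 \<le> m1" "0 \<le> m2" "m1\<^sup>2 + m2\<^sup>2 = 1"
    and D: "\<bar>m1 - A\<bar> \<le> D" "\<bar>m2 - B\<bar> \<le> D"
  shows "3 * max m1 m2 + (min m1 m2)\<^sup>2 / max m1 m2 - ((3 - (B / A)\<^sup>2) * m1 + 2 * (B / A) * m2) \<le> 16 * D\<^sup>2"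
proof -
  have half: "1 / 2 \<le> y" if "0 \<le> x" "x \<le> y" "y\<^sup>2 + x\<^sup>2 = 1" for x y :: real
  proof (rule ccontr)
    assume "\<not> ?thesis"
    then have "y\<^sup>2 \<le> (1/2)\<^sup>2" "x\<^sup>2 \<le> (1/2)\<^sup>2" using that by (auto intro!: power_mono)
    then show False using that(3) by (simp add: power2_eq_square)
  qed
  have A2: "1 / 2 \<le> A" using half[of B A] A by simp
  have le1: "y \<le> 1" if "y\<^sup>2 + x\<^sup>2 = 1" for x y :: real
    using that by (metis abs_le_square_iff abs_one abs_ge_self le_add_same_cancel1 one_power2 order_trans zero_le_power2)
  have AB1: "A \<le> 1" "B \<le> 1" using le1[of A B] le1[of B A] A by simp_all
  have D0: "0 \<le> D" using D by linarith
  define s where "s = B / A"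
  have s: "B = s * A" "0 \<le> s" "s \<le> 1" using A A2 by (simp_all add: s_def)
  show ?thesis
  proof (cases "m2 \<le> m1")
    case True
    have m12: "1 / 2 \<le> m1" "m1 \<le> 1" using half[of m2 m1] le1[of m1 m2] m True by simp_all
    define t where "t = m2 / m1"
    have t: "m2 = t * m1" using m12 by (simp add: t_def)
    define d where "d = t - s"
    have "m1 * A * d = (m2 - B) * A - B * (m1 - A)" by (simp add: t s(1) d_def algebra_simps)
    then have "\<bar>m1 * A * d\<bar> \<le> \<bar>(m2 - B) * A\<bar> + \<bar>B * (m1 - A)\<bar>" by linarith
    also have "\<bar>(m2 - B) * A\<bar> \<le> D * 1" unfolding abs_mult using D AB1 A by (intro mult_mono) auto
    also have "\<bar>B * (m1 - A)\<bar> \<le> 1 * D" unfolding abs_mult using D AB1 A by (intro mult_mono) auto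
    finally have 1: "\<bar>m1 * A * d\<bar> \<le> 2 * D" by simp
    have "1 / 2 * (1 / 2) \<le> m1 * A" using m12 A2 by (intro mult_mono) auto
    then have "1 / 4 * \<bar>d\<bar> \<le> (m1 * A) * \<bar>d\<bar>" by (intro mult_right_mono) auto
    also have "\<dots> = \<bar>m1 * A * d\<bar>" using m12 A2 by (simp add: abs_mult)
    finally have "\<bar>d\<bar> \<le> 8 * D" using 1 by linarith
    have "m1 * d\<^sup>2 \<le> 16 * D\<^sup>2"
    proof -
      have "m1 * d\<^sup>2 * (m1 * A * A) = (m1 * A * d)\<^sup>2" by (simp add: power2_eq_square)
      also have "\<dots> \<le> (2 * D)\<^sup>2" using 1 by (metis abs_ge_zero power2_abs power_mono)
      finally have 2: "m1 * d\<^sup>2 * (m1 * A * A) \<le> 4 * D\<^sup>2" by (simp add: power_mult_distrib)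
      \<comment> \<open>The bound A^2 \<ge> 1/2, stronger than what A \<ge> 1/2 gives, keeps the
        constant at 16: m1 A^2 \<ge> 1/4, against (2 D)^2 = 4 D^2.\<close>
      have "1 / 2 \<le> A\<^sup>2" using A power_mono[of B A 2] by linarith
      then have "1 / 2 * (1 / 2) \<le> m1 * A\<^sup>2" using m12 by (intro mult_mono) auto
      then have "m1 * d\<^sup>2 * (1 / 4) \<le> m1 * d\<^sup>2 * (m1 * A * A)"
        using m12 by (intro mult_left_mono) (auto simp: power2_eq_square mult.assoc)
      then show ?thesis using 2 by linarith
    qed
    moreover have "3 * m1 + m2\<^sup>2 / m1 - ((3 - s\<^sup>2) * m1 + 2 * s * m2) = m1 * d\<^sup>2"
      using m12 by (simp add: t d_def power2_eq_square field_simps)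
    moreover have "max m1 m2 = m1" "min m1 m2 = m2" using True by auto
    ultimately show ?thesis unfolding s_def[symmetric] by simp
  next
    case False
    have m12: "1 / 2 \<le> m2" "m2 \<le> 1" using half[of m1 m2] le1[of m2 m1] m False by simp_all
    define t where "t = m1 / m2"
    have t: "m1 = t * m2" "0 \<le> t" "t \<le> 1" using m12 m False by (simp_all add: t_def)
    \<comment> \<open>The product carries only the first power of 1 - s, but its other factor is of
      order \<open>D\<close> too: the new bound completes (1 - t)^2 to the square of (1 - t) + (1 -
      s).\<close>
    have "(1 - s) * (2 - t * (1 + s)) \<le> (1 - s) * (2 * (1 - t) + (1 - s))"
    proof (rule mult_left_mono)
      have "t * (1 - s) \<le> 1 * (1 - s)" using t s by (intro mult_right_mono) auto
      then show "2 - t * (1 + s) \<le> 2 * (1 - t) + (1 - s)" by (simp add: algebra_simps)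
    qed (use s in simp)
    then have 1: "(1 - t)\<^sup>2 + (1 - s) * (2 - t * (1 + s)) \<le> ((1 - t) + (1 - s))\<^sup>2"
      by (simp add: power2_eq_square algebra_simps)
    have "(1 - t) * (1 / 2) \<le> (1 - t) * m2" using m12 t by (intro mult_left_mono) auto
    moreover have "m2 - m1 = (1 - t) * m2" by (simp add: t(1) algebra_simps)
    ultimately have "(1 - t) * (1 / 2) \<le> m2 - m1" by (simp only:)
    then have 2: "1 - t \<le> 2 * (m2 - m1)" by (simp add: field_simps)
    have "(1 - s) * (1 / 2) \<le> (1 - s) * A" using A2 s by (intro mult_left_mono) auto
    moreover have "A - B = (1 - s) * A" by (simp add: s(1) algebra_simps)
    ultimately have "(1 - s) * (1 / 2) \<le> A - B" by (simp only:)
    then have 3: "1 - s \<le> 2 * (A - B)" by (simp add: field_simps)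
    have "(1 - t) + (1 - s) \<le> 4 * D" using 2 3 D by argo
    then have "((1 - t) + (1 - s))\<^sup>2 \<le> (4 * D)\<^sup>2" using t s by (intro power_mono) auto
    then have 4: "(1 - t)\<^sup>2 + (1 - s) * (2 - t * (1 + s)) \<le> 16 * D\<^sup>2" using 1 by (simp add: power_mult_distrib)
    have "t * (1 + s) \<le> 1 * (1 + 1)" using t s by (intro mult_mono) auto
    then have "0 \<le> (1 - s) * (2 - t * (1 + s))" using s by (intro mult_nonneg_nonneg) auto
    then have "m2 * ((1 - t)\<^sup>2 + (1 - s) * (2 - t * (1 + s))) \<le> 1 * (16 * D\<^sup>2)"
      using m12 4 by (intro mult_mono) auto
    moreover have "3 * m2 + m1\<^sup>2 / m2 - ((3 - s\<^sup>2) * m1 + 2 * s * m2) = m2 * ((1 - t)\<^sup>2 + (1 - s) * (2 - t * (1 + s)))"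
      using m12 by (simp add: t(1) power2_eq_square field_simps)
    moreover have "max m1 m2 = m2" "min m1 m2 = m1" using False by auto
    ultimately show ?thesis unfolding s_def[symmetric] by simp
  qed
qed

lemma two_powr_three_halves: "2 powr (3/2) = 2 * sqrt (2::real)"
  using powr_add[of "2::real" 1 "1/2"] by (simp add: powr_half_sqrt)

lemma cal_inner:
  fixes x w :: R6
  assumes "norm (snd x) \<le> norm (fst x)" "fst x \<noteq> 0"
  shows "2 * sqrt 2 * (cal 0 x \<bullet> w) = (3 - (norm (snd x) / norm (fst x))\<^sup>2) * ((fst x \<bullet> fst w) / norm (fst x))
      - 2 * ((snd x \<bullet> snd w) / norm (fst x))"
proof -
  define a b where "a = norm (fst x)" and "b = norm (snd x)"
  have ab: "fst x \<bullet> fst x = a\<^sup>2" "snd x \<bullet> snd x = b\<^sup>2" "0 < a"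
    using assms by (simp_all add: a_def b_def power2_norm_eq_inner)
  have P: "calP 0 x = 2 * a" unfolding calP_zero using assms(1) by (simp add: a_def)
  have f: "2 * calf 0 x = (3 - (b / a)\<^sup>2) / a"
    unfolding calf_def P ab using ab(3) by (simp add: field_simps power2_eq_square power3_eq_cube)
  have h: "2 * calh 0 x = 2 / a"
    unfolding calh_def P ab using ab(3) by (simp add: field_simps power2_eq_square power3_eq_cube)
  have "2 * sqrt 2 * (cal 0 x \<bullet> w) = (2 * calf 0 x) * (fst x \<bullet> fst w) - (2 * calh 0 x) * (snd x \<bullet> snd w)"
    unfolding cal_def by (simp add: inner_prod_def algebra_simps)
  then show ?thesis unfolding f h a_def[symmetric] b_def[symmetric] by simp
qed

text \<open>Cauchy-Schwarz in each factor \<real>^3 reduces both bounds to lengths. Its loss is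
  itself quadratic in the deviation from \<open>\<nu>\<^sub>u x\<close>, with total coefficient at
  most 3 + 2 = 5, which together with the 16 for the lengths makes 21.\<close>

lemma calibration_dominant:
  fixes x w :: R6
  assumes dom: "norm (snd x) \<le> norm (fst x)" and x: "x \<noteq> 0"
  shows "cal 0 x \<bullet> w \<le> \<Phi>\<^sub>0 w" "norm w = 1 \<Longrightarrow> \<Phi>\<^sub>0 w - cal 0 x \<bullet> w \<le> 21 * (norm (w - \<nu>\<^sub>u x))\<^sup>2"
proof -
  have p: "fst x \<noteq> 0" using dom x by (auto simp: prod_eq_iff)
  define a b where "a = norm (fst x)" and "b = norm (snd x)"
  define m1 m2 where "m1 = norm (fst w)" and "m2 = norm (snd w)"
  have ab: "0 < a" "0 \<le> b" "b \<le> a" using p dom by (simp_all add: a_def b_def)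
  have m: "0 \<le> m1" "0 \<le> m2" by (simp_all add: m1_def m2_def)
  have s: "0 \<le> b / a" "b / a \<le> 1" using ab by simp_all
  then have s2: "0 \<le> 3 - (b / a)\<^sup>2" "3 - (b / a)\<^sup>2 \<le> 3" using power_le_one[of "b / a" 2] by simp_all
  note inner = cal_inner[OF dom p, of w, folded a_def b_def]
  have Phi: "2 * sqrt 2 * \<Phi>\<^sub>0 w = 3 * max m1 m2 + (min m1 m2)\<^sup>2 / max m1 m2"
    unfolding \<Phi>\<^sub>0_max_min two_powr_three_halves m1_def m2_def by simp
  have "(fst x \<bullet> fst w) / a \<le> (a * m1) / a"
    using ab norm_cauchy_schwarz[of "fst x" "fst w"] by (intro divide_right_mono) (auto simp: a_def m1_def)
  then have 1: "(fst x \<bullet> fst w) / a \<le> m1" using ab by simp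
  have "- (snd x \<bullet> snd w) \<le> b * m2"
    using norm_cauchy_schwarz[of "- snd x" "snd w"] by (simp add: b_def m2_def)
  then have "(- (snd x \<bullet> snd w)) / a \<le> (b * m2) / a" using ab by (intro divide_right_mono) auto
  then have 2: "- 2 * ((snd x \<bullet> snd w) / a) \<le> 2 * (b / a) * m2" by simp
  have "2 * sqrt 2 * (cal 0 x \<bullet> w) \<le> (3 - (b / a)\<^sup>2) * m1 + 2 * (b / a) * m2"
    unfolding inner using mult_left_mono[OF 1 s2(1)] 2 by linarith
  also have "\<dots> \<le> 2 * sqrt 2 * \<Phi>\<^sub>0 w" unfolding Phi by (rule calibration_real_lower[OF s m])
  finally show le: "cal 0 x \<bullet> w \<le> \<Phi>\<^sub>0 w" by simp
  assume w: "norm w = 1"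
  define N where "N = norm x"
  have N: "0 < N" using x by (simp add: N_def)
  define A B where "A = a / N" and "B = b / N"
  define v1 v2 where "v1 = fst x /\<^sub>R N" and "v2 = - (snd x /\<^sub>R N)"
  have nu: "\<nu>\<^sub>u x = (v1, v2)"
  proof -
    have "norm (fst x, - snd x) = N" by (simp add: N_def norm_prod_def)
    then show ?thesis by (simp add: \<nu>\<^sub>u_def case_prod_beta sgn_div_norm v1_def v2_def)
  qed
  have v: "norm v1 = A" "norm v2 = B" using N by (simp_all add: v1_def v2_def A_def B_def a_def b_def divide_inverse mult.commute)
  define D where "D = norm (w - \<nu>\<^sub>u x)"
  have D12: "norm (fst w - v1) \<le> D" "norm (snd w - v2) \<le> D"
    using norm_fst_le[of "fst w - v1" "snd w - v2"] norm_snd_le[of "snd w - v2" "fst w - v1"] by (simp_all add: D_def nu minus_prod_def)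
  have "N\<^sup>2 = a\<^sup>2 + b\<^sup>2" by (simp add: N_def a_def b_def norm_prod_def)
  then have AB: "0 \<le> B" "B \<le> A" "A\<^sup>2 + B\<^sup>2 = 1"
    using ab N by (simp_all add: A_def B_def divide_right_mono power_divide add_divide_distrib[symmetric])
  have mm: "m1\<^sup>2 + m2\<^sup>2 = 1" using w by (simp add: m1_def m2_def norm_prod_def)
  have md: "\<bar>m1 - A\<bar> \<le> D" "\<bar>m2 - B\<bar> \<le> D"
    using norm_triangle_ineq3[of "fst w" v1] norm_triangle_ineq3[of "snd w" v2] D12 v by (simp_all add: m1_def m2_def)
  have BA: "B / A = b / a" using N by (simp add: A_def B_def)
  have A2: "1 / 2 \<le> A"
  proof (rule ccontr)
    assume "\<not> ?thesis"
    then have "A\<^sup>2 \<le> (1/2)\<^sup>2" "B\<^sup>2 \<le> (1/2)\<^sup>2" using AB by (auto intro!: power_mono)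
    then show False using AB(3) by (simp add: power2_eq_square)
  qed
  \<comment> \<open>The loss in Cauchy-Schwarz is half the squared distance minus half the squared
    difference of the lengths.\<close>
  have polar: "norm r * norm y - r \<bullet> y \<le> (norm (y - r))\<^sup>2 / 2" for r y :: R3
  proof -
    have "(norm (y - r))\<^sup>2 = (norm y)\<^sup>2 + (norm r)\<^sup>2 - 2 * (r \<bullet> y)"
      by (simp add: power2_norm_eq_inner inner_diff_left inner_diff_right inner_commute)
    moreover have "0 \<le> (norm y - norm r)\<^sup>2" by simp
    ultimately show ?thesis by (simp add: power2_eq_square algebra_simps)
  qed
  have quad: "norm r * norm y / A - D\<^sup>2 \<le> (r \<bullet> y) / A" if "norm (y - r) \<le> D" for r y :: R3
  proof -
    have "(norm (y - r))\<^sup>2 \<le> D\<^sup>2" using that by (intro power_mono) auto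
    then have "norm r * norm y - r \<bullet> y \<le> D\<^sup>2 / 2" using polar[of r y] by linarith
    also have "\<dots> \<le> D\<^sup>2 * A" using A2 mult_left_mono[OF A2, of "D\<^sup>2"] by simp
    finally have "(norm r * norm y - r \<bullet> y) / A \<le> (D\<^sup>2 * A) / A" using A2 by (intro divide_right_mono) auto
    then show ?thesis using A2 by (simp add: diff_divide_distrib)
  qed
  have "(v1 \<bullet> fst w) / A = (fst x \<bullet> fst w) / a" "(v2 \<bullet> snd w) / A = - ((snd x \<bullet> snd w) / a)"
    using N by (simp_all add: v1_def v2_def A_def divide_inverse)
  note eqs = this
  have "A * m1 / A = m1" using A2 by simp
  moreover have "B * m2 / A = (b / a) * m2" unfolding BA[symmetric] by simp
  ultimately have q1: "m1 - D\<^sup>2 \<le> (fst x \<bullet> fst w) / a" and q2: "(b / a) * m2 - D\<^sup>2 \<le> - ((snd x \<bullet> snd w) / a)"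
    using quad[OF D12(1)] quad[OF D12(2)] unfolding v m1_def[symmetric] m2_def[symmetric] eqs by (simp_all only:)
  have "(3 - (b / a)\<^sup>2) * m1 - 3 * D\<^sup>2 \<le> (3 - (b / a)\<^sup>2) * (m1 - D\<^sup>2)"
    using s2 mult_right_mono[OF s2(2), of "D\<^sup>2"] by (simp add: right_diff_distrib)
  also have "\<dots> \<le> (3 - (b / a)\<^sup>2) * ((fst x \<bullet> fst w) / a)" by (rule mult_left_mono[OF q1 s2(1)])
  finally have "(3 - (b / a)\<^sup>2) * m1 + 2 * (b / a) * m2 - 5 * D\<^sup>2 \<le> 2 * sqrt 2 * (cal 0 x \<bullet> w)"
    unfolding inner using q2 by linarith
  moreover have "2 * sqrt 2 * \<Phi>\<^sub>0 w - ((3 - (b / a)\<^sup>2) * m1 + 2 * (b / a) * m2) \<le> 16 * D\<^sup>2"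
    using calibration_real_upper[OF AB m mm md] unfolding Phi BA .
  ultimately have "2 * sqrt 2 * \<Phi>\<^sub>0 w - 2 * sqrt 2 * (cal 0 x \<bullet> w) \<le> 21 * D\<^sup>2" by linarith
  then have 3: "2 * sqrt 2 * (\<Phi>\<^sub>0 w - cal 0 x \<bullet> w) \<le> 21 * D\<^sup>2" by (simp add: right_diff_distrib)
  have "1 * (\<Phi>\<^sub>0 w - cal 0 x \<bullet> w) \<le> 2 * sqrt 2 * (\<Phi>\<^sub>0 w - cal 0 x \<bullet> w)"
  proof (rule mult_right_mono)
    have "1 \<le> sqrt (2::real)" by simp
    then show "1 \<le> 2 * sqrt (2::real)" by linarith
  qed (use le in simp)
  then show "\<Phi>\<^sub>0 w - cal 0 x \<bullet> w \<le> 21 * (norm (w - \<nu>\<^sub>u x))\<^sup>2" using 3 by (simp add: D_def)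
qed

text \<open>The exchange of \<open>p\<close> and \<open>q\<close> reduces the region \<open>\<bar>p\<bar> < \<bar>q\<bar>\<close> to the dominant one.\<close>

lemma cal_exchange: "cal 0 x \<bullet> w = cal 0 (snd x, fst x) \<bullet> (- snd w, - fst w)"
proof -
  have "calP 0 (snd x, fst x) = calP 0 x" by (simp add: calP_zero max.commute)
  then have "calf 0 (snd x, fst x) = calh 0 x" "calh 0 (snd x, fst x) = calf 0 x" by (simp_all add: calf_def calh_def)
  then show ?thesis by (simp add: cal_def inner_prod_def)
qed

lemma \<Phi>\<^sub>0_exchange: "\<Phi>\<^sub>0 (- snd w, - fst w) = \<Phi>\<^sub>0 w"
  by (simp add: \<Phi>\<^sub>0_max_min max.commute min.commute)

lemma calibration:
  "cal 0 x \<bullet> w \<le> \<Phi>\<^sub>0 w"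
  "x \<noteq> 0 \<Longrightarrow> norm w = 1 \<Longrightarrow> \<Phi>\<^sub>0 w - cal 0 x \<bullet> w \<le> 21 * (norm (w - \<nu>\<^sub>u x))\<^sup>2"
proof -
  have nonneg: "0 \<le> \<Phi>\<^sub>0 w"
    unfolding \<Phi>\<^sub>0_max_min by (intro divide_nonneg_nonneg add_nonneg_nonneg mult_nonneg_nonneg) (auto simp: le_max_iff_disj)
  have "cal 0 x \<bullet> w \<le> \<Phi>\<^sub>0 w \<and> (x \<noteq> 0 \<longrightarrow> norm w = 1 \<longrightarrow> \<Phi>\<^sub>0 w - cal 0 x \<bullet> w \<le> 21 * (norm (w - \<nu>\<^sub>u x))\<^sup>2)"
  proof (cases "x = 0")
    case True
    then have "cal 0 x = 0" by (simp add: cal_def zero_prod_def)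
    then show ?thesis using True nonneg by simp
  next
    case x: False
    show ?thesis
    proof (cases "norm (snd x) \<le> norm (fst x)")
      case True
      then show ?thesis using calibration_dominant[OF True x] by blast
    next
      case False
      define y w' where "y = (snd x, fst x)" and "w' = (- snd w, - fst w)"
      have y: "norm (snd y) \<le> norm (fst y)" "y \<noteq> 0" using False x by (auto simp: y_def prod_eq_iff)
      have "\<nu>\<^sub>u y = (- snd (\<nu>\<^sub>u x), - fst (\<nu>\<^sub>u x))"
        by (simp add: \<nu>\<^sub>u_def y_def case_prod_beta sgn_div_norm norm_prod_def add.commute)
      then have "norm (w' - \<nu>\<^sub>u y) = norm (w - \<nu>\<^sub>u x)"
        by (simp add: w'_def norm_prod_def add.commute norm_minus_commute minus_prod_def)
      moreover have "norm w' = norm w" by (simp add: w'_def norm_prod_def add.commute)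
      ultimately show ?thesis
        using calibration_dominant[OF y, of w'] unfolding cal_exchange[of x w] \<Phi>\<^sub>0_exchange[of w, symmetric] y_def[symmetric] w'_def[symmetric]
        by simp
    qed
  qed
  then show "cal 0 x \<bullet> w \<le> \<Phi>\<^sub>0 w"
    "x \<noteq> 0 \<Longrightarrow> norm w = 1 \<Longrightarrow> \<Phi>\<^sub>0 w - cal 0 x \<bullet> w \<le> 21 * (norm (w - \<nu>\<^sub>u x))\<^sup>2" by blast+
qed

lemma norm_\<nu>\<^sub>u: "x \<noteq> 0 \<Longrightarrow> norm (\<nu>\<^sub>u x) = 1"
  by (auto simp: \<nu>\<^sub>u_def case_prod_beta norm_sgn prod_eq_iff)

text \<open>Both estimates at w = \<open>\<nu>\<^sub>u x\<close>, where the quadratic error is 0,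
  force equality. At the origin both sides are 0 because \<open>sgn 0 = 0\<close>.\<close>

lemma cal_\<nu>\<^sub>u: "cal 0 x \<bullet> \<nu>\<^sub>u x = \<Phi>\<^sub>0 (\<nu>\<^sub>u x)"
proof (cases "x = 0")
  case True
  have "\<nu>\<^sub>u 0 = 0" by (simp add: \<nu>\<^sub>u_def case_prod_beta zero_prod_def[symmetric])
  then show ?thesis using True by (simp add: \<Phi>\<^sub>0_max_min)
next
  case False
  then show ?thesis using calibration(1)[of x "\<nu>\<^sub>u x"] calibration(2)[OF False norm_\<nu>\<^sub>u[OF False]] by simp
qed

section \<open>The foliations\<close>

lemma u_scale: "u (r *\<^sub>R x) = r\<^sup>2 * u x"
  by (cases x) (simp add: u_def power_mult_distrib algebra_simps)

lemma u_inner: "u x = (fst x \<bullet> fst x - snd x \<bullet> snd x) / 2"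
  by (cases x) (simp add: u_def power2_norm_eq_inner)

lemma gderiv_u: "GDERIV u x :> (fst x, - snd x)"
proof -
  have eq: "u = (\<lambda>x. (fst x \<bullet> fst x - snd x \<bullet> snd x) / 2)" by (simp add: fun_eq_iff u_inner)
  show ?thesis unfolding gderiv_def eq
    by (auto intro!: derivative_eq_intros simp: inner_prod_def inner_commute)
qed

lemma image_dilation_level: "0 < r \<Longrightarrow> (*\<^sub>R) r ` {x. u x = c} = {x. u x = r\<^sup>2 * c}"
proof (intro equalityI subsetI)
  fix x assume "0 < r" "x \<in> {x. u x = r\<^sup>2 * c}"
  then have "x = r *\<^sub>R (x /\<^sub>R r)" "u (x /\<^sub>R r) = c" by (simp_all add: u_scale power2_eq_square field_simps)
  then show "x \<in> (*\<^sub>R) r ` {x. u x = c}" by blast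
next
  fix y assume "y \<in> (*\<^sub>R) r ` {x. u x = c}"
  then obtain x where "u x = c" "y = r *\<^sub>R x" by blast
  then show "y \<in> {x. u x = r\<^sup>2 * c}" by (simp add: u_scale)
qed

text \<open>The level set is an image of the connected space S^2 x \<real>^3: \<open>q\<close> is
  free, and |p|^2 = 2 d + |q|^2 > 0 leaves only the direction of \<open>p\<close> to be
  chosen.\<close>

lemma connected_level_pos:
  assumes "0 < d" shows "connected {x. u x = d}"
proof -
  define \<phi> :: "R6 \<Rightarrow> R6" where "\<phi> = (\<lambda>(w, q). (sqrt (2 * d + q \<bullet> q) *\<^sub>R w, q))"
  have "connected (\<phi> ` (sphere 0 1 \<times> UNIV))"
  proof (rule connected_continuous_image)
    show "continuous_on (sphere 0 1 \<times> UNIV) \<phi>" unfolding \<phi>_def case_prod_beta by (intro continuous_intros)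
    show "connected (sphere (0::R3) 1 \<times> (UNIV :: R3 set))"
      by (intro connected_Times connected_sphere connected_UNIV) simp
  qed
  moreover have "\<phi> ` (sphere 0 1 \<times> UNIV) = {x. u x = d}"
  proof (intro equalityI subsetI)
    fix x assume "x \<in> \<phi> ` (sphere 0 1 \<times> UNIV)"
    then obtain w q where wq: "norm w = 1" "x = (sqrt (2 * d + q \<bullet> q) *\<^sub>R w, q)" by (auto simp: \<phi>_def)
    have "0 \<le> 2 * d + q \<bullet> q" using assms by simp
    moreover have "w \<bullet> w = 1" using wq(1) by (simp add: norm_eq_1)
    ultimately show "x \<in> {x. u x = d}" by (simp add: wq(2) u_inner)
  next
    fix x assume "x \<in> {x. u x = d}"
    then have eq: "fst x \<bullet> fst x = 2 * d + snd x \<bullet> snd x" by (simp add: u_inner)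
    then have n: "norm (fst x) = sqrt (2 * d + snd x \<bullet> snd x)" by (simp add: norm_eq_sqrt_inner)
    have "0 < 2 * d + snd x \<bullet> snd x" using assms by (simp add: add_pos_nonneg)
    then have "norm (fst x) \<noteq> 0" unfolding n by simp
    then have "x = \<phi> (fst x /\<^sub>R norm (fst x), snd x)" "norm (fst x /\<^sub>R norm (fst x)) = 1"
      unfolding \<phi>_def case_prod_conv n[symmetric] by simp_all
    then show "x \<in> \<phi> ` (sphere 0 1 \<times> UNIV)"
      by (intro image_eqI[of x \<phi> "(fst x /\<^sub>R norm (fst x), snd x)"]) simp_all
  qed
  ultimately show ?thesis by simp
qed

lemma connected_level:
  assumes "d \<noteq> 0" shows "connected {x. u x = d}"
proof (cases "0 < d")
  case False
  then have "connected ((\<lambda>x. (snd x, fst x)) ` {x. u x = - d})"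
    using assms by (intro connected_continuous_image connected_level_pos continuous_intros) auto
  moreover have "(\<lambda>x. (snd x, fst x)) ` {x. u x = - d} = {x. u x = d}"
  proof (intro equalityI subsetI)
    fix x assume "x \<in> {x. u x = d}"
    then have "(snd x, fst x) \<in> {x. u x = - d}" by (simp add: u_inner)
    then show "x \<in> (\<lambda>x. (snd x, fst x)) ` {x. u x = - d}" by (rule rev_image_eqI) simp
  qed (auto simp: u_inner)
  ultimately show ?thesis by simp
qed (rule connected_level_pos)

lemma level_nonempty: "{x. u x = d} \<noteq> {}"
proof -
  obtain e :: R3 where e: "norm e = 1" using norm_Basis nonempty_Basis by blast
  have "u (sqrt (2 * d) *\<^sub>R e, 0) = d" if "0 \<le> d" using that e by (simp add: u_def power_mult_distrib)
  moreover have "u (0, sqrt (- 2 * d) *\<^sub>R e) = d" if "\<not> 0 \<le> d" using that e by (simp add: u_def power_mult_distrib)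
  ultimately show ?thesis by blast
qed

text \<open>The whole side of the cone serves as one chart with \<open>u\<close> as submersion: each
  leaf is a connected level set, hence its own only plaque. The levels r^2 s with r > 0 are all
  those with the sign of \<open>s\<close>, which treats both sides at once.\<close>

lemma foliates_levels:
  assumes s: "s \<noteq> 0"
  shows "foliates (dilations {x. u x = s}) {x. 0 < s * u x}"
proof -
  define \<L> where "\<L> = {{x. u x = r\<^sup>2 * s} | r. 0 < r}"
  have dil: "dilations {x. u x = s} = \<L>"
    unfolding dilations_def \<L>_def using image_dilation_level by blast
  have part: "partition_on {x. 0 < s * u x} \<L>"
  proof (rule partition_onI)
    show "\<Union>\<L> = {x. 0 < s * u x}"
    proof (intro equalityI subsetI)
      fix x assume "x \<in> \<Union>\<L>"
      then obtain r where "0 < r" "u x = r\<^sup>2 * s" by (auto simp: \<L>_def)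
      then have "s * u x = r\<^sup>2 * s\<^sup>2" by (simp add: power2_eq_square)
      then show "x \<in> {x. 0 < s * u x}" using s \<open>0 < r\<close> by simp
    next
      fix x assume "x \<in> {x. 0 < s * u x}"
      then have "0 < u x / s" by (auto simp: zero_less_mult_iff zero_less_divide_iff)
      then have "0 < sqrt (u x / s)" "u x = (sqrt (u x / s))\<^sup>2 * s" using s by simp_all
      then show "x \<in> \<Union>\<L>" unfolding \<L>_def by blast
    qed
    show "disjnt p q" if "p \<in> \<L>" "q \<in> \<L>" "p \<noteq> q" for p q using that by (auto simp: \<L>_def disjnt_def)
    show "{} \<notin> \<L>" using level_nonempty by (auto simp: \<L>_def)
  qed
  have conn: "connected L" "L \<noteq> {}" "\<exists>c. L = {x. u x = c}" if "L \<in> \<L>" for L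
    using that s level_nonempty by (auto simp: \<L>_def intro!: connected_level)
  have sub: "L \<subseteq> {x. 0 < s * u x}" if "L \<in> \<L>" for L using partition_onD1[OF part] that by blast
  have cu: "continuous_on UNIV u"
    using gderiv_u unfolding gderiv_def by (intro continuous_at_imp_continuous_on ballI has_derivative_continuous) blast
  have op: "open {x. 0 < s * u x}" by (intro open_Collect_less continuous_intros cu)
  have ne: "(fst y, - snd y) \<noteq> 0" if "0 < s * u y" for y using that by (auto simp: u_inner prod_eq_iff)
  show ?thesis
    unfolding foliates_def dil
  proof (intro conjI ballI part conn(1))
    fix x assume x: "x \<in> {x. 0 < s * u x}"
    show "\<exists>U (f :: R6 \<Rightarrow> real) G. open U \<and> x \<in> U \<and> U \<subseteq> {x. 0 < s * u x} \<and> (\<forall>y\<in>U. GDERIV f y :> G y \<and> G y \<noteq> 0) \<and>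
        continuous_on U G \<and> (\<forall>L\<in>\<L>. \<forall>P\<in>components (L \<inter> U). \<exists>c. P = {y \<in> U. f y = c})"
    proof (rule exI[of _ "{x. 0 < s * u x}"], rule exI[of _ u], rule exI[of _ "\<lambda>y. (fst y, - snd y)"], intro conjI ballI)
      fix L P assume L: "L \<in> \<L>" and P: "P \<in> components (L \<inter> {x. 0 < s * u x})"
      have "L \<inter> {x. 0 < s * u x} = L" using sub[OF L] by blast
      moreover have "components L = {L}" using conn[OF L] by (simp add: components_eq_sing_iff)
      ultimately have "P = L" using P by simp
      then show "\<exists>c. P = {y \<in> {x. 0 < s * u x}. u y = c}" using conn(3)[OF L] sub[OF L] by blast
    qed (use x op gderiv_u ne in \<open>auto intro!: continuous_intros\<close>)
  qed
qed

section \<open>Calibrated boundaries\<close>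

text \<open>The limit field is discontinuous at the origin, but it is a pointwise limit of
  continuous ones.\<close>

lemma cal_measurable: "0 \<le> c \<Longrightarrow> cal c \<in> borel_measurable borel"
proof -
  have pos: "cal c \<in> borel_measurable borel" if "0 < c" for c
  proof (rule cal_derivative[OF that])
    fix X' assume "\<And>x. (cal c has_derivative X' x) (at x)"
    then show ?thesis
      by (intro borel_measurable_continuous_onI continuous_at_imp_continuous_on ballI has_derivative_continuous)
  qed
  assume "0 \<le> c"
  show ?thesis
  proof (cases "c = 0")
    case True
    have "(\<lambda>n. cal (1 / real (Suc n)) x) \<longlonglongrightarrow> cal 0 x" for x
      by (rule filterlim_compose[OF cal_tendsto])
        (auto simp: filterlim_at LIMSEQ_Suc[OF lim_1_over_n] simp del: of_nat_Suc)
    then have "cal 0 \<in> borel_measurable borel"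
      by (rule borel_measurable_LIMSEQ_metric[rotated]) (simp add: pos)
    then show ?thesis using True by simp
  qed (use pos \<open>0 \<le> c\<close> in auto)
qed

lemma oriented_boundaryD:
  assumes "oriented_boundary E S \<nu>"
  shows "S \<in> sets borel" "\<nu> \<in> borel_measurable borel" "AE x in surface_measure. x \<in> S \<longrightarrow> norm (\<nu> x) = 1"
    "compact K \<Longrightarrow> emeasure surface_measure (S \<inter> K) < \<infinity>"
    "C_k_map 1 X \<Longrightarrow> compact (supp X) \<Longrightarrow> (LINT x:E|lebesgue. divergence X x) = (LINT x:S|surface_measure. X x \<bullet> \<nu> x)"
  using assms unfolding oriented_boundary_def compactly_supported_def supp_def by auto

lemma C1_scalar_measurable: "C1_scalar f F \<Longrightarrow> f \<in> borel_measurable borel"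
  by (rule borel_measurable_continuous_onI) (rule C1_scalar_cont)

text \<open>The bound is asked only where \<nu> has length 1, which is almost everywhere on
  \<open>S\<close>: the normal of an oriented boundary may take any values on a null set.\<close>

lemma surface_limit:
  fixes h :: "nat \<Rightarrow> 'a::euclidean_space \<Rightarrow> real" and \<nu> :: "'a \<Rightarrow> 'a"
  assumes S: "S \<in> sets borel" and n1: "AE x in surface_measure. x \<in> S \<longrightarrow> norm (\<nu> x) = 1"
    and fin: "emeasure surface_measure (S \<inter> K) < \<infinity>" and K: "compact K"
    and meas: "\<And>n. h n \<in> borel_measurable borel" "h0 \<in> borel_measurable borel"
    and lim: "\<And>x. (\<lambda>n. h n x) \<longlonglongrightarrow> h0 x"
    and bd: "\<And>n x. norm (\<nu> x) = 1 \<Longrightarrow> \<bar>h n x\<bar> \<le> B" and zero: "\<And>n x. x \<notin> K \<Longrightarrow> h n x = 0"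
  shows "(\<lambda>n. (LINT x:S|surface_measure. h n x)) \<longlonglongrightarrow> (LINT x:S|surface_measure. h0 x)"
    "integrable surface_measure (\<lambda>x. indicator S x * h n x)"
proof -
  note [measurable] = S meas
  have SK [measurable]: "S \<inter> K \<in> sets borel" using S K by (auto intro: borel_compact)
  have int: "integrable surface_measure (\<lambda>x. indicator (S \<inter> K) x * B)"
    using fin SK by (intro integrable_mult_left integrable_real_indicator) auto
  have bound: "AE x in surface_measure. norm (indicator S x * h n x) \<le> indicator (S \<inter> K) x * B" for n
    using n1
  proof eventually_elim
    case (elim x)
    show ?case
    proof (cases "x \<in> S \<inter> K")
      case True
      then show ?thesis using elim bd[of x n] by simp
    qed (use zero[of x n] in \<open>auto simp: indicator_def\<close>)
  qed
  have lim': "(\<lambda>n. indicator S x * h n x) \<longlonglongrightarrow> indicator S x * h0 x" for x by (intro tendsto_intros lim)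
  have m: "(\<lambda>x. indicator S x * h n x) \<in> borel_measurable surface_measure" for n by measurable
  have m0: "(\<lambda>x. indicator S x * h0 x) \<in> borel_measurable surface_measure" by measurable
  show "(\<lambda>n. (LINT x:S|surface_measure. h n x)) \<longlonglongrightarrow> (LINT x:S|surface_measure. h0 x)"
    unfolding set_lebesgue_integral_def real_scaleR_def
    by (rule integral_dominated_convergence[OF m0 m int AE_I2[OF lim'] bound])
  show "integrable surface_measure (\<lambda>x. indicator S x * h n x)"
    by (rule integrable_dominated_convergence2[OF m0 m int AE_I2[OF lim'] bound])
qed

lemmas boundary_limit = surface_limit[OF oriented_boundaryD(1,3,4)]

lemma cal_flux_limit:
  assumes ob: "oriented_boundary E S \<nu>" and e: "C1_scalar e H" "compact (supp e)"
  shows "(\<lambda>n. (LINT x:S|surface_measure. (e x *\<^sub>R cal (1 / real (Suc n)) x) \<bullet> \<nu> x))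
      \<longlonglongrightarrow> (LINT x:S|surface_measure. e x * (cal 0 x \<bullet> \<nu> x))"
proof -
  obtain M where M: "\<And>x. \<bar>e x\<bar> \<le> M" using C1_bounded[OF e] by blast
  note [measurable] = oriented_boundaryD(2)[OF ob] C1_scalar_measurable[OF e(1)]
  have cm [measurable]: "cal (1 / real (Suc n)) \<in> borel_measurable borel" for n by (rule cal_measurable) simp
  have c0 [measurable]: "cal 0 \<in> borel_measurable borel" by (rule cal_measurable) simp
  show ?thesis
  proof (rule boundary_limit(1)[OF ob ob ob e(2) e(2)])
    show "(\<lambda>x. (e x *\<^sub>R cal (1 / real (Suc n)) x) \<bullet> \<nu> x) \<in> borel_measurable borel" for n by measurable
    show "(\<lambda>x. e x * (cal 0 x \<bullet> \<nu> x)) \<in> borel_measurable borel" by measurable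
    have "(\<lambda>n. cal (1 / real (Suc n)) x) \<longlonglongrightarrow> cal 0 x" for x
      by (rule filterlim_compose[OF cal_tendsto])
        (auto simp: filterlim_at LIMSEQ_Suc[OF lim_1_over_n] simp del: of_nat_Suc)
    then show "(\<lambda>n. (e x *\<^sub>R cal (1 / real (Suc n)) x) \<bullet> \<nu> x) \<longlonglongrightarrow> e x * (cal 0 x \<bullet> \<nu> x)" for x
      unfolding inner_scaleR_left by (intro tendsto_intros)
    show "\<bar>(e x *\<^sub>R cal (1 / real (Suc n)) x) \<bullet> \<nu> x\<bar> \<le> M * 14" if "norm (\<nu> x) = 1" for n x
    proof -
      have "\<bar>cal (1 / real (Suc n)) x \<bullet> \<nu> x\<bar> \<le> 14"
        using Cauchy_Schwarz_ineq2[of "cal (1 / real (Suc n)) x" "\<nu> x"] cal_bound[of "1 / real (Suc n)" x] that by simp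
      then show ?thesis unfolding inner_scaleR_left abs_mult using M[of x] by (intro mult_mono) auto
    qed
    show "(e x *\<^sub>R cal (1 / real (Suc n)) x) \<bullet> \<nu> x = 0" if "x \<notin> supp e" for n x
      using supp_subset[OF that] by simp
  qed
qed

lemma divergence_cutoff:
  assumes X: "C_k_map 1 X" and e: "C1_scalar e H"
  shows "C_k_map 1 (\<lambda>x. e x *\<^sub>R X x)" "divergence (\<lambda>x. e x *\<^sub>R X x) x = e x * divergence X x + X x \<bullet> H x"
proof -
  define Z where "Z = (\<lambda>x. frechet_derivative X (at x))"
  have Z: "(X has_derivative Z x) (at x)" "continuous_on UNIV (\<lambda>x. Z x v)" for x v
    unfolding Z_def using C_k_map_1D[OF X] by blast+
  have contX: "continuous_on UNIV X"
    using Z(1) by (intro continuous_at_imp_continuous_on ballI has_derivative_continuous)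
  have der: "((\<lambda>x. e x *\<^sub>R X x) has_derivative (\<lambda>v. e x *\<^sub>R Z x v + (v \<bullet> H x) *\<^sub>R X x)) (at x)" for x
    using C1_scalar_gderiv[OF e, of x] unfolding gderiv_def by (rule has_derivative_scaleR[OF _ Z(1)])
  have cont: "continuous_on UNIV (\<lambda>x. e x *\<^sub>R Z x v + (v \<bullet> H x) *\<^sub>R X x)" for v
    by (intro continuous_intros C1_scalar_cont[OF e] C1_scalar_cont_grad[OF e] Z(2) contX)
  note C1 = C_k_map_1I[OF der cont]
  show "C_k_map 1 (\<lambda>x. e x *\<^sub>R X x)" by (rule C1(1))
  have "divergence (\<lambda>x. e x *\<^sub>R X x) x = (\<Sum>b\<in>Basis. e x * (Z x b \<bullet> b) + (X x \<bullet> b) * (H x \<bullet> b))"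
    unfolding C1(2) by (intro sum.cong refl) (simp add: inner_add_left inner_commute[of _ "H x"] mult.commute)
  also have "\<dots> = e x * divergence X x + X x \<bullet> H x"
    unfolding sum.distrib sum_distrib_left[symmetric] euclidean_inner[of "X x" "H x"] divergence_def Z_def ..
  finally show "divergence (\<lambda>x. e x *\<^sub>R X x) x = e x * divergence X x + X x \<bullet> H x" .
qed

lemma cal_cutoff:
  assumes c: "0 < c" and e: "C1_scalar e H"
  shows "C_k_map 1 (\<lambda>x. e x *\<^sub>R cal c x)" "divergence (\<lambda>x. e x *\<^sub>R cal c x) x = cal c x \<bullet> H x"
proof -
  obtain Z where Z: "\<And>x. (cal c has_derivative Z x) (at x)" "\<And>v. continuous_on UNIV (\<lambda>x. Z x v)"
    "\<And>x. (\<Sum>b\<in>Basis. Z x b \<bullet> b) = 0" using cal_derivative[OF c] by blast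
  note C1 = C_k_map_1I[OF Z(1,2), unfolded Z(3)]
  show "C_k_map 1 (\<lambda>x. e x *\<^sub>R cal c x)" "divergence (\<lambda>x. e x *\<^sub>R cal c x) x = cal c x \<bullet> H x"
    using divergence_cutoff[OF C1(1) e] C1(2) by simp_all
qed

lemma C1_scalar_locally_const:
  assumes "C1_scalar e H" "open W" "x \<in> W" "\<And>y. y \<in> W \<Longrightarrow> e y = k"
  shows "H x = 0"
proof -
  have "GDERIV e x :> 0"
    unfolding gderiv_def
    by (rule has_derivative_transform_within_open[where f="\<lambda>_. k" and s=W]) (use assms in auto)
  then have "(\<lambda>h. h \<bullet> H x) = (\<lambda>h. h \<bullet> 0)"
    using C1_scalar_gderiv[OF assms(1), of x] unfolding gderiv_def by (rule has_derivative_unique[rotated])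
  then have "H x \<bullet> H x = H x \<bullet> 0" by (rule fun_cong)
  then show ?thesis by simp
qed

text \<open>The divergence of \<open>e\<close> times \<open>cal c\<close> is the inner product of
  \<open>cal c\<close> with the gradient of \<open>e\<close>. This vanishes on \<open>K\<close>,
  since \<open>e\<close> is 1 nearby, and off \<open>K\<close> the sets \<open>E\<close> and
  \<open>E'\<close> coincide. So the volume integrals agree, hence the fluxes for c > 0, and then
  their limits as c tends to 0.\<close>

lemma calibration_identity:
  assumes ob: "oriented_boundary E S \<nu>" "oriented_boundary E' S' \<nu>'"
    and K: "(E - E') \<union> (E' - E) \<subseteq> K" and e: "C1_scalar e H" "compact (supp e)"
    and W: "open W" "K \<subseteq> W" "\<And>x. x \<in> W \<Longrightarrow> e x = 1"
  shows "(LINT x:S|surface_measure. e x * (cal 0 x \<bullet> \<nu> x)) = (LINT x:S'|surface_measure. e x * (cal 0 x \<bullet> \<nu>' x))"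
proof -
  have "(LINT x:S|surface_measure. (e x *\<^sub>R cal c x) \<bullet> \<nu> x) = (LINT x:S'|surface_measure. (e x *\<^sub>R cal c x) \<bullet> \<nu>' x)"
    if c: "0 < c" for c
  proof -
    define X where "X = (\<lambda>x. e x *\<^sub>R cal c x)"
    note X = cal_cutoff[OF c e(1), folded X_def]
    have "supp X \<subseteq> supp e" unfolding X_def by (rule supp_mono) auto
    then have sX: "compact (supp X)" using e(2) closed_supp[of X] by (metis compact_Int_closed inf.absorb2)
    have "indicator E x *\<^sub>R divergence X x = indicator E' x *\<^sub>R divergence X x" for x
    proof (cases "x \<in> K")
      case True
      then have "x \<in> W" using W(2) by blast
      then have "H x = 0" by (rule C1_scalar_locally_const[OF e(1) W(1) _ W(3)])
      then show ?thesis by (simp add: X(2))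
    next
      case False
      then have "x \<in> E \<longleftrightarrow> x \<in> E'" using K by blast
      then show ?thesis by (simp add: indicator_def)
    qed
    then have "(LINT x:E|lebesgue. divergence X x) = (LINT x:E'|lebesgue. divergence X x)"
      unfolding set_lebesgue_integral_def by (simp only:)
    then show ?thesis
      using oriented_boundaryD(5)[OF ob(1) X(1) sX] oriented_boundaryD(5)[OF ob(2) X(1) sX] by (simp add: X_def)
  qed
  then have "(\<lambda>n. (LINT x:S|surface_measure. (e x *\<^sub>R cal (1 / real (Suc n)) x) \<bullet> \<nu> x))
      = (\<lambda>n. (LINT x:S'|surface_measure. (e x *\<^sub>R cal (1 / real (Suc n)) x) \<bullet> \<nu>' x))" by simp
  then show ?thesis
    using LIMSEQ_unique[OF cal_flux_limit[OF ob(1) e]] cal_flux_limit[OF ob(2) e] by simp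
qed

lemma \<Phi>\<^sub>0_measurable [measurable]: "\<Phi>\<^sub>0 \<in> borel_measurable borel"
  by (rule borel_measurable_continuous_onI[OF continuous_on_\<Phi>\<^sub>0])

lemma \<Phi>\<^sub>0_bound: obtains B where "0 \<le> B" "\<And>w. norm w = 1 \<Longrightarrow> \<bar>\<Phi>\<^sub>0 w\<bar> \<le> B"
proof -
  have "bounded (\<Phi>\<^sub>0 ` sphere 0 1)"
    by (intro compact_imp_bounded compact_continuous_image continuous_on_subset[OF continuous_on_\<Phi>\<^sub>0]) auto
  then obtain B where "\<forall>y\<in>\<Phi>\<^sub>0 ` sphere 0 1. norm y \<le> B" unfolding bounded_iff by blast
  then have B: "\<bar>\<Phi>\<^sub>0 w\<bar> \<le> B" if "norm w = 1" for w using that by (simp add: image_iff)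
  then have "\<bar>\<Phi>\<^sub>0 w\<bar> \<le> max B 0" if "norm w = 1" for w using B[OF that] by linarith
  then show thesis by (intro that[of "max B 0"]) auto
qed

text \<open>Areas are compared in an open set \<open>U\<close>, while the flux identity needs
  compactly supported weights equal to 1 near \<open>K\<close>. Convergence to the indicator at
  every point lets dominated convergence remove the weights on any hypersurface.\<close>

lemma cutoff_sequence:
  fixes U :: "'a::euclidean_space set"
  assumes "open U" "compact K" "K \<subseteq> U"
  obtains e :: "nat \<Rightarrow> 'a \<Rightarrow> real" and H W where "\<And>n. C1_scalar (e n) (H n)" "\<And>n x. 0 \<le> e n x" "\<And>n x. e n x \<le> 1"
    "\<And>n. open (W n)" "\<And>n. K \<subseteq> W n" "\<And>n x. x \<in> W n \<Longrightarrow> e n x = 1" "\<And>n. compact (supp (e n))"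
    "\<And>n. supp (e n) \<subseteq> U" "\<And>x. (\<lambda>n. e n x) \<longlonglongrightarrow> indicator U x"
proof -
  have "\<exists>C::nat \<Rightarrow> 'a set. (\<forall>m. compact (C m)) \<and> (\<forall>m. C m \<subseteq> U) \<and> (\<forall>L. compact L \<and> L \<subseteq> U \<longrightarrow> (\<exists>N. \<forall>n\<ge>N. L \<subseteq> C n))"
  proof (rule open_Union_compact_subsets[OF assms(1)])
    fix C :: "nat \<Rightarrow> 'a set"
    assume "\<And>n. compact (C n)" "\<And>n. C n \<subseteq> U" "\<And>K. compact K \<Longrightarrow> K \<subseteq> U \<Longrightarrow> \<exists>N. \<forall>n\<ge>N. K \<subseteq> C n"
    then show ?thesis by (intro exI[of _ C]) simp
  qed
  then obtain C :: "nat \<Rightarrow> 'a set" where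
    "(\<forall>m. compact (C m)) \<and> (\<forall>m. C m \<subseteq> U) \<and> (\<forall>L. compact L \<and> L \<subseteq> U \<longrightarrow> (\<exists>N. \<forall>n\<ge>N. L \<subseteq> C n))"
    by (elim exE)
  then have C: "compact (C m)" "C m \<subseteq> U" "compact L \<Longrightarrow> L \<subseteq> U \<Longrightarrow> \<exists>N. \<forall>n\<ge>N. L \<subseteq> C n" for m L
    by simp_all
  define P where "P n e H W \<longleftrightarrow> C1_scalar e H \<and> (\<forall>x. 0 \<le> e x \<and> e x \<le> 1) \<and> open W \<and> C n \<union> K \<subseteq> W \<and> (\<forall>x\<in>W. e x = 1)
      \<and> compact (supp e) \<and> supp e \<subseteq> U" for n e H W
  have "\<exists>e H W. P n e H W" for n
  proof (rule C1_urysohn[OF compact_Un[OF C(1)[of n] assms(2)] assms(1)])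
    show "C n \<union> K \<subseteq> U" using C(2) assms(3) by simp
    fix e E W assume "C1_scalar e E" "\<And>x. 0 \<le> e x" "\<And>x. e x \<le> 1" "open W" "C n \<union> K \<subseteq> W"
      "\<And>x. x \<in> W \<Longrightarrow> e x = 1" "compact (supp e)" "supp e \<subseteq> U"
    then have "P n e E W" unfolding P_def by simp
    then show "\<exists>e H W. P n e H W" by blast
  qed
  then obtain e H W where "\<And>n. P n (e n) (H n) (W n)" by metis
  then have eHW: "C1_scalar (e n) (H n) \<and> (\<forall>x. 0 \<le> e n x \<and> e n x \<le> 1) \<and> open (W n) \<and> C n \<union> K \<subseteq> W n
      \<and> (\<forall>x\<in>W n. e n x = 1) \<and> compact (supp (e n)) \<and> supp (e n) \<subseteq> U" for n
    unfolding P_def .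
  have lim: "(\<lambda>n. e n x) \<longlonglongrightarrow> indicator U x" for x
  proof (cases "x \<in> U")
    case True
    then obtain N where N: "\<forall>n\<ge>N. {x} \<subseteq> C n" using C(3)[of "{x}"] by auto
    have "e n x = indicator U x" if "N \<le> n" for n
    proof -
      have "x \<in> W n" using N that eHW[of n] by blast
      then show ?thesis using eHW[of n] True by simp
    qed
    then show ?thesis by (intro tendsto_eventually eventually_sequentiallyI)
  next
    case False
    have "e n x = indicator U x" for n
    proof -
      have "x \<notin> supp (e n)" using False eHW[of n] by blast
      then have "e n x = 0" by (rule supp_subset)
      then show ?thesis using False by simp
    qed
    then show ?thesis by simp
  qed
  show thesis
  proof (rule that[of e H W])
    show "(\<lambda>n. e n x) \<longlonglongrightarrow> indicator U x" for x by (rule lim)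
  qed (use eHW in blast)+
qed

lemma area_limit:
  fixes e :: "nat \<Rightarrow> R6 \<Rightarrow> real"
  assumes ob: "oriented_boundary E S \<nu>" and U: "bounded U" "open U"
    and e: "\<And>n. e n \<in> borel_measurable borel" "\<And>n x. 0 \<le> e n x" "\<And>n x. e n x \<le> 1" "\<And>n x. x \<notin> U \<Longrightarrow> e n x = 0"
      "\<And>x. (\<lambda>n. e n x) \<longlonglongrightarrow> indicator U x"
  shows "(\<lambda>n. (LINT x:S|surface_measure. e n x * \<Phi>\<^sub>0 (\<nu> x))) \<longlonglongrightarrow> anisotropic_area \<Phi>\<^sub>0 (S \<inter> U) \<nu>"
    "integrable surface_measure (\<lambda>x. indicator S x * (e n x * \<Phi>\<^sub>0 (\<nu> x)))"
proof -
  obtain B where B: "0 \<le> B" "\<And>w. norm w = 1 \<Longrightarrow> \<bar>\<Phi>\<^sub>0 w\<bar> \<le> B" using \<Phi>\<^sub>0_bound by blast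
  note [measurable] = oriented_boundaryD(2)[OF ob] e(1) borel_open[OF U(2)]
  have K: "compact (closure U)" using U by (simp add: compact_closure)
  have m: "(\<lambda>x. e n x * \<Phi>\<^sub>0 (\<nu> x)) \<in> borel_measurable borel" for n by measurable
  have m0: "(\<lambda>x. indicator U x * \<Phi>\<^sub>0 (\<nu> x)) \<in> borel_measurable borel" by measurable
  have lim: "(\<lambda>n. e n x * \<Phi>\<^sub>0 (\<nu> x)) \<longlonglongrightarrow> indicator U x * \<Phi>\<^sub>0 (\<nu> x)" for x by (intro tendsto_intros e(5))
  have bd: "\<bar>e n x * \<Phi>\<^sub>0 (\<nu> x)\<bar> \<le> 1 * B" if "norm (\<nu> x) = 1" for n x
    unfolding abs_mult using e(2,3)[of n x] B(2)[OF that] by (intro mult_mono) auto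
  have zero: "e n x * \<Phi>\<^sub>0 (\<nu> x) = 0" if "x \<notin> closure U" for n x
  proof -
    have "x \<notin> U" using that closure_subset[of U] by blast
    then show ?thesis by (simp add: e(4))
  qed
  have "(LINT x:S|surface_measure. indicator U x * \<Phi>\<^sub>0 (\<nu> x)) = anisotropic_area \<Phi>\<^sub>0 (S \<inter> U) \<nu>"
    unfolding anisotropic_area_def set_lebesgue_integral_def by (simp add: indicator_inter_arith mult.assoc)
  then show "(\<lambda>n. (LINT x:S|surface_measure. e n x * \<Phi>\<^sub>0 (\<nu> x))) \<longlonglongrightarrow> anisotropic_area \<Phi>\<^sub>0 (S \<inter> U) \<nu>"
    using boundary_limit(1)[OF ob ob ob K K m m0 lim bd zero] by simp
  show "integrable surface_measure (\<lambda>x. indicator S x * (e n x * \<Phi>\<^sub>0 (\<nu> x)))"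
    by (rule boundary_limit(2)[OF ob ob ob K K m m0 lim bd zero])
qed

lemma cal_integrable:
  assumes ob: "oriented_boundary E S \<nu>" and e: "C1_scalar e H" "compact (supp e)"
  shows "integrable surface_measure (\<lambda>x. indicator S x * (e x * (cal 0 x \<bullet> \<nu> x)))"
proof -
  obtain M where M: "\<And>x. \<bar>e x\<bar> \<le> M" using C1_bounded[OF e] by blast
  note [measurable] = oriented_boundaryD(2)[OF ob] C1_scalar_measurable[OF e(1)]
  have c0 [measurable]: "cal 0 \<in> borel_measurable borel" by (rule cal_measurable) simp
  show ?thesis
  proof (rule surface_integrable[OF oriented_boundaryD(1)[OF ob] borel_compact[OF e(2)] oriented_boundaryD(4)[OF ob e(2)]])
    show "(\<lambda>x. e x * (cal 0 x \<bullet> \<nu> x)) \<in> borel_measurable borel" by measurable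
    show "AE x in surface_measure. x \<in> S \<longrightarrow> \<bar>e x * (cal 0 x \<bullet> \<nu> x)\<bar> \<le> M * 14"
      using oriented_boundaryD(3)[OF ob]
    proof eventually_elim
      case (elim x)
      show ?case
      proof
        assume "x \<in> S"
        then have "\<bar>cal 0 x \<bullet> \<nu> x\<bar> \<le> 14"
          using Cauchy_Schwarz_ineq2[of "cal 0 x" "\<nu> x"] cal_bound[of 0 x] elim by simp
        then show "\<bar>e x * (cal 0 x \<bullet> \<nu> x)\<bar> \<le> M * 14" unfolding abs_mult using M[of x] by (intro mult_mono) auto
      qed
    qed
    show "e x * (cal 0 x \<bullet> \<nu> x) = 0" if "x \<notin> supp e" for x using supp_subset[OF that] by simp
  qed
qed

text \<open>The calibration argument in weighted form: integrand and flux agree on \<open>S\<close>,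
  the flux is the same for \<open>S'\<close>, and there it is at most the integrand. Nonnegative
  weights preserve the last inequality.\<close>

theorem calibrated_minimizer:
  assumes ob: "oriented_boundary E S \<nu>\<^sub>u"
  shows "anisotropic_minimizer \<Phi>\<^sub>0 E S \<nu>\<^sub>u"
  unfolding anisotropic_minimizer_def
proof (intro conjI allI impI ob, elim conjE)
  fix E' S' \<nu>' K U
  assume ob': "oriented_boundary E' S' \<nu>'" and K: "compact K" "K \<subseteq> U" and U: "open U" "bounded U"
    and diff: "(E - E') \<union> (E' - E) \<subseteq> K"
  obtain e :: "nat \<Rightarrow> R6 \<Rightarrow> real" and H W where e: "\<And>n. C1_scalar (e n) (H n)" "\<And>n x. 0 \<le> e n x" "\<And>n x. e n x \<le> 1"
    "\<And>n. open (W n)" "\<And>n. K \<subseteq> W n" "\<And>n x. x \<in> W n \<Longrightarrow> e n x = 1" "\<And>n. compact (supp (e n))"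
    "\<And>n. supp (e n) \<subseteq> U" "\<And>x. (\<lambda>n. e n x) \<longlonglongrightarrow> indicator U x"
    by (rule cutoff_sequence[OF U(1) K]) (rule that)
  have e0: "e n x = 0" if "x \<notin> U" for n x using e(8)[of n] that by (intro supp_subset) blast
  have le: "(LINT x:S|surface_measure. e n x * \<Phi>\<^sub>0 (\<nu>\<^sub>u x)) \<le> (LINT x:S'|surface_measure. e n x * \<Phi>\<^sub>0 (\<nu>' x))" for n
  proof -
    have "(LINT x:S|surface_measure. e n x * \<Phi>\<^sub>0 (\<nu>\<^sub>u x)) = (LINT x:S|surface_measure. e n x * (cal 0 x \<bullet> \<nu>\<^sub>u x))"
      by (simp add: cal_\<nu>\<^sub>u)
    also have "\<dots> = (LINT x:S'|surface_measure. e n x * (cal 0 x \<bullet> \<nu>' x))"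
      by (rule calibration_identity[OF ob ob' diff e(1,7,4,5,6)])
    also have "\<dots> \<le> (LINT x:S'|surface_measure. e n x * \<Phi>\<^sub>0 (\<nu>' x))"
      unfolding set_lebesgue_integral_def real_scaleR_def
    proof (rule integral_mono)
      show "integrable surface_measure (\<lambda>x. indicator S' x * (e n x * (cal 0 x \<bullet> \<nu>' x)))"
        by (rule cal_integrable[OF ob' e(1,7)])
      show "integrable surface_measure (\<lambda>x. indicator S' x * (e n x * \<Phi>\<^sub>0 (\<nu>' x)))"
        by (rule area_limit(2)[OF ob' U(2,1) C1_scalar_measurable[OF e(1)] e(2,3) e0 e(9)])
      show "indicator S' x * (e n x * (cal 0 x \<bullet> \<nu>' x)) \<le> indicator S' x * (e n x * \<Phi>\<^sub>0 (\<nu>' x))" for x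
        by (intro mult_left_mono calibration(1) e(2)) simp
    qed
    finally show ?thesis .
  qed
  show "anisotropic_area \<Phi>\<^sub>0 (S \<inter> U) \<nu>\<^sub>u \<le> anisotropic_area \<Phi>\<^sub>0 (S' \<inter> U) \<nu>'"
    by (rule LIMSEQ_le[OF area_limit(1)[OF ob U(2,1) C1_scalar_measurable[OF e(1)] e(2,3) e0 e(9)]
        area_limit(1)[OF ob' U(2,1) C1_scalar_measurable[OF e(1)] e(2,3) e0 e(9)]])
      (intro exI allI impI le | assumption)+
qed

section \<open>The level sets of \<open>u\<close>\<close>

text \<open>An iterated product of lines, so that Prekopa-Leindler follows by tensorization; its
  dimension is that of the tangent hyperplanes in \<real>^6.\<close>

type_synonym R5 = "real \<times> real \<times> real \<times> real \<times> real"

lemma prekopa_leindler_R5: "prekopa_leindler TYPE(R5)"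
  by (intro prekopa_leindler_prod prekopa_leindler_real)

lemma \<nu>\<^sub>u_measurable [measurable]: "\<nu>\<^sub>u \<in> borel_measurable borel"
proof -
  have "(\<lambda>x::R6. (fst x, - snd x)) \<in> borel_measurable borel"
    by (intro borel_measurable_continuous_onI continuous_intros)
  moreover have n: "(\<lambda>x::R6. norm (fst x, - snd x)) \<in> borel_measurable borel"
    by (intro borel_measurable_continuous_onI continuous_intros)
  ultimately have "(\<lambda>x::R6. (fst x, - snd x) /\<^sub>R norm (fst x, - snd x)) \<in> borel_measurable borel"
    by (intro borel_measurable_scaleR[OF borel_measurable_inverse[OF n]])
  then show ?thesis by (simp add: \<nu>\<^sub>u_def case_prod_beta sgn_div_norm)
qed

lemma continuous_u: "continuous_on A u"
  using gderiv_u unfolding gderiv_def by (intro continuous_at_imp_continuous_on ballI has_derivative_continuous) blast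

lemma level_borel: "{x. u x < c} \<in> sets borel" "{x. u x = c} \<in> sets borel"
proof -
  have "open {x. u x < c}" by (intro open_Collect_less continuous_u continuous_intros)
  then show "{x. u x < c} \<in> sets borel" by simp
  have "closed {x. u x = c}" by (intro closed_Collect_eq continuous_u continuous_intros)
  then show "{x. u x = c} \<in> sets borel" by simp
qed

lemma C1_side_level:
  assumes "x \<noteq> 0" shows "C1_side {x. u x < c} {x. u x = c} \<nu>\<^sub>u x"
  unfolding C1_side_def
proof (intro exI conjI)
  show "open (- {0} :: R6 set)" by (intro open_Compl closed_singleton)
  show "x \<in> - {0}" using assms by simp
  show "{x. u x < c} \<inter> - {0} = {y \<in> - {0}. u y - c < 0}" "{x. u x = c} \<inter> - {0} = {y \<in> - {0}. u y - c = 0}" by auto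
  show "\<forall>y\<in>- {0}. GDERIV (\<lambda>y. u y - c) y :> (fst y, - snd y) \<and> (fst y, - snd y) \<noteq> 0"
    using GDERIV_diff[OF gderiv_u GDERIV_const] by (auto simp: prod_eq_iff)
  show "continuous_on (- {0}) (\<lambda>y::R6. (fst y, - snd y))" by (intro continuous_intros)
  show "\<forall>y\<in>{x. u x = c} \<inter> - {0}. \<nu>\<^sub>u y = sgn (fst y, - snd y)" by (simp add: \<nu>\<^sub>u_def case_prod_beta)
qed

text \<open>The gradient of \<open>u\<close> vanishes at the origin alone, and for c \<noteq> 0 the
  origin has a neighbourhood lying entirely on one side of the level set.\<close>

lemma C1_side_level_all:
  assumes "c \<noteq> 0" shows "C1_side {x. u x < c} {x. u x = c} \<nu>\<^sub>u x"
proof (cases "x = 0")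
  case True
  have u0: "u 0 = 0" by (simp add: u_inner)
  show ?thesis
  proof (cases "0 < c")
    case pos: True
    show ?thesis
    proof (rule C1_side_away)
      show "open {x. u x < c}" by (intro open_Collect_less continuous_u continuous_intros)
    qed (use pos True u0 in auto)
  next
    case False
    show ?thesis
    proof (rule C1_side_away)
      show "open {x. c < u x}" by (intro open_Collect_less continuous_u continuous_intros)
    qed (use False assms True u0 in auto)
  qed
qed (rule C1_side_level)

section \<open>The cone and its vertex\<close>

interpretation cone: C1_domain "{x. u x < 0}" "{x. u x = 0}" \<nu>\<^sub>u "- {0}" "TYPE(R5)"
  by (rule C1_domain.intro)
    (simp_all add: prekopa_leindler_R5 level_borel C1_side_level \<nu>\<^sub>u_measurable open_Compl)

lemma surface_measure_R6: "(surface_measure :: R6 measure) = hausdorff_measure 5"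
  by (simp add: surface_measure_def)

lemma emeasure_surface: "A \<in> sets borel \<Longrightarrow> emeasure (surface_measure :: R6 measure) A = hausdorff_outer 5 A"
  unfolding surface_measure_R6 by (rule emeasure_hausdorff_measure)

lemma null_origin: "emeasure (surface_measure :: R6 measure) {0} = 0"
  by (simp add: emeasure_surface hausdorff_outer_singleton)

text \<open>The dyadic annuli of the cone are rescaled copies of one of them, so that their areas form a
  convergent geometric series.\<close>

lemma cone_finite_unit: "emeasure (surface_measure :: R6 measure) ({x. u x = 0} \<inter> cball 0 1) < \<infinity>"
proof -
  define A :: "R6 set" where "A = {x. u x = 0} \<inter> (cball 0 1 - ball 0 (1/2))"
  have K: "compact (cball 0 1 - ball 0 (1/2) :: R6 set)" by (intro compact_diff) auto
  have Ab: "A \<in> sets borel" unfolding A_def using level_borel(2) borel_compact[OF K] by blast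
  have Afin: "hausdorff_outer 5 A < \<infinity>"
    using cone.compact_finite[OF K] emeasure_surface[OF Ab] by (auto simp: A_def)
  define B where "B = (\<lambda>k::nat. (\<lambda>x. (1/2) ^ k *\<^sub>R x) ` A)"
  have cover: "{x. u x = 0} \<inter> cball 0 1 \<subseteq> {0} \<union> (\<Union>k. B k)"
  proof
    fix x :: R6 assume x: "x \<in> {x. u x = 0} \<inter> cball 0 1"
    show "x \<in> {0} \<union> (\<Union>k. B k)"
    proof (cases "x = 0")
      case False
      define P where "P k \<longleftrightarrow> (1/2) ^ Suc k \<le> norm x" for k :: nat
      obtain m where "(1/2) ^ m < norm x" using real_arch_pow_inv[of "norm x" "1/2"] False by auto
      moreover have "(1/2::real) ^ Suc m \<le> (1/2) ^ m" by simp
      ultimately have "P m" unfolding P_def by linarith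
      \<comment> \<open>The index of an annulus (1/2)^(k+1) \<le> |x| \<le> (1/2)^k that contains
        \<open>x\<close>.\<close>
      define k where "k = (LEAST k. P k)"
      have k: "P k" unfolding k_def using \<open>P m\<close> by (rule LeastI)
      have "norm x \<le> (1/2) ^ k"
      proof (cases k)
        case (Suc j)
        then have "\<not> P j" unfolding k_def using not_less_Least[of j P] by auto
        then show ?thesis using Suc by (simp add: P_def)
      qed (use x in auto)
      then have n: "norm (2 ^ k *\<^sub>R x) \<le> 1" by (simp add: power_one_over field_simps)
      have "1/2 \<le> norm (2 ^ k *\<^sub>R x)" using k by (simp add: P_def power_one_over field_simps)
      then have "2 ^ k *\<^sub>R x \<in> A" using n x by (auto simp: A_def u_scale)
      moreover have "x = (1/2) ^ k *\<^sub>R (2 ^ k *\<^sub>R x)" by (simp add: power_one_over)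
      ultimately have "x \<in> B k" unfolding B_def by blast
      then show ?thesis by blast
    qed simp
  qed
  have Bk: "hausdorff_outer 5 (B k) \<le> ennreal ((1/2) ^ k) * hausdorff_outer 5 A" for k
  proof -
    have "hausdorff_outer 5 (B k) \<le> ennreal (((1/2) ^ k) ^ 5) * hausdorff_outer 5 A"
      unfolding B_def by (rule hausdorff_outer_lipschitz) (simp, simp add: dist_norm scaleR_diff_right[symmetric])
    \<comment> \<open>Area scales by (1/2)^(5k); the weaker ratio 1/2 already gives a convergent
      series.\<close>
    also have "\<dots> \<le> ennreal ((1/2) ^ k) * hausdorff_outer 5 A"
    proof (intro mult_right_mono ennreal_leI)
      show "((1/2::real) ^ k) ^ 5 \<le> (1/2) ^ k" using power_decreasing[of 1 5 "(1/2::real) ^ k"] by (simp add: power_le_one)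
    qed simp
    finally show ?thesis .
  qed
  have "emeasure (surface_measure :: R6 measure) ({x. u x = 0} \<inter> cball 0 1) = hausdorff_outer 5 ({x. u x = 0} \<inter> cball 0 1)"
    using level_borel(2)[of 0] by (intro emeasure_surface) auto
  also have "\<dots> \<le> hausdorff_outer 5 ({0} \<union> (\<Union>k. B k))" by (rule hausdorff_outer_mono[OF cover])
  also have "\<dots> \<le> hausdorff_outer 5 {0::R6} + hausdorff_outer 5 (\<Union>k. B k)" by (rule hausdorff_outer_Un)
  also have "\<dots> = hausdorff_outer 5 (\<Union>k. B k)" by (simp add: hausdorff_outer_singleton)
  also have "\<dots> \<le> (\<Sum>k. hausdorff_outer 5 (B k))" by (rule hausdorff_outer_subadditive)
  also have "\<dots> \<le> (\<Sum>k. ennreal ((1/2) ^ k) * hausdorff_outer 5 A)" by (intro suminf_le Bk) auto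
  also have "\<dots> = (\<Sum>k. ennreal ((1/2) ^ k)) * hausdorff_outer 5 A" by (rule ennreal_suminf_multc)
  also have "\<dots> < \<infinity>"
  proof -
    have "(\<Sum>k. ennreal ((1/2) ^ k)) = ennreal (\<Sum>k. (1/2) ^ k)"
      by (rule suminf_ennreal2) (auto intro: summable_geometric)
    then show ?thesis using Afin by (simp add: ennreal_mult_less_top)
  qed
  finally show ?thesis .
qed

lemma cone_finite:
  assumes "compact K" shows "emeasure (surface_measure :: R6 measure) ({x. u x = 0} \<inter> K) < \<infinity>"
proof -
  have K': "compact (K - ball 0 1)" by (intro compact_diff assms) simp
  have m: "{x. u x = 0} \<inter> cball 0 1 \<in> sets borel" "{x. u x = 0} \<inter> (K - ball 0 1) \<in> sets borel"
    using level_borel(2)[of 0] borel_compact[OF K'] by auto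
  have "emeasure surface_measure ({x. u x = 0} \<inter> K)
      \<le> emeasure surface_measure (({x. u x = 0} \<inter> cball 0 1) \<union> ({x. u x = 0} \<inter> (K - ball 0 1)))"
    using m by (intro emeasure_mono) auto
  also have "\<dots> \<le> emeasure surface_measure ({x. u x = 0} \<inter> cball 0 1) + emeasure surface_measure ({x. u x = 0} \<inter> (K - ball 0 1))"
    using m by (intro emeasure_subadditive) auto
  also have "\<dots> < \<infinity>" using cone_finite_unit cone.compact_finite[OF K'] by auto
  finally show ?thesis .
qed

lemma AE_normal_cone: "AE x in surface_measure. x \<in> {x. u x = 0} \<longrightarrow> norm (\<nu>\<^sub>u x) = 1"
proof -
  have "{0} \<in> null_sets (surface_measure :: R6 measure)" using null_origin by (simp add: null_sets_def)
  then have "AE x in (surface_measure :: R6 measure). x \<notin> {0}" by (rule AE_not_in)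
  then show ?thesis by eventually_elim (simp add: norm_\<nu>\<^sub>u)
qed

lemma gradient_bump_bounded:
  obtains F :: "'a::euclidean_space \<Rightarrow> 'a" and B where "C1_scalar (bump 0 1) F" "\<And>x. norm (F x) \<le> B" "\<And>x. 2 < norm x \<Longrightarrow> F x = 0"
proof -
  obtain F :: "'a \<Rightarrow> 'a" where F: "C1_scalar (bump 0 1) F" using C1_bump[of 1 0] by auto
  have s: "supp (bump 0 1) \<subseteq> cball (0::'a) 2"
    by (rule supp_subset_closed) (use bump_nonzero[of 1 0] in auto)
  have z: "F x = 0" if "2 < norm x" for x
    by (rule C1_scalar_grad_supp[OF F]) (use s that in auto)
  have "bounded (F ` cball 0 2)" by (intro compact_imp_bounded compact_continuous_image C1_scalar_cont_grad[OF F]) auto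
  then obtain B where "\<forall>y\<in>F ` cball 0 2. norm y \<le> B" unfolding bounded_iff by blast
  then have "norm (F x) \<le> B" if "\<not> 2 < norm x" for x using that by simp
  then have "norm (F x) \<le> max B 0" for x using z[of x] by (cases "2 < norm x") (auto intro: max.coboundedI1)
  then show thesis using that F z by blast
qed

text \<open>The singularity is removed by cutoffs on balls of radius \<open>r\<close>: their gradients are of order
  \<open>1 / r\<close>, on a set of volume of order \<open>r\<^sup>6\<close>.\<close>

theorem cone_boundary: "oriented_boundary {x. u x < 0} {x. u x = 0} \<nu>\<^sub>u"
proof -
  let ?E = "{x. u x < 0}" and ?S = "{x. u x = 0}"
  have gg: "(LINT x:?E|lebesgue. divergence X x) = (LINT x:?S|surface_measure. X x \<bullet> \<nu>\<^sub>u x)"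
    if X: "C_k_map 1 X" "compact (supp X)" for X
  proof -
    obtain F :: "R6 \<Rightarrow> R6" and B where F: "C1_scalar (bump 0 1) F" "\<And>x. norm (F x) \<le> B" "\<And>x. 2 < norm x \<Longrightarrow> F x = 0"
      using gradient_bump_bounded by blast
    have B0: "0 \<le> B" using F(2)[of 0] norm_ge_zero[of "F 0"] by linarith
    define R where "R = (\<lambda>n. real (Suc n))"
    have R: "0 < R n" for n by (simp add: R_def)
    define e where "e = (\<lambda>n x. 1 - bump 0 1 (R n *\<^sub>R x :: R6))"
    define H where "H = (\<lambda>n x. - (R n *\<^sub>R F (R n *\<^sub>R x)))"
    have e: "C1_scalar (e n) (H n)" for n
      unfolding C1_scalar_def
    proof (intro conjI allI)
      fix x
      have "((\<lambda>x. bump 0 1 (R n *\<^sub>R x)) has_derivative (\<lambda>h. (R n *\<^sub>R h) \<bullet> F (R n *\<^sub>R x))) (at x)"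
        by (rule has_derivative_compose[where g="bump 0 1" and f="\<lambda>x. R n *\<^sub>R x"])
          (use C1_scalar_gderiv[OF F(1)] in \<open>auto simp: gderiv_def intro!: derivative_eq_intros\<close>)
      then show "GDERIV (e n) x :> H n x"
        unfolding gderiv_def e_def H_def by (auto intro!: derivative_eq_intros)
      show "continuous_on UNIV (H n)"
        unfolding H_def by (intro continuous_intros continuous_on_compose2[OF C1_scalar_cont_grad[OF F(1), of UNIV]]) auto
    qed
    have e01: "0 \<le> e n x" "e n x \<le> 1" for n x using bump_range[of 0 1 "R n *\<^sub>R x"] by (auto simp: e_def)
    have e_near: "e n x = 0" if "norm x \<le> 1 / R n" for n x
    proof -
      have "norm (R n *\<^sub>R x - 0) \<le> 1" using that R[of n] by (simp add: field_simps)
      then show ?thesis unfolding e_def by (simp add: bump_eq_1)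
    qed
    have e_far: "e n x = 1" if "2 / R n \<le> norm x" for n x
    proof -
      have "2 * 1 \<le> norm (R n *\<^sub>R x - 0)" using that R[of n] by (simp add: field_simps)
      then show ?thesis unfolding e_def by (simp add: bump_eq_0)
    qed
    have e_lim: "(\<lambda>n. e n x) \<longlonglongrightarrow> 1" if "x \<noteq> 0" for x
    proof -
      obtain N :: nat where N: "2 / norm x \<le> real N" using real_arch_simple by blast
      have "e n x = 1" if "N \<le> n" for n
      proof (rule e_far)
        have "2 / norm x \<le> R n" using N that unfolding R_def by linarith
        then show "2 / R n \<le> norm x" using R[of n] \<open>x \<noteq> 0\<close> by (simp add: field_simps)
      qed
      then show ?thesis by (intro tendsto_eventually eventually_sequentiallyI)
    qed
    define Y where "Y = (\<lambda>n x. e n x *\<^sub>R X x)"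
    note Y = divergence_cutoff[OF X(1) e, folded Y_def]
    have Y1: "C_k_map 1 (Y n)" "divergence (Y n) x = e n x * divergence X x + X x \<bullet> H n x" for n x
      using Y by (simp_all add: Y_def)
    have sY: "supp (Y n) \<subseteq> supp X" for n unfolding Y_def by (rule supp_mono) simp
    have sY0: "supp (Y n) \<subseteq> - {0}" for n
    proof -
      have "supp (Y n) \<subseteq> - ball 0 (1 / R n)"
        by (rule supp_subset_closed) (use e_near[of _ n] in \<open>force simp: Y_def\<close>)+
      moreover have "0 \<in> ball 0 (1 / R n)" using R[of n] by simp
      ultimately show ?thesis by blast
    qed
    have cY: "compact (supp (Y n))" for n using sY X(2) closed_supp[of "Y n"] by (metis compact_Int_closed inf.absorb2)
    have contX: "continuous_on UNIV X"
      using C_k_map_1D(1)[OF X(1)] by (intro continuous_at_imp_continuous_on ballI has_derivative_continuous)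
    have contD: "continuous_on UNIV (divergence X)"
      unfolding divergence_def[abs_def] by (intro continuous_intros C_k_map_1D(2)[OF X(1)])
    obtain M where M: "\<And>x. norm (X x) \<le> M"
    proof -
      have "bounded (X ` supp X)" by (intro compact_imp_bounded compact_continuous_image X continuous_on_subset[OF contX]) auto
      then obtain M where "\<forall>y\<in>X ` supp X. norm y \<le> M" unfolding bounded_iff by blast
      then have M: "norm (X x) \<le> M" if "x \<in> supp X" for x using that by simp
      have "norm (X x) \<le> max M 0" for x
      proof (cases "x \<in> supp X")
        case True
        then show ?thesis using M[OF True] by linarith
      qed (simp add: supp_subset[of x X])
      then show thesis by (rule that)
    qed
    have M0: "0 \<le> M" using M[of 0] norm_ge_zero[of "X 0"] by linarith
    have [measurable]: "X \<in> borel_measurable borel" "divergence X \<in> borel_measurable borel" "e n \<in> borel_measurable borel"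
      "H n \<in> borel_measurable borel" "?E \<in> sets borel" for n
      using contX contD C1_scalar_cont[OF e] C1_scalar_cont_grad[OF e] level_borel(1)
      by (auto intro: borel_measurable_continuous_onI)
    have D0: "divergence X x = 0" if "x \<notin> supp X" for x
    proof -
      have "(X has_derivative (\<lambda>_. 0)) (at x)"
        by (rule has_derivative_transform_within_open[where f="\<lambda>_. 0" and s="- supp X"])
          (use that closed_supp[of X] supp_subset[of _ X] in auto)
      then have "frechet_derivative X (at x) = (\<lambda>_. 0)" by (metis frechet_derivative_at)
      then show ?thesis by (simp add: divergence_def)
    qed
    have toE: "(LINT x:?E|lebesgue. d x) = (\<integral>x. indicator ?E x * d x \<partial>lborel)" if "d \<in> borel_measurable borel" for d :: "R6 \<Rightarrow> real"
      unfolding set_lebesgue_integral_def real_scaleR_def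
      by (rule integral_completion) (use that level_borel(1)[of 0] in measurable)
    have intD: "integrable lborel (\<lambda>x. indicator ?E x * divergence X x)"
      by (rule integrable_compact_support[OF contD X(2) D0 level_borel(1)])
    have lim1: "(\<lambda>n. (\<integral>x. indicator ?E x * (e n x * divergence X x) \<partial>lborel)) \<longlonglongrightarrow> (\<integral>x. indicator ?E x * divergence X x \<partial>lborel)"
    proof (rule integral_dominated_convergence[where w="\<lambda>x. norm (indicator ?E x * divergence X x)"])
      show "integrable lborel (\<lambda>x. norm (indicator ?E x * divergence X x))" using intD by (rule integrable_norm)
      show "AE x in lborel. (\<lambda>n. indicator ?E x * (e n x * divergence X x)) \<longlonglongrightarrow> indicator ?E x * divergence X x"
        using AE_lborel_singleton[of "0::R6"]
      proof eventually_elim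
        case (elim x)
        have "(\<lambda>n. indicator ?E x * (e n x * divergence X x)) \<longlonglongrightarrow> indicator ?E x * (1 * divergence X x)"
          by (intro tendsto_intros e_lim elim)
        then show ?case by simp
      qed
      show "AE x in lborel. norm (indicator ?E x * (e n x * divergence X x)) \<le> norm (indicator ?E x * divergence X x)" for n
      proof (rule AE_I2)
        fix x show "norm (indicator ?E x * (e n x * divergence X x)) \<le> norm (indicator ?E x * divergence X x)"
          using e01[of n x] by (auto simp: abs_mult indicator_def intro: mult_left_le_one_le)
      qed
    qed measurable
    have Hb: "norm (indicator ?E x * (X x \<bullet> H n x)) \<le> M * (R n * B) * indicator (cball 0 (2 / R n)) x" for n x
    proof (cases "x \<in> cball 0 (2 / R n)")
      case True
      have "\<bar>X x \<bullet> H n x\<bar> \<le> norm (X x) * norm (H n x)" by (rule Cauchy_Schwarz_ineq2)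
      also have "\<dots> \<le> M * (R n * B)"
        using M[of x] F(2)[of "R n *\<^sub>R x"] R[of n] M0 by (intro mult_mono) (auto simp: H_def)
      finally show ?thesis using True M0 R[of n] B0 by (auto simp: indicator_def)
    next
      case False
      then have "2 < norm (R n *\<^sub>R x)" using R[of n] by (simp add: field_simps)
      then have "H n x = 0" by (simp add: H_def F(3))
      then show ?thesis using False by simp
    qed
    have intB: "integrable lborel (\<lambda>x::R6. M * (R n * B) * indicator (cball 0 (2 / R n)) x)" for n
      by (intro integrable_mult_right integrable_real_indicator) (use emeasure_lborel_cball_finite in auto)
    have intH: "integrable lborel (\<lambda>x. indicator ?E x * (X x \<bullet> H n x))" for n
      by (rule Bochner_Integration.integrable_bound[OF intB[of n]])
        (measurable, use Hb[of _ n] in \<open>auto intro!: AE_I2 order_trans[OF _ abs_ge_self]\<close>)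
    have lim2: "(\<lambda>n. (\<integral>x. indicator ?E x * (X x \<bullet> H n x) \<partial>lborel)) \<longlonglongrightarrow> 0"
    proof (rule Lim_null_comparison)
      \<comment> \<open>The ball of radius 2 / R has volume \<open>unit_ball_vol 6\<close> times 64
        / R^6 and the gradient of the cutoff is at most R B; the resulting power R^(-5) is weakened
        to 1 / R.\<close>
      define C where "C = M * B * unit_ball_vol 6 * 64"
      have "norm (\<integral>x. indicator ?E x * (X x \<bullet> H n x) \<partial>lborel) \<le> C * (1 / R n)" for n
      proof -
        have "norm (\<integral>x. indicator ?E x * (X x \<bullet> H n x) \<partial>lborel) \<le> (\<integral>x. norm (indicator ?E x * (X x \<bullet> H n x)) \<partial>lborel)"
          by (rule integral_norm_bound)
        also have "\<dots> \<le> (\<integral>x. M * (R n * B) * indicator (cball (0::R6) (2 / R n)) x \<partial>lborel)"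
          by (rule integral_mono[OF integrable_norm[OF intH] intB Hb])
        also have "\<dots> = M * (R n * B) * (unit_ball_vol 6 * (2 / R n) ^ 6)"
          using R[of n] by (simp add: content_cball)
        also have "\<dots> = C * ((1 / R n) ^ 5)"
          using R[of n] by (simp add: C_def field_simps eval_nat_numeral)
        also have "\<dots> \<le> C * (1 / R n)"
        proof (rule mult_left_mono)
          show "(1 / R n) ^ 5 \<le> 1 / R n" using power_decreasing[of 1 5 "1 / R n"] by (simp add: R_def)
          show "0 \<le> C" using M0 B0 by (simp add: C_def)
        qed
        finally show ?thesis .
      qed
      then show "\<forall>\<^sub>F n in sequentially. norm (\<integral>x. indicator ?E x * (X x \<bullet> H n x) \<partial>lborel) \<le> C * (1 / R n)"
        by simp
      have "(\<lambda>n. C * (1 / R n)) \<longlonglongrightarrow> C * 0"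
        unfolding R_def by (intro tendsto_intros LIMSEQ_Suc[OF lim_1_over_n])
      then show "(\<lambda>n. C * (1 / R n)) \<longlonglongrightarrow> 0" by simp
    qed
    have dY: "(LINT x:?E|lebesgue. divergence (Y n) x)
        = (\<integral>x. indicator ?E x * (e n x * divergence X x) \<partial>lborel) + (\<integral>x. indicator ?E x * (X x \<bullet> H n x) \<partial>lborel)" for n
    proof -
      have "(LINT x:?E|lebesgue. divergence (Y n) x) = (\<integral>x. indicator ?E x * (e n x * divergence X x + X x \<bullet> H n x) \<partial>lborel)"
        unfolding Y1(2) by (rule toE) measurable
      moreover have "integrable lborel (\<lambda>x. indicator ?E x * (e n x * divergence X x))"
        by (rule integrable_compact_support[OF _ X(2) _ level_borel(1)])
          (auto intro!: continuous_on_mult C1_scalar_cont[OF e] contD simp: D0)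
      ultimately show ?thesis unfolding distrib_left by (simp add: Bochner_Integration.integral_add intH)
    qed
    have lhs: "(\<lambda>n. (LINT x:?E|lebesgue. divergence (Y n) x)) \<longlonglongrightarrow> (LINT x:?E|lebesgue. divergence X x)"
      using tendsto_add[OF lim1 lim2] unfolding dY toE[OF \<open>divergence X \<in> borel_measurable borel\<close>] by simp
    have rhs: "(\<lambda>n. (LINT x:?S|surface_measure. Y n x \<bullet> \<nu>\<^sub>u x)) \<longlonglongrightarrow> (LINT x:?S|surface_measure. X x \<bullet> \<nu>\<^sub>u x)"
    proof (rule surface_limit(1)[OF level_borel(2) AE_normal_cone cone_finite[OF X(2)] X(2)])
      show "(\<lambda>x. Y n x \<bullet> \<nu>\<^sub>u x) \<in> borel_measurable borel" for n unfolding Y_def by measurable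
      show "(\<lambda>x. X x \<bullet> \<nu>\<^sub>u x) \<in> borel_measurable borel" by measurable
      \<comment> \<open>At the origin the cutoffs are all 0, and the limit is correct because
        \<open>\<nu>\<^sub>u 0 = 0\<close>.\<close>
      show "(\<lambda>n. Y n x \<bullet> \<nu>\<^sub>u x) \<longlonglongrightarrow> X x \<bullet> \<nu>\<^sub>u x" for x
      proof (cases "x = 0")
        case True
        have "\<nu>\<^sub>u 0 = 0" by (simp add: \<nu>\<^sub>u_def case_prod_beta zero_prod_def[symmetric])
        then show ?thesis using True by simp
      next
        case False
        have "(\<lambda>n. (e n x *\<^sub>R X x) \<bullet> \<nu>\<^sub>u x) \<longlonglongrightarrow> (1 *\<^sub>R X x) \<bullet> \<nu>\<^sub>u x"
          by (intro tendsto_intros e_lim False)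
        then show ?thesis by (simp add: Y_def)
      qed
      show "\<bar>Y n x \<bullet> \<nu>\<^sub>u x\<bar> \<le> 1 * M" if "norm (\<nu>\<^sub>u x) = 1" for n x
      proof -
        have "\<bar>X x \<bullet> \<nu>\<^sub>u x\<bar> \<le> M" using Cauchy_Schwarz_ineq2[of "X x" "\<nu>\<^sub>u x"] M[of x] that by simp
        then show ?thesis unfolding Y_def inner_scaleR_left abs_mult using e01[of n x] by (intro mult_mono) auto
      qed
      show "Y n x \<bullet> \<nu>\<^sub>u x = 0" if "x \<notin> supp X" for n x using supp_subset[OF that] by (simp add: Y_def)
    qed
    have "(LINT x:?E|lebesgue. divergence (Y n) x) = (LINT x:?S|surface_measure. Y n x \<bullet> \<nu>\<^sub>u x)" for n
      by (rule cone.gauss_green[OF Y1(1) cY sY0])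
    then show ?thesis using LIMSEQ_unique[OF lhs] rhs by simp
  qed
  show ?thesis
    unfolding oriented_boundary_def
  proof (intro conjI allI impI)
    show "AE x in surface_measure. x \<in> ?S \<longrightarrow> norm (\<nu>\<^sub>u x) = 1" by (rule AE_normal_cone)
    show "emeasure surface_measure (?S \<inter> K) < \<infinity>" if "compact K" for K by (rule cone_finite[OF that])
    fix X :: "R6 \<Rightarrow> R6" assume "C_k_map 1 X \<and> compactly_supported X"
    then show "(LINT x:?E|lebesgue. divergence X x) = (LINT x:?S|surface_measure. X x \<bullet> \<nu>\<^sub>u x)"
      by (intro gg) (auto simp: compactly_supported_def supp_def)
  qed (use level_borel \<nu>\<^sub>u_measurable in auto)
qed

lemma cone_C_level: "cone_C = {x. u x = 0}"
  by (auto simp: cone_C_def u_def)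

section \<open>First variation\<close>

text \<open>With derivative at most 1/2 in norm, id + Y is bijective by the contraction principle,
  and it and its inverse are 2-Lipschitz. The bound \<open>l\<close> is kept as a parameter because
  it will be proportional to \<open>t\<close> for Y = t X, and the deviation of the normals has to
  be of order \<open>t\<close>.\<close>

locale small_perturbation =
  fixes Y :: "'a::euclidean_space \<Rightarrow> 'a" and Y' :: "'a \<Rightarrow> 'a \<Rightarrow> 'a" and l :: real
  assumes der: "\<And>x. (Y has_derivative Y' x) (at x)" and cont: "\<And>v. continuous_on UNIV (\<lambda>x. Y' x v)"
    and l: "0 \<le> l" "l \<le> 1 / 2" and Y'_le: "\<And>x h. norm (Y' x h) \<le> l * norm h"
begin

definition \<phi> where "\<phi> x = x + Y x"
definition \<psi> where "\<psi> = inv \<phi>"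

lemma Y_lipschitz: "norm (Y x - Y y) \<le> l * norm (x - y)"
  by (rule differentiable_bound[OF convex_UNIV]) (use der Y'_le in \<open>auto intro!: onorm_le intro: has_derivative_at_withinI\<close>)

lemma \<phi>_lower: "norm (x - y) \<le> 2 * norm (\<phi> x - \<phi> y)"
proof -
  have "x - y = (\<phi> x - \<phi> y) - (Y x - Y y)" by (simp add: \<phi>_def)
  then have "norm (x - y) \<le> norm (\<phi> x - \<phi> y) + norm (Y x - Y y)" by (metis norm_triangle_ineq4)
  moreover have "norm (Y x - Y y) \<le> (1/2) * norm (x - y)"
    using Y_lipschitz[of x y] mult_right_mono[OF l(2) norm_ge_zero[of "x - y"]] by linarith
  ultimately show ?thesis by linarith
qed

lemma \<phi>_upper: "dist (\<phi> x) (\<phi> y) \<le> 2 * dist x y"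
proof -
  have "\<phi> x - \<phi> y = (x - y) + (Y x - Y y)" by (simp add: \<phi>_def)
  then have "norm (\<phi> x - \<phi> y) \<le> norm (x - y) + norm (Y x - Y y)" by (metis norm_triangle_ineq)
  moreover have "norm (Y x - Y y) \<le> (1/2) * norm (x - y)"
    using Y_lipschitz[of x y] mult_right_mono[OF l(2) norm_ge_zero[of "x - y"]] by linarith
  ultimately show ?thesis unfolding dist_norm using norm_ge_zero[of "x-y"] by linarith
qed

lemma bij_\<phi>: "bij \<phi>"
proof (rule bijI)
  show "inj \<phi>"
  proof (rule injI)
    fix x y assume "\<phi> x = \<phi> y"
    then show "x = y" using \<phi>_lower[of x y] by simp
  qed
  show "surj \<phi>"
    unfolding surj_def
  proof
    fix y
    \<comment> \<open>Solving x + Y x = y means finding a fixed point of the contraction that sends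
      x to y - Y x.\<close>
    have "\<exists>!x. y - Y x = x"
    proof (rule banach_fix_type)
      show "0 \<le> l" "l < 1" using l by auto
      show "\<forall>a b. dist (y - Y a) (y - Y b) \<le> l * dist a b"
        using Y_lipschitz by (simp add: dist_norm norm_minus_commute)
    qed
    then obtain x where "y - Y x = x" by blast
    then have "y = \<phi> x" by (metis \<phi>_def diff_add_cancel)
    then show "\<exists>x. y = \<phi> x" ..
  qed
qed

lemma \<phi>\<psi> [simp]: "\<phi> (\<psi> y) = y" "\<psi> (\<phi> x) = x"
  using bij_\<phi> by (simp_all add: \<psi>_def bij_is_inj bij_is_surj surj_f_inv_f)

lemma \<psi>_lipschitz: "dist (\<psi> x) (\<psi> y) \<le> 2 * dist x y"
  using \<phi>_lower[of "\<psi> x" "\<psi> y"] by (simp add: dist_norm)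

lemma continuous_\<psi>: "continuous_on A \<psi>"
  unfolding continuous_on_iff
proof (intro ballI allI impI)
  fix x e assume "0 < (e::real)"
  then show "\<exists>d>0. \<forall>x'\<in>A. dist x' x < d \<longrightarrow> dist (\<psi> x') (\<psi> x) < e"
    by (intro exI[of _ "e/2"]) (auto intro: le_less_trans[OF \<psi>_lipschitz])
qed

lemma image_\<phi>: "\<phi> ` A = \<psi> -` A"
proof (intro equalityI subsetI)
  fix y assume "y \<in> \<psi> -` A"
  then show "y \<in> \<phi> ` A" by (metis \<phi>\<psi>(1) image_eqI vimageE)
qed auto

definition L where "L x h = h + Y' x h"

lemma derivative_\<phi>: "(\<phi> has_derivative L x) (at x)"
  unfolding \<phi>_def L_def[abs_def] by (intro derivative_intros der)

lemma linear_L: "linear (L x)"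
  using derivative_\<phi> by (rule has_derivative_linear)

lemma L_lower: "norm h \<le> 2 * norm (L x h)"
proof -
  have "h = L x h - Y' x h" by (simp add: L_def)
  then have "norm h \<le> norm (L x h) + norm (Y' x h)" by (metis norm_triangle_ineq4)
  moreover have "norm (Y' x h) \<le> (1/2) * norm h"
    using Y'_le[of x h] mult_right_mono[OF l(2) norm_ge_zero[of h]] by linarith
  ultimately show ?thesis by linarith
qed

lemma inv_L: "L x (inv (L x) h) = h" "inv (L x) (L x h) = h" "linear (inv (L x))"
proof -
  have inj: "inj (L x)"
    unfolding linear_injective_0[OF linear_L] by (metis L_lower mult_zero_right norm_le_zero_iff norm_zero)
  then have "surj (L x)" using linear_injective_imp_surjective[OF linear_L] by blast
  then show 1: "L x (inv (L x) h) = h" "inv (L x) (L x h) = h" for h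
    using inj by (simp_all add: surj_f_inv_f)
  show "linear (inv (L x))"
  proof (rule linearI)
    fix a b and r :: real
    have "L x (inv (L x) a + inv (L x) b) = a + b" by (simp add: linear_add[OF linear_L] 1(1))
    then show "inv (L x) (a + b) = inv (L x) a + inv (L x) b" by (metis 1(2))
    have "L x (r *\<^sub>R inv (L x) a) = r *\<^sub>R a" by (simp add: linear_scale[OF linear_L] 1(1))
    then show "inv (L x) (r *\<^sub>R a) = r *\<^sub>R inv (L x) a" by (metis 1(2))
  qed
qed

lemma inv_L_near: "norm (inv (L x) h - h) \<le> 2 * l * norm h"
proof -
  have "inv (L x) h - h = - Y' x (inv (L x) h)" using inv_L(1)[of x h] by (simp add: L_def algebra_simps)
  then have "norm (inv (L x) h - h) \<le> l * norm (inv (L x) h)" using Y'_le by simp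
  also have "\<dots> \<le> l * (2 * norm h)"
    using L_lower[of "inv (L x) h" x] l by (intro mult_left_mono) (simp_all add: inv_L)
  finally show ?thesis by simp
qed

lemma continuous_inv_L: "continuous_on UNIV (\<lambda>x. inv (L x) h)"
  unfolding continuous_on_def
proof
  fix x
  have "((\<lambda>z. Y' z (inv (L x) h)) \<longlongrightarrow> Y' x (inv (L x) h)) (at x)"
    using cont by (simp add: continuous_on_def)
  then have lim: "((\<lambda>z. 2 * norm (Y' z (inv (L x) h) - Y' x (inv (L x) h))) \<longlongrightarrow> 0) (at x)"
    by (intro tendsto_mult_right_zero tendsto_norm_zero LIM_zero)
  \<comment> \<open>The resolvent identity: the difference of two inverses is one inverse applied to
    the difference of the maps, evaluated at the other inverse.\<close>
  have "norm (inv (L z) h - inv (L x) h) \<le> 2 * norm (Y' z (inv (L x) h) - Y' x (inv (L x) h))" for z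
  proof -
    have "L z (inv (L z) h - inv (L x) h) = L x (inv (L x) h) - L z (inv (L x) h)"
      by (simp add: linear_diff[OF linear_L] inv_L(1))
    also have "\<dots> = - (Y' z (inv (L x) h) - Y' x (inv (L x) h))" by (simp add: L_def)
    finally show ?thesis using L_lower[of "inv (L z) h - inv (L x) h" z] by (simp only: norm_minus_cancel)
  qed
  then have "((\<lambda>z. inv (L z) h - inv (L x) h) \<longlongrightarrow> 0) (at x)"
    by (intro Lim_null_comparison[OF _ lim] always_eventually) auto
  then show "((\<lambda>z. inv (L z) h) \<longlongrightarrow> inv (L x) h) (at x within UNIV)"
    by (simp add: LIM_zero_iff)
qed

lemma derivative_\<psi>: "(\<psi> has_derivative inv (L (\<psi> y))) (at y)"
proof (rule has_derivative_inverse_basic[OF derivative_\<phi>])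
  show "bounded_linear (inv (L (\<psi> y)))" using inv_L(3) by (simp add: linear_conv_bounded_linear)
  show "inv (L (\<psi> y)) \<circ> L (\<psi> y) = id" by (auto simp: inv_L)
  show "continuous (at y) \<psi>" using continuous_\<psi>[of UNIV] by (simp add: continuous_on_eq_continuous_at)
qed (rule open_UNIV, auto)

text \<open>The transpose of the inverse differential, written in coordinates so that continuity in
  \<open>x\<close> and linearity in \<open>v\<close> are visible.\<close>

definition N where "N x v = (\<Sum>b\<in>Basis. (inv (L x) b \<bullet> v) *\<^sub>R b)"

lemma inner_N: "h \<bullet> N x v = inv (L x) h \<bullet> v"
proof -
  have "inv (L x) h \<bullet> v = inv (L x) (\<Sum>b\<in>Basis. (h \<bullet> b) *\<^sub>R b) \<bullet> v" by (simp add: euclidean_representation)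
  also have "\<dots> = h \<bullet> N x v"
    by (simp add: N_def linear_sum[OF inv_L(3)] linear_scale[OF inv_L(3)] inner_sum_left inner_sum_right mult.commute)
  finally show ?thesis ..
qed

lemma N_adjoint: "N x v = adjoint (inv (frechet_derivative \<phi> (at x))) v"
proof -
  have "frechet_derivative \<phi> (at x) = L x" using frechet_derivative_at[OF derivative_\<phi>] by simp
  then have "h \<bullet> adjoint (inv (frechet_derivative \<phi> (at x))) v = h \<bullet> N x v" for h
    by (simp add: inner_N adjoint_works[OF inv_L(3)])
  then show ?thesis by (metis vector_eq_ldot)
qed

lemma N_scale: "N x (r *\<^sub>R v) = r *\<^sub>R N x v"
  by (simp add: N_def scaleR_sum_right)

text \<open>A map and its transpose are equally close to the identity, as testing against the
  difference \<open>d\<close> itself shows.\<close>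

lemma N_near: "norm (N x v - v) \<le> 2 * l * norm v"
proof -
  define d where "d = N x v - v"
  have "d \<bullet> d = (inv (L x) d - d) \<bullet> v" by (simp add: d_def inner_diff_right inner_N inner_diff_left)
  also have "\<dots> \<le> norm (inv (L x) d - d) * norm v" by (rule norm_cauchy_schwarz)
  also have "\<dots> \<le> (2 * l * norm d) * norm v" by (intro mult_right_mono inv_L_near) simp
  finally have "norm d * norm d \<le> norm d * (2 * l * norm v)"
    by (simp add: dot_square_norm power2_eq_square mult.commute mult.left_commute)
  then show ?thesis
    unfolding d_def[symmetric] using l(1) by (cases "norm d = 0") (auto simp: mult_le_cancel_left_pos)
qed

lemma N_nonzero: "v \<noteq> 0 \<Longrightarrow> N x v \<noteq> 0"
  using inner_N[of "L x v" x v] by (auto simp: inv_L)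

lemma transported_normal_N: "transported_normal \<phi> \<nu> y = sgn (N (\<psi> y) (\<nu> (\<psi> y)))"
  by (simp add: transported_normal_def Let_def N_adjoint \<psi>_def)

lemma transported_normal_measurable:
  assumes [measurable]: "\<nu> \<in> borel_measurable borel"
  shows "transported_normal \<phi> \<nu> \<in> borel_measurable borel"
proof -
  have [measurable]: "\<psi> \<in> borel_measurable borel"
    by (rule borel_measurable_continuous_onI[OF continuous_\<psi>])
  have [measurable]: "(\<lambda>x. inv (L x) b) \<in> borel_measurable borel" for b
    by (rule borel_measurable_continuous_onI[OF continuous_inv_L])
  have [measurable]: "(\<lambda>y. N (\<psi> y) (\<nu> (\<psi> y))) \<in> borel_measurable borel"
    unfolding N_def by measurable
  have "(\<lambda>y. N (\<psi> y) (\<nu> (\<psi> y)) /\<^sub>R norm (N (\<psi> y) (\<nu> (\<psi> y)))) \<in> borel_measurable borel"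
    by (intro borel_measurable_scaleR borel_measurable_inverse borel_measurable_norm) measurable
  then show ?thesis unfolding transported_normal_N[abs_def] sgn_div_norm .
qed

text \<open>Composing \<open>g\<close> with \<psi> gives a defining function of the images, whose
  gradient is \<open>N\<close> applied to that of \<open>g\<close>. As \<open>N\<close> is linear in
  the vector, the positive factor between gradient and unit normal disappears under
  \<open>sgn\<close>.\<close>

lemma C1_side_image:
  assumes side: "C1_side E S \<nu> (\<psi> y)"
  shows "C1_side (\<phi> ` E) (\<phi> ` S) (transported_normal \<phi> \<nu>) y"
proof -
  from side obtain U and g :: "'a \<Rightarrow> real" and G where U: "open U" "\<psi> y \<in> U" "E \<inter> U = {y\<in>U. g y < 0}" "S \<inter> U = {y\<in>U. g y = 0}"
    and g: "\<And>y. y \<in> U \<Longrightarrow> GDERIV g y :> G y" "\<And>y. y \<in> U \<Longrightarrow> G y \<noteq> 0" "continuous_on U G" "\<And>y. y \<in> S \<inter> U \<Longrightarrow> \<nu> y = sgn (G y)"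
    unfolding C1_side_def by blast
  show ?thesis
    unfolding C1_side_def image_\<phi>
  proof (intro exI conjI ballI)
    show "open (\<psi> -` U)" using continuous_\<psi>[of UNIV] U(1) by (simp add: continuous_on_open_vimage[OF open_UNIV])
    show "y \<in> \<psi> -` U" using U by simp
    show "\<psi> -` E \<inter> \<psi> -` U = {z \<in> \<psi> -` U. g (\<psi> z) < 0}" "\<psi> -` S \<inter> \<psi> -` U = {z \<in> \<psi> -` U. g (\<psi> z) = 0}"
      using U(3,4) by blast+
    fix z assume z: "z \<in> \<psi> -` U"
    have "((\<lambda>z. g (\<psi> z)) has_derivative (\<lambda>h. inv (L (\<psi> z)) h \<bullet> G (\<psi> z))) (at z)"
      by (rule has_derivative_compose[OF derivative_\<psi>]) (use g(1)[of "\<psi> z"] z in \<open>simp add: gderiv_def\<close>)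
    then show "GDERIV (\<lambda>z. g (\<psi> z)) z :> N (\<psi> z) (G (\<psi> z))" by (simp add: gderiv_def inner_N)
    show "N (\<psi> z) (G (\<psi> z)) \<noteq> 0" using N_nonzero g(2) z by simp
  next
    show "continuous_on (\<psi> -` U) (\<lambda>z. N (\<psi> z) (G (\<psi> z)))"
      unfolding N_def
      by (intro continuous_intros continuous_on_compose2[OF continuous_inv_L continuous_\<psi>]
          continuous_on_compose2[OF g(3) continuous_\<psi>]) auto
  next
    fix z assume "z \<in> \<psi> -` S \<inter> \<psi> -` U"
    then have z: "\<psi> z \<in> S \<inter> U" by simp
    have "0 < norm (G (\<psi> z))" using g(2) z by simp
    then show "transported_normal \<phi> \<nu> z = sgn (N (\<psi> z) (G (\<psi> z)))"
      using g(4)[OF z] by (simp add: transported_normal_N sgn_div_norm N_scale)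
  qed
qed

lemma outside:
  assumes K: "closed K" "\<And>x. x \<notin> K \<Longrightarrow> Y x = 0"
  shows "y \<notin> K \<Longrightarrow> \<psi> y = y" "y \<notin> K \<Longrightarrow> N y v = v" "\<phi> ` (A \<inter> K) = \<phi> ` A \<inter> K"
proof -
  show out: "\<psi> y = y" if "y \<notin> K" for y using \<phi>\<psi>(2)[of y] K(2)[OF that] by (simp add: \<phi>_def)
  show "N y v = v" if "y \<notin> K"
  proof -
    have "(Y has_derivative (\<lambda>_. 0)) (at y)"
      by (rule has_derivative_transform_within_open[where f="\<lambda>_. 0" and s="- K"]) (use K that in auto)
    then have "Y' y = (\<lambda>_. 0)" by (rule has_derivative_unique[OF der])
    then have L: "L y = (\<lambda>h. h)" by (simp add: L_def fun_eq_iff)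
    have "inv (L y) h = h" for h using inv_L(1)[of y h] by (simp add: L)
    then have "h \<bullet> N y v = h \<bullet> v" for h by (simp add: inner_N)
    then show ?thesis by (metis vector_eq_ldot)
  qed
  have "\<psi> y \<in> K \<longleftrightarrow> y \<in> K" for y
  proof
    assume "y \<in> K" then show "\<psi> y \<in> K" using K(2)[of "\<psi> y"] \<phi>\<psi>(1)[of y] by (cases "\<psi> y \<in> K") (auto simp: \<phi>_def)
  next
    assume "\<psi> y \<in> K" then show "y \<in> K" using out[of y] by metis
  qed
  then show "\<phi> ` (A \<inter> K) = \<phi> ` A \<inter> K" unfolding image_\<phi> by auto
qed

end

section \<open>Level sets and their deformations\<close>

lemma level_boundary:
  assumes "c \<noteq> 0" shows "oriented_boundary {x. u x < c} {x. u x = c} \<nu>\<^sub>u"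
proof -
  interpret C1_domain "{x. u x < c}" "{x. u x = c}" \<nu>\<^sub>u UNIV "TYPE(R5)"
    by (rule C1_domain.intro) (simp_all add: prekopa_leindler_R5 level_borel C1_side_level_all assms \<nu>\<^sub>u_measurable)
  show ?thesis by (rule oriented_boundary) simp
qed

lemma perturbed_boundary:
  assumes "small_perturbation Y Y' l" and c: "c \<noteq> 0"
  defines "\<phi> \<equiv> small_perturbation.\<phi> Y"
  shows "oriented_boundary (\<phi> ` {x. u x < c}) (\<phi> ` {x. u x = c}) (transported_normal \<phi> \<nu>\<^sub>u)"
proof -
  interpret p: small_perturbation Y Y' l by fact
  have [measurable]: "p.\<psi> \<in> borel_measurable borel"
    by (rule borel_measurable_continuous_onI[OF p.continuous_\<psi>])
  have meas: "p.\<phi> ` A \<in> sets borel" if "A \<in> sets borel" for A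
    using measurable_sets[of p.\<psi> borel borel A] that unfolding p.image_\<phi> by simp
  interpret C1_domain "p.\<phi> ` {x. u x < c}" "p.\<phi> ` {x. u x = c}" "transported_normal p.\<phi> \<nu>\<^sub>u" UNIV "TYPE(R5)"
    by (rule C1_domain.intro)
      (simp_all add: prekopa_leindler_R5 meas level_borel p.C1_side_image C1_side_level_all c p.transported_normal_measurable)
  show ?thesis unfolding \<phi>_def by (rule oriented_boundary) simp
qed

lemma sgn_near:
  fixes a b :: "'a::real_normed_vector"
  assumes "a \<noteq> 0" shows "norm (sgn b - sgn a) \<le> 2 * norm (b - a) / norm a"
proof (cases "b = 0")
  case False
  have "norm (norm a *\<^sub>R (sgn b - sgn a)) = norm ((norm a - norm b) *\<^sub>R sgn b + (b - a))"
    using assms False by (simp add: sgn_div_norm algebra_simps)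
  also have "\<dots> \<le> \<bar>norm a - norm b\<bar> * 1 + norm (b - a)"
    using False by (intro order_trans[OF norm_triangle_ineq]) (simp add: norm_sgn)
  also have "\<dots> \<le> 2 * norm (b - a)" using norm_triangle_ineq3[of a b] by (simp add: norm_minus_commute)
  finally have "norm a * norm (sgn b - sgn a) \<le> 2 * norm (b - a)" by (simp only: norm_scaleR abs_norm_cancel)
  then show ?thesis using assms by (simp add: field_simps)
qed (use assms in \<open>simp add: norm_sgn\<close>)

text \<open>The level {u = c} keeps distance sqrt (2 |c|) from the origin, where
  \<open>\<nu>\<^sub>u\<close> is singular. This controls the turning of the normal field and the
  admissible size of a deformation.\<close>

lemma level_norm: "2 * \<bar>u x\<bar> \<le> (norm x)\<^sup>2"
proof -
  have "(norm x)\<^sup>2 = fst x \<bullet> fst x + snd x \<bullet> snd x"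
    by (metis dot_square_norm inner_prod_def)
  moreover have "2 * \<bar>u x\<bar> = \<bar>fst x \<bullet> fst x - snd x \<bullet> snd x\<bar>" by (simp add: u_inner)
  ultimately show ?thesis using inner_ge_zero[of "fst x"] inner_ge_zero[of "snd x"] by linarith
qed

text \<open>The calibration has the same flux through the perturbed hypersurface, and it falls short of the
  integrand only to second order in the deviation of the normals.\<close>

lemma perturbed_area:
  assumes p: "small_perturbation Y Y' l" and c: "c \<noteq> 0" and K: "compact K" "\<And>x. x \<notin> K \<Longrightarrow> Y x = 0"
    and M: "\<And>x. norm (Y x) \<le> M" "M < sqrt (2 * \<bar>c\<bar>)"
  defines "\<phi> \<equiv> small_perturbation.\<phi> Y" and "S \<equiv> {x. u x = c}"
  shows "\<bar>anisotropic_area \<Phi>\<^sub>0 (\<phi> ` (S \<inter> K)) (transported_normal \<phi> \<nu>\<^sub>u)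
      - (LINT x:S \<inter> K|surface_measure. cal 0 x \<bullet> \<nu>\<^sub>u x)\<bar>
    \<le> 21 * (4 * l + 2 * M / sqrt (2 * \<bar>c\<bar>))\<^sup>2 * (32 * measure surface_measure (S \<inter> K))"
proof -
  interpret p: small_perturbation Y Y' l by fact
  define \<rho> where "\<rho> = sqrt (2 * \<bar>c\<bar>)"
  \<comment> \<open>Bound for the deviation of the transported normal from
    \<open>\<nu>\<^sub>u\<close> at the displaced point. \<open>N\<close> moves a unit vector by at
    most 2 l, and normalization doubles this; displacing the base point by at most \<open>M\<close>,
    from distance at least \<rho> to the origin, turns the normal field by at most 2 M /
    \<rho>.\<close>
  define D where "D = 4 * l + 2 * M / \<rho>"
  define E where "E = {x. u x < c}"
  define \<nu> where "\<nu> = transported_normal \<phi> \<nu>\<^sub>u"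
  have \<rho>: "0 < \<rho>" using c by (simp add: \<rho>_def)
  have M0: "0 \<le> M" using M(1)[of 0] norm_ge_zero[of "Y 0"] by linarith
  have \<phi>: "p.\<phi> = \<phi>" by (simp add: \<phi>_def)
  have cK: "closed K" using K(1) by (rule compact_imp_closed)
  have out: "y \<notin> K \<Longrightarrow> p.\<psi> y = y" "y \<notin> K \<Longrightarrow> p.N y v = v" "\<phi> ` (A \<inter> K) = \<phi> ` A \<inter> K" for y v A
    using p.outside[OF cK] K(2) unfolding \<phi> by blast+
  have ob: "oriented_boundary E S \<nu>\<^sub>u" unfolding E_def S_def by (rule level_boundary[OF c])
  have ob': "oriented_boundary (\<phi> ` E) (\<phi> ` S) \<nu>"
    unfolding E_def S_def \<nu>_def \<phi>_def by (rule perturbed_boundary[OF p c])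
  note d = oriented_boundaryD[OF ob] and d' = oriented_boundaryD[OF ob']
  have [measurable]: "S \<in> sets borel" "\<phi> ` S \<in> sets borel" "\<nu> \<in> borel_measurable borel" "K \<in> sets borel"
      "cal 0 \<in> borel_measurable borel"
    using d(1) d'(1,2) borel_compact[OF K(1)] by (auto intro: cal_measurable)
  have mem: "x \<in> \<phi> ` A \<longleftrightarrow> p.\<psi> x \<in> A" for x A using p.image_\<phi>[of A] by (simp add: \<phi>)
  have norm_S: "\<rho> \<le> norm x" if "x \<in> S" for x
    using level_norm[of x] that unfolding \<rho>_def S_def by (intro real_le_lsqrt) auto
  have normal_near: "y \<noteq> 0" "norm (\<nu> y) = 1" "norm (\<nu> y - \<nu>\<^sub>u y) \<le> D" if "y \<in> \<phi> ` S" for y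
  proof -
    define x where "x = p.\<psi> y"
    have x: "x \<in> S" "y = x + Y x" using that p.\<phi>\<psi>(1)[of y] by (auto simp: mem x_def p.\<phi>_def)
    have x0: "x \<noteq> 0" using norm_S[OF x(1)] \<rho> by auto
    have v: "norm (\<nu>\<^sub>u x) = 1" "\<nu>\<^sub>u x \<noteq> 0" using norm_\<nu>\<^sub>u[OF x0] by auto
    \<comment> \<open>The displacement is shorter than the distance of the level set from the
      origin, so the quadratic estimate, stated away from the origin, applies at
      \<open>y\<close>.\<close>
    show "y \<noteq> 0"
    proof
      assume "y = 0"
      then have "norm x = norm (Y x)" using x(2) by (metis add.inverse_unique norm_minus_cancel)
      then show False using M(1)[of x] M(2) norm_S[OF x(1)] by (simp add: \<rho>_def)
    qed
    have \<nu>y: "\<nu> y = sgn (p.N x (\<nu>\<^sub>u x))" unfolding \<nu>_def x_def \<phi>[symmetric] by (rule p.transported_normal_N)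
    show "norm (\<nu> y) = 1" unfolding \<nu>y using p.N_nonzero[OF v(2)] by (simp add: norm_sgn)
    have "norm (sgn (p.N x (\<nu>\<^sub>u x)) - sgn (\<nu>\<^sub>u x)) \<le> 4 * l"
      using sgn_near[OF v(2), of "p.N x (\<nu>\<^sub>u x)"] p.N_near[of x "\<nu>\<^sub>u x"] v by simp
    then have 1: "norm (\<nu> y - \<nu>\<^sub>u x) \<le> 4 * l" using v by (simp add: \<nu>y sgn_div_norm)
    have nx: "norm (fst x, - snd x) = norm x" by (simp add: norm_prod_def)
    then have "(fst x, - snd x) \<noteq> 0" using x0 by (metis norm_eq_zero)
    from sgn_near[OF this, of "(fst y, - snd y)"]
    have "norm (\<nu>\<^sub>u y - \<nu>\<^sub>u x) \<le> 2 * norm ((fst y, - snd y) - (fst x, - snd x)) / norm x"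
      unfolding nx by (simp add: \<nu>\<^sub>u_def case_prod_beta)
    also have "norm ((fst y, - snd y) - (fst x, - snd x)) = norm (Y x)"
      using x(2) by (simp add: norm_prod_def)
    also have "2 * norm (Y x) / norm x \<le> 2 * M / \<rho>"
      using M(1)[of x] norm_S[OF x(1)] \<rho> M0 by (intro frac_le) auto
    finally have 2: "norm (\<nu>\<^sub>u y - \<nu>\<^sub>u x) \<le> 2 * M / \<rho>" .
    show "norm (\<nu> y - \<nu>\<^sub>u y) \<le> D"
      using 1 2 norm_triangle_ineq4[of "\<nu> y - \<nu>\<^sub>u x" "\<nu>\<^sub>u y - \<nu>\<^sub>u x"] unfolding D_def by simp
  qed
  have diff: "(E - \<phi> ` E) \<union> (\<phi> ` E - E) \<subseteq> K"
  proof
    fix x assume "x \<in> (E - \<phi> ` E) \<union> (\<phi> ` E - E)"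
    then have "p.\<psi> x \<noteq> x" by (auto simp: mem)
    then show "x \<in> K" using out(1) by blast
  qed
  \<comment> \<open>The flux identity carries a weight whose support may exceed \<open>K\<close>.
    Off \<open>K\<close> the two hypersurfaces and their normals coincide, so that part cancels, and
    on \<open>K\<close> the weight is 1.\<close>
  obtain e H W where e: "C1_scalar e H" "open W" "K \<subseteq> W" "\<And>x. x \<in> W \<Longrightarrow> e x = 1" "compact (supp e)"
    using C1_urysohn[OF K(1) open_UNIV] by (metis subset_UNIV)
  have e1: "e x = 1" if "x \<in> K" for x using e(3,4) that by blast
  note int = cal_integrable[OF ob e(1,5)] and int' = cal_integrable[OF ob' e(1,5)]
  have split: "(\<integral>x. g x \<partial>surface_measure) = (\<integral>x. indicator K x * g x \<partial>surface_measure) + (\<integral>x. indicator (- K) x * g x \<partial>surface_measure)"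
    if "integrable surface_measure g" for g :: "R6 \<Rightarrow> real"
  proof -
    have "integrable surface_measure (\<lambda>x. indicator A x * g x)" if "A \<in> sets borel" for A
      using integrable_mult_indicator[of A surface_measure g] that \<open>integrable surface_measure g\<close> by simp
    then have "(\<integral>x. indicator K x * g x + indicator (- K) x * g x \<partial>surface_measure)
        = (\<integral>x. indicator K x * g x \<partial>surface_measure) + (\<integral>x. indicator (- K) x * g x \<partial>surface_measure)"
      by (intro Bochner_Integration.integral_add) auto
    moreover have "(\<lambda>x. indicator K x * g x + indicator (- K) x * g x) = g"
      by (auto simp: indicator_def fun_eq_iff)
    ultimately show ?thesis by simp
  qed
  have flux: "(LINT x:\<phi> ` S \<inter> K|surface_measure. cal 0 x \<bullet> \<nu> x) = (LINT x:S \<inter> K|surface_measure. cal 0 x \<bullet> \<nu>\<^sub>u x)"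
  proof -
    have off: "indicator (- K) x * (indicator S x * (e x * (cal 0 x \<bullet> \<nu>\<^sub>u x)))
        = indicator (- K) x * (indicator (\<phi> ` S) x * (e x * (cal 0 x \<bullet> \<nu> x)))" for x
    proof (cases "x \<in> K")
      case False
      have "\<nu> x = sgn (\<nu>\<^sub>u x)"
        using p.transported_normal_N[of \<nu>\<^sub>u x] out(1)[OF False] out(2)[OF False] by (simp add: \<nu>_def \<phi>)
      moreover have "\<nu>\<^sub>u 0 = 0" by (simp add: \<nu>\<^sub>u_def case_prod_beta zero_prod_def[symmetric])
      ultimately have "\<nu> x = \<nu>\<^sub>u x" using norm_\<nu>\<^sub>u[of x] by (cases "x = 0") (simp_all add: sgn_div_norm)
      moreover have "x \<in> \<phi> ` S \<longleftrightarrow> x \<in> S" using out(1)[OF False] by (simp add: mem)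
      ultimately show ?thesis by (simp add: indicator_def)
    qed simp
    have on: "indicator K x * (indicator A x * (e x * b)) = indicator (A \<inter> K) x * b" for x A and b :: real
      using e1[of x] by (auto simp: indicator_def)
    from calibration_identity[OF ob ob' diff e(1,5,2,3,4)] show ?thesis
      unfolding set_lebesgue_integral_def real_scaleR_def split[OF int] split[OF int'] off on by simp
  qed
  have fin: "emeasure surface_measure (\<phi> ` S \<inter> K) < \<infinity>" "emeasure surface_measure (S \<inter> K) < \<infinity>"
    using d(4)[OF K(1)] d'(4)[OF K(1)] by auto
  \<comment> \<open>32 = 2^5, from a 2-Lipschitz map and five-dimensional measure.\<close>
  have area_le: "measure surface_measure (\<phi> ` S \<inter> K) \<le> 32 * measure surface_measure (S \<inter> K)"
  proof -
    have "emeasure surface_measure (\<phi> ` S \<inter> K) = hausdorff_outer 5 (\<phi> ` (S \<inter> K))"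
      by (simp add: emeasure_surface out(3))
    also have "\<dots> \<le> ennreal (2 ^ 5) * hausdorff_outer 5 (S \<inter> K)"
      by (rule hausdorff_outer_lipschitz) (use p.\<phi>_upper \<phi> in auto)
    also have "hausdorff_outer 5 (S \<inter> K) = emeasure surface_measure (S \<inter> K)"
      by (simp add: emeasure_surface)
    finally have "enn2real (emeasure surface_measure (\<phi> ` S \<inter> K)) \<le> enn2real (ennreal 32 * emeasure surface_measure (S \<inter> K))"
      using fin(2) by (intro enn2real_mono) (auto simp: ennreal_mult_less_top)
    then show ?thesis by (simp add: measure_def enn2real_mult)
  qed
  obtain B where B: "\<And>w. norm w = 1 \<Longrightarrow> \<bar>\<Phi>\<^sub>0 w\<bar> \<le> B" using \<Phi>\<^sub>0_bound by blast
  have iK: "integrable surface_measure (\<lambda>x. indicator (\<phi> ` S \<inter> K) x * g x)"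
    if "g \<in> borel_measurable borel" "\<And>x. norm (\<nu> x) = 1 \<Longrightarrow> \<bar>g x\<bar> \<le> b" for g :: "R6 \<Rightarrow> real" and b
  proof -
    have "integrable surface_measure (\<lambda>x. indicator (\<phi> ` S) x * (indicator K x * g x))"
    proof (rule surface_integrable[OF d'(1) borel_compact[OF K(1)] fin(1)])
      show "AE x in surface_measure. x \<in> \<phi> ` S \<longrightarrow> \<bar>indicator K x * g x\<bar> \<le> b"
      proof (intro AE_I2 impI)
        fix x assume "x \<in> \<phi> ` S"
        then have "\<bar>g x\<bar> \<le> b" using that(2) normal_near(2) by blast
        then show "\<bar>indicator K x * g x\<bar> \<le> b" using abs_ge_zero[of "g x"] by (cases "x \<in> K") simp_all
      qed
    qed (use that in auto)
    then show ?thesis by (simp add: indicator_inter_arith mult.assoc)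
  qed
  have i1: "integrable surface_measure (\<lambda>x. indicator (\<phi> ` S \<inter> K) x * \<Phi>\<^sub>0 (\<nu> x))"
    by (rule iK[OF _ B]) measurable
  have i2: "integrable surface_measure (\<lambda>x. indicator (\<phi> ` S \<inter> K) x * (cal 0 x \<bullet> \<nu> x))"
  proof (rule iK[where b=14])
    fix x assume "norm (\<nu> x) = 1"
    then show "\<bar>cal 0 x \<bullet> \<nu> x\<bar> \<le> 14" using Cauchy_Schwarz_ineq2[of "cal 0 x" "\<nu> x"] cal_bound[of 0 x] by simp
  qed measurable
  have "anisotropic_area \<Phi>\<^sub>0 (\<phi> ` (S \<inter> K)) \<nu> - (LINT x:S \<inter> K|surface_measure. cal 0 x \<bullet> \<nu>\<^sub>u x)
      = (\<integral>x. indicator (\<phi> ` S \<inter> K) x * \<Phi>\<^sub>0 (\<nu> x) - indicator (\<phi> ` S \<inter> K) x * (cal 0 x \<bullet> \<nu> x) \<partial>surface_measure)"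
    unfolding flux[symmetric]
    unfolding anisotropic_area_def out(3) set_lebesgue_integral_def real_scaleR_def
    by (rule Bochner_Integration.integral_diff[OF i1 i2, symmetric])
  also have "\<bar>\<dots>\<bar> \<le> (\<integral>x. indicator (\<phi> ` S \<inter> K) x * (21 * D\<^sup>2) \<partial>surface_measure)"
    unfolding real_norm_def[symmetric]
  proof (rule Bochner_Integration.integral_norm_bound_integral)
    show "integrable surface_measure (\<lambda>x. indicator (\<phi> ` S \<inter> K) x * (21 * D\<^sup>2))"
      using fin(1) by (intro integrable_mult_left integrable_real_indicator) auto
    fix y
    show "norm (indicator (\<phi> ` S \<inter> K) y * \<Phi>\<^sub>0 (\<nu> y) - indicator (\<phi> ` S \<inter> K) y * (cal 0 y \<bullet> \<nu> y))
        \<le> indicator (\<phi> ` S \<inter> K) y * (21 * D\<^sup>2)"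
    proof (cases "y \<in> \<phi> ` S \<inter> K")
      case True
      then have y: "y \<in> \<phi> ` S" by simp
      have "(norm (\<nu> y - \<nu>\<^sub>u y))\<^sup>2 \<le> D\<^sup>2" by (intro power_mono normal_near[OF y]) simp
      then show ?thesis
        using True calibration(1)[of y "\<nu> y"] calibration(2)[OF normal_near(1,2)[OF y]] by simp
    qed simp
  qed (intro Bochner_Integration.integrable_diff i1 i2)
  also have "\<dots> = 21 * D\<^sup>2 * measure surface_measure (\<phi> ` S \<inter> K)" by simp
  also have "\<dots> \<le> 21 * D\<^sup>2 * (32 * measure surface_measure (S \<inter> K))"
    by (intro mult_left_mono area_le) simp
  finally show ?thesis unfolding D_def \<rho>_def \<nu>_def .
qed

lemma bounded_derivative_compact_support:
  fixes X :: "'a::euclidean_space \<Rightarrow> 'a"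
  assumes X: "C_k_map 1 X" and K: "compact K" "\<And>x. x \<notin> K \<Longrightarrow> X x = 0"
  obtains M \<Lambda> where "0 \<le> M" "0 \<le> \<Lambda>" "\<And>x. norm (X x) \<le> M" "\<And>x h. norm (frechet_derivative X (at x) h) \<le> \<Lambda> * norm h"
proof -
  let ?X' = "\<lambda>x. frechet_derivative X (at x)"
  note der = C_k_map_1D(1)[OF X] and cont = C_k_map_1D(2)[OF X]
  have bd: "\<exists>m\<ge>0. \<forall>x. norm (f x) \<le> m" if f: "continuous_on UNIV f" "\<And>x. x \<notin> K \<Longrightarrow> f x = 0" for f :: "'a \<Rightarrow> 'a"
  proof -
    have "bounded (f ` K)" by (intro compact_imp_bounded compact_continuous_image continuous_on_subset[OF f(1)] K) auto
    then obtain m where m: "\<forall>y\<in>f ` K. norm y \<le> m" unfolding bounded_iff by blast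
    have "norm (f x) \<le> max m 0" for x using m f(2)[of x] by (cases "x \<in> K") (auto simp: le_max_iff_disj)
    then show ?thesis by (intro exI[of _ "max m 0"]) auto
  qed
  have "continuous_on UNIV X" using der by (intro continuous_at_imp_continuous_on ballI has_derivative_continuous)
  then obtain M where M: "0 \<le> M" "\<And>x. norm (X x) \<le> M" using bd K(2) by blast
  have zero: "?X' x b = 0" if "x \<notin> K" for x b
  proof -
    have "(X has_derivative (\<lambda>_. 0)) (at x)"
      by (rule has_derivative_transform_within_open[where f="\<lambda>_. 0" and s="- K"])
        (use K that compact_imp_closed in auto)
    then have "?X' x = (\<lambda>_. 0)" using has_derivative_unique[OF der] by blast
    then show ?thesis by simp
  qed
  have "\<exists>m\<ge>0. \<forall>x. norm (?X' x b) \<le> m" for b by (rule bd[OF cont zero])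
  then obtain m where m: "\<And>b. 0 \<le> m b" "\<And>b x. norm (?X' x b) \<le> m b" by metis
  show thesis
  proof (rule that[of M "\<Sum>b\<in>Basis. m b"])
    fix x h
    have lin: "linear (?X' x)" using der by (rule has_derivative_linear)
    have "?X' x h = ?X' x (\<Sum>b\<in>Basis. (h \<bullet> b) *\<^sub>R b)" by (simp add: euclidean_representation)
    also have "\<dots> = (\<Sum>b\<in>Basis. (h \<bullet> b) *\<^sub>R ?X' x b)" by (simp add: linear_sum[OF lin] linear_scale[OF lin])
    finally have "norm (?X' x h) \<le> (\<Sum>b\<in>Basis. norm h * m b)"
      using m by (auto intro!: sum_norm_le mult_mono simp: Basis_le_norm)
    then show "norm (?X' x h) \<le> (\<Sum>b\<in>Basis. m b) * norm h" by (simp add: sum_distrib_left mult.commute)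
  qed (use M m in \<open>auto intro: sum_nonneg\<close>)
qed

text \<open>The area of the deformed level set stays within C t^2 of the flux \<open>J\<close>,
  which does not depend on \<open>t\<close>, so its difference quotients at 0 are of order
  t.\<close>

lemma critical_level:
  assumes c: "c \<noteq> 0" shows "anisotropic_critical_point \<Phi>\<^sub>0 {x. u x = c} \<nu>\<^sub>u"
  unfolding anisotropic_critical_point_def
proof (intro conjI allI impI)
  show "closed {x. u x = c}" by (intro closed_Collect_eq continuous_u continuous_intros)
  show "oriented_hypersurface {x. u x = c} \<nu>\<^sub>u"
    unfolding oriented_hypersurface_def
  proof
    fix x assume "x \<in> {x. u x = c}"
    have "C1_side {x. u x < c} {x. u x = c} \<nu>\<^sub>u x" by (rule C1_side_level_all[OF c])
    then show "\<exists>U (g :: R6 \<Rightarrow> real) G. open U \<and> x \<in> U \<and> {x. u x = c} \<inter> U = {y \<in> U. g y = 0} \<and>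
        (\<forall>y\<in>U. GDERIV g y :> G y) \<and> continuous_on U G \<and> (\<forall>y\<in>{x. u x = c} \<inter> U. G y \<noteq> 0 \<and> \<nu>\<^sub>u y = sgn (G y))"
      unfolding C1_side_def by (elim ex_forward) blast
  qed
next
  fix X :: "R6 \<Rightarrow> R6" and K assume *: "(\<forall>k. C_k_map k X) \<and> compact K \<and> {x. X x \<noteq> 0} \<subseteq> K"
  then have X: "C_k_map 1 X" and K: "compact K" "\<And>x. x \<notin> K \<Longrightarrow> X x = 0" by blast+
  obtain M \<Lambda> where M: "0 \<le> M" "\<And>x. norm (X x) \<le> M"
    and \<Lambda>: "0 \<le> \<Lambda>" "\<And>x h. norm (frechet_derivative X (at x) h) \<le> \<Lambda> * norm h"
    using bounded_derivative_compact_support[OF X K] by metis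
  let ?S = "{x. u x = c}"
  define \<rho> where "\<rho> = sqrt (2 * \<bar>c\<bar>)"
  have \<rho>: "0 < \<rho>" using c by (simp add: \<rho>_def)
  define f where "f t = (let \<phi> = (\<lambda>x. x + t *\<^sub>R X x) in anisotropic_area \<Phi>\<^sub>0 (\<phi> ` (?S \<inter> K)) (transported_normal \<phi> \<nu>\<^sub>u))" for t
  define J where "J = (LINT x:?S \<inter> K|surface_measure. cal 0 x \<bullet> \<nu>\<^sub>u x)"
  define C where "C = 21 * (4 * \<Lambda> + 2 * M / \<rho>)\<^sup>2 * (32 * measure surface_measure (?S \<inter> K))"
  \<comment> \<open>The first bound keeps the derivative of t X below 1/2 in norm, the second its
    length below \<rho>; the summands 1 keep both denominators positive.\<close>
  define \<delta> where "\<delta> = min (1 / (2 * \<Lambda> + 1)) (\<rho> / (M + 1))"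
  have \<delta>: "0 < \<delta>" using \<Lambda>(1) M(1) \<rho> by (simp add: \<delta>_def)
  have bound: "\<bar>f t - J\<bar> \<le> C * t\<^sup>2" if t: "\<bar>t\<bar> < \<delta>" for t
  proof -
    have t1: "\<bar>t\<bar> * (2 * \<Lambda> + 1) < 1" "\<bar>t\<bar> * (M + 1) < \<rho>"
      using t \<Lambda>(1) M(1) unfolding \<delta>_def by (simp_all add: pos_less_divide_eq)
    have p: "small_perturbation (\<lambda>x. t *\<^sub>R X x) (\<lambda>x h. t *\<^sub>R frechet_derivative X (at x) h) (\<bar>t\<bar> * \<Lambda>)"
    proof
      show "((\<lambda>x. t *\<^sub>R X x) has_derivative (\<lambda>h. t *\<^sub>R frechet_derivative X (at x) h)) (at x)" for x
        by (intro derivative_intros C_k_map_1D(1)[OF X])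
      show "continuous_on UNIV (\<lambda>x. t *\<^sub>R frechet_derivative X (at x) v)" for v
        by (intro continuous_intros C_k_map_1D(2)[OF X])
      show "0 \<le> \<bar>t\<bar> * \<Lambda>" using \<Lambda>(1) by simp
      show "\<bar>t\<bar> * \<Lambda> \<le> 1 / 2" using t1(1) abs_ge_zero[of t] unfolding distrib_left by linarith
      show "norm (t *\<^sub>R frechet_derivative X (at x) h) \<le> \<bar>t\<bar> * \<Lambda> * norm h" for x h
        using mult_left_mono[OF \<Lambda>(2)[of x h] abs_ge_zero[of t]] by (simp add: mult.assoc)
    qed
    have \<phi>: "small_perturbation.\<phi> (\<lambda>x. t *\<^sub>R X x) = (\<lambda>x. x + t *\<^sub>R X x)"
      using small_perturbation.\<phi>_def[OF p] by (simp add: fun_eq_iff)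
    have "\<bar>f t - J\<bar> \<le> 21 * (4 * (\<bar>t\<bar> * \<Lambda>) + 2 * (\<bar>t\<bar> * M) / sqrt (2 * \<bar>c\<bar>))\<^sup>2 * (32 * measure surface_measure (?S \<inter> K))"
      unfolding f_def Let_def J_def \<phi>[symmetric]
    proof (rule perturbed_area[OF p c K(1)])
      show "t *\<^sub>R X x = 0" if "x \<notin> K" for x using K(2)[OF that] by simp
      show "norm (t *\<^sub>R X x) \<le> \<bar>t\<bar> * M" for x using mult_left_mono[OF M(2)[of x] abs_ge_zero[of t]] by simp
      show "\<bar>t\<bar> * M < sqrt (2 * \<bar>c\<bar>)" using t1(2) abs_ge_zero[of t] unfolding \<rho>_def distrib_left by linarith
    qed
    also have "4 * (\<bar>t\<bar> * \<Lambda>) + 2 * (\<bar>t\<bar> * M) / sqrt (2 * \<bar>c\<bar>) = \<bar>t\<bar> * (4 * \<Lambda> + 2 * M / \<rho>)"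
      by (simp add: \<rho>_def algebra_simps)
    finally show ?thesis by (simp add: C_def power_mult_distrib mult_ac)
  qed
  have f0: "f 0 = J" using bound[of 0] \<delta> by simp
  have "((\<lambda>h. (f (0 + h) - f 0) / h) \<longlongrightarrow> 0) (at 0)"
  proof (rule Lim_null_comparison)
    have "norm ((f (0 + h) - f 0) / h) \<le> C * \<bar>h\<bar>" if "\<bar>h\<bar> < \<delta>" "h \<noteq> 0" for h
      using bound[OF that(1)] that(2) by (simp add: f0 abs_divide pos_divide_le_eq power2_eq_square mult.assoc)
    then show "\<forall>\<^sub>F h in at 0. norm ((f (0 + h) - f 0) / h) \<le> C * \<bar>h\<bar>"
      unfolding eventually_at using \<delta> by (intro exI[of _ \<delta>]) (auto simp: dist_norm)
    show "((\<lambda>h. C * \<bar>h\<bar>) \<longlongrightarrow> 0) (at 0)"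
      by (intro tendsto_mult_right_zero tendsto_rabs_zero tendsto_ident_at)
  qed
  then show "((\<lambda>t. let \<phi> = (\<lambda>x. x + t *\<^sub>R X x) in anisotropic_area \<Phi>\<^sub>0 (\<phi> ` (?S \<inter> K)) (transported_normal \<phi> \<nu>\<^sub>u))
      has_real_derivative 0) (at 0)"
    unfolding DERIV_def f_def .
qed

theorem mainTheorem2:
  shows "anisotropic_minimizer \<Phi>\<^sub>0 {x. u x < 0} cone_C \<nu>\<^sub>u
    \<and> anisotropic_critical_point \<Phi>\<^sub>0 {x. u x = 1} \<nu>\<^sub>u
    \<and> anisotropic_critical_point \<Phi>\<^sub>0 {x. u x = -1} \<nu>\<^sub>u
    \<and> foliates (dilations {x. u x = 1}) {(p, q). norm p > norm q}
    \<and> foliates (dilations {x. u x = -1}) {(p, q). norm p < norm q}"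
proof -
  \<comment> \<open>The two sides of the cone are the sets where s u is positive, for s = 1 and s =
    -1.\<close>
  have "{(p, q). norm p > norm q} = {x. 0 < 1 * u x}" "{(p, q). norm p < norm q} = {x. 0 < - 1 * u x}"
    by (auto simp: u_def power2_less_imp_less intro!: power_strict_mono)
  then show ?thesis
    using calibrated_minimizer[OF cone_boundary] critical_level[of 1] critical_level[of "-1"]
      foliates_levels[of 1] foliates_levels[of "-1"] by (simp add: cone_C_level)
qed

end
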